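(* Let $(M,g)$ be a spatially homogeneous solution of the Einstein equations coupled to a (massless, linear) scalar field $\phi$ in four spacetime dimensions, with symmetry of a Bianchi type other than IX or VI${}_{-1/9}$. If the solution is expanding at some time and the time interval of definition of the solution is maximal, then the upper limit of this interval is infinity, and the generalized Kasner exponents $p_1,p_2,p_3$ and the density parameter $\Omega$ converge to limits as $t\to\infty$.
   Context: All objects are smooth. Setting. $G$ is a connected and simply connected three-dimensional Lie group with a basis $\theta^1,\theta^2,\theta^3$ of left-invariant one-forms, $I\subset\mathbb{R}$ is an open interval, and $M=I\times G$ carries the metric $$-dt^2+\sum_{a,b=1}^3 g_{ab}(t)\,\theta^a\otimes\theta^b,$$ with $(g_{ab}(t))$ symmetric positive definite. The scalar field $\phi=\phi(t)$ depends only on $t$. The Einstein equations coupled to the scalar field are $\mathrm{Ric}_{\alpha\beta}-\frac12 \mathrm{Scal}\,g_{\alpha\beta}=T_{\alpha\beta}$ with $T_{\alpha\beta}=\nabla_\alpha\phi\nabla_\beta\phi-\frac12(\nabla_\gamma\phi\nabla^\gamma\phi)g_{\alpha\beta}$, together with the wave equation $\nabla^\alpha\nabla_\alpha\phi=0$. The energy density is $\rho=\frac12(\partial_t\phi)^2$. The interval $I$ is maximal if the solution cannot be extended, as a solution of this form, to a larger interval. The second fundamental form $k_{ab}$ of the hypersurfaces of constant $t$ is defined by $\partial_t g_{ab}=-2k_{ab}$, and $\mathrm{tr}\,k=g^{ab}k_{ab}$. The solution is expanding at time $t$ if $\mathrm{tr}\,k(t)<0$. Let $\lambda_1(t),\lambda_2(t),\lambda_3(t)$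 be the eigenvalues, with multiplicity, of $k_{ab}(t)$ with respect to $g_{ab}(t)$ (solutions $\lambda$ of $k_{ab}v^b=\lambda g_{ab}v^b$ with $v\ne0$), labelled for instance in increasing order. At times where $\mathrm{tr}\,k\neq0$ the generalized Kasner exponents are $p_a=\lambda_a/\mathrm{tr}\,k$ and the density parameter is $\Omega=\dfrac{3\rho}{(\mathrm{tr}\,k)^2}$. Bianchi types. Three-dimensional real Lie algebras are classified into Bianchi types I to IX. Type IX is the Lie algebra $su(2)$. Type VI${}_h$ is the Lie algebra with basis $e_1,e_2,e_3$ and $[e_2,e_3]=0$, $[e_1,e_2]=\alpha e_2$, $[e_1,e_3]=\beta e_3$, where $\alpha\neq\beta$ are non-zero reals and $h=-\left(\frac{\alpha+\beta}{\alpha-\beta}\right)^2$. In particular type VI${}_{-1/9}$ is the case $\alpha/\beta\in\{-2,-\tfrac12\}$. The Bianchi type of the symmetry is that of the Lie algebra of $G$. *)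

theory Defs
  imports "HOL-Analysis.Analysis"
begin

section \<open>The Lie algebra of the symmetry group\<close>

text \<open>
  A connected and simply connected Lie group is determined by its Lie algebra, and every
  finite-dimensional real Lie algebra arises in this way.  The group \<open>G\<close> with its chosen basis
  \<open>\<theta>\<^sup>1, \<theta>\<^sup>2, \<theta>\<^sup>3\<close> of left-invariant one-forms is therefore represented by the bracket
  of its Lie algebra; the standard basis of \<open>real ^ 3\<close> stands for the left-invariant frame
  \<open>e\<^sub>1, e\<^sub>2, e\<^sub>3\<close> dual to \<open>\<theta>\<^sup>1, \<theta>\<^sup>2, \<theta>\<^sup>3\<close>.
\<close>

definition lie_bracket :: "(real^3 \<Rightarrow> real^3 \<Rightarrow> real^3) \<Rightarrow> bool" where
  "lie_bracket br \<longleftrightarrow>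
     bilinear br \<and> (\<forall>x. br x x = 0) \<and>
     (\<forall>x y z. br x (br y z) + br y (br z x) + br z (br x y) = 0)"

definition su2 :: "(complex^2^2) set" where
  "su2 = {A. (\<chi> i j. cnj (A $ j $ i)) = - A \<and> trace A = 0}"

definition bianchi_IX :: "(real^3 \<Rightarrow> real^3 \<Rightarrow> real^3) \<Rightarrow> bool" where
  "bianchi_IX br \<longleftrightarrow>
     (\<exists>F :: real^3 \<Rightarrow> complex^2^2. linear F \<and> bij_betw F UNIV su2 \<and>
        (\<forall>x y. F (br x y) = F x ** F y - F y ** F x))"

definition bianchi_VI :: "real \<Rightarrow> (real^3 \<Rightarrow> real^3 \<Rightarrow> real^3) \<Rightarrow> bool" where
  "bianchi_VI h br \<longleftrightarrow>
     (\<exists>e1 e2 e3 \<alpha> \<beta>.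
        distinct [e1, e2, e3] \<and> independent {e1, e2, e3} \<and> span {e1, e2, e3} = UNIV \<and>
        br e2 e3 = 0 \<and> br e1 e2 = \<alpha> *\<^sub>R e2 \<and> br e1 e3 = \<beta> *\<^sub>R e3 \<and>
        \<alpha> \<noteq> \<beta> \<and> \<alpha> \<noteq> 0 \<and> \<beta> \<noteq> 0 \<and> h = - ((\<alpha> + \<beta>) / (\<alpha> - \<beta>))\<^sup>2)"


section \<open>Spacetime geometry in the invariant frame\<close>

text \<open>
  Tensors on \<open>I \<times> G\<close> are given by their components in the global frame
  \<open>e_None = \<partial>\<^sub>t\<close>, \<open>e_(Some a) = e\<^sub>a\<close>.  Components of spatially homogeneous tensors
  are functions of \<open>t\<close> alone.  A spatial metric is a function \<open>g :: real \<Rightarrow> real^3^3\<close>.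
\<close>

definition structure_coeff ::
    "(real^3 \<Rightarrow> real^3 \<Rightarrow> real^3) \<Rightarrow> 3 option \<Rightarrow> 3 option \<Rightarrow> 3 option \<Rightarrow> real" where
  "structure_coeff br \<mu> \<nu> \<kappa> =
     (case (\<mu>, \<nu>, \<kappa>) of
        (Some a, Some b, Some c) \<Rightarrow> br (axis a 1) (axis b 1) $ c
      | _ \<Rightarrow> 0)"

text \<open>The derivative \<open>e\<^sub>\<mu> f\<close> of a function \<open>f\<close> that depends only on \<open>t\<close>.\<close>

definition frame_deriv :: "3 option \<Rightarrow> (real \<Rightarrow> real) \<Rightarrow> real \<Rightarrow> real" where
  "frame_deriv \<mu> f t = (case \<mu> of None \<Rightarrow> deriv f t | Some a \<Rightarrow> 0)"

definition spacetime_metric :: "(real \<Rightarrow> real^3^3) \<Rightarrow> real \<Rightarrow> real^(3 option)^(3 option)" where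
  "spacetime_metric g t =
     (\<chi> \<mu> \<nu>. case (\<mu>, \<nu>) of
        (None, None) \<Rightarrow> -1
      | (Some a, Some b) \<Rightarrow> g t $ a $ b
      | _ \<Rightarrow> 0)"

definition inverse_metric :: "(real \<Rightarrow> real^3^3) \<Rightarrow> real \<Rightarrow> real^(3 option)^(3 option)" where
  "inverse_metric g t = matrix_inv (spacetime_metric g t)"

text \<open>
  The Levi-Civita connection,
  \<open>\<nabla>\<^bsub>e\<^sub>\<mu>\<^esub> e\<^sub>\<nu> = (\<Sum>\<kappa>. connection br g \<mu> \<nu> \<kappa> t *\<^sub>R e\<^sub>\<kappa>)\<close>, is defined by the Koszul formula for
  \<open>2 \<langle>\<nabla>\<^bsub>e\<^sub>\<mu>\<^esub> e\<^sub>\<nu>, e\<^sub>\<xi>\<rangle>\<close>.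
\<close>

definition koszul ::
    "(real^3 \<Rightarrow> real^3 \<Rightarrow> real^3) \<Rightarrow> (real \<Rightarrow> real^3^3) \<Rightarrow>
     3 option \<Rightarrow> 3 option \<Rightarrow> 3 option \<Rightarrow> real \<Rightarrow> real" where
  "koszul br g \<mu> \<nu> \<xi> t =
     (let G = spacetime_metric g; C = structure_coeff br in
        frame_deriv \<mu> (\<lambda>s. G s $ \<nu> $ \<xi>) t
      + frame_deriv \<nu> (\<lambda>s. G s $ \<mu> $ \<xi>) t
      - frame_deriv \<xi> (\<lambda>s. G s $ \<mu> $ \<nu>) t
      + (\<Sum>\<sigma>\<in>UNIV. C \<mu> \<nu> \<sigma> * G t $ \<sigma> $ \<xi>)
      - (\<Sum>\<sigma>\<in>UNIV. C \<mu> \<xi> \<sigma> * G t $ \<sigma> $ \<nu>)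
      - (\<Sum>\<sigma>\<in>UNIV. C \<nu> \<xi> \<sigma> * G t $ \<sigma> $ \<mu>))"

definition connection ::
    "(real^3 \<Rightarrow> real^3 \<Rightarrow> real^3) \<Rightarrow> (real \<Rightarrow> real^3^3) \<Rightarrow>
     3 option \<Rightarrow> 3 option \<Rightarrow> 3 option \<Rightarrow> real \<Rightarrow> real" where
  "connection br g \<mu> \<nu> \<kappa> t =
     (\<Sum>\<xi>\<in>UNIV. inverse_metric g t $ \<kappa> $ \<xi> * (koszul br g \<mu> \<nu> \<xi> t / 2))"

text \<open>
  \<open>riemann br g \<mu> \<nu> \<xi> \<kappa>\<close> is the \<open>e\<^sub>\<kappa>\<close>-component of \<open>R(e\<^sub>\<mu>, e\<^sub>\<nu>) e\<^sub>\<xi>\<close>, where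
  \<open>R(X, Y) = [\<nabla>\<^sub>X, \<nabla>\<^sub>Y] - \<nabla>\<^bsub>[X, Y]\<^esub>\<close>.  The Ricci tensor \<open>Ric(Y, Z)\<close> is the trace of
  \<open>X \<mapsto> R(X, Y) Z\<close>, so that round spheres have positive Ricci curvature.
\<close>

definition riemann ::
    "(real^3 \<Rightarrow> real^3 \<Rightarrow> real^3) \<Rightarrow> (real \<Rightarrow> real^3^3) \<Rightarrow>
     3 option \<Rightarrow> 3 option \<Rightarrow> 3 option \<Rightarrow> 3 option \<Rightarrow> real \<Rightarrow> real" where
  "riemann br g \<mu> \<nu> \<xi> \<kappa> t =
     (let \<Gamma> = connection br g; C = structure_coeff br in
        frame_deriv \<mu> (\<Gamma> \<nu> \<xi> \<kappa>) t - frame_deriv \<nu> (\<Gamma> \<mu> \<xi> \<kappa>) t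
      + (\<Sum>\<sigma>\<in>UNIV. \<Gamma> \<nu> \<xi> \<sigma> t * \<Gamma> \<mu> \<sigma> \<kappa> t - \<Gamma> \<mu> \<xi> \<sigma> t * \<Gamma> \<nu> \<sigma> \<kappa> t)
      - (\<Sum>\<sigma>\<in>UNIV. C \<mu> \<nu> \<sigma> * \<Gamma> \<sigma> \<xi> \<kappa> t))"

definition ricci ::
    "(real^3 \<Rightarrow> real^3 \<Rightarrow> real^3) \<Rightarrow> (real \<Rightarrow> real^3^3) \<Rightarrow>
     3 option \<Rightarrow> 3 option \<Rightarrow> real \<Rightarrow> real" where
  "ricci br g \<nu> \<xi> t = (\<Sum>\<mu>\<in>UNIV. riemann br g \<mu> \<nu> \<xi> \<mu> t)"

definition scalar_curvature ::
    "(real^3 \<Rightarrow> real^3 \<Rightarrow> real^3) \<Rightarrow> (real \<Rightarrow> real^3^3) \<Rightarrow> real \<Rightarrow> real" where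
  "scalar_curvature br g t =
     (\<Sum>\<mu>\<in>UNIV. \<Sum>\<nu>\<in>UNIV. inverse_metric g t $ \<mu> $ \<nu> * ricci br g \<mu> \<nu> t)"


section \<open>The Einstein-scalar field equations\<close>

definition stress_energy ::
    "(real \<Rightarrow> real^3^3) \<Rightarrow> (real \<Rightarrow> real) \<Rightarrow> 3 option \<Rightarrow> 3 option \<Rightarrow> real \<Rightarrow> real" where
  "stress_energy g \<phi> \<mu> \<nu> t =
     frame_deriv \<mu> \<phi> t * frame_deriv \<nu> \<phi> t
     - 1/2 * (\<Sum>\<sigma>\<in>UNIV. \<Sum>\<tau>\<in>UNIV.
         inverse_metric g t $ \<sigma> $ \<tau> * frame_deriv \<sigma> \<phi> t * frame_deriv \<tau> \<phi> t)
       * spacetime_metric g t $ \<mu> $ \<nu>"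

definition hessian ::
    "(real^3 \<Rightarrow> real^3 \<Rightarrow> real^3) \<Rightarrow> (real \<Rightarrow> real^3^3) \<Rightarrow> (real \<Rightarrow> real) \<Rightarrow>
     3 option \<Rightarrow> 3 option \<Rightarrow> real \<Rightarrow> real" where
  "hessian br g \<phi> \<mu> \<nu> t =
     frame_deriv \<mu> (frame_deriv \<nu> \<phi>) t
     - (\<Sum>\<kappa>\<in>UNIV. connection br g \<mu> \<nu> \<kappa> t * frame_deriv \<kappa> \<phi> t)"

definition einstein_equations ::
    "(real^3 \<Rightarrow> real^3 \<Rightarrow> real^3) \<Rightarrow> (real \<Rightarrow> real^3^3) \<Rightarrow> (real \<Rightarrow> real) \<Rightarrow> real \<Rightarrow> bool" where
  "einstein_equations br g \<phi> t \<longleftrightarrow>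
     (\<forall>\<mu> \<nu>. ricci br g \<mu> \<nu> t - 1/2 * scalar_curvature br g t * spacetime_metric g t $ \<mu> $ \<nu>
             = stress_energy g \<phi> \<mu> \<nu> t)"

definition wave_equation ::
    "(real^3 \<Rightarrow> real^3 \<Rightarrow> real^3) \<Rightarrow> (real \<Rightarrow> real^3^3) \<Rightarrow> (real \<Rightarrow> real) \<Rightarrow> real \<Rightarrow> bool" where
  "wave_equation br g \<phi> t \<longleftrightarrow>
     (\<Sum>\<mu>\<in>UNIV. \<Sum>\<nu>\<in>UNIV. inverse_metric g t $ \<mu> $ \<nu> * hessian br g \<phi> \<mu> \<nu> t) = 0"

text \<open>Meant for open \<open>I\<close>, where \<open>deriv\<close> at a point of \<open>I\<close> is determined by the values on \<open>I\<close>.\<close>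

definition smooth_on :: "real set \<Rightarrow> (real \<Rightarrow> real) \<Rightarrow> bool" where
  "smooth_on I f \<longleftrightarrow> (\<forall>n. \<forall>t\<in>I. (deriv ^^ n) f differentiable (at t))"

definition sym_pos_def :: "real^'n^'n \<Rightarrow> bool" where
  "sym_pos_def A \<longleftrightarrow> transpose A = A \<and> (\<forall>v. v \<noteq> 0 \<longrightarrow> v \<bullet> (A *v v) > 0)"

definition homogeneous_solution ::
    "(real^3 \<Rightarrow> real^3 \<Rightarrow> real^3) \<Rightarrow> real set \<Rightarrow> (real \<Rightarrow> real^3^3) \<Rightarrow> (real \<Rightarrow> real) \<Rightarrow> bool" where
  "homogeneous_solution br I g \<phi> \<longleftrightarrow>
     open I \<and> is_interval I \<and> I \<noteq> {} \<and>
     (\<forall>a b. smooth_on I (\<lambda>t. g t $ a $ b)) \<and> smooth_on I \<phi> \<and>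
     (\<forall>t\<in>I. sym_pos_def (g t) \<and> einstein_equations br g \<phi> t \<and> wave_equation br g \<phi> t)"

definition maximal_solution ::
    "(real^3 \<Rightarrow> real^3 \<Rightarrow> real^3) \<Rightarrow> real set \<Rightarrow> (real \<Rightarrow> real^3^3) \<Rightarrow> (real \<Rightarrow> real) \<Rightarrow> bool" where
  "maximal_solution br I g \<phi> \<longleftrightarrow>
     homogeneous_solution br I g \<phi> \<and>
     \<not> (\<exists>J g' \<phi>'. I \<subset> J \<and> homogeneous_solution br J g' \<phi>' \<and> (\<forall>t\<in>I. g' t = g t \<and> \<phi>' t = \<phi> t))"


section \<open>Kasner exponents and density parameter\<close>

definition second_fundamental_form :: "(real \<Rightarrow> real^3^3) \<Rightarrow> real \<Rightarrow> real^3^3" where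
  "second_fundamental_form g t = (\<chi> a b. - deriv (\<lambda>s. g s $ a $ b) t / 2)"

definition mean_curvature :: "(real \<Rightarrow> real^3^3) \<Rightarrow> real \<Rightarrow> real" where
  "mean_curvature g t =
     (\<Sum>a\<in>UNIV. \<Sum>b\<in>UNIV. matrix_inv (g t) $ a $ b * second_fundamental_form g t $ a $ b)"

text \<open>
  The eigenvalues of \<open>k\<close> with respect to \<open>g\<close> in increasing order, repeated according to
  multiplicity.  For symmetric \<open>k\<close> and positive definite \<open>g\<close> multiplicities are dimensions of
  eigenspaces, and the list exists and has length 3.
\<close>

definition relative_eigenvalues :: "real^3^3 \<Rightarrow> real^3^3 \<Rightarrow> real list" where
  "relative_eigenvalues g k =
     (THE xs. sorted xs \<and> (\<forall>x. count_list xs x = dim {v. k *v v = x *\<^sub>R (g *v v)}))"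

text \<open>The index ranges over \<open>0, 1, 2\<close>.\<close>

definition kasner_exponent :: "(real \<Rightarrow> real^3^3) \<Rightarrow> nat \<Rightarrow> real \<Rightarrow> real" where
  "kasner_exponent g i t =
     relative_eigenvalues (g t) (second_fundamental_form g t) ! i / mean_curvature g t"

definition energy_density :: "(real \<Rightarrow> real) \<Rightarrow> real \<Rightarrow> real" where
  "energy_density \<phi> t = 1/2 * (deriv \<phi> t)\<^sup>2"

definition density_parameter :: "(real \<Rightarrow> real^3^3) \<Rightarrow> (real \<Rightarrow> real) \<Rightarrow> real \<Rightarrow> real" where
  "density_parameter g \<phi> t = 3 * energy_density \<phi> t / (mean_curvature g t)\<^sup>2"

end

theory Submission
  imports Defs "HOL-Complex_Analysis.Complex_Analysis"
begin

text \<open>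
  Put \<open>\<kappa> = - k\<close> with one index raised, so that \<open>\<theta> = tr \<kappa> > 0\<close> means expansion.  The momentum constraint
  provides a basis \<open>b1, b2, b3\<close> of the Lie algebra for which \<open>b1\<close> stays orthogonal to the plane of
  \<open>b2, b3\<close>; this is where type VI\<open>\<^sub>h\<close> with \<open>h = -1/9\<close> is exceptional.  Outside type IX the scalar curvature of the
  slices is nonpositive, so that the Hamiltonian constraint bounds everything except one rotation
  component by \<open>\<theta>\<close>, which is positive and nonincreasing.

  In an orthonormal frame obtained from \<open>b1, b2, b3\<close> by a triangular change of basis the equations form an
  ordinary differential equation with homogeneous quadratic right-hand side.  Its solutions are
  real-analytic and live for a time that depends only on the size of the data; the field
  equations continue analytically.  Hence a solution that stays bounded extends, and a maximal one exists
  for all future times.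

  After division by powers of \<open>\<theta>\<close>, convergence is proved type by type: by monotone quantities,
  by quantities whose variation is controlled by a monotone one, and for type VIII by a
  Lyapunov function of the system averaged over its oscillations.
\<close>

no_notation fps_nth (infixl "$" 75)


section \<open>Asymptotics of the normalized equations\<close>

text \<open>Only three limits are needed. The eigenvalues of \<open>\<kappa>\<close> are
  \<open>\<theta>\<close> times \<open>1 - y\<close>, \<open>y / 2 + sqrt Z\<close> and
  \<open>y / 2 - sqrt Z\<close>, and \<open>\<Omega>\<close> is a multiple of the square of
  \<open>x\<close>. The principal axes may turn for ever, which is why the flow is written in
  quantities that do not change when the frame is rotated in the plane. The obstacle is the
  oscillation between \<open>Z\<close> and \<open>W\<close> that a large \<open>b\<close> drives: no
  monotone quantity sees \<open>Z\<close> or \<open>W\<close> alone. The remedy is the quotient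
  \<open>\<xi> / b\<close>. Its derivative contains \<open>2 * (Z - W)\<close>, so adding a multiple
  of it trades \<open>W\<close> for \<open>Z\<close> in a derivative at the price of a bounded,
  often small, correction. Time enters only through \<open>\<tau>\<close>, and every argument by
  contradiction ends with a bounded quantity forced to grow with \<open>\<tau>\<close>. For the
  continuation only evolution equations are solved. Propagation of the constraints is never
  computed: the complete field equations hold on an overlap and are analytic.\<close>

lemma nondecreasing_from_deriv:
  fixes f f' :: "real \<Rightarrow> real"
  assumes "\<And>t. t \<ge> t0 \<Longrightarrow> (f has_real_derivative f' t) (at t)"
    and "\<And>t. t \<ge> t0 \<Longrightarrow> f' t \<ge> 0" and "t0 \<le> s" "s \<le> t"
  shows "f s \<le> f t"
  by (rule DERIV_nonneg_imp_nondecreasing[OF assms(4)]) (use assms in \<open>meson order_trans\<close>)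

lemma nondecreasing_bounded_converges:
  fixes f :: "real \<Rightarrow> real"
  assumes mono: "\<And>s t. t0 \<le> s \<Longrightarrow> s \<le> t \<Longrightarrow> f s \<le> f t" and bd: "\<And>t. t0 \<le> t \<Longrightarrow> f t \<le> B"
  shows "\<exists>l. (f \<longlongrightarrow> l) at_top"
proof (intro exI)
  let ?l = "SUP t\<in>{t0..}. f t"
  have bdd: "bdd_above (f ` {t0..})" using bd by (auto intro!: bdd_aboveI[of _ B])
  show "(f \<longlongrightarrow> ?l) at_top"
  proof (rule order_tendstoI)
    fix a assume "a < ?l"
    then obtain s where s: "s \<ge> t0" "a < f s" using less_cSUP_iff[OF _ bdd] by auto
    then have "\<And>t. t \<ge> s \<Longrightarrow> a < f t" using mono less_le_trans by blast
    then show "\<forall>\<^sub>F t in at_top. a < f t" using eventually_at_top_linorder by blast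
  next
    fix a assume a: "?l < a"
    have "\<And>t. t \<ge> t0 \<Longrightarrow> f t < a" using cSUP_upper[OF _ bdd] a
      by (metis atLeast_iff le_less_trans)
    then show "\<forall>\<^sub>F t in at_top. f t < a" using eventually_at_top_linorder by blast
  qed
qed

lemma nonincreasing_bounded_converges:
  fixes f :: "real \<Rightarrow> real"
  assumes "\<And>s t. t0 \<le> s \<Longrightarrow> s \<le> t \<Longrightarrow> f t \<le> f s" and "\<And>t. t0 \<le> t \<Longrightarrow> B \<le> f t"
  shows "\<exists>l. (f \<longlongrightarrow> l) at_top"
proof -
  obtain l where "((\<lambda>t. - f t) \<longlongrightarrow> l) at_top"
    using nondecreasing_bounded_converges[of t0 "\<lambda>t. - f t" "-B"] assms by auto
  then show ?thesis using tendsto_minus by fastforce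
qed

text \<open>The bound makes \<open>f + h\<close> nonincreasing and \<open>f - h\<close>
  nondecreasing: the variation of \<open>f\<close> is paid for by the decrease of \<open>h\<close>,
  and only finitely much can be paid.\<close>

lemma controlled_variation_converges:
  fixes f h f' h' :: "real \<Rightarrow> real"
  assumes f: "\<And>t. t \<ge> t0 \<Longrightarrow> (f has_real_derivative f' t) (at t)"
    and h: "\<And>t. t \<ge> t0 \<Longrightarrow> (h has_real_derivative h' t) (at t)"
    and le: "\<And>t. t \<ge> t0 \<Longrightarrow> \<bar>f' t\<bar> \<le> - h' t"
    and bd: "\<And>t. t \<ge> t0 \<Longrightarrow> B \<le> h t"
  shows "\<exists>l. (f \<longlongrightarrow> l) at_top"
proof -
  have plus: "f t + h t \<le> f s + h s" if "t0 \<le> s" "s \<le> t" for s t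
    using nondecreasing_from_deriv[of t0 "\<lambda>t. - (f t + h t)" "\<lambda>t. - (f' t + h' t)" s t] that le
    by (force intro!: derivative_eq_intros f h)
  have minus: "f s - h s \<le> f t - h t" if "t0 \<le> s" "s \<le> t" for s t
    using nondecreasing_from_deriv[of t0 "\<lambda>t. f t - h t" "\<lambda>t. f' t - h' t" s t] that le
    by (force intro!: derivative_eq_intros f h)
  have "h t \<le> h s" if "t0 \<le> s" "s \<le> t" for s t
    using nondecreasing_from_deriv[of t0 "\<lambda>t. - h t" "\<lambda>t. - h' t" s t] that le
    by (force intro!: derivative_eq_intros h)
  then obtain lh where lh: "(h \<longlongrightarrow> lh) at_top"
    using nonincreasing_bounded_converges[of t0 h B] bd by blast
  have "f t0 - h t0 + 2 * B \<le> f t + h t" if "t0 \<le> t" for t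
    using minus[of t0 t] bd[OF that] that by linarith
  then obtain l where "((\<lambda>t. f t + h t) \<longlongrightarrow> l) at_top"
    using nonincreasing_bounded_converges[of t0 "\<lambda>t. f t + h t"] plus by blast
  from tendsto_diff[OF this lh] show ?thesis by auto
qed

text \<open>After the last time in \<open>{t1..t}\<close> at which \<open>f\<close> is at most
  \<open>M\<close>, the function is nonincreasing, so it cannot have risen above
  \<open>M\<close>.\<close>

lemma barrier:
  fixes f f' :: "real \<Rightarrow> real"
  assumes f: "\<And>t. t1 \<le> t \<Longrightarrow> (f has_real_derivative f' t) (at t)"
    and f': "\<And>t. t1 \<le> t \<Longrightarrow> f t > M \<Longrightarrow> f' t \<le> 0"
    and "f t1 \<le> M" "t1 \<le> t"
  shows "f t \<le> M"
proof (rule ccontr)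
  assume "\<not> f t \<le> M"
  then have ft: "f t > M" by simp
  have cont: "continuous_on {t1..t} f"
    by (intro continuous_at_imp_continuous_on ballI DERIV_isCont[OF f]) auto
  define S where "S = {s \<in> {t1..t}. f s \<le> M}"
  have "closed S" unfolding S_def
    using continuous_closed_preimage[OF cont closed_atLeastAtMost, of "{..M}"] by (simp add: vimage_def Int_def conj_commute)
  moreover have "bounded S" by (rule bounded_subset[of "{t1..t}"]) (auto simp: S_def)
  ultimately have "compact S" by (simp add: compact_eq_bounded_closed)
  moreover have "S \<noteq> {}" using assms(3,4) unfolding S_def by auto
  ultimately obtain s where s: "s \<in> S" "\<And>r. r \<in> S \<Longrightarrow> r \<le> s" using compact_attains_sup by metis
  then have st: "t1 \<le> s" "s \<le> t" "f s \<le> M" unfolding S_def by auto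
  have "f t \<le> f s"
  proof (rule DERIV_nonpos_imp_decreasing_open[OF st(2)])
    fix x assume x: "s < x" "x < t"
    then have "f x > M" using s(2)[of x] st unfolding S_def by force
    then show "\<exists>y. DERIV f x :> y \<and> y \<le> 0" using f[of x] f'[of x] x st by auto
  qed (rule continuous_on_subset[OF cont], use st in auto)
  then show False using ft st by simp
qed

text \<open>
  Here \<open>\<theta>\<close> is the expansion and \<open>\<tau>\<close> the logarithm of the volume.  The other functions are divided by the appropriate
  power of \<open>\<theta>\<close>: \<open>y\<close> is the part of the expansion in the plane of \<open>b2, b3\<close>, \<open>Z\<close> the square of the
  trace-free part of \<open>\<kappa>\<close> in the plane; \<open>a\<close>, \<open>W\<close> and \<open>b\<close> are the trace, the square of the trace-free symmetric part and
  the antisymmetric part of \<open>ad b1\<close> on the plane; \<open>n\<close> is the coefficient of \<open>[b2, b3]\<close>; \<open>x\<close> is the velocity of the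
  scalar field, \<open>\<xi>\<close> the cross product of the two trace-free symmetric parts, and \<open>- r\<close> the scalar curvature.
\<close>

locale normalized_flow =
  fixes t0 :: real and \<theta> \<tau> y a W Z x b n \<xi> r :: "real \<Rightarrow> real"
  assumes \<theta>_pos: "t0 \<le> t \<Longrightarrow> \<theta> t > 0"
    and \<tau>_deriv: "t0 \<le> t \<Longrightarrow> (\<tau> has_real_derivative \<theta> t) (at t)"
    and \<tau>_lim: "filterlim \<tau> at_top at_top"
    and r_eq: "t0 \<le> t \<Longrightarrow> r t = 2 * W t + 3/2 * (a t)\<^sup>2 + (n t)\<^sup>2 / 2 - 2 * b t * n t"
    and y_deriv: "t0 \<le> t \<Longrightarrow>
      (y has_real_derivative \<theta> t * ((a t)\<^sup>2 + (n t)\<^sup>2 - 2 * b t * n t - r t * y t)) (at t)"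
    and a_deriv: "t0 \<le> t \<Longrightarrow> (a has_real_derivative \<theta> t * (a t * (y t - r t))) (at t)"
    and x_deriv: "t0 \<le> t \<Longrightarrow> (x has_real_derivative - (\<theta> t * (r t * x t))) (at t)"
    and n_deriv: "t0 \<le> t \<Longrightarrow> (n has_real_derivative \<theta> t * (n t * (2 - 2 * y t - r t))) (at t)"
    and b_deriv: "t0 \<le> t \<Longrightarrow>
      (b has_real_derivative \<theta> t * ((y t - r t) * b t + 2 * \<xi> t)) (at t)"
    and W_deriv: "t0 \<le> t \<Longrightarrow>
      (W has_real_derivative \<theta> t * (2 * (y t - r t) * W t + 4 * b t * \<xi> t)) (at t)"
    and Z_deriv: "t0 \<le> t \<Longrightarrow>
      (Z has_real_derivative
        \<theta> t * (- 2 * r t * Z t - 2 * (2 * b t - n t) * \<xi> t + (a t)\<^sup>2 * (2 - 3 * y t) / 2)) (at t)"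
    and \<xi>_deriv: "t0 \<le> t \<Longrightarrow>
      (\<xi> has_real_derivative
        \<theta> t * ((y t - 2 * r t) * \<xi> t - (2 * b t - n t) * W t + 2 * b t * Z t)) (at t)"
    and Hamiltonian: "t0 \<le> t \<Longrightarrow> 3/2 * (y t)\<^sup>2 - 2 * y t + 2 * Z t + (x t)\<^sup>2 + r t = 0"
    and momentum: "t0 \<le> t \<Longrightarrow> (a t * (2 - 3 * y t) / 4)\<^sup>2 \<le> Z t * W t"
    and \<xi>_le: "t0 \<le> t \<Longrightarrow> (\<xi> t)\<^sup>2 \<le> Z t * W t"
    and W_nonneg: "t0 \<le> t \<Longrightarrow> 0 \<le> W t" and Z_nonneg: "t0 \<le> t \<Longrightarrow> 0 \<le> Z t"
    and bn_nonpos: "t0 \<le> t \<Longrightarrow> b t * n t \<le> 0"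
begin

section \<open>A priori bounds from the Hamiltonian constraint\<close>

lemma eventually_from_t0: "(\<And>t. t0 \<le> t \<Longrightarrow> P t) \<Longrightarrow> \<forall>\<^sub>F t in at_top. P t"
  using eventually_at_top_linorder by blast

lemma r_nonneg: "t0 \<le> t \<Longrightarrow> 0 \<le> r t"
  using r_eq[of t] W_nonneg[of t] bn_nonpos[of t] zero_le_power2[of "a t"] zero_le_power2[of "n t"]
  unfolding mult.assoc by linarith

lemma y_nonneg: assumes "t0 \<le> t" shows "0 \<le> y t"
  using Hamiltonian[OF assms] Z_nonneg[OF assms] r_nonneg[OF assms]
    zero_le_power2[of "x t"] zero_le_power2[of "y t"] by linarith

text \<open>Both bounds drop nonnegative terms of the Hamiltonian constraint; 2/3 is the maximum of
  \<open>2 * y - 3/2 * y^2\<close>, attained at \<open>y = 2/3\<close>.\<close>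

lemma r_le: assumes "t0 \<le> t" shows "r t \<le> 2 * y t" and "r t \<le> 2/3"
proof -
  show "r t \<le> 2 * y t"
    using Hamiltonian[OF assms] Z_nonneg[OF assms] zero_le_power2[of "x t"] zero_le_power2[of "y t"]
    by linarith
  have "3/2 * (y t)\<^sup>2 - 2 * y t + 2/3 = 3/2 * (y t - 2/3)\<^sup>2" by (simp add: power2_eq_square algebra_simps)
  then show "r t \<le> 2/3"
    using Hamiltonian[OF assms] Z_nonneg[OF assms] zero_le_power2[of "x t"]
      zero_le_power2[of "y t - 2/3"] by linarith
qed

lemma Zx_le: assumes "t0 \<le> t" shows "2 * Z t \<le> 2 * y t" and "(x t)\<^sup>2 \<le> 2 * y t"
  using Hamiltonian[OF assms] Z_nonneg[OF assms] r_nonneg[OF assms]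
      zero_le_power2[of "x t"] zero_le_power2[of "y t"] by linarith+

lemma y_le: assumes "t0 \<le> t" shows "y t \<le> 4/3"
proof (rule ccontr)
  assume "\<not> y t \<le> 4/3"
  then have "0 < y t * (3/2 * y t - 2)" by (intro mult_pos_pos) auto
  moreover have "y t * (3/2 * y t - 2) = 3/2 * (y t)\<^sup>2 - 2 * y t" by (simp add: power2_eq_square algebra_simps)
  ultimately show False
    using Hamiltonian[OF assms] Z_nonneg[OF assms] r_nonneg[OF assms] zero_le_power2[of "x t"] by linarith
qed

lemma x_converges: "\<exists>l. ((\<lambda>t. (x t)\<^sup>2) \<longlongrightarrow> l) at_top"
proof (rule nonincreasing_bounded_converges[where ?t0.0=t0 and B=0])
  fix s t assume st: "t0 \<le> s" "s \<le> t"
  have "- (x s)\<^sup>2 \<le> - (x t)\<^sup>2"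
  proof (rule nondecreasing_from_deriv[of t0 "\<lambda>t. - (x t)\<^sup>2" "\<lambda>t. 2 * \<theta> t * r t * (x t)\<^sup>2", OF _ _ st])
    fix u assume u: "t0 \<le> u"
    show "((\<lambda>t. - (x t)\<^sup>2) has_real_derivative 2 * \<theta> u * r u * (x u)\<^sup>2) (at u)"
      by (auto intro!: derivative_eq_intros x_deriv[OF u] simp: power2_eq_square)
    show "0 \<le> 2 * \<theta> u * r u * (x u)\<^sup>2" using \<theta>_pos[OF u] r_nonneg[OF u] by simp
  qed
  then show "(x t)\<^sup>2 \<le> (x s)\<^sup>2" by simp
qed auto

text \<open>The Hamiltonian constraint expresses \<open>Z\<close> through \<open>y\<close>,
  \<open>r\<close> and the square of \<open>x\<close>, and the latter always converges. In the cases
  where \<open>Z\<close> has no direct argument the task is thus to treat \<open>y\<close> and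
  \<open>r\<close>.\<close>

lemma Z_converges_if:
  assumes "(y \<longlongrightarrow> yl) at_top" "(r \<longlongrightarrow> rl) at_top"
  shows "\<exists>l. (Z \<longlongrightarrow> l) at_top"
proof -
  obtain xl where "((\<lambda>t. (x t)\<^sup>2) \<longlongrightarrow> xl) at_top" using x_converges by blast
  then have "((\<lambda>t. (2 * y t - 3/2 * (y t)\<^sup>2 - (x t)\<^sup>2 - r t) / 2) \<longlongrightarrow>
      (2 * yl - 3/2 * yl\<^sup>2 - xl - rl) / 2) at_top"
    by (intro tendsto_intros assms) auto
  moreover have "\<forall>\<^sub>F t in at_top. (2 * y t - 3/2 * (y t)\<^sup>2 - (x t)\<^sup>2 - r t) / 2 = Z t"
    using eventually_ge_at_top[of t0] by eventually_elim (use Hamiltonian in force)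
  ultimately show ?thesis using Lim_transform_eventually by blast
qed

text \<open>Types I and II. Here \<open>W = 0\<close> forces \<open>\<xi> = 0\<close>, so nothing
  oscillates: \<open>y\<close> is nondecreasing and \<open>Z\<close> nonincreasing.\<close>

lemma converges_without_brackets:
  assumes "\<And>t. t0 \<le> t \<Longrightarrow> a t = 0" "\<And>t. t0 \<le> t \<Longrightarrow> b t = 0" "\<And>t. t0 \<le> t \<Longrightarrow> W t = 0"
  shows "(\<exists>l. (y \<longlongrightarrow> l) at_top) \<and> (\<exists>l. (Z \<longlongrightarrow> l) at_top)"
proof
  have rn: "r t = (n t)\<^sup>2 / 2" if "t0 \<le> t" for t using r_eq[OF that] assms that by simp
  show "\<exists>l. (y \<longlongrightarrow> l) at_top"
  proof (rule nondecreasing_bounded_converges[where ?t0.0=t0 and B="4/3"])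
    fix s t assume st: "t0 \<le> s" "s \<le> t"
    show "y s \<le> y t"
    proof (rule nondecreasing_from_deriv[OF y_deriv _ st])
      fix u assume u: "t0 \<le> u"
      have "(a u)\<^sup>2 + (n u)\<^sup>2 - 2 * b u * n u - r u * y u = (n u)\<^sup>2 / 2 * (2 - y u)"
        using assms u rn by (simp add: algebra_simps)
      also have "\<dots> \<ge> 0" using y_le[OF u] by (intro mult_nonneg_nonneg) auto
      finally show "0 \<le> \<theta> u * ((a u)\<^sup>2 + (n u)\<^sup>2 - 2 * b u * n u - r u * y u)"
        using \<theta>_pos[OF u] by simp
    qed
  qed (use y_le in auto)
  show "\<exists>l. (Z \<longlongrightarrow> l) at_top"
  proof (rule nonincreasing_bounded_converges[where ?t0.0=t0 and B=0])
    fix s t assume st: "t0 \<le> s" "s \<le> t"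
    have "- Z s \<le> - Z t"
    proof (rule nondecreasing_from_deriv[OF DERIV_minus[OF Z_deriv] _ st])
      fix u assume u: "t0 \<le> u"
      have "(\<xi> u)\<^sup>2 \<le> 0" using \<xi>_le[OF u] assms u by simp
      then have "\<xi> u = 0" by simp
      then show "0 \<le> - (\<theta> u * (- 2 * r u * Z u - 2 * (2 * b u - n u) * \<xi> u + (a u)\<^sup>2 * (2 - 3 * y u) / 2))"
        using assms u \<theta>_pos[OF u] r_nonneg[OF u] Z_nonneg[OF u] by simp
    qed
    then show "Z t \<le> Z s" by simp
  qed (use Z_nonneg in auto)
qed

lemma \<tau>_unbounded_contradiction:
  fixes c :: real
  assumes "c > 0" "\<And>t. T \<le> t \<Longrightarrow> c * \<tau> t \<le> K"
  shows False
proof -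
  have "\<forall>\<^sub>F t in at_top. \<tau> t > K / c" using \<tau>_lim by (simp add: filterlim_at_top_dense)
  then have "\<forall>\<^sub>F t in at_top. \<tau> t > K / c \<and> t \<ge> T"
    using eventually_ge_at_top[of T] by eventually_elim simp
  then obtain t where "\<tau> t > K / c" "t \<ge> T" using eventually_happens by fastforce
  then show False using assms(1) assms(2)[of t] by (simp add: field_simps)
qed

text \<open>The trace-free case of types VI and VII. The difference of the square of
  \<open>b\<close> and \<open>W\<close> is the normalized determinant of \<open>ad b1\<close> on the
  plane, so \<open>det\<close> separates real from imaginary eigenvalues. If \<open>y\<close> stays
  away from 0, then \<open>ln y\<close> is bounded with derivative \<open>- (\<theta> * r)\<close>,
  which makes \<open>r\<close> integrable against \<open>\<tau>\<close>; both cases rest on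
  this.\<close>

lemma converges_unimodular_plane:
  assumes a0: "\<And>t. t0 \<le> t \<Longrightarrow> a t = 0" and n0: "\<And>t. t0 \<le> t \<Longrightarrow> n t = 0"
    and det: "(\<forall>t\<ge>t0. (b t)\<^sup>2 \<le> W t) \<or> (\<forall>t\<ge>t0. W t < (b t)\<^sup>2)"
  shows "(\<exists>l. (y \<longlongrightarrow> l) at_top) \<and> (\<exists>l. (Z \<longlongrightarrow> l) at_top)"
proof -
  have rW: "r t = 2 * W t" if "t0 \<le> t" for t using r_eq[OF that] a0 n0 that by simp
  have y': "(y has_real_derivative - (\<theta> t * (r t * y t))) (at t)" if "t0 \<le> t" for t
    using y_deriv[OF that] a0 n0 that by simp
  have ymono: "y t \<le> y s" if "t0 \<le> s" "s \<le> t" for s t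
  proof -
    have "- y s \<le> - y t"
      by (rule nondecreasing_from_deriv[OF DERIV_minus[OF y'] _ that])
        (use \<theta>_pos r_nonneg y_nonneg in \<open>auto simp: less_imp_le\<close>)
    then show ?thesis by simp
  qed
  then obtain yl where yl: "(y \<longlongrightarrow> yl) at_top"
    using nonincreasing_bounded_converges[of t0 y 0] y_nonneg by blast
  have yl_le: "yl \<le> y t" if "t0 \<le> t" for t
  proof (rule tendsto_upperbound[OF yl])
    show "\<forall>\<^sub>F s in at_top. y s \<le> y t"
      using eventually_ge_at_top[of t] by eventually_elim (use ymono that in blast)
  qed simp
  have "0 \<le> yl" by (rule tendsto_lowerbound[OF yl eventually_from_t0[OF y_nonneg]]) auto
  have "\<exists>rl. (r \<longlongrightarrow> rl) at_top"
  proof (cases "yl = 0")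
    case True
    have "(r \<longlongrightarrow> 0) at_top"
    proof (rule tendsto_sandwich[of "\<lambda>_. 0" r at_top "\<lambda>t. 2 * y t"])
      show "((\<lambda>t. 2 * y t) \<longlongrightarrow> 0) at_top" using tendsto_mult_left[OF yl, of 2] True by simp
    qed (use r_nonneg r_le(1) in \<open>auto intro: eventually_from_t0\<close>)
    then show ?thesis by blast
  next
    case False
    then have ylp: "0 < yl" using \<open>0 \<le> yl\<close> by simp
    then have yp: "0 < y t" if "t0 \<le> t" for t using yl_le[OF that] by simp
    have lny: "((\<lambda>t. ln (y t)) has_real_derivative - (\<theta> t * r t)) (at t)" if "t0 \<le> t" for t
      using yp[OF that] by (auto intro!: derivative_eq_intros y'[OF that])
    have lnyb: "ln yl \<le> ln (y t)" if "t0 \<le> t" for t using yl_le[OF that] ylp by simp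
    show ?thesis using det
    proof
      assume bW: "\<forall>t\<ge>t0. (b t)\<^sup>2 \<le> W t"
      \<comment> \<open>Squaring \<open>W\<close> supplies the factor \<open>2 * W = r\<close> that
        the derivative of \<open>ln y\<close> pays for. The other factor need only be bounded, and
        14/9 + 8/9 is below 3.\<close>
      have "\<exists>l. ((\<lambda>t. (W t)\<^sup>2) \<longlongrightarrow> l) at_top"
      proof (rule controlled_variation_converges[where ?t0.0=t0 and h="\<lambda>t. 3 * ln (y t)" and B="3 * ln yl"])
        fix t assume t: "t0 \<le> t"
        let ?d = "2 * (y t - r t) * W t + 4 * b t * \<xi> t"
        show "((\<lambda>t. (W t)\<^sup>2) has_real_derivative 2 * W t * (\<theta> t * ?d)) (at t)"
          by (auto intro!: derivative_eq_intros W_deriv[OF t])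
        show "((\<lambda>t. 3 * ln (y t)) has_real_derivative - (3 * \<theta> t * r t)) (at t)"
          using DERIV_cmult[OF lny[OF t], of 3] by (simp add: mult.assoc)
        have W3: "W t \<le> 1/3" using rW[OF t] r_le(2)[OF t] by simp
        have "(\<xi> t)\<^sup>2 \<le> 4/3 * (1/3)"
          using Zx_le(1)[OF t] y_le[OF t] W_nonneg[OF t]
          by (intro order_trans[OF \<xi>_le[OF t]] mult_mono W3) auto
        moreover have "(b t)\<^sup>2 \<le> 1/3" using bW t W3 by force
        moreover have "2 * \<bar>b t * \<xi> t\<bar> \<le> (b t)\<^sup>2 + (\<xi> t)\<^sup>2"
          using sum_squares_bound[of "\<bar>b t\<bar>" "\<bar>\<xi> t\<bar>"] by (simp add: abs_mult)
        moreover have "\<bar>4 * b t * \<xi> t\<bar> = 2 * (2 * \<bar>b t * \<xi> t\<bar>)" by (simp add: abs_mult)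
        ultimately have 1: "\<bar>4 * b t * \<xi> t\<bar> \<le> 14/9" by linarith
        have "\<bar>y t - r t\<bar> \<le> 4/3" using y_nonneg[OF t] y_le[OF t] r_nonneg[OF t] r_le(2)[OF t] by linarith
        from mult_mono[OF this W3] have "\<bar>2 * (y t - r t) * W t\<bar> \<le> 8/9"
          using W_nonneg[OF t] by (simp add: abs_mult mult_ac del: right_diff_distrib_numeral)
        with 1 have "\<bar>?d\<bar> \<le> 3" by linarith
        then have "\<bar>2 * W t * (\<theta> t * ?d)\<bar> \<le> 2 * W t * (\<theta> t * 3)"
          unfolding abs_mult using W_nonneg[OF t] \<theta>_pos[OF t] by (intro mult_mono) auto
        then show "\<bar>2 * W t * (\<theta> t * ?d)\<bar> \<le> - (- (3 * \<theta> t * r t))"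
          by (simp add: rW[OF t] mult_ac)
        show "3 * ln yl \<le> 3 * ln (y t)" using lnyb[OF t] by simp
      qed
      then obtain l where "((\<lambda>t. (W t)\<^sup>2) \<longlongrightarrow> l) at_top" by blast
      from tendsto_mult_left[OF tendsto_real_sqrt[OF this], of 2]
      have "((\<lambda>t. 2 * sqrt ((W t)\<^sup>2)) \<longlongrightarrow> 2 * sqrt l) at_top" .
      then have "(r \<longlongrightarrow> 2 * sqrt l) at_top"
        by (rule Lim_transform_eventually)
          (rule eventually_from_t0, use W_nonneg rW in simp)
      then show ?thesis by blast
    next
      assume Wb: "\<forall>t\<ge>t0. W t < (b t)\<^sup>2"
      have bnz: "b t \<noteq> 0" if "t0 \<le> t" for t using Wb W_nonneg[OF that] that by fastforce
      \<comment> \<open>The structure constants fix this determinant up to the scale of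
        \<open>b1\<close>, hence its closed equation. Dividing by the square of \<open>y\<close>
        cancels \<open>r\<close>; the quotient is nondecreasing, which keeps \<open>b\<close> away
        from 0.\<close>
      let ?\<Delta> = "\<lambda>t. (b t)\<^sup>2 - W t"
      have \<Delta>': "(?\<Delta> has_real_derivative 2 * \<theta> t * (y t - r t) * ?\<Delta> t) (at t)" if t: "t0 \<le> t" for t
        by (rule derivative_eq_intros b_deriv[OF t] W_deriv[OF t] refl)+ (simp add: power2_eq_square algebra_simps)
      define c where "c = ?\<Delta> t0 / (y t0)\<^sup>2 * yl\<^sup>2"
      have c: "c > 0" using Wb yp[of t0] ylp unfolding c_def by simp
      have cb: "c \<le> (b t)\<^sup>2" if t: "t0 \<le> t" for t
      proof -
        have "?\<Delta> t0 / (y t0)\<^sup>2 \<le> ?\<Delta> t / (y t)\<^sup>2"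
        proof (rule nondecreasing_from_deriv[OF _ _ order_refl t])
          fix u assume u: "t0 \<le> u"
          show "((\<lambda>t. ?\<Delta> t / (y t)\<^sup>2) has_real_derivative 2 * \<theta> u * ?\<Delta> u / y u) (at u)"
            using yp[OF u]
            by (intro DERIV_cong[OF DERIV_divide[OF \<Delta>'[OF u] DERIV_power[OF y'[OF u]]]])
              (auto simp: power2_eq_square field_simps)
          show "0 \<le> 2 * \<theta> u * ?\<Delta> u / y u" using \<theta>_pos[OF u] yp[OF u] Wb u by (simp add: less_imp_le)
        qed
        then have "c \<le> ?\<Delta> t / (y t)\<^sup>2 * yl\<^sup>2" unfolding c_def by (rule mult_right_mono) simp
        also have "\<dots> \<le> ?\<Delta> t / (y t)\<^sup>2 * (y t)\<^sup>2"
          using yl_le[OF t] ylp Wb t by (intro mult_left_mono power_mono) (auto simp: less_imp_le)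
        also have "\<dots> \<le> (b t)\<^sup>2" using yp[OF t] W_nonneg[OF t] by simp
        finally show ?thesis .
      qed
      \<comment> \<open>The derivative of \<open>\<xi> / b\<close> contains
        \<open>2 * Z - r\<close>. With \<open>r\<close> integrable, a positive limit of
        \<open>2 * Z + r\<close> would make this bounded quotient grow like
        \<open>\<tau>\<close>.\<close>
      define f where "f t = \<xi> t / b t" for t
      have f': "(f has_real_derivative \<theta> t * (2 * Z t - r t - r t * f t - 2 * (f t)\<^sup>2)) (at t)"
        if t: "t0 \<le> t" for t
        unfolding f_def using bnz[OF t] n0[OF t] rW[OF t]
        by (auto intro!: derivative_eq_intros \<xi>_deriv[OF t] b_deriv[OF t] simp: power2_eq_square field_simps)
      have fZ: "(f t)\<^sup>2 \<le> 2/3 * r t / c" and f2: "\<bar>f t\<bar> \<le> 2" if t: "t0 \<le> t" for t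
      proof -
        have fe: "(f t)\<^sup>2 = (\<xi> t)\<^sup>2 / (b t)\<^sup>2" unfolding f_def by (simp add: power_divide)
        have Z43: "Z t \<le> 4/3" using Zx_le(1)[OF t] y_le[OF t] by linarith
        have "(\<xi> t)\<^sup>2 \<le> 4/3 * W t" using order_trans[OF \<xi>_le[OF t] mult_right_mono[OF Z43 W_nonneg[OF t]]] .
        then have "(\<xi> t)\<^sup>2 \<le> 2/3 * r t" using rW[OF t] by simp
        then show "(f t)\<^sup>2 \<le> 2/3 * r t / c"
          unfolding fe using cb[OF t] c r_nonneg[OF t] by (intro frac_le) auto
        have "(\<xi> t)\<^sup>2 \<le> 4 * (b t)\<^sup>2" using \<open>(\<xi> t)\<^sup>2 \<le> 4/3 * W t\<close> Wb t W_nonneg[OF t] by force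
        then have "(f t)\<^sup>2 \<le> 2\<^sup>2" unfolding fe using bnz[OF t] by (simp add: field_simps)
        then show "\<bar>f t\<bar> \<le> 2" using abs_le_square_iff[of "f t" 2] by simp
      qed
      define e where "e t = 2 * Z t + r t" for t
      have ee: "e t = 2 * y t - 3/2 * (y t)\<^sup>2 - (x t)\<^sup>2" if "t0 \<le> t" for t
        unfolding e_def using Hamiltonian[OF that] by linarith
      obtain xl where xl: "((\<lambda>t. (x t)\<^sup>2) \<longlongrightarrow> xl) at_top" using x_converges by blast
      define el where "el = 2 * yl - 3/2 * yl\<^sup>2 - xl"
      have el: "(e \<longlongrightarrow> el) at_top"
      proof (rule Lim_transform_eventually)
        show "((\<lambda>t. 2 * y t - 3/2 * (y t)\<^sup>2 - (x t)\<^sup>2) \<longlongrightarrow> el) at_top"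
          unfolding el_def by (intro tendsto_intros yl xl)
      qed (rule eventually_from_t0, use ee in simp)
      have "el \<le> 0"
      proof (rule ccontr)
        assume "\<not> el \<le> 0"
        then have "\<forall>\<^sub>F t in at_top. e t > el / 2" using order_tendstoD(1)[OF el, of "el/2"] by simp
        then obtain T0 where T0: "\<And>t. t \<ge> T0 \<Longrightarrow> e t > el / 2" by (auto simp: eventually_at_top_linorder)
        define T where "T = max T0 t0"
        \<comment> \<open>Since \<open>2 * Z - r = e - 2 * r\<close>, the summand 4 covers
          \<open>2 * r\<close> and the bound \<open>2 * r\<close> of \<open>r * f\<close>; the
          summand \<open>4/(3 * c)\<close> covers twice the square of \<open>f\<close>, by
          \<open>fZ\<close>.\<close>
        define k where "k = 4 + 4/(3 * c)"
        define G where "G t = f t - k * ln (y t) - el / 2 * \<tau> t" for t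
        have G: "G T \<le> G t" if "T \<le> t" for t
        proof (rule nondecreasing_from_deriv[OF _ _ order_refl that])
          fix u assume u: "T \<le> u"
          then have u0: "t0 \<le> u" and uT: "T0 \<le> u" unfolding T_def by auto
          let ?h = "2 * Z u - r u - r u * f u - 2 * (f u)\<^sup>2 + k * r u - el / 2"
          show "(G has_real_derivative \<theta> u * ?h) (at u)"
            unfolding G_def
            by (rule derivative_eq_intros f'[OF u0] lny[OF u0] \<tau>_deriv[OF u0] refl)+ (simp add: algebra_simps)
          have "r u * f u \<le> r u * 2" using f2[OF u0] r_nonneg[OF u0] by (intro mult_left_mono) auto
          moreover have "k * r u = 4 * r u + 2 * (2/3 * r u / c)" unfolding k_def by (simp add: field_simps)
          ultimately have "?h \<ge> 0" using fZ[OF u0] T0[OF uT] unfolding e_def by linarith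
          then show "0 \<le> \<theta> u * ?h" using \<theta>_pos[OF u0] by simp
        qed
        have "el / 2 * \<tau> t \<le> 2 - k * ln yl - G T" if t: "T \<le> t" for t
        proof -
          have t0: "t0 \<le> t" using t unfolding T_def by simp
          have "k * ln yl \<le> k * ln (y t)" using lnyb[OF t0] c unfolding k_def by (intro mult_left_mono) auto
          then show ?thesis using G[OF t] f2[OF t0] unfolding G_def by linarith
        qed
        from \<tau>_unbounded_contradiction[OF _ this] \<open>\<not> el \<le> 0\<close> show False by simp
      qed
      moreover have "0 \<le> el" by (rule tendsto_lowerbound[OF el])
        (use Z_nonneg r_nonneg in \<open>auto simp: e_def intro!: eventually_from_t0\<close>)
      ultimately have e0: "(e \<longlongrightarrow> 0) at_top" using el by simp
      have "(r \<longlongrightarrow> 0) at_top"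
      proof (rule tendsto_sandwich[OF _ _ tendsto_const e0])
        show "\<forall>\<^sub>F t in at_top. r t \<le> e t"
          using eventually_ge_at_top[of t0] by eventually_elim (use Z_nonneg in \<open>simp add: e_def\<close>)
      qed (use r_nonneg in \<open>auto intro: eventually_from_t0\<close>)
      then show ?thesis by blast
    qed
  qed
  then show ?thesis using yl Z_converges_if by blast
qed

text \<open>The types with nonzero trace of \<open>ad\<close>. The constraints give
  \<open>a \<le> y\<close>, and \<open>q = a / y\<close> increases. The rate \<open>y - r\<close> of
  \<open>ln a\<close> is at most of order \<open>y * sqrt (1 - q)\<close>, while
  \<open>sqrt (1 - q)\<close> decreases at a rate of that same order. So it controls the variation
  of \<open>ln a\<close>.\<close>

lemma converges_nonunimodular:
  assumes a_pos: "\<And>t. t0 \<le> t \<Longrightarrow> 0 < a t" and n0: "\<And>t. t0 \<le> t \<Longrightarrow> n t = 0"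
  shows "(\<exists>l. (y \<longlongrightarrow> l) at_top) \<and> (\<exists>l. (Z \<longlongrightarrow> l) at_top)"
proof -
  define C :: "real \<Rightarrow> real" where "C t = a t * (2 - 3 * y t) / 4" for t
  have CZW: "(C t)\<^sup>2 \<le> Z t * W t" if "t0 \<le> t" for t using momentum[OF that] unfolding C_def .
  have ZWC: "0 \<le> Z t + W t - 2 * C t" if t: "t0 \<le> t" for t
  proof -
    have "(2 * C t)\<^sup>2 \<le> 4 * (Z t * W t)" using CZW[OF t] by (simp add: power2_eq_square)
    also have "\<dots> \<le> (Z t + W t)\<^sup>2"
      using zero_le_power2[of "Z t - W t"] by (simp add: power2_eq_square algebra_simps)
    finally show ?thesis
      using abs_le_square_iff[of "2 * C t" "Z t + W t"] Z_nonneg[OF t] W_nonneg[OF t] by linarith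
  qed
  text \<open>The two constraints combine into a sum of squares.\<close>
  have id: "2 * (y t - a t) = 3/2 * (y t - a t)\<^sup>2 + (x t)\<^sup>2 + 2 * (Z t + W t - 2 * C t)"
    if t: "t0 \<le> t" for t
    using Hamiltonian[OF t] r_eq[OF t] n0[OF t] unfolding C_def by (simp add: power2_eq_square field_simps)
  have \<delta>2: "Z t + W t - 2 * C t \<le> y t - a t" if t: "t0 \<le> t" for t
  proof -
    define A where "A = 3/2 * (y t - a t)\<^sup>2 + (x t)\<^sup>2"
    have "0 \<le> A" unfolding A_def by simp
    moreover have "2 * (y t - a t) = A + 2 * (Z t + W t - 2 * C t)" unfolding A_def by (rule id[OF t])
    ultimately have "2 * (Z t + W t - 2 * C t) \<le> 2 * (y t - a t)" by linarith
    then show ?thesis by simp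
  qed
  have ay: "a t \<le> y t" if t: "t0 \<le> t" for t using \<delta>2[OF t] ZWC[OF t] by linarith
  have yp: "0 < y t" if t: "t0 \<le> t" for t using ay[OF t] a_pos[OF t] by linarith
  define q where "q t = a t / y t" for t
  have q0: "0 < q t" and q1: "q t \<le> 1" if t: "t0 \<le> t" for t
    unfolding q_def using ay[OF t] a_pos[OF t] yp[OF t] by auto
  have qa: "a t = q t * y t" if t: "t0 \<le> t" for t unfolding q_def using yp[OF t] by simp
  have q': "(q has_real_derivative \<theta> t * (y t * (q t * (1 - (q t)\<^sup>2)))) (at t)" if t: "t0 \<le> t" for t
    unfolding q_def using yp[OF t] n0[OF t]
    by (auto intro!: derivative_eq_intros a_deriv[OF t] y_deriv[OF t] simp: power2_eq_square field_simps)
  have q'_nonneg: "0 \<le> \<theta> t * (y t * (q t * (1 - (q t)\<^sup>2)))" if t: "t0 \<le> t" for t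
    using \<theta>_pos[OF t] yp[OF t] q0[OF t] q1[OF t] by (simp add: power_le_one)
  have qmono: "q s \<le> q t" if "t0 \<le> s" "s \<le> t" for s t
    by (rule nondecreasing_from_deriv[OF q' q'_nonneg that])
  obtain ql where ql: "(q \<longlongrightarrow> ql) at_top"
    using nondecreasing_bounded_converges[of t0 q 1] qmono q1 by blast
  have ql_ge: "q t \<le> ql" if t: "t0 \<le> t" for t
    by (rule tendsto_lowerbound[OF ql])
      (rule eventually_mono[OF eventually_ge_at_top[of t]], use qmono t in auto)
  have ql1: "ql \<le> 1" by (rule tendsto_upperbound[OF ql eventually_from_t0[OF q1]]) auto
  have ql0: "0 < ql" using ql_ge[of t0] q0[of t0] by simp
  define \<epsilon> where "\<epsilon> t = 1 - q t" for t
  have \<epsilon>0: "0 \<le> \<epsilon> t" and \<epsilon>1: "\<epsilon> t \<le> 1" if t: "t0 \<le> t" for t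
    unfolding \<epsilon>_def using q0[OF t] q1[OF t] by auto
  have yr: "\<bar>y t - r t\<bar> \<le> 5 * y t * sqrt (\<epsilon> t)" if t: "t0 \<le> t" for t
  proof -
    let ?\<delta> = "y t - a t"
    have \<delta>\<epsilon>: "?\<delta> = y t * \<epsilon> t" unfolding \<epsilon>_def using qa[OF t] by (simp add: algebra_simps)
    \<comment> \<open>Replacing the square of \<open>C\<close> by \<open>Z * W\<close> in the
      expanded square leaves \<open>W\<close> times the expression that \<open>\<delta>2\<close>
      bounds by \<open>y - a\<close>.\<close>
    have "(W t - C t)\<^sup>2 \<le> (Z t + W t - 2 * C t) * W t"
      using CZW[OF t] by (simp add: power2_eq_square algebra_simps)
    also have "\<dots> \<le> ?\<delta> * W t" by (rule mult_right_mono[OF \<delta>2[OF t] W_nonneg[OF t]])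
    also have "2 * W t + 3/2 * (a t)\<^sup>2 = r t" using r_eq[OF t] n0[OF t] by simp
    then have "W t \<le> y t" using r_le(1)[OF t] zero_le_power2[of "a t"] by linarith
    then have "?\<delta> * W t \<le> ?\<delta> * y t" using ay[OF t] by (intro mult_left_mono) auto
    also have "\<dots> = (y t * sqrt (\<epsilon> t))\<^sup>2"
      unfolding \<delta>\<epsilon> using \<epsilon>0[OF t] by (simp add: power_mult_distrib power2_eq_square)
    finally have WC: "\<bar>W t - C t\<bar> \<le> y t * sqrt (\<epsilon> t)"
      using abs_le_square_iff[of "W t - C t" "y t * sqrt (\<epsilon> t)"] yp[OF t] \<epsilon>0[OF t] by simp
    have "\<epsilon> t \<le> sqrt (\<epsilon> t)"
      using \<epsilon>0[OF t] \<epsilon>1[OF t] by (intro real_le_rsqrt) (simp add: power2_eq_square mult_left_le)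
    then have "y t * \<epsilon> t \<le> y t * sqrt (\<epsilon> t)" using yp[OF t] by simp
    moreover have "?\<delta> * (1 + 3/2 * a t) \<le> ?\<delta> * 3"
      using ay[OF t] y_le[OF t] by (intro mult_left_mono) auto
    moreover have "?\<delta> * 3 = 3 * (y t * \<epsilon> t)" using \<delta>\<epsilon> by simp
    ultimately have 1: "?\<delta> * (1 + 3/2 * a t) \<le> 3 * (y t * sqrt (\<epsilon> t))"
      using order_trans by (metis mult_left_mono zero_le_numeral)
    have 2: "0 \<le> ?\<delta> * (1 + 3/2 * a t)" using ay[OF t] a_pos[OF t] by simp
    have "y t - r t = ?\<delta> * (1 + 3/2 * a t) - 2 * (W t - C t)"
      using r_eq[OF t] n0[OF t] unfolding C_def by (simp add: power2_eq_square field_simps)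
    moreover have "u = v - 2 * w \<Longrightarrow> \<bar>u\<bar> \<le> \<bar>v\<bar> + 2 * \<bar>w\<bar>" for u v w :: real by linarith
    ultimately have "\<bar>y t - r t\<bar> \<le> \<bar>?\<delta> * (1 + 3/2 * a t)\<bar> + 2 * \<bar>W t - C t\<bar>" by blast
    also have "\<dots> \<le> 3 * (y t * sqrt (\<epsilon> t)) + 2 * (y t * sqrt (\<epsilon> t))"
      using 1 2 WC by (intro add_mono mult_left_mono) auto
    finally show ?thesis by (simp add: algebra_simps)
  qed
  have lna: "((\<lambda>t. ln (a t)) has_real_derivative \<theta> t * (y t - r t)) (at t)" if t: "t0 \<le> t" for t
    using a_pos[OF t] by (auto intro!: derivative_eq_intros a_deriv[OF t])
  have "\<exists>l. ((\<lambda>t. ln (a t)) \<longlongrightarrow> l) at_top"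
  \<comment> \<open>The square root is not differentiable at 0, so a zero of
    \<open>\<epsilon>\<close> is treated apart. Since \<open>q\<close> is nondecreasing and at most
    1, \<open>\<epsilon>\<close> then stays zero and the rate of \<open>ln a\<close>
    vanishes.\<close>
  proof (cases "\<exists>t1\<ge>t0. \<epsilon> t1 = 0")
    case True
    then obtain t1 where t1: "t0 \<le> t1" "\<epsilon> t1 = 0" by blast
    have \<epsilon>z: "\<epsilon> t = 0" if t: "t1 \<le> t" for t
      using qmono[of t1 t] t t1 \<epsilon>0[of t] unfolding \<epsilon>_def by auto
    show ?thesis
    proof (rule controlled_variation_converges[where ?t0.0=t1 and h="\<lambda>_. 0" and h'="\<lambda>_. 0" and B=0])
      fix t assume t: "t1 \<le> t"
      show "((\<lambda>t. ln (a t)) has_real_derivative \<theta> t * (y t - r t)) (at t)" using lna t t1 by simp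
      show "\<bar>\<theta> t * (y t - r t)\<bar> \<le> - 0" using yr[of t] \<epsilon>z[OF t] t t1 by simp
    qed auto
  next
    case False
    then have \<epsilon>p: "0 < \<epsilon> t" if "t0 \<le> t" for t using \<epsilon>0[OF that] that by fastforce
    \<comment> \<open>The factor \<open>10 / q t0\<close> compensates the one half from the square
      root and the lower bound \<open>q t0\<close> of \<open>q * (1 + q)\<close>, leaving the
      constant 5 of \<open>yr\<close>.\<close>
    let ?h' = "\<lambda>t. - (5 / q t0 * (\<theta> t * (y t * (q t * (1 + q t)) * sqrt (\<epsilon> t))))"
    show ?thesis
    proof (rule controlled_variation_converges[where ?t0.0=t0 and h="\<lambda>t. 10 / q t0 * sqrt (\<epsilon> t)" and h'="?h'" and B=0, OF lna])
      fix t assume t: "t0 \<le> t"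
      have e': "(\<epsilon> has_real_derivative - (\<theta> t * (y t * (q t * (1 - (q t)\<^sup>2))))) (at t)"
        unfolding \<epsilon>_def by (auto intro!: derivative_eq_intros q'[OF t])
      have e2: "1 - (q t)\<^sup>2 = (1 + q t) * (sqrt (\<epsilon> t) * sqrt (\<epsilon> t))"
        using \<epsilon>0[OF t] unfolding \<epsilon>_def by (simp add: power2_eq_square algebra_simps)
      show "((\<lambda>t. 10 / q t0 * sqrt (\<epsilon> t)) has_real_derivative ?h' t) (at t)"
        by (rule DERIV_cong[OF DERIV_cmult[OF DERIV_chain2[OF DERIV_real_sqrt[OF \<epsilon>p[OF t]] e'], of "10 / q t0"]])
          (use \<epsilon>p[OF t] q0[of t0] real_sqrt_gt_zero[OF \<epsilon>p[OF t]] in \<open>simp add: e2 field_simps del: real_sqrt_mult_self\<close>)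
      have "q t0 * 1 \<le> q t * (1 + q t)" using qmono[OF order_refl t] q0[OF t] q0[of t0] by (intro mult_mono) auto
      then have "5 * 1 \<le> 5 / q t0 * (q t * (1 + q t))" using q0[of t0] by (simp add: field_simps)
      from mult_right_mono[OF this, of "\<theta> t * (y t * sqrt (\<epsilon> t))"]
      have "\<theta> t * (5 * y t * sqrt (\<epsilon> t)) \<le> - ?h' t"
        using \<theta>_pos[OF t] yp[OF t] \<epsilon>0[OF t] by (simp add: mult_ac)
      then show "\<bar>\<theta> t * (y t - r t)\<bar> \<le> - ?h' t"
        using order_trans[OF mult_left_mono[OF yr[OF t] less_imp_le[OF \<theta>_pos[OF t]]]] \<theta>_pos[OF t]
        unfolding abs_mult abs_of_pos[OF \<theta>_pos[OF t]] by blast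
      show "0 \<le> 10 / q t0 * sqrt (\<epsilon> t)" using q0[of t0] \<epsilon>0[OF t] by simp
    qed
  qed
  then obtain l where "((\<lambda>t. ln (a t)) \<longlongrightarrow> l) at_top" by blast
  from tendsto_exp[OF this] have al: "(a \<longlongrightarrow> exp l) at_top"
    by (rule Lim_transform_eventually) (rule eventually_from_t0, use a_pos in simp)
  define yl where "yl = exp l / ql"
  have yl: "(y \<longlongrightarrow> yl) at_top"
    unfolding yl_def
  proof (rule Lim_transform_eventually[OF tendsto_divide[OF al ql]])
    show "\<forall>\<^sub>F t in at_top. a t / q t = y t"
      by (rule eventually_from_t0) (use q0 qa in \<open>force simp: field_simps\<close>)
  qed (use ql0 in simp)
  have ylp: "0 < yl" unfolding yl_def using ql0 by simp
  \<comment> \<open>If the limit were below 1, \<open>q\<close> would gain at least a fixed multiple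
    of \<open>\<tau>\<close>, although it is at most 1.\<close>
  have "ql = 1"
  proof (rule ccontr)
    assume "ql \<noteq> 1"
    then have qlt: "ql < 1" using ql1 by simp
    obtain T0 where T0: "\<And>t. T0 \<le> t \<Longrightarrow> yl / 2 < y t"
      using order_tendstoD(1)[OF yl, of "yl/2"] ylp by (auto simp: eventually_at_top_linorder)
    define T where "T = max t0 T0"
    define c where "c = yl / 2 * (q t0 * (1 - ql\<^sup>2))"
    have c: "0 < c" unfolding c_def using ylp q0[of t0] qlt ql0 by (simp add: abs_square_less_1)
    have "q T - c * \<tau> T \<le> q t - c * \<tau> t" if t: "T \<le> t" for t
    proof (rule nondecreasing_from_deriv[OF _ _ order_refl t])
      fix u assume "T \<le> u"
      then have u: "t0 \<le> u" and uT: "T0 \<le> u" unfolding T_def by auto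
      let ?h = "y u * (q u * (1 - (q u)\<^sup>2)) - c"
      show "((\<lambda>t. q t - c * \<tau> t) has_real_derivative \<theta> u * ?h) (at u)"
        by (rule derivative_eq_intros q'[OF u] \<tau>_deriv[OF u] refl)+ (simp add: algebra_simps)
      have "(q u)\<^sup>2 \<le> ql\<^sup>2" using ql_ge[OF u] q0[OF u] by (intro power_mono) auto
      moreover have "ql\<^sup>2 \<le> 1" using ql0 ql1 by (simp add: power_le_one)
      ultimately have "c \<le> y u * (q u * (1 - (q u)\<^sup>2))"
        unfolding c_def using T0[OF uT] ylp q0[of t0] q0[OF u] qmono[OF order_refl u]
        by (intro mult_mono) auto
      then show "0 \<le> \<theta> u * ?h" using \<theta>_pos[OF u] by simp
    qed
    then have "c * \<tau> t \<le> 1 - q T + c * \<tau> T" if t: "T \<le> t" for t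
      using that q1[of t] unfolding T_def by force
    then show False using \<tau>_unbounded_contradiction[OF c] by blast
  qed
  then have "(\<epsilon> \<longlongrightarrow> 0) at_top" unfolding \<epsilon>_def using tendsto_diff[OF tendsto_const[of 1] ql] by simp
  then have "((\<lambda>t. 5 * y t * sqrt (\<epsilon> t)) \<longlongrightarrow> 5 * yl * sqrt 0) at_top"
    by (intro tendsto_intros yl)
  then have lim0: "((\<lambda>t. 5 * y t * sqrt (\<epsilon> t)) \<longlongrightarrow> 0) at_top" by simp
  have "((\<lambda>t. y t - r t) \<longlongrightarrow> 0) at_top"
  proof (rule Lim_null_comparison[OF _ lim0])
    show "\<forall>\<^sub>F t in at_top. norm (y t - r t) \<le> 5 * y t * sqrt (\<epsilon> t)"
      by (rule eventually_from_t0) (use yr in simp)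
  qed
  from tendsto_diff[OF yl this] have "(r \<longlongrightarrow> yl) at_top" by simp
  then show ?thesis using yl Z_converges_if by blast
qed

text \<open>The derivative \<open>\<theta> * (2 - 3 * r)\<close> of \<open>ln \<Lambda>\<close> is
  nonnegative and vanishes only at \<open>y = 2/3\<close>, \<open>Z = x = 0\<close>. Exactly there
  \<open>f\<close> increases, so a combination of the two grows at least like \<open>\<tau>\<close>.
  As \<open>- b * n\<close> is bounded, \<open>\<Lambda>\<close> can grow only together with
  \<open>b\<close>.\<close>

lemma b_unbounded:
  assumes a0: "\<And>t. t0 \<le> t \<Longrightarrow> a t = 0" and n_neg: "\<And>t. t0 \<le> t \<Longrightarrow> n t < 0"
    and b_pos: "\<And>t. t0 \<le> t \<Longrightarrow> 0 < b t" and det: "\<And>t. t0 \<le> t \<Longrightarrow> W t < (b t)\<^sup>2"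
  shows "filterlim b at_top at_top"
proof -
  define g where "g t = \<xi> t / b t" for t
  \<comment> \<open>Near \<open>y = 2/3\<close> the derivative of \<open>y\<close> alone may be
    negative when \<open>r\<close> comes mainly from \<open>W\<close>. The multiple 4/3 of
    \<open>g\<close> contributes \<open>8/3 * W\<close> and raises the leading part to at least
    \<open>r / 3\<close>.\<close>
  define f where "f t = y t - 4/3 * g t" for t
  define \<Lambda> where "\<Lambda> t = - n t * ((b t)\<^sup>2 - W t)" for t
  have \<Lambda>p: "0 < \<Lambda> t" if "t0 \<le> t" for t unfolding \<Lambda>_def using n_neg det that by (simp add: mult_neg_pos)
  have r: "r t = 2 * W t + (n t)\<^sup>2 / 2 - 2 * b t * n t" if "t0 \<le> t" for t
    using r_eq[OF that] a0[OF that] by simp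
  have g': "(g has_real_derivative
      \<theta> t * (- r t * g t - 2 * W t + n t * W t / b t + 2 * Z t - 2 * (g t)\<^sup>2)) (at t)" if t: "t0 \<le> t" for t
    unfolding g_def using b_pos[OF t]
    by (intro DERIV_cong[OF DERIV_divide[OF \<xi>_deriv[OF t] b_deriv[OF t]]])
      (auto simp: power2_eq_square field_simps)
  have gZ: "(g t)\<^sup>2 \<le> Z t" if t: "t0 \<le> t" for t
  proof -
    have "(\<xi> t)\<^sup>2 \<le> Z t * (b t)\<^sup>2"
      using order_trans[OF \<xi>_le[OF t] mult_left_mono[OF less_imp_le[OF det[OF t]] Z_nonneg[OF t]]] .
    then show ?thesis unfolding g_def power_divide using b_pos[OF t] by (simp add: field_simps)
  qed
  define h where "h t = (n t)\<^sup>2 - 2 * b t * n t - r t * y t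
    - 4/3 * (- r t * g t - 2 * W t + n t * W t / b t + 2 * Z t - 2 * (g t)\<^sup>2)" for t
  have f': "(f has_real_derivative \<theta> t * h t) (at t)" if t: "t0 \<le> t" for t
    unfolding f_def h_def using a0[OF t]
    by (intro DERIV_cong[OF DERIV_diff[OF y_deriv[OF t] DERIV_cmult[OF g'[OF t]]]])
      (auto simp: algebra_simps)
  have ln\<Lambda>': "((\<lambda>t. ln (\<Lambda> t)) has_real_derivative \<theta> t * (2 - 3 * r t)) (at t)" if t: "t0 \<le> t" for t
  proof -
    have "(\<Lambda> has_real_derivative \<theta> t * (2 - 3 * r t) * \<Lambda> t) (at t)"
      unfolding \<Lambda>_def
      by (rule derivative_eq_intros n_deriv[OF t] b_deriv[OF t] W_deriv[OF t] refl)+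
        (simp add: power2_eq_square algebra_simps)
    from DERIV_chain2[OF DERIV_ln_divide[OF \<Lambda>p[OF t]] this] show ?thesis
      using \<Lambda>p[OF t] by simp
  qed
  have h: "1/9 \<le> h t + 3 * (2 - 3 * r t)" if t: "t0 \<le> t" for t
  proof -
    \<comment> \<open>The weights are chosen so that both linear error terms fit into
      \<open>9/2 * (y - 2/3)^2 + 6 * Z\<close>, which \<open>y2\<close> bounds by
      \<open>2 - 3 * r\<close>, and leave a positive constant.\<close>
    have young: "v \<le> 1/24 + 6 * v\<^sup>2" for v :: real
      using zero_le_power2[of "12 * v - 1"] by (simp add: power2_eq_square algebra_simps)
    have \<mu>: "2 - 3 * r t = 1/2 * (3 * y t - 2)\<^sup>2 + 6 * Z t + 3 * (x t)\<^sup>2"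
      using Hamiltonian[OF t] by (simp add: power2_eq_square algebra_simps)
    have y2: "9/2 * (y t - 2/3)\<^sup>2 + 6 * Z t \<le> 2 - 3 * r t"
      unfolding \<mu> by (simp add: power2_eq_square algebra_simps)
    have "r t * (y t - 2/3) \<le> r t * \<bar>y t - 2/3\<bar>" using r_nonneg[OF t] by (intro mult_left_mono) auto
    also have "\<dots> \<le> 2/3 * \<bar>y t - 2/3\<bar>" using r_le(2)[OF t] by (intro mult_right_mono) auto
    also have "\<dots> \<le> 2/3 * (1/24 + 6 * (y t - 2/3)\<^sup>2)" using young[of "\<bar>y t - 2/3\<bar>"] by simp
    finally have 1: "r t * (y t - 2/3) \<le> 1/36 + 4 * (y t - 2/3)\<^sup>2" by simp
    have "r t * - g t \<le> r t * \<bar>g t\<bar>" using r_nonneg[OF t] by (intro mult_left_mono) auto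
    also have "\<dots> \<le> 2/3 * \<bar>g t\<bar>" using r_le(2)[OF t] by (intro mult_right_mono) auto
    also have "\<dots> \<le> 2/3 * (1/24 + 6 * (g t)\<^sup>2)" using young[of "\<bar>g t\<bar>"] by simp
    finally have 2: "- (r t * g t) \<le> 1/36 + 4 * Z t" using gZ[OF t] by simp
    have 3: "n t * W t / b t \<le> 0"
      using n_neg[OF t] W_nonneg[OF t] b_pos[OF t] by (simp add: divide_nonpos_pos mult_nonpos_nonneg)
    have "h t = (n t)\<^sup>2 - 2 * b t * n t - r t * (y t - 2/3) - 2/3 * r t
       + 4/3 * (r t * g t) + 8/3 * W t - 4/3 * (n t * W t / b t) - 8/3 * Z t + 8/3 * (g t)\<^sup>2"
      unfolding h_def by (simp add: algebra_simps)
    moreover have "(n t)\<^sup>2 - 2 * b t * n t - 2/3 * r t + 8/3 * W t \<ge> r t / 3"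
      using r[OF t] W_nonneg[OF t] zero_le_power2[of "n t"] by linarith
    moreover have "\<lbrakk>h0 = N - P - V - 2/3 * R + 4/3 * G + 8/3 * W0 - 4/3 * T - 8/3 * Z0 + 8/3 * G2;
        R / 3 \<le> N - P - 2/3 * R + 8/3 * W0; V \<le> 1/36 + 4 * Y; - G \<le> 1/36 + 4 * Z0; T \<le> 0; 0 \<le> G2;
        9/2 * Y + 6 * Z0 \<le> 2 - 3 * R; 0 \<le> Z0; R \<le> 2/3; 0 \<le> Y\<rbrakk> \<Longrightarrow> 1/9 \<le> h0 + 3 * (2 - 3 * R)"
      for h0 N P V R G W0 T Z0 G2 Y :: real by argo
    ultimately show ?thesis
      using 1 2 3 zero_le_power2 y2 Z_nonneg[OF t] r_le(2)[OF t] by blast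
  qed
  have G: "f t0 + 3 * ln (\<Lambda> t0) - \<tau> t0 / 9 \<le> f t + 3 * ln (\<Lambda> t) - \<tau> t / 9" if t: "t0 \<le> t" for t
  proof (rule nondecreasing_from_deriv[OF _ _ order_refl t])
    fix u assume u: "t0 \<le> u"
    let ?k = "h u + 3 * (2 - 3 * r u) - 1/9"
    show "((\<lambda>t. f t + 3 * ln (\<Lambda> t) - \<tau> t / 9) has_real_derivative \<theta> u * ?k) (at u)"
      by (rule derivative_eq_intros f'[OF u] ln\<Lambda>'[OF u] \<tau>_deriv[OF u] refl | simp add: algebra_simps)+
    show "0 \<le> \<theta> u * ?k" using h[OF u] \<theta>_pos[OF u] by simp
  qed
  have f4: "f t \<le> 4" if t: "t0 \<le> t" for t
  proof -
    have "(g t)\<^sup>2 \<le> 2\<^sup>2" using gZ[OF t] Zx_le(1)[OF t] y_le[OF t] by simp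
    then have "\<bar>g t\<bar> \<le> 2" using abs_le_square_iff[of "g t" 2] by simp
    then show ?thesis unfolding f_def using y_le[OF t] by linarith
  qed
  define K where "K = f t0 + 3 * ln (\<Lambda> t0) - \<tau> t0 / 9 - 4"
  have b_ge: "(K + 3) + 1/9 * \<tau> t \<le> b t" if t: "t0 \<le> t" for t
  proof -
    have "(\<tau> t / 9 + K) / 3 \<le> ln (\<Lambda> t)" unfolding K_def using G[OF t] f4[OF t] by simp
    then have "exp ((\<tau> t / 9 + K) / 3) \<le> \<Lambda> t" using ln_ge_iff[OF \<Lambda>p[OF t]] by blast
    also have "\<Lambda> t \<le> - n t * (b t)\<^sup>2"
      unfolding \<Lambda>_def using n_neg[OF t] W_nonneg[OF t] by (intro mult_left_mono) auto
    also have "\<dots> = (- 2 * b t * n t) * b t / 2" by (simp add: power2_eq_square)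
    also have "\<dots> \<le> (2/3) * b t / 2"
    proof -
      have "- 2 * b t * n t \<le> 2/3" using r[OF t] r_le(2)[OF t] W_nonneg[OF t] zero_le_power2[of "n t"] by linarith
      then show ?thesis using b_pos[OF t] by (intro divide_right_mono mult_right_mono) auto
    qed
    finally have "3 * exp ((\<tau> t / 9 + K) / 3) \<le> b t" by simp
    then show ?thesis using exp_ge_add_one_self[of "(\<tau> t / 9 + K) / 3"] by argo
  qed
  have "filterlim (\<lambda>t. (K + 3) + 1/9 * \<tau> t) at_top at_top"
    by (intro filterlim_tendsto_add_at_top[OF tendsto_const]
        filterlim_tendsto_pos_mult_at_top[OF tendsto_const _ \<tau>_lim]) simp
  then show ?thesis
    by (rule filterlim_at_top_mono) (rule eventually_from_t0, use b_ge in blast)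
qed

text \<open>The limit is \<open>y = 1\<close>, \<open>Z = 0\<close>. After division by powers of
  \<open>y\<close>, and in the time with rate \<open>\<theta> * y\<close>, growth of
  \<open>b\<close> removes \<open>F\<close> and \<open>\<nu>\<close>. For the averaged system
  \<open>u - ln u / 2 + E / 2 + X / 2\<close> then has derivative
  \<open>- (u - 1/2)^2 - X / 2\<close>, and the rest point is \<open>u = 1/2\<close>,
  \<open>E = X = 0\<close>.\<close>

lemma converges_type_VIII:
  assumes a0: "\<And>t. t0 \<le> t \<Longrightarrow> a t = 0" and n_neg: "\<And>t. t0 \<le> t \<Longrightarrow> n t < 0"
    and b_pos: "\<And>t. t0 \<le> t \<Longrightarrow> 0 < b t" and det: "\<And>t. t0 \<le> t \<Longrightarrow> W t < (b t)\<^sup>2"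
  shows "(\<exists>l. (y \<longlongrightarrow> l) at_top) \<and> (\<exists>l. (Z \<longlongrightarrow> l) at_top)"
proof -
  define p where "p t = - 2 * b t * n t" for t
  have pp: "0 < p t" if "t0 \<le> t" for t unfolding p_def using b_pos n_neg that by (simp add: mult_pos_neg)
  have r: "r t = 2 * W t + (n t)\<^sup>2 / 2 + p t" if "t0 \<le> t" for t
    using r_eq[OF that] a0[OF that] unfolding p_def by simp
  have p_le: "p t \<le> 2 * y t" if t: "t0 \<le> t" for t
    using r[OF t] r_le(1)[OF t] W_nonneg[OF t] zero_le_power2[of "n t"] by linarith
  have yp: "0 < y t" if t: "t0 \<le> t" for t using pp[OF t] p_le[OF t] by linarith
  define u \<nu> X E D F \<kappa> where "u t = p t / (y t)\<^sup>2" and "\<nu> t = (n t)\<^sup>2 / (y t)\<^sup>2"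
    and "X t = (x t)\<^sup>2 / (y t)\<^sup>2" and "E t = 2 * (Z t + W t) / (y t)\<^sup>2"
    and "D t = 2 * W t / (y t)\<^sup>2" and "F t = \<xi> t / (b t * y t)" and "\<kappa> t = - n t / (2 * b t)" for t
  note defs = u_def \<nu>_def X_def E_def D_def F_def \<kappa>_def
  have u_pos: "0 < u t" and nn: "0 \<le> \<nu> t" "0 \<le> X t" "0 \<le> E t" "0 \<le> D t" "0 \<le> \<kappa> t" if t: "t0 \<le> t" for t
    unfolding defs using pp[OF t] yp[OF t] Z_nonneg[OF t] W_nonneg[OF t] n_neg[OF t] b_pos[OF t]
    by (auto simp: divide_nonpos_pos)
  have Ham: "2 / y t = 3/2 + E t + X t + \<nu> t / 2 + u t" if t: "t0 \<le> t" for t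
  proof -
    have "2 * y t = 3/2 * (y t)\<^sup>2 + 2 * (Z t + W t) + (x t)\<^sup>2 + (n t)\<^sup>2 / 2 + p t"
      using Hamiltonian[OF t] r[OF t] by simp
    from arg_cong[OF this, of "\<lambda>v. v / (y t)\<^sup>2"] show ?thesis
      unfolding defs using yp[OF t] by (simp add: add_divide_distrib power2_eq_square)
  qed
  have u': "(u has_real_derivative
      \<theta> t * y t * (u t * (1/2 - u t + E t + X t - 3/2 * \<nu> t + 2 * F t))) (at t)" if t: "t0 \<le> t" for t
  proof -
    have "(u has_real_derivative \<theta> t * y t * (u t * (2 / y t - 1 + 2 * F t - 2 * (\<nu> t + u t)))) (at t)"
      unfolding u_def p_def F_def \<nu>_def using yp[OF t] b_pos[OF t] a0[OF t]
      by (auto intro!: derivative_eq_intros y_deriv[OF t] b_deriv[OF t] n_deriv[OF t]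
          simp: power2_eq_square field_simps)
    then show ?thesis unfolding Ham[OF t] by (simp add: algebra_simps)
  qed
  have X': "(X has_real_derivative \<theta> t * y t * (- 2 * (u t + \<nu> t) * X t)) (at t)" if t: "t0 \<le> t" for t
    unfolding X_def u_def p_def \<nu>_def using yp[OF t] a0[OF t]
    by (auto intro!: derivative_eq_intros y_deriv[OF t] x_deriv[OF t]
          simp: power2_eq_square field_simps)
  have E': "(E has_real_derivative
      \<theta> t * y t * (2 * D t - 2 * E t * (u t + \<nu> t) - 2 * F t * u t)) (at t)" if t: "t0 \<le> t" for t
    unfolding E_def D_def u_def p_def \<nu>_def F_def using yp[OF t] b_pos[OF t] a0[OF t]
    by (auto intro!: derivative_eq_intros y_deriv[OF t] Z_deriv[OF t] W_deriv[OF t]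
          simp: power2_eq_square field_simps)
  have F': "(F has_real_derivative
      \<theta> t * y t * (E t - 2 * D t - \<kappa> t * D t - 2 * (F t)\<^sup>2 - F t * (u t + \<nu> t))) (at t)" if t: "t0 \<le> t" for t
    unfolding E_def D_def u_def p_def \<nu>_def F_def \<kappa>_def using yp[OF t] b_pos[OF t] a0[OF t]
    by (auto intro!: derivative_eq_intros y_deriv[OF t] \<xi>_deriv[OF t] b_deriv[OF t]
          simp: power2_eq_square field_simps)
  have b_lim: "filterlim b at_top at_top" by (rule b_unbounded[OF a0 n_neg b_pos det])
  \<comment> \<open>Keeping the factor \<open>E + u + 3/2\<close>, a lower bound of
    \<open>2 / y\<close>, yields three estimates at once: for \<open>F\<close> alone, for
    \<open>F * u\<close>, and for \<open>F\<close> against \<open>E\<close>.\<close>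
  have F_le: "\<bar>F t\<bar> * (E t + u t + 3/2) \<le> E t / (2 * b t)" if t: "t0 \<le> t" for t
  proof -
    have "(2 * \<bar>\<xi> t\<bar>)\<^sup>2 \<le> 4 * (Z t * W t)" using \<xi>_le[OF t] by (simp add: power_mult_distrib)
    also have "\<dots> \<le> (Z t + W t)\<^sup>2"
      using zero_le_power2[of "Z t - W t"] by (simp add: power2_eq_square algebra_simps)
    finally have "2 * \<bar>\<xi> t\<bar> \<le> Z t + W t"
      using Z_nonneg[OF t] W_nonneg[OF t] by - (erule power2_le_imp_le, simp)
    then have "4 * \<bar>\<xi> t\<bar> \<le> E t * (y t)\<^sup>2" unfolding E_def using yp[OF t] by simp
    then have "4 * \<bar>F t\<bar> \<le> E t * y t / b t"
      unfolding F_def using yp[OF t] b_pos[OF t] by (simp add: abs_mult field_simps power2_eq_square)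
    moreover have "E t + u t + 3/2 \<le> 2 / y t" unfolding Ham[OF t] using nn[OF t] by simp
    ultimately have "4 * \<bar>F t\<bar> * (E t + u t + 3/2) \<le> E t * y t / b t * (2 / y t)"
      using nn[OF t] u_pos[OF t] yp[OF t] b_pos[OF t] by (intro mult_mono) auto
    then show ?thesis using yp[OF t] b_pos[OF t] by (simp add: field_simps)
  qed
  have F_small: "\<bar>F t\<bar> \<le> 1 / (2 * b t)" "\<bar>F t\<bar> * u t \<le> E t / (2 * b t)" "\<bar>F t\<bar> \<le> E t / (2 * b t)"
    if t: "t0 \<le> t" for t
  proof -
    have e: "\<bar>F t\<bar> * (E t + u t + 3/2) = \<bar>F t\<bar> * E t + \<bar>F t\<bar> * u t + 3/2 * \<bar>F t\<bar>"
      by (simp add: algebra_simps)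
    have pos: "0 \<le> \<bar>F t\<bar> * E t" "0 \<le> \<bar>F t\<bar> * u t" using nn[OF t] u_pos[OF t] by auto
    show "\<bar>F t\<bar> * u t \<le> E t / (2 * b t)" "\<bar>F t\<bar> \<le> E t / (2 * b t)"
      using F_le[OF t] e pos abs_ge_zero[of "F t"] by linarith+
    have "\<bar>F t\<bar> * (E t + u t + 3/2) \<le> (E t + u t + 3/2) / (2 * b t)"
      using F_le[OF t] b_pos[OF t] u_pos[OF t] by (elim order_trans) (simp add: divide_right_mono)
    then have "\<bar>F t\<bar> * (E t + u t + 3/2) \<le> 1 / (2 * b t) * (E t + u t + 3/2)" by simp
    then show "\<bar>F t\<bar> \<le> 1 / (2 * b t)"
      by (rule mult_right_le_imp_le) (use nn[OF t] u_pos[OF t] in simp)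
  qed
  have \<nu>_le: "\<nu> t \<le> 1 / (b t)\<^sup>2" if t: "t0 \<le> t" for t
  proof -
    have "- n t * b t \<le> y t" using p_le[OF t] unfolding p_def by (simp add: mult.commute)
    then have "(- n t * b t)\<^sup>2 \<le> (y t)\<^sup>2"
      using n_neg[OF t] b_pos[OF t] by (intro power_mono) (auto simp: mult_nonpos_nonneg)
    then show ?thesis unfolding \<nu>_def using yp[OF t] b_pos[OF t] by (simp add: power_mult_distrib field_simps)
  qed
  text \<open>Averaging over the oscillation between \<open>Z\<close> and \<open>W\<close> is done by the correction \<open>F\<close> to \<open>E\<close>; the averaged
    system is a damped Lotka--Volterra system in \<open>u\<close> and \<open>E\<close>.  The shift \<open>\<delta>\<close> makes its Lyapunov function strict.\<close>
  define L where "L \<delta> t = u t - (1/2 + \<delta>) * ln (u t) + (E t + F t) / 2 + X t / 2" for \<delta> t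
  define L' where "L' \<delta> t = (u t - 1/2 - \<delta>) * (1/2 - u t + E t + X t - 3/2 * \<nu> t + 2 * F t)
    + (E t * (1 - 2 * u t) - 2 * \<nu> t * E t - \<kappa> t * D t - 2 * (F t)\<^sup>2 - F t * (3 * u t + \<nu> t)) / 2
    - (u t + \<nu> t) * X t" for \<delta> t
  have L_deriv: "(L \<delta> has_real_derivative \<theta> t * y t * L' \<delta> t) (at t)" if t: "t0 \<le> t" for \<delta> t
    unfolding L_def L'_def using u_pos[OF t]
    by (auto intro!: derivative_eq_intros u'[OF t] E'[OF t] F'[OF t] X'[OF t]
        simp: field_simps power2_eq_square)
  have L'_le: "L' \<delta> t \<le> 2 * \<delta>\<^sup>2 - (u t - 1/2)\<^sup>2 / 2 - \<delta> / 2 * E t - X t / 2"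
    if \<delta>: "0 < \<delta>" "\<delta> \<le> 1" and t: "t0 \<le> t" and b: "8 / \<delta>\<^sup>2 \<le> b t" for \<delta> t
  proof -
    define v \<eta> where "v = u t - 1/2" and "\<eta> = 1 / b t"
    have \<eta>: "0 < \<eta>" "\<eta> \<le> \<delta>\<^sup>2 / 8" unfolding \<eta>_def using b_pos[OF t] b \<delta> by (auto simp: field_simps)
    have \<delta>2: "\<delta>\<^sup>2 \<le> 1" "\<delta>\<^sup>2 \<le> \<delta>" using \<delta>
      by (simp_all add: power_le_one power2_eq_square mult_left_le mult_le_one)
    have F: "\<bar>F t\<bar> \<le> \<eta> / 2" "\<bar>F t\<bar> * u t \<le> \<eta> / 2 * E t"
      using F_small(1,2)[OF t] unfolding \<eta>_def by auto
    have "\<eta>\<^sup>2 \<le> \<eta>" using \<eta> \<delta>2 by (simp add: power2_eq_square mult_left_le)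
    then have \<nu>: "0 \<le> \<nu> t" "\<nu> t \<le> \<eta>" using \<nu>_le[OF t] nn[OF t] unfolding \<eta>_def by (auto simp: power_divide)
    have expand: "L' \<delta> t = - v\<^sup>2 + \<delta> * v - \<delta> * E t - (1/2 + \<delta> + \<nu> t) * X t + 3/2 * (\<nu> t * (\<delta> - v))
        + F t * (u t / 2 - 1 - 2 * \<delta> - \<nu> t / 2) - \<nu> t * E t - \<kappa> t * D t / 2 - (F t)\<^sup>2"
      unfolding L'_def v_def by (simp add: field_simps power2_eq_square)
    have 1: "\<nu> t * (\<delta> - v) \<le> \<eta> * (1 + \<bar>v\<bar>)"
    proof -
      have "\<nu> t * (\<delta> - v) \<le> \<nu> t * (1 + \<bar>v\<bar>)" using \<nu>(1) \<delta> by (intro mult_left_mono) auto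
      also have "\<dots> \<le> \<eta> * (1 + \<bar>v\<bar>)" using \<nu>(2) by (intro mult_right_mono) auto
      finally show ?thesis .
    qed
    have 2: "F t * (u t / 2 - 1 - 2 * \<delta> - \<nu> t / 2) \<le> \<eta> / 4 * E t + 7/4 * \<eta>"
    proof -
      have "\<nu> t \<le> 1" using \<nu> \<eta> \<delta>2 by simp
      then have "\<bar>u t / 2 - 1 - 2 * \<delta> - \<nu> t / 2\<bar> \<le> u t / 2 + 7/2" using u_pos[OF t] \<nu>(1) \<delta> by linarith
      then have "\<bar>F t * (u t / 2 - 1 - 2 * \<delta> - \<nu> t / 2)\<bar> \<le> \<bar>F t\<bar> * (u t / 2 + 7/2)"
        unfolding abs_mult by (intro mult_left_mono) auto
      also have "\<dots> = \<bar>F t\<bar> * u t / 2 + 7/2 * \<bar>F t\<bar>" by (simp add: algebra_simps)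
      also have "\<dots> \<le> \<eta> / 4 * E t + 7/4 * \<eta>" using F by simp
      finally show ?thesis by simp
    qed
    have 3: "\<eta> * (1 + \<bar>v\<bar>) \<le> \<delta>\<^sup>2 / 8 * (3/2) + v\<^sup>2 / 16"
    proof -
      have "\<eta> * (1 + \<bar>v\<bar>) \<le> \<delta>\<^sup>2 / 8 * (3/2 + v\<^sup>2 / 2)"
        using \<eta> zero_le_power2[of "\<bar>v\<bar> - 1"] by (intro mult_mono) (auto simp: power2_eq_square algebra_simps)
      also have "\<dots> = \<delta>\<^sup>2 / 8 * (3/2) + \<delta>\<^sup>2 * v\<^sup>2 / 16" by (simp add: algebra_simps)
      also have "\<dots> \<le> \<delta>\<^sup>2 / 8 * (3/2) + 1 * v\<^sup>2 / 16"
        using \<delta>2 by (intro add_left_mono divide_right_mono mult_right_mono) auto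
      finally show ?thesis by simp
    qed
    have 4: "\<delta> * v \<le> \<delta>\<^sup>2 + v\<^sup>2 / 4"
      using zero_le_power2[of "\<delta> - v / 2"] by (simp add: power2_eq_square algebra_simps)
    have 5: "\<eta> / 4 * E t \<le> \<delta> / 2 * E t" using \<eta> \<delta>2 nn[OF t] by (intro mult_right_mono) auto
    have 6: "1/2 * X t \<le> (1/2 + \<delta> + \<nu> t) * X t" using \<delta> \<nu> nn[OF t] by (intro mult_right_mono) auto
    have 7: "0 \<le> \<nu> t * E t" "0 \<le> \<kappa> t * D t" using nn[OF t] by auto
    have "L' \<delta> t \<le> - v\<^sup>2 + \<delta> * v - \<delta> * E t - 1/2 * X t + 3/2 * (\<eta> * (1 + \<bar>v\<bar>)) + (\<eta> / 4 * E t + 7/4 * \<eta>)"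
      using expand 1 2 6 7 zero_le_power2[of "F t"] by argo
    also have "\<dots> \<le> - v\<^sup>2 + (\<delta>\<^sup>2 + v\<^sup>2 / 4) - \<delta> / 2 * E t - 1/2 * X t + 3/2 * (\<delta>\<^sup>2 / 8 * (3/2) + v\<^sup>2 / 16) + 7/4 * (\<delta>\<^sup>2 / 8)"
      using 3 4 5 \<eta>(2) by argo
    also have "\<dots> \<le> 2 * \<delta>\<^sup>2 - v\<^sup>2 / 2 - \<delta> / 2 * E t - X t / 2"
      using zero_le_power2[of v] zero_le_power2[of \<delta>] by argo
    finally show ?thesis unfolding v_def .
  qed
  \<comment> \<open>The minimum of \<open>u - c * ln u\<close> for
    \<open>c = 1/2 + \<delta>\<close>, attained at \<open>u = c\<close>. The excess over it is the
    relative entropy in the next claim.\<close>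
  define h where "h \<delta> = (1/2 + \<delta>) - (1/2 + \<delta>) * ln (1/2 + \<delta>)" for \<delta> :: real
  have entropy: "u t - (1/2 + \<delta>) * ln (u t) - h \<delta>
      = (1/2 + \<delta>) * (u t / (1/2 + \<delta>) - 1 - ln (u t / (1/2 + \<delta>)))"
    if "0 < \<delta>" "t0 \<le> t" for \<delta> t
  proof -
    define c where "c = 1/2 + \<delta>"
    have c: "0 < c" unfolding c_def using that by simp
    have ln_quot: "ln (u t / c) = ln (u t) - ln c" using u_pos[OF that(2)] c by (simp add: ln_div)
    have "u t - c * ln (u t) - (c - c * ln c) = c * (u t / c - 1 - ln (u t / c))"
      unfolding ln_quot using c by (simp add: algebra_simps)
    then show ?thesis unfolding h_def c_def .
  qed
  \<comment> \<open>Where \<open>L\<close> fails to decrease at the rate \<open>\<delta>^2\<close>,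
    \<open>L'_le\<close> confines \<open>u\<close>, \<open>E\<close> and \<open>X\<close> to a
    neighbourhood of the rest point, and there \<open>L\<close> is close to its minimum.\<close>
  have L_small: "L \<delta> t \<le> h \<delta> + 10 * \<delta>"
    if \<delta>: "0 < \<delta>" "\<delta> \<le> 1/16" and t: "t0 \<le> t" and b: "8 / \<delta>\<^sup>2 \<le> b t" and L': "- \<delta>\<^sup>2 < L' \<delta> t" for \<delta> t
  proof -
    define c where "c = 1/2 + \<delta>"
    have c: "0 < c" unfolding c_def using \<delta> by simp
    have all: "(u t - 1/2)\<^sup>2 / 2 + \<delta> / 2 * E t + X t / 2 < 3 * \<delta>\<^sup>2"
      using L'_le[OF \<delta>(1) _ t b] \<delta> L' by simp
    have parts: "0 \<le> \<delta> / 2 * E t" "0 \<le> X t / 2" using nn[OF t] \<delta> by auto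
    have "\<delta> / 2 * E t \<le> 3 * \<delta>\<^sup>2" using all parts zero_le_power2[of "u t - 1/2"] by argo
    then have "\<delta> / 2 * E t \<le> \<delta> / 2 * (6 * \<delta>)" by (simp add: power2_eq_square)
    then have E6: "E t \<le> 6 * \<delta>" using \<delta> by simp
    have "\<delta>\<^sup>2 \<le> \<delta> / 16" using \<delta> mult_left_mono[of \<delta> "1/16" \<delta>] by (simp add: power2_eq_square)
    then have X6: "X t \<le> \<delta>" using all parts zero_le_power2[of "u t - 1/2"] by argo
    have "(u t - 1/2)\<^sup>2 \<le> 25/4 * \<delta>\<^sup>2" using all parts zero_le_power2[of \<delta>] by argo
    also have "\<dots> = (5/2 * \<delta>)\<^sup>2" by (simp add: power_mult_distrib power_divide)
    finally have "(u t - 1/2)\<^sup>2 \<le> (5/2 * \<delta>)\<^sup>2" .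
    then have v: "\<bar>u t - 1/2\<bar> \<le> 5/2 * \<delta>" using \<delta> abs_le_square_iff[of "u t - 1/2" "5/2 * \<delta>"] by simp
    then have u3: "1/3 \<le> u t" using \<delta> by linarith
    have "\<bar>u t - c\<bar> \<le> 7/2 * \<delta>" unfolding c_def using v by linarith
    then have uc: "(u t - c)\<^sup>2 \<le> 49/4 * \<delta>\<^sup>2"
      using power_mono[of "\<bar>u t - c\<bar>" "7/2 * \<delta>" 2] by (simp add: power_mult_distrib power_divide)
    have "1 - c / u t \<le> ln (u t / c)"
      using ln_le_minus_one[of "c / u t"] u_pos[OF t] c by (simp add: ln_div)
    then have "u t / c - 1 - ln (u t / c) \<le> u t / c - 1 - (1 - c / u t)" by simp
    also have "\<dots> = (u t - c)\<^sup>2 / (c * u t)"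
      using u_pos[OF t] c by (simp add: field_simps power2_eq_square)
    finally have "c * (u t / c - 1 - ln (u t / c)) \<le> c * ((u t - c)\<^sup>2 / (c * u t))"
      using c by (intro mult_left_mono) auto
    also have "\<dots> = (u t - c)\<^sup>2 / u t" using c by simp
    also have "\<dots> \<le> (49/4 * \<delta>\<^sup>2) / (1/3)" using uc u3 by (intro frac_le) auto
    also have "\<dots> \<le> 3 * \<delta>" using \<open>\<delta>\<^sup>2 \<le> \<delta> / 16\<close> \<delta> by simp
    finally have "u t - c * ln (u t) - h \<delta> \<le> 3 * \<delta>" using entropy[OF \<delta>(1) t] unfolding c_def by simp
    moreover have "8 \<le> 8 / \<delta>\<^sup>2" using \<delta> by (simp add: field_simps power_le_one)
    then have "8 \<le> b t" using b by linarith
    then have "E t / (2 * b t) \<le> E t / 1" using nn[OF t] by (intro divide_left_mono) auto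
    then have "F t \<le> E t" using F_small(3)[OF t] by linarith
    ultimately show ?thesis unfolding L_def c_def using E6 X6 \<delta>(1) by argo
  qed
  have L_eventually: "\<exists>T\<ge>t0. \<forall>t\<ge>T. L \<delta> t \<le> h \<delta> + 10 * \<delta> \<and> 8 / \<delta>\<^sup>2 \<le> b t" if \<delta>: "0 < \<delta>" "\<delta> \<le> 1/16" for \<delta>
  proof -
    have "\<forall>\<^sub>F t in at_top. 8 / \<delta>\<^sup>2 \<le> b t" using b_lim by (simp add: filterlim_at_top)
    then obtain T0 where T0: "\<And>t. T0 \<le> t \<Longrightarrow> 8 / \<delta>\<^sup>2 \<le> b t" by (auto simp: eventually_at_top_linorder)
    define T where "T = max t0 T0"
    have T: "t0 \<le> t" "8 / \<delta>\<^sup>2 \<le> b t" if "T \<le> t" for t using that T0 unfolding T_def by auto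
    have "\<exists>t1\<ge>T. L \<delta> t1 \<le> h \<delta> + 10 * \<delta>"
    proof (rule ccontr)
      assume "\<not> ?thesis"
      then have big: "h \<delta> + 10 * \<delta> < L \<delta> t" if "T \<le> t" for t using that by force
      have dec: "L' \<delta> t \<le> - \<delta>\<^sup>2" if "T \<le> t" for t using L_small[OF \<delta> T[OF that]] big[OF that] by force
      \<comment> \<open>A priori \<open>y\<close> could tend to 0, so the clock with rate
        \<open>\<theta> * y\<close> has to be shown to run for ever. As \<open>1 / y\<close> grows
        at most like \<open>2 * \<tau>\<close>, its integral diverges at least logarithmically in
        \<open>\<tau>\<close>, and a decrease of \<open>L\<close> at a definite rate is
        impossible.\<close>
      define C where "C = 1 / y T - 2 * \<tau> T"
      have yC: "1 / y t \<le> 2 * \<tau> t + C" if t: "T \<le> t" for t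
      proof -
        have "2 * \<tau> T - 1 / y T \<le> 2 * \<tau> t - 1 / y t"
        proof (rule nondecreasing_from_deriv[OF _ _ order_refl t])
          fix s assume "T \<le> s"
          then have s: "t0 \<le> s" using T by blast
          let ?k = "2 + ((n s)\<^sup>2 + p s - r s * y s) / (y s)\<^sup>2"
          show "((\<lambda>t. 2 * \<tau> t - 1 / y t) has_real_derivative \<theta> s * ?k) (at s)"
            using yp[OF s] a0[OF s] unfolding p_def
            by (auto intro!: derivative_eq_intros \<tau>_deriv[OF s] y_deriv[OF s] simp: field_simps power2_eq_square)
          have "r s * y s \<le> 2 * y s * y s" using r_le(1)[OF s] yp[OF s] by (intro mult_right_mono) auto
          then have "r s * y s \<le> 2 * (y s)\<^sup>2" by (simp add: power2_eq_square)
          then have "0 \<le> 2 * (y s)\<^sup>2 + ((n s)\<^sup>2 + p s - r s * y s)"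
            using pp[OF s] zero_le_power2[of "n s"] by argo
          then have "0 \<le> ?k" using yp[OF s] by (simp add: field_simps)
          then show "0 \<le> \<theta> s * ?k" using \<theta>_pos[OF s] by simp
        qed
        then show ?thesis unfolding C_def by simp
      qed
      have Cp: "0 < 2 * \<tau> t + C" if t: "T \<le> t" for t
        using yC[OF t] yp[OF T(1)[OF t]] by (smt (verit) divide_pos_pos)
      have "L \<delta> t + \<delta>\<^sup>2 / 2 * ln (2 * \<tau> t + C) \<le> L \<delta> T + \<delta>\<^sup>2 / 2 * ln (2 * \<tau> T + C)" if t: "T \<le> t" for t
      proof -
        have "- (L \<delta> T + \<delta>\<^sup>2 / 2 * ln (2 * \<tau> T + C)) \<le> - (L \<delta> t + \<delta>\<^sup>2 / 2 * ln (2 * \<tau> t + C))"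
        proof (rule nondecreasing_from_deriv[OF _ _ order_refl t])
          fix s assume Ts: "T \<le> s"
          then have s: "t0 \<le> s" using T by blast
          let ?k = "- (y s * L' \<delta> s) - \<delta>\<^sup>2 / (2 * \<tau> s + C)"
          show "((\<lambda>t. - (L \<delta> t + \<delta>\<^sup>2 / 2 * ln (2 * \<tau> t + C))) has_real_derivative \<theta> s * ?k) (at s)"
            using Cp[OF Ts]
            by (auto intro!: derivative_eq_intros \<tau>_deriv[OF s] L_deriv[OF s] simp: field_simps)
          have "1 / (2 * \<tau> s + C) \<le> y s" using yC[OF Ts] Cp[OF Ts] yp[OF s] by (simp add: field_simps)
          from mult_left_mono[OF this, of "\<delta>\<^sup>2"] have "\<delta>\<^sup>2 / (2 * \<tau> s + C) \<le> y s * \<delta>\<^sup>2" by (simp add: mult.commute)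
          also have "\<dots> \<le> y s * (- L' \<delta> s)" using dec[OF Ts] yp[OF s] by (intro mult_left_mono) auto
          finally have "0 \<le> ?k" by simp
          then show "0 \<le> \<theta> s * ?k" using \<theta>_pos[OF s] by simp
        qed
        then show ?thesis by simp
      qed
      then have lnb: "\<delta>\<^sup>2 / 2 * ln (2 * \<tau> t + C) \<le> L \<delta> T + \<delta>\<^sup>2 / 2 * ln (2 * \<tau> T + C) - h \<delta>" if t: "T \<le> t" for t
        using that big[OF t] \<delta> by force
      define K where "K = (L \<delta> T + \<delta>\<^sup>2 / 2 * ln (2 * \<tau> T + C) - h \<delta>) / (\<delta>\<^sup>2 / 2)"
      have "2 * \<tau> t \<le> exp K - C" if t: "T \<le> t" for t
      proof -
        have "ln (2 * \<tau> t + C) \<le> K" unfolding K_def using lnb[OF t] \<delta> by (simp add: field_simps)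
        then have "2 * \<tau> t + C \<le> exp K" using Cp[OF t] by (metis exp_le_cancel_iff exp_ln)
        then show ?thesis by simp
      qed
      from \<tau>_unbounded_contradiction[OF _ this] show False by simp
    qed
    then obtain t1 where t1: "T \<le> t1" "L \<delta> t1 \<le> h \<delta> + 10 * \<delta>" by blast
    \<comment> \<open>Above the level \<open>L\<close> decreases, so having been below it once it
      never returns.\<close>
    have "L \<delta> t \<le> h \<delta> + 10 * \<delta>" if t: "t1 \<le> t" for t
    proof (rule barrier[where f="L \<delta>" and f'="\<lambda>s. \<theta> s * y s * L' \<delta> s", OF _ _ t1(2) t])
      fix s assume s: "t1 \<le> s"
      then have Ts: "T \<le> s" using t1 by simp
      show "(L \<delta> has_real_derivative \<theta> s * y s * L' \<delta> s) (at s)" by (rule L_deriv[OF T(1)[OF Ts]])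
      assume "L \<delta> s > h \<delta> + 10 * \<delta>"
      then have "L' \<delta> s \<le> - \<delta>\<^sup>2" using L_small[OF \<delta> T[OF Ts]] by force
      then have "L' \<delta> s \<le> 0" using zero_le_power2[of \<delta>] by linarith
      then show "\<theta> s * y s * L' \<delta> s \<le> 0"
        using \<theta>_pos[OF T(1)[OF Ts]] yp[OF T(1)[OF Ts]] by (simp add: mult_nonneg_nonpos)
    qed
    then show ?thesis using T t1 by (intro exI[of _ t1]) auto
  qed
  have close: "\<exists>T\<ge>t0. \<forall>t\<ge>T. E t \<le> 40 * \<delta> \<and> X t \<le> 20 * \<delta> \<and> \<bar>sqrt (u t) - sqrt (1/2)\<bar> \<le> 6 * sqrt \<delta>"
    if \<delta>: "0 < \<delta>" "\<delta> \<le> 1/16" for \<delta>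
  proof -
    obtain T where T: "t0 \<le> T" "\<And>t. T \<le> t \<Longrightarrow> L \<delta> t \<le> h \<delta> + 10 * \<delta>" "\<And>t. T \<le> t \<Longrightarrow> 8 / \<delta>\<^sup>2 \<le> b t"
      using L_eventually[OF \<delta>] by blast
    define c where "c = 1/2 + \<delta>"
    have c: "0 < c" "c \<le> 1" unfolding c_def using \<delta> by auto
    have "E t \<le> 40 * \<delta> \<and> X t \<le> 20 * \<delta> \<and> \<bar>sqrt (u t) - sqrt (1/2)\<bar> \<le> 6 * sqrt \<delta>" if t: "T \<le> t" for t
    proof -
      have tt: "t0 \<le> t" using T t by simp
      have "8 \<le> 8 / \<delta>\<^sup>2" using \<delta> by (simp add: field_simps power_le_one)
      then have "8 \<le> b t" using T(3)[OF t] by linarith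
      then have "E t / (2 * b t) \<le> E t / 2" using nn[OF tt] by (intro divide_left_mono) auto
      then have EF: "E t / 2 \<le> E t + F t" using F_small(3)[OF tt] by linarith
      define w where "w = u t / c"
      have w: "0 < w" unfolding w_def using u_pos[OF tt] c by simp
      \<comment> \<open>Passing to \<open>sqrt w\<close> bounds the relative entropy below by a
        square for all positive \<open>w\<close>, large or small.\<close>
      have "ln w = 2 * ln (sqrt w)" using w by (simp add: ln_sqrt)
      also have "\<dots> \<le> 2 * (sqrt w - 1)" using ln_le_minus_one[of "sqrt w"] w by simp
      finally have sq: "(sqrt w - 1)\<^sup>2 \<le> w - 1 - ln w" using w by (simp add: power2_eq_square algebra_simps)
      have "u t - (1/2 + \<delta>) * ln (u t) - h \<delta> = c * (w - 1 - ln w)"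
        using entropy[OF \<delta>(1) tt] unfolding c_def w_def .
      then have Lb: "c * (w - 1 - ln w) + (E t + F t) / 2 + X t / 2 \<le> 10 * \<delta>"
        using T(2)[OF t] unfolding L_def by simp
      have csq: "c * (sqrt w - 1)\<^sup>2 \<le> c * (w - 1 - ln w)" using sq c by (intro mult_left_mono) auto
      have csq0: "0 \<le> c * (sqrt w - 1)\<^sup>2" using c by simp
      have EX: "E t \<le> 40 * \<delta>" "X t \<le> 20 * \<delta>" "c * (sqrt w - 1)\<^sup>2 \<le> 10 * \<delta>"
        using Lb EF csq csq0 nn[OF tt] by argo+
      have "sqrt c * sqrt w = sqrt (u t)" unfolding w_def using c by (simp add: real_sqrt_mult[symmetric])
      then have "sqrt (u t) - sqrt c = sqrt c * (sqrt w - 1)" by (simp add: algebra_simps)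
      then have "(sqrt (u t) - sqrt c)\<^sup>2 = c * (sqrt w - 1)\<^sup>2" using c by (simp add: power_mult_distrib)
      also have "\<dots> \<le> (5 * sqrt \<delta>)\<^sup>2" using EX(3) \<delta> by (simp add: power_mult_distrib)
      finally have 1: "\<bar>sqrt (u t) - sqrt c\<bar> \<le> 5 * sqrt \<delta>"
        using abs_le_square_iff[of "sqrt (u t) - sqrt c" "5 * sqrt \<delta>"] \<delta> by simp
      have "sqrt (1/2) \<le> sqrt c" "sqrt c \<le> sqrt (1/2) + sqrt \<delta>"
        unfolding c_def using \<delta> sqrt_add_le_add_sqrt[of "1/2" \<delta>] by auto
      then have "\<bar>sqrt (u t) - sqrt (1/2)\<bar> \<le> 6 * sqrt \<delta>" using 1 by linarith
      then show ?thesis using EX by simp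
    qed
    then show ?thesis using T(1) by blast
  qed
  have small_lim: "(f \<longlongrightarrow> 0) at_top"
    if f: "\<And>\<delta>. 0 < \<delta> \<Longrightarrow> \<delta> \<le> 1/16 \<Longrightarrow> \<exists>T. \<forall>t\<ge>T. \<bar>f t\<bar> \<le> K * sqrt \<delta>" and K: "0 < K" for f :: "real \<Rightarrow> real" and K
  proof (rule tendstoI)
    fix e :: real assume e: "0 < e"
    define \<delta> where "\<delta> = min (1/16) ((e / (2 * K))\<^sup>2)"
    have \<delta>: "0 < \<delta>" "\<delta> \<le> 1/16" unfolding \<delta>_def using e K by auto
    have "sqrt \<delta> \<le> sqrt ((e / (2 * K))\<^sup>2)" unfolding \<delta>_def
      by (intro real_sqrt_le_mono) simp
    also have "\<dots> = e / (2 * K)" using e K by simp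
    finally have "K * sqrt \<delta> < e" using e K by (simp add: field_simps)
    with f[OF \<delta>] show "\<forall>\<^sub>F t in at_top. dist (f t) 0 < e"
      by (force simp: eventually_at_top_linorder dist_real_def)
  qed
  have lam: "\<delta> \<le> sqrt \<delta>" if "0 < \<delta>" "\<delta> \<le> 1/16" for \<delta> :: real
    using that by (intro real_le_rsqrt) (auto simp: power2_eq_square mult_left_le)
  have E0: "(E \<longlongrightarrow> 0) at_top"
  proof (rule small_lim[of _ 40])
    fix \<delta> :: real assume \<delta>: "0 < \<delta>" "\<delta> \<le> 1/16"
    obtain T where "t0 \<le> T" "\<And>t. T \<le> t \<Longrightarrow> E t \<le> 40 * \<delta>" using close[OF \<delta>] by blast
    then have "\<bar>E t\<bar> \<le> 40 * sqrt \<delta>" if "T \<le> t" for t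
      using that nn(3)[of t] lam[OF \<delta>] by (smt (verit))
    then show "\<exists>T. \<forall>t\<ge>T. \<bar>E t\<bar> \<le> 40 * sqrt \<delta>" by blast
  qed simp
  have X0: "(X \<longlongrightarrow> 0) at_top"
  proof (rule small_lim[of _ 20])
    fix \<delta> :: real assume \<delta>: "0 < \<delta>" "\<delta> \<le> 1/16"
    obtain T where "t0 \<le> T" "\<And>t. T \<le> t \<Longrightarrow> X t \<le> 20 * \<delta>" using close[OF \<delta>] by blast
    then have "\<bar>X t\<bar> \<le> 20 * sqrt \<delta>" if "T \<le> t" for t
      using that nn(2)[of t] lam[OF \<delta>] by (smt (verit))
    then show "\<exists>T. \<forall>t\<ge>T. \<bar>X t\<bar> \<le> 20 * sqrt \<delta>" by blast
  qed simp
  have "((\<lambda>t. sqrt (u t) - sqrt (1/2)) \<longlongrightarrow> 0) at_top"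
    using close by (intro small_lim[of _ 6]) (force, simp)
  from tendsto_power[OF tendsto_add[OF this tendsto_const[of "sqrt (1/2)"]], of 2]
  have "((\<lambda>t. (sqrt (u t))\<^sup>2) \<longlongrightarrow> 1/2) at_top" by simp
  then have u0: "(u \<longlongrightarrow> 1/2) at_top"
    by (rule Lim_transform_eventually) (rule eventually_from_t0, use u_pos in \<open>simp add: less_imp_le\<close>)
  have \<nu>0: "(\<nu> \<longlongrightarrow> 0) at_top"
  proof (rule tendsto_sandwich[of "\<lambda>_. 0" \<nu> at_top "\<lambda>t. 1 / (b t)\<^sup>2"])
    show "((\<lambda>t. 1 / (b t)\<^sup>2) \<longlongrightarrow> 0) at_top"
      using tendsto_power[OF tendsto_inverse_0_at_top[OF b_lim], of 2]
      by (simp add: inverse_eq_divide power_one_over)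
  qed (use nn \<nu>_le in \<open>auto intro: eventually_from_t0\<close>)
  have "((\<lambda>t. 2 / (3/2 + E t + X t + \<nu> t / 2 + u t)) \<longlongrightarrow> 2 / (3/2 + 0 + 0 + 0 / 2 + 1/2)) at_top"
    by (intro tendsto_intros E0 X0 \<nu>0 u0) auto
  then have "((\<lambda>t. 2 / (3/2 + E t + X t + \<nu> t / 2 + u t)) \<longlongrightarrow> 1) at_top" by simp
  then have y1: "(y \<longlongrightarrow> 1) at_top"
    by (rule Lim_transform_eventually)
      (rule eventually_from_t0, use Ham yp in \<open>simp flip: Ham\<close>)
  have "((\<lambda>t. E t * (y t)\<^sup>2) \<longlongrightarrow> 0 * 1\<^sup>2) at_top" by (intro tendsto_intros E0 y1)
  then have Ey: "((\<lambda>t. E t * (y t)\<^sup>2) \<longlongrightarrow> 0) at_top" by simp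
  have "(Z \<longlongrightarrow> 0) at_top"
  proof (rule tendsto_sandwich[OF _ _ tendsto_const Ey])
    show "\<forall>\<^sub>F t in at_top. Z t \<le> E t * (y t)\<^sup>2"
    proof (rule eventually_from_t0)
      fix t assume t: "t0 \<le> t"
      show "Z t \<le> E t * (y t)\<^sup>2"
        unfolding E_def using yp[OF t] Z_nonneg[OF t] W_nonneg[OF t] by simp
    qed
  qed (use Z_nonneg in \<open>auto intro: eventually_from_t0\<close>)
  then show ?thesis using y1 by blast
qed

end

section \<open>Quadratic differential equations and real-analytic functions\<close>

text \<open>The factor \<open>exp (- C * s)\<close> makes the product nonincreasing forwards in
  time, \<open>exp (C * s)\<close> nondecreasing when \<open>t\<close> lies before
  \<open>t0\<close>. Both directions occur, since the reference time is interior to the interval of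
  existence.\<close>

lemma gronwall_zero:
  fixes f f' :: "real \<Rightarrow> real"
  assumes f: "\<And>s. s \<in> closed_segment t0 t \<Longrightarrow> (f has_real_derivative f' s) (at s)"
    and nn: "\<And>s. s \<in> closed_segment t0 t \<Longrightarrow> 0 \<le> f s"
    and le: "\<And>s. s \<in> closed_segment t0 t \<Longrightarrow> \<bar>f' s\<bar> \<le> C * f s"
    and "f t0 = 0"
  shows "f t = 0"
proof (cases "t0 \<le> t")
  case True
  have "f t * exp (- C * t) \<le> f t0 * exp (- C * t0)"
  proof (rule DERIV_nonpos_imp_nonincreasing[OF True])
    fix s assume "t0 \<le> s" "s \<le> t"
    then have s: "s \<in> closed_segment t0 t" by (auto simp: closed_segment_eq_real_ivl)
    have "((\<lambda>s. f s * exp (- C * s)) has_real_derivative (f' s - C * f s) * exp (- C * s)) (at s)"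
      by (auto intro!: derivative_eq_intros f[OF s] simp: algebra_simps)
    moreover have "(f' s - C * f s) * exp (- C * s) \<le> 0"
      using le[OF s] by (intro mult_nonpos_nonneg) auto
    ultimately show "\<exists>y. ((\<lambda>s. f s * exp (- C * s)) has_real_derivative y) (at s) \<and> y \<le> 0" by blast
  qed
  then have "f t \<le> 0" using assms(4) by (simp add: mult_le_0_iff)
  then show ?thesis using nn[of t] by simp
next
  case False
  have "f t * exp (C * t) \<le> f t0 * exp (C * t0)"
  proof (rule DERIV_nonneg_imp_nondecreasing[of t t0 "\<lambda>s. f s * exp (C * s)"])
    show "t \<le> t0" using False by simp
    fix s assume "t \<le> s" "s \<le> t0"
    then have s: "s \<in> closed_segment t0 t" by (auto simp: closed_segment_eq_real_ivl)
    have "((\<lambda>s. f s * exp (C * s)) has_real_derivative (f' s + C * f s) * exp (C * s)) (at s)"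
      by (auto intro!: derivative_eq_intros f[OF s] simp: algebra_simps)
    moreover have "0 \<le> (f' s + C * f s) * exp (C * s)"
      using le[OF s] by (intro mult_nonneg_nonneg) auto
    ultimately show "\<exists>y. ((\<lambda>s. f s * exp (C * s)) has_real_derivative y) (at s) \<and> 0 \<le> y" by blast
  qed
  then have "f t \<le> 0" using assms(4) by (simp add: mult_le_0_iff)
  then show ?thesis using nn[of t] by simp
qed

lemma gronwall_zero_vector:
  fixes u u' :: "real \<Rightarrow> 'a::real_inner"
  assumes u: "\<And>s. s \<in> closed_segment t0 t \<Longrightarrow> (u has_vector_derivative u' s) (at s)"
    and le: "\<And>s. s \<in> closed_segment t0 t \<Longrightarrow> norm (u' s) \<le> C * norm (u s)"
    and "u t0 = 0"
  shows "u t = 0"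
proof -
  have "u t \<bullet> u t = 0"
  proof (rule gronwall_zero[where f="\<lambda>s. u s \<bullet> u s" and f'="\<lambda>s. 2 * (u s \<bullet> u' s)" and C="2 * C"])
    fix s assume s: "s \<in> closed_segment t0 t"
    have "((\<lambda>s. u s \<bullet> u s) has_derivative (\<lambda>h. u s \<bullet> (h *\<^sub>R u' s) + (h *\<^sub>R u' s) \<bullet> u s)) (at s)"
      using u[OF s] unfolding has_vector_derivative_def by (intro has_derivative_inner)
    then show "((\<lambda>s. u s \<bullet> u s) has_real_derivative 2 * (u s \<bullet> u' s)) (at s)"
      unfolding has_field_derivative_def by (rule has_derivative_eq_rhs) (auto simp: inner_commute algebra_simps)
    show "0 \<le> u s \<bullet> u s" by simp
    have "\<bar>u s \<bullet> u' s\<bar> \<le> norm (u s) * norm (u' s)" by (rule Cauchy_Schwarz_ineq2)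
    also have "\<dots> \<le> norm (u s) * (C * norm (u s))" by (intro mult_left_mono le[OF s]) auto
    also have "\<dots> = C * (u s \<bullet> u s)" by (simp add: dot_square_norm power2_eq_square)
    finally show "\<bar>2 * (u s \<bullet> u' s)\<bar> \<le> 2 * C * (u s \<bullet> u s)" by simp
  qed (use assms(3) in simp)
  then show ?thesis by simp
qed

lemma gronwall_bound:
  fixes v v' :: "real \<Rightarrow> real"
  assumes v: "\<And>s. t1 \<le> s \<Longrightarrow> s < T \<Longrightarrow> (v has_real_derivative v' s) (at s)"
    and le: "\<And>s. t1 \<le> s \<Longrightarrow> s < T \<Longrightarrow> v' s \<le> C * v s"
    and t: "t1 \<le> t" "t < T"
  shows "v t \<le> v t1 * exp (C * (t - t1))"
proof -
  have "v t * exp (- C * (t - t1)) \<le> v t1 * exp (- C * (t1 - t1))"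
  proof (rule DERIV_nonpos_imp_nonincreasing[OF t(1)])
    fix s assume s: "t1 \<le> s" "s \<le> t"
    then have s': "s < T" using t by simp
    have "((\<lambda>s. v s * exp (- C * (s - t1))) has_real_derivative (v' s - C * v s) * exp (- C * (s - t1))) (at s)"
      by (auto intro!: derivative_eq_intros v[OF s(1) s'] simp: algebra_simps)
    moreover have "(v' s - C * v s) * exp (- C * (s - t1)) \<le> 0"
      using le[OF s(1) s'] by (intro mult_nonpos_nonneg) auto
    ultimately show "\<exists>y. ((\<lambda>s. v s * exp (- C * (s - t1))) has_real_derivative y) (at s) \<and> y \<le> 0" by blast
  qed
  then have "v t * exp (- C * (t - t1)) \<le> v t1" by simp
  from mult_right_mono[OF this, of "exp (C * (t - t1))"]
  show ?thesis by (simp add: mult.assoc mult_exp_exp)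
qed

text \<open>Analyticity is encoded by a holomorphic extension near the point, so that derivatives
  and the identity theorem are inherited from complex analysis.\<close>

definition real_analytic_at :: "(real \<Rightarrow> real) \<Rightarrow> real \<Rightarrow> bool" where
  "real_analytic_at f t \<longleftrightarrow>
     (\<exists>F. F analytic_on {complex_of_real t} \<and> (\<forall>\<^sub>F s in nhds t. F (of_real s) = of_real (f s)))"

lemma real_analytic_atI:
  "F analytic_on {complex_of_real t} \<Longrightarrow> (\<forall>\<^sub>F s in nhds t. F (of_real s) = of_real (f s)) \<Longrightarrow> real_analytic_at f t"
  unfolding real_analytic_at_def by blast

lemma real_analytic_at_const: "real_analytic_at (\<lambda>_. c) t"
  by (rule real_analytic_atI[of "\<lambda>_. of_real c"]) auto

lemma real_analytic_at_add:
  assumes "real_analytic_at f t" "real_analytic_at g t"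
  shows "real_analytic_at (\<lambda>s. f s + g s) t"
proof -
  obtain F G where "F analytic_on {complex_of_real t}" "\<forall>\<^sub>F s in nhds t. F (of_real s) = of_real (f s)"
    "G analytic_on {complex_of_real t}" "\<forall>\<^sub>F s in nhds t. G (of_real s) = of_real (g s)"
    using assms unfolding real_analytic_at_def by blast
  then show ?thesis
    by (intro real_analytic_atI[of "\<lambda>z. F z + G z"] analytic_intros) (auto elim: eventually_elim2)
qed

lemma real_analytic_at_mult:
  assumes "real_analytic_at f t" "real_analytic_at g t"
  shows "real_analytic_at (\<lambda>s. f s * g s) t"
proof -
  obtain F G where "F analytic_on {complex_of_real t}" "\<forall>\<^sub>F s in nhds t. F (of_real s) = of_real (f s)"
    "G analytic_on {complex_of_real t}" "\<forall>\<^sub>F s in nhds t. G (of_real s) = of_real (g s)"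
    using assms unfolding real_analytic_at_def by blast
  then show ?thesis
    by (intro real_analytic_atI[of "\<lambda>z. F z * G z"] analytic_intros) (auto elim: eventually_elim2)
qed

lemma real_analytic_at_minus: "real_analytic_at f t \<Longrightarrow> real_analytic_at (\<lambda>s. - f s) t"
  using real_analytic_at_mult[OF real_analytic_at_const[of "-1"]] by simp

lemma real_analytic_at_diff:
  "real_analytic_at f t \<Longrightarrow> real_analytic_at g t \<Longrightarrow> real_analytic_at (\<lambda>s. f s - g s) t"
  using real_analytic_at_add[OF _ real_analytic_at_minus] by fastforce

lemma real_analytic_at_sum:
  "(\<And>i. i \<in> A \<Longrightarrow> real_analytic_at (f i) t) \<Longrightarrow> real_analytic_at (\<lambda>s. \<Sum>i\<in>A. f i s) t"
  by (induction A rule: infinite_finite_induct)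
    (auto intro: real_analytic_at_const real_analytic_at_add)

lemma real_analytic_at_prod:
  "(\<And>i. i \<in> A \<Longrightarrow> real_analytic_at (f i) t) \<Longrightarrow> real_analytic_at (\<lambda>s. \<Prod>i\<in>A. f i s) t"
  by (induction A rule: infinite_finite_induct)
    (auto intro: real_analytic_at_const real_analytic_at_mult)

lemma real_analytic_at_cong:
  assumes "real_analytic_at f t" "\<forall>\<^sub>F s in nhds t. f s = g s"
  shows "real_analytic_at g t"
proof -
  obtain F where F: "F analytic_on {complex_of_real t}" "\<forall>\<^sub>F s in nhds t. F (of_real s) = of_real (f s)"
    using assms unfolding real_analytic_at_def by blast
  have "\<forall>\<^sub>F s in nhds t. F (of_real s) = of_real (g s)" using F(2) assms(2) by eventually_elim simp
  then show ?thesis using F(1) real_analytic_atI by blast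
qed

lemma real_analytic_at_inverse:
  assumes "real_analytic_at f t" "f t \<noteq> 0"
  shows "real_analytic_at (\<lambda>s. inverse (f s)) t"
proof -
  obtain F where F: "F analytic_on {complex_of_real t}" "\<forall>\<^sub>F s in nhds t. F (of_real s) = of_real (f s)"
    using assms unfolding real_analytic_at_def by blast
  have "F (of_real t) = of_real (f t)" using eventually_nhds_x_imp_x[OF F(2)] .
  then have "(\<lambda>z. inverse (F z)) analytic_on {complex_of_real t}"
    using assms(2) by (intro analytic_on_inverse F(1)) auto
  moreover have "\<forall>\<^sub>F s in nhds t. inverse (F (of_real s)) = of_real (inverse (f s))"
    using F(2) by eventually_elim simp
  ultimately show ?thesis by (rule real_analytic_atI)
qed

lemma real_analytic_at_divide:
  "real_analytic_at f t \<Longrightarrow> real_analytic_at g t \<Longrightarrow> g t \<noteq> 0 \<Longrightarrow> real_analytic_at (\<lambda>s. f s / g s) t"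
  unfolding divide_inverse by (intro real_analytic_at_mult real_analytic_at_inverse)

text \<open>The derivative along the real axis of a function with real values there has imaginary
  part 0, because the imaginary part of the function is constantly 0.\<close>

lemma real_restriction_deriv:
  fixes F :: "complex \<Rightarrow> complex" and f :: "real \<Rightarrow> real"
  assumes "(F has_field_derivative D) (at (of_real t))" "\<forall>\<^sub>F s in nhds t. F (of_real s) = of_real (f s)"
  shows "(f has_real_derivative Re D) (at t)" "D = of_real (Re D)"
proof -
  have "((\<lambda>s. F (of_real s)) has_vector_derivative D) (at t)"
    using has_vector_derivative_real_field[OF assms(1)] by (simp add: o_def)
  moreover obtain S where S: "open S" "t \<in> S" "\<And>s. s \<in> S \<Longrightarrow> F (of_real s) = complex_of_real (f s)"
    using assms(2) unfolding eventually_nhds by blast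
  ultimately have d: "((\<lambda>s. complex_of_real (f s)) has_vector_derivative D) (at t)"
    by (rule has_vector_derivative_transform_within_open)
  have "((\<lambda>s. Re (complex_of_real (f s))) has_vector_derivative Re D) (at t)"
    by (rule bounded_linear.has_vector_derivative[OF bounded_linear_Re d])
  then show "(f has_real_derivative Re D) (at t)" by (simp add: has_real_derivative_iff_has_vector_derivative)
  have "((\<lambda>s. Im (complex_of_real (f s))) has_vector_derivative Im D) (at t)"
    by (rule bounded_linear.has_vector_derivative[OF bounded_linear_Im d])
  then have "((\<lambda>s. 0 :: real) has_real_derivative Im D) (at t)" by (simp add: has_real_derivative_iff_has_vector_derivative)
  from DERIV_unique[OF this DERIV_const] show "D = of_real (Re D)" by (simp add: complex_eq_iff)
qed

lemma real_analytic_at_deriv: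
  assumes "real_analytic_at f t"
  shows "real_analytic_at (deriv f) t"
proof -
  obtain F where F: "F analytic_on {complex_of_real t}" "\<forall>\<^sub>F s in nhds t. F (of_real s) = of_real (f s)"
    using assms unfolding real_analytic_at_def by blast
  obtain r where r: "0 < r" "F holomorphic_on ball (of_real t) r"
    using F(1) by (auto simp: analytic_at_ball)
  \<comment> \<open>Comparing derivatives at a nearby \<open>s\<close> needs the two functions to
    agree on a neighbourhood of \<open>s\<close>, not just at \<open>s\<close>.\<close>
  have 1: "\<forall>\<^sub>F s in nhds t. \<forall>\<^sub>F s' in nhds s. F (of_real s') = of_real (f s')"
    using F(2) eventually_eventually by blast
  have 2: "\<forall>\<^sub>F s in nhds t. s \<in> ball t r" using r(1) eventually_nhds_in_open[of "ball t r" t] by simp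
  have "\<forall>\<^sub>F s in nhds t. deriv F (of_real s) = of_real (deriv f s)"
    using 1 2
  proof eventually_elim
    case (elim s)
    then have "(F has_field_derivative deriv F (of_real s)) (at (of_real s))"
      using r(2) by (intro holomorphic_derivI[of F "ball (of_real t) r"]) (auto simp: dist_of_real)
    from real_restriction_deriv[OF this elim(1)] show ?case by (metis DERIV_imp_deriv)
  qed
  moreover have "deriv F analytic_on {complex_of_real t}"
    using analytic_on_deriv[of F "\<lambda>z. z" "{complex_of_real t}"] F(1) by simp
  ultimately show ?thesis by (intro real_analytic_atI[of "deriv F"])
qed

lemma real_analytic_at_differentiable:
  assumes "real_analytic_at f t"
  shows "f differentiable (at t)"
proof -
  obtain F where F: "F analytic_on {complex_of_real t}" "\<forall>\<^sub>F s in nhds t. F (of_real s) = of_real (f s)"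
    using assms unfolding real_analytic_at_def by blast
  have "(F has_field_derivative deriv F (of_real t)) (at (of_real t))"
    using analytic_on_imp_differentiable_at[OF F(1)] DERIV_deriv_iff_field_differentiable by blast
  from real_restriction_deriv(1)[OF this F(2)] show ?thesis
    using real_differentiable_def by blast
qed

lemma real_analytic_imp_smooth_on:
  assumes "\<And>t. t \<in> I \<Longrightarrow> real_analytic_at f t"
  shows "smooth_on I f"
proof -
  have "real_analytic_at ((deriv ^^ n) f) t" if "t \<in> I" for n t
    by (induction n) (auto intro: assms[OF that] real_analytic_at_deriv)
  then show ?thesis unfolding smooth_on_def using real_analytic_at_differentiable by blast
qed

text \<open>The set of points near which \<open>f\<close> vanishes is open and closed in
  \<open>J\<close>. For closedness, the holomorphic extension at a limit point vanishes on a short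
  real interval inside its disc, hence on the whole disc.\<close>

lemma real_analytic_identity:
  assumes f: "\<And>t. t \<in> J \<Longrightarrow> real_analytic_at f t" and J: "open J" "connected J"
    and t0: "t0 \<in> J" "\<forall>\<^sub>F s in nhds t0. f s = 0" and t: "t \<in> J"
  shows "f t = 0"
proof -
  define S where "S = {t \<in> J. \<forall>\<^sub>F s in nhds t. f s = 0}"
  have "openin (top_of_set J) S"
  proof -
    have "open S"
      unfolding open_subopen[of S]
    proof
      fix x assume x: "x \<in> S"
      then obtain U where U: "open U" "x \<in> U" "\<forall>s\<in>U. f s = 0" unfolding S_def eventually_nhds by auto
      then have "U \<inter> J \<subseteq> S" unfolding S_def eventually_nhds by auto
      then show "\<exists>T. open T \<and> x \<in> T \<and> T \<subseteq> S" using U J x unfolding S_def by (intro exI[of _ "U \<inter> J"]) auto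
    qed
    then show ?thesis by (simp add: S_def J openin_open_eq Collect_restrict)
  qed
  moreover have "closedin (top_of_set J) S"
    unfolding closedin_limpt
  proof (intro conjI allI impI)
    show "S \<subseteq> J" unfolding S_def by auto
    fix x assume "x islimpt S \<and> x \<in> J"
    then have x: "x islimpt S" "x \<in> J" by auto
    obtain F where F: "F analytic_on {complex_of_real x}" "\<forall>\<^sub>F s in nhds x. F (of_real s) = of_real (f s)"
      using f[OF x(2)] unfolding real_analytic_at_def by blast
    obtain r where r: "0 < r" "F holomorphic_on ball (of_real x) r" using F(1) by (auto simp: analytic_at_ball)
    obtain d where d: "0 < d" "\<And>s. dist s x < d \<Longrightarrow> F (of_real s) = of_real (f s)"
      using F(2) unfolding eventually_nhds_metric by auto
    define e where "e = min r d"
    have e: "0 < e" unfolding e_def using r d by simp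
    obtain s where s: "s \<in> S" "dist s x < e" using x(1) e unfolding islimpt_approachable by blast
    obtain \<delta> where \<delta>: "0 < \<delta>" "\<And>s'. dist s' s < \<delta> \<Longrightarrow> f s' = 0"
      using s(1) unfolding S_def eventually_nhds_metric by auto
    define U where "U = complex_of_real ` (ball s \<delta> \<inter> ball x e)"
    have zero: "F z = 0" if z: "z \<in> ball (of_real x) e" for z
    proof (rule analytic_continuation[of F "ball (of_real x) e" U "of_real s"])
      show "F holomorphic_on ball (of_real x) e" by (rule holomorphic_on_subset[OF r(2) subset_ball]) (simp add: e_def)
      show "U \<subseteq> ball (of_real x) e" unfolding U_def by (auto simp: dist_of_real)
      show "complex_of_real s \<in> ball (of_real x) e" using s by (simp add: dist_of_real dist_commute)
      have "s islimpt (ball s \<delta> \<inter> ball x e)"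
        using s(2) \<delta> by (intro open_imp_islimpt) (auto simp: dist_commute)
      then show "complex_of_real s islimpt U"
        unfolding U_def islimpt_approachable by (force simp: dist_of_real)
      show "F z = 0" if "z \<in> U" for z
        using that d(2) \<delta>(2) unfolding U_def e_def by (auto simp: dist_commute)
    qed (use z in auto)
    have "\<forall>\<^sub>F s in nhds x. f s = 0"
      unfolding eventually_nhds_metric
    proof (intro exI[of _ e] conjI allI impI e)
      fix s assume "dist s x < e"
      then have "F (of_real s) = of_real (f s)" "F (of_real s) = 0"
        using d(2)[of s] zero[of "of_real s"] by (auto simp: e_def dist_of_real dist_commute)
      then show "f s = 0" by simp
    qed
    then show "x \<in> S" unfolding S_def using x by simp
  qed
  ultimately have "S = {} \<or> S = J" using J(2) unfolding connected_clopen by blast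
  then have "t \<in> S" using t0 t unfolding S_def by auto
  then show ?thesis unfolding S_def using eventually_nhds_x_imp_x by force
qed

text \<open>The Taylor coefficients of the solution of \<open>Y' = Q Y Y\<close> with initial value
  \<open>y0\<close>: comparing powers, \<open>Suc n\<close> times the next coefficient is a Cauchy
  product.\<close>

fun quadratic_flow_coeff :: "('a \<Rightarrow> 'a \<Rightarrow> 'a) \<Rightarrow> 'a \<Rightarrow> nat \<Rightarrow> 'a::real_normed_vector" where
  "quadratic_flow_coeff Q y0 0 = y0"
| "quadratic_flow_coeff Q y0 (Suc n) =
     (1 / real (Suc n)) *\<^sub>R
       (\<Sum>k\<le>n. Q (quadratic_flow_coeff Q y0 k) (quadratic_flow_coeff Q y0 (n - k)))"

text \<open>Majorization: the bounds are the Taylor coefficients of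
  \<open>M / (1 - q * M * t)\<close>, which solves \<open>v' = q * v^2\<close> with
  \<open>v 0 = M\<close>. The \<open>Suc n\<close> equal bounds in the sum cancel the
  denominator.\<close>

lemma quadratic_flow_coeff_bound:
  assumes Q: "\<And>x y. norm (Q x y) \<le> q * norm x * norm y" and "0 \<le> q" "norm y0 \<le> M" "0 \<le> M"
  shows "norm (quadratic_flow_coeff Q y0 n) \<le> M * (q * M) ^ n"
proof (induction n rule: less_induct)
  case (less n)
  show ?case
  proof (cases n)
    case (Suc m)
    let ?c = "quadratic_flow_coeff Q y0"
    have "norm (Q (?c k) (?c (m - k))) \<le> M * (q * M) ^ Suc m" if "k \<le> m" for k
    proof -
      have "norm (Q (?c k) (?c (m - k))) \<le> q * norm (?c k) * norm (?c (m - k))" by (rule Q)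
      also have "\<dots> \<le> q * (M * (q * M) ^ k) * (M * (q * M) ^ (m - k))"
        using that assms by (intro mult_mono less) (auto simp: Suc)
      also have "\<dots> = M * (q * M * ((q * M) ^ k * (q * M) ^ (m - k)))" by (simp add: mult_ac)
      also have "(q * M) ^ k * (q * M) ^ (m - k) = (q * M) ^ m" using that by (simp flip: power_add)
      finally show ?thesis by simp
    qed
    then have "norm (\<Sum>k\<le>m. Q (?c k) (?c (m - k))) \<le> (\<Sum>k\<le>m. M * (q * M) ^ Suc m)"
      by (intro sum_norm_le) auto
    also have "\<dots> = real (Suc m) * (M * (q * M) ^ Suc m)" by simp
    finally have "norm (?c (Suc m)) \<le> (1 / real (Suc m)) * (real (Suc m) * (M * (q * M) ^ Suc m))"
      unfolding quadratic_flow_coeff.simps norm_scaleR by (intro mult_mono) auto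
    then show ?thesis by (simp add: Suc)
  qed (use assms in simp)
qed

text \<open>The lifetime depends on the data only through the bound \<open>M\<close>. This
  uniformity is what later turns boundedness of a solution into extendibility.\<close>

lemma quadratic_flow_exists:
  fixes Q :: "'a \<Rightarrow> 'a \<Rightarrow> 'a::euclidean_space"
  assumes bil: "bilinear Q" and Q: "\<And>x y. norm (Q x y) \<le> q * norm x * norm y"
    and q: "0 < q" and M: "0 < M" "norm y0 \<le> M"
  shows "\<exists>Y. Y t0 = y0 \<and>
    (\<forall>t. \<bar>t - t0\<bar> < 1 / (q * M) \<longrightarrow> (Y has_vector_derivative Q (Y t) (Y t)) (at t)
       \<and> (\<forall>v. real_analytic_at (\<lambda>s. Y s \<bullet> v) t))"
proof -
  let ?c = "quadratic_flow_coeff Q y0"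
  define \<rho> where "\<rho> = 1 / (q * M)"
  have \<rho>: "0 < \<rho>" unfolding \<rho>_def using q M by simp
  have cb: "norm (?c n) \<le> M * (q * M) ^ n" for n
    by (rule quadratic_flow_coeff_bound[OF Q]) (use q M in auto)
  have summ: "summable (\<lambda>n. norm (?c n) * r ^ n)" if "0 \<le> r" "r < \<rho>" for r
  proof (rule summable_comparison_test')
    show "summable (\<lambda>n. M * (q * M * r) ^ n)"
      using that q M unfolding \<rho>_def by (intro summable_mult summable_geometric) (simp add: field_simps)
    show "norm (norm (?c n) * r ^ n) \<le> M * (q * M * r) ^ n" if "n \<ge> 0" for n
      using mult_right_mono[OF cb[of n], of "r ^ n"] \<open>0 \<le> r\<close> by (simp add: power_mult_distrib mult_ac)
  qed
  define Y where "Y t = (\<Sum>n. (t - t0) ^ n *\<^sub>R ?c n)" for t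
  have abs_summ: "summable (\<lambda>n. norm ((t - t0) ^ n *\<^sub>R ?c n))" if "\<bar>t - t0\<bar> < \<rho>" for t
  proof -
    have eq: "norm ((t - t0) ^ n *\<^sub>R ?c n) = norm (?c n) * \<bar>t - t0\<bar> ^ n" for n
      unfolding norm_scaleR power_abs by (rule mult.commute)
    show ?thesis unfolding eq using summ[of "\<bar>t - t0\<bar>"] that by simp
  qed
  have sums: "(\<lambda>n. (t - t0) ^ n *\<^sub>R ?c n) sums Y t" if "\<bar>t - t0\<bar> < \<rho>" for t
    unfolding Y_def by (rule summable_sums[OF summable_norm_cancel[OF abs_summ[OF that]]])
  \<comment> \<open>Stated for any complete normed field: the real instance gives the derivative,
    the complex one the holomorphic extension.\<close>
  have csum: "summable (\<lambda>n. norm (of_real (?c n \<bullet> v) * w ^ n))" if "norm w < \<rho>" for v and w :: "'b::{real_normed_field,banach}"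
  proof (rule summable_comparison_test')
    show "summable (\<lambda>n. norm v * (norm (?c n) * norm w ^ n))" by (rule summable_mult[OF summ]) (use that in auto)
    show "norm (norm (of_real (?c n \<bullet> v) * w ^ n)) \<le> norm v * (norm (?c n) * norm w ^ n)" if "n \<ge> 0" for n
      using mult_right_mono[OF Cauchy_Schwarz_ineq2[of "?c n" v], of "norm w ^ n"]
      by (simp add: norm_mult norm_power mult_ac)
  qed
  have Yv: "Y t \<bullet> v = (\<Sum>n. (?c n \<bullet> v) * (t - t0) ^ n)" if "\<bar>t - t0\<bar> < \<rho>" for t v
    using bounded_linear.sums[OF bounded_linear_inner_left sums[OF that], of v]
    by (simp add: sums_iff mult.commute)
  have Yv': "((\<lambda>t. Y t \<bullet> v) has_real_derivative Q (Y t) (Y t) \<bullet> v) (at t)" if t: "\<bar>t - t0\<bar> < \<rho>" for t v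
  proof -
    define x where "x = t - t0"
    have x: "\<bar>x\<bar> < \<rho>" unfolding x_def by (rule t)
    have "((\<lambda>z. \<Sum>n. (?c n \<bullet> v) * z ^ n) has_field_derivative (\<Sum>n. diffs (\<lambda>n. ?c n \<bullet> v) n * x ^ n)) (at x)"
    proof (rule termdiffs_strong')
      show "summable (\<lambda>n. (?c n \<bullet> v) * z ^ n)" if "norm z < \<rho>" for z :: real
        using summable_norm_cancel[OF csum[OF that, of v]] by simp
    qed (use x in simp)
    moreover have "(\<lambda>n. diffs (\<lambda>n. ?c n \<bullet> v) n * x ^ n) sums (Q (Y t) (Y t) \<bullet> v)"
    proof -
      define a where "a i n = (?c n \<bullet> i) * x ^ n" for i n
      have a_sum: "summable (\<lambda>n. norm (a i n))" for i using csum[of x i] x unfolding a_def by simp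
      have aY: "(\<Sum>n. a i n) = Y t \<bullet> i" for i using Yv[OF t] unfolding a_def x_def by simp
      have "(\<lambda>n. \<Sum>k\<le>n. a i k * a j (n - k)) sums ((Y t \<bullet> i) * (Y t \<bullet> j))" for i j
        using Cauchy_product_sums[OF a_sum[of i] a_sum[of j]] unfolding aY .
      then have Qsums: "(\<lambda>n. \<Sum>i\<in>Basis. \<Sum>j\<in>Basis. (\<Sum>k\<le>n. a i k * a j (n - k)) * (Q i j \<bullet> v))
          sums (\<Sum>i\<in>Basis. \<Sum>j\<in>Basis. (Y t \<bullet> i) * (Y t \<bullet> j) * (Q i j \<bullet> v))"
        by (intro sums_sum sums_mult2)
      have Qexp: "Q p r \<bullet> v = (\<Sum>i\<in>Basis. \<Sum>j\<in>Basis. (p \<bullet> i) * (r \<bullet> j) * (Q i j \<bullet> v))" for p r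
      proof -
        have "Q p r = Q (\<Sum>i\<in>Basis. (p \<bullet> i) *\<^sub>R i) (\<Sum>j\<in>Basis. (r \<bullet> j) *\<^sub>R j)"
          by (simp add: euclidean_representation)
        also have "\<dots> = (\<Sum>i\<in>Basis. \<Sum>j\<in>Basis. ((p \<bullet> i) * (r \<bullet> j)) *\<^sub>R Q i j)"
          unfolding bilinear_sum[OF bil] sum.cartesian_product[symmetric]
          by (simp add: bilinear_lmul[OF bil] bilinear_rmul[OF bil] mult.commute)
        finally show ?thesis by (simp add: inner_sum_left)
      qed
      have coeff: "diffs (\<lambda>n. ?c n \<bullet> v) n * x ^ n
          = (\<Sum>i\<in>Basis. \<Sum>j\<in>Basis. (\<Sum>k\<le>n. a i k * a j (n - k)) * (Q i j \<bullet> v))" for n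
      proof -
        have "diffs (\<lambda>n. ?c n \<bullet> v) n = (\<Sum>k\<le>n. Q (?c k) (?c (n - k)) \<bullet> v)"
          unfolding diffs_def by (simp add: inner_sum_left)
        also have "\<dots> * x ^ n = (\<Sum>k\<le>n. \<Sum>i\<in>Basis. \<Sum>j\<in>Basis. a i k * a j (n - k) * (Q i j \<bullet> v))"
          unfolding sum_distrib_right
        proof (intro sum.cong refl)
          fix k assume "k \<in> {..n}"
          then have "x ^ n = x ^ k * x ^ (n - k)" by (simp flip: power_add)
          then show "Q (?c k) (?c (n - k)) \<bullet> v * x ^ n
              = (\<Sum>i\<in>Basis. \<Sum>j\<in>Basis. a i k * a j (n - k) * (Q i j \<bullet> v))"
            unfolding Qexp[of "?c k"] a_def sum_distrib_right by (simp add: mult_ac)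
        qed
        also have "\<dots> = (\<Sum>i\<in>Basis. \<Sum>k\<le>n. \<Sum>j\<in>Basis. a i k * a j (n - k) * (Q i j \<bullet> v))" by (rule sum.swap)
        also have "\<dots> = (\<Sum>i\<in>Basis. \<Sum>j\<in>Basis. \<Sum>k\<le>n. a i k * a j (n - k) * (Q i j \<bullet> v))"
          by (intro sum.cong refl sum.swap)
        finally show ?thesis by (simp add: sum_distrib_right)
      qed
      show ?thesis unfolding coeff Qexp[of "Y t"] by (rule Qsums)
    qed
    ultimately have d: "((\<lambda>z. \<Sum>n. (?c n \<bullet> v) * z ^ n) has_field_derivative Q (Y t) (Y t) \<bullet> v) (at x)"
      by (simp add: sums_iff)
    have "((\<lambda>s. s - t0) has_real_derivative 1) (at t)" by (auto intro!: derivative_eq_intros)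
    then have "((\<lambda>s. \<Sum>n. (?c n \<bullet> v) * (s - t0) ^ n) has_field_derivative Q (Y t) (Y t) \<bullet> v) (at t)"
      using DERIV_chain2[where f="\<lambda>z. \<Sum>n. (?c n \<bullet> v) * z ^ n" and g="\<lambda>s. s - t0" and x=t and s=UNIV and Db=1
          and Da="Q (Y t) (Y t) \<bullet> v"] d unfolding x_def by simp
    then show ?thesis
      by (rule has_field_derivative_transform_within_open[of _ _ _ "{s. \<bar>s - t0\<bar> < \<rho>}"])
        (use t Yv in \<open>auto intro!: open_Collect_less continuous_intros\<close>)
  qed
  have "(Y has_vector_derivative Q (Y t) (Y t)) (at t)" if t: "\<bar>t - t0\<bar> < \<rho>" for t
    unfolding has_vector_derivative_def
    by (subst has_derivative_componentwise_within)
      (use Yv'[OF t] in \<open>auto simp: has_field_derivative_def mult_commute_abs\<close>)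
  moreover have "real_analytic_at (\<lambda>s. Y s \<bullet> v) t" if t: "\<bar>t - t0\<bar> < \<rho>" for t v
  proof (rule real_analytic_atI)
    let ?F = "\<lambda>z. \<Sum>n. complex_of_real (?c n \<bullet> v) * (z - of_real t0) ^ n"
    have "?F holomorphic_on ball (of_real t0) \<rho>"
    proof (rule power_series_holomorphic)
      fix w assume "w \<in> ball (complex_of_real t0) \<rho>"
      then have "norm (w - of_real t0) < \<rho>" by (simp add: dist_norm norm_minus_commute)
      from summable_sums[OF summable_norm_cancel[OF csum[OF this, of v]]]
      show "(\<lambda>n. complex_of_real (?c n \<bullet> v) * (w - of_real t0) ^ n) sums ?F w" .
    qed
    then have "?F analytic_on ball (of_real t0) \<rho>" by (simp add: analytic_on_open)
    then show "?F analytic_on {complex_of_real t}"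
      by (rule analytic_on_subset) (use t in \<open>simp add: dist_of_real dist_real_def abs_minus_commute\<close>)
    have "?F (of_real s) = of_real (Y s \<bullet> v)" if "\<bar>s - t0\<bar> < \<rho>" for s
    proof -
      have "norm (s - t0) < \<rho>" using that by simp
      from sums_of_real[OF summable_sums[OF summable_norm_cancel[OF csum[OF this, of v]]], where 'a=complex]
      show ?thesis unfolding Yv[OF that] by (simp add: sums_iff)
    qed
    moreover have "\<forall>\<^sub>F s in nhds t. s \<in> {s. \<bar>s - t0\<bar> < \<rho>}"
      using t by (intro eventually_nhds_in_open open_Collect_less continuous_intros) auto
    ultimately show "\<forall>\<^sub>F s in nhds t. ?F (of_real s) = of_real (Y s \<bullet> v)" by (auto elim: eventually_mono)
  qed
  moreover have "Y t0 = y0" unfolding Y_def using suminf_finite[of "{0}" "\<lambda>n. (0::real) ^ n *\<^sub>R ?c n"] by simp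
  ultimately show ?thesis unfolding \<rho>_def by blast
qed

lemma bilinear_bound_pos:
  fixes Q :: "'a::euclidean_space \<Rightarrow> 'b::euclidean_space \<Rightarrow> 'c::real_normed_vector"
  assumes "bilinear Q"
  obtains q where "0 < q" "\<And>x y. norm (Q x y) \<le> q * norm x * norm y"
  using bilinear_bounded_pos[OF assms] by blast

text \<open>By bilinearity the derivative of the difference is linear in the difference, with
  coefficients bounded on the compact segment.\<close>

lemma quadratic_flow_unique:
  fixes Q :: "'a \<Rightarrow> 'a \<Rightarrow> 'a::euclidean_space"
  assumes bil: "bilinear Q"
    and x: "\<And>s. s \<in> closed_segment t0 t \<Longrightarrow> (x has_vector_derivative Q (x s) (x s)) (at s)"
    and y: "\<And>s. s \<in> closed_segment t0 t \<Longrightarrow> (y has_vector_derivative Q (y s) (y s)) (at s)"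
    and "x t0 = y t0"
  shows "x t = y t"
proof -
  let ?S = "closed_segment t0 t"
  obtain q where q: "0 < q" "\<And>x y. norm (Q x y) \<le> q * norm x * norm y" using bilinear_bound_pos[OF bil] by blast
  have "continuous_on ?S x" "continuous_on ?S y"
    by (intro continuous_at_imp_continuous_on ballI; use has_vector_derivative_continuous x y in blast)+
  then have "bounded (x ` ?S)" "bounded (y ` ?S)"
    by (auto intro!: compact_imp_bounded compact_continuous_image)
  then obtain B1 B2 where B: "\<And>s. s \<in> ?S \<Longrightarrow> norm (x s) \<le> B1" "\<And>s. s \<in> ?S \<Longrightarrow> norm (y s) \<le> B2"
    unfolding bounded_iff by auto
  have "x t - y t = 0"
  proof (rule gronwall_zero_vector[where u="\<lambda>s. x s - y s" and u'="\<lambda>s. Q (x s) (x s) - Q (y s) (y s)" and C="q * (B1 + B2)"])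
    fix s assume s: "s \<in> ?S"
    show "((\<lambda>s. x s - y s) has_vector_derivative Q (x s) (x s) - Q (y s) (y s)) (at s)"
      by (rule has_vector_derivative_diff[OF x[OF s] y[OF s]])
    have "Q (x s) (x s) - Q (y s) (y s) = Q (x s) (x s - y s) + Q (x s - y s) (y s)"
      by (simp add: bilinear_rsub[OF bil] bilinear_lsub[OF bil])
    also have "norm \<dots> \<le> q * norm (x s) * norm (x s - y s) + q * norm (x s - y s) * norm (y s)"
      by (rule order_trans[OF norm_triangle_ineq add_mono[OF q(2) q(2)]])
    also have "\<dots> = q * (norm (x s) + norm (y s)) * norm (x s - y s)" by (simp add: algebra_simps)
    also have "\<dots> \<le> q * (B1 + B2) * norm (x s - y s)"
      using q B[OF s] by (intro mult_right_mono mult_left_mono add_mono) auto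
    finally show "norm (Q (x s) (x s) - Q (y s) (y s)) \<le> q * (B1 + B2) * norm (x s - y s)" .
  qed (use assms(4) in simp)
  then show ?thesis by simp
qed

section \<open>Symmetric matrices relative to a metric\<close>

abbreviation form :: "real^'n^'n \<Rightarrow> real^'n \<Rightarrow> real^'n \<Rightarrow> real" where
  "form A x y \<equiv> x \<bullet> (A *v y)"

lemma form_commute: "sym_pos_def A \<Longrightarrow> form A x y = form A y x"
  unfolding sym_pos_def_def by (metis dot_lmul_matrix inner_commute transpose_matrix_vector)

lemma form_pos: "sym_pos_def A \<Longrightarrow> v \<noteq> 0 \<Longrightarrow> 0 < form A v v"
  unfolding sym_pos_def_def by blast

lemma form_nonneg: "sym_pos_def A \<Longrightarrow> 0 \<le> form A v v"
  using form_pos[of A v] by (cases "v = 0") auto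

lemma bilinear_form: "bilinear (form A)"
  unfolding bilinear_def
  by (auto intro!: linearI simp: inner_add_left inner_add_right matrix_vector_right_distrib
      matrix_vector_mult_scaleR)

lemmas form_simps = bilinear_ladd[OF bilinear_form] bilinear_radd[OF bilinear_form]
  bilinear_lmul[OF bilinear_form] bilinear_rmul[OF bilinear_form]
  bilinear_lneg[OF bilinear_form] bilinear_rneg[OF bilinear_form]
  bilinear_lsub[OF bilinear_form] bilinear_rsub[OF bilinear_form]
  bilinear_lzero[OF bilinear_form] bilinear_rzero[OF bilinear_form]

text \<open>A maximizer of the Rayleigh quotient on the unit sphere of the invariant subspace is an
  eigenvector. Stationarity is tested in the single direction
  \<open>\<mu> *\<^sub>R v - T v\<close>, which has to vanish.\<close>

lemma self_adjoint_eigenvector: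
  fixes A :: "real^'n^'n" and T :: "real^'n \<Rightarrow> real^'n"
  assumes A: "sym_pos_def A" and T: "linear T" and sa: "\<And>x y. form A (T x) y = form A x (T y)"
    and S: "subspace S" "\<And>x. x \<in> S \<Longrightarrow> T x \<in> S" and nz: "w0 \<in> S" "w0 \<noteq> 0"
  obtains v \<mu> where "v \<in> S" "v \<noteq> 0" "T v = \<mu> *\<^sub>R v"
proof -
  define K where "K = S \<inter> sphere 0 1"
  have K0: "v \<noteq> 0" if "v \<in> K" for v using that unfolding K_def by auto
  have compK: "compact K" unfolding K_def using closed_subspace[OF S(1)] by (simp add: closed_Int_compact)
  have "(1 / norm w0) *\<^sub>R w0 \<in> K" unfolding K_def using nz S(1) by (simp add: subspace_scale)
  then have neK: "K \<noteq> {}" by blast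
  have contK: "continuous_on K (\<lambda>v. form A (T v) v / form A v v)"
  proof -
    have "continuous_on K T" "continuous_on K ((*v) A)"
      using T matrix_vector_mul_linear[of A] by (auto intro: linear_continuous_on linear_linear[THEN iffD2])
    then show ?thesis using form_pos[OF A K0] by (intro continuous_intros) force+
  qed
  obtain v where v: "v \<in> K" "\<And>w. w \<in> K \<Longrightarrow> form A (T w) w / form A w w \<le> form A (T v) v / form A v v"
    using continuous_attains_sup[OF compK neK contK] by blast
  define \<mu> where "\<mu> = form A (T v) v / form A v v"
  have vv: "0 < form A v v" using form_pos[OF A K0[OF v(1)]] .
  have B: "form A (T w) w \<le> \<mu> * form A w w" if w: "w \<in> S" for w
  proof (cases "w = 0")
    case False
    define u where "u = (1 / norm w) *\<^sub>R w"
    have "u \<in> K" unfolding K_def u_def using w S(1) False by (simp add: subspace_scale)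
    from v(2)[OF this] have "form A (T u) u / form A u u \<le> \<mu>" unfolding \<mu>_def .
    then have "form A (T w) w / form A w w \<le> \<mu>"
      unfolding u_def linear_scale[OF T] using False by (simp add: form_simps)
    then show ?thesis using form_pos[OF A False] by (simp add: field_simps)
  qed (simp add: linear_0[OF T])
  define w where "w = \<mu> *\<^sub>R v - T v"
  have vS: "v \<in> S" using v(1) unfolding K_def by simp
  then have wS: "w \<in> S" unfolding w_def using S by (simp add: subspace_diff subspace_scale)
  have Tv: "form A (T v) v = \<mu> * form A v v" unfolding \<mu>_def using vv by simp
  text \<open>The form \<open>\<mu> \<langle>x, x\<rangle> - \<langle>T x, x\<rangle>\<close> is nonnegative on \<open>S\<close> and vanishes at \<open>v\<close>, hence to second order.\<close>
  have q: "0 \<le> 2 * s * form A w w + s\<^sup>2 * (\<mu> * form A w w - form A (T w) w)" for s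
  proof -
    have "v + s *\<^sub>R w \<in> S" using vS wS S(1) by (simp add: subspace_add subspace_scale)
    from B[OF this] have "0 \<le> \<mu> * form A (v + s *\<^sub>R w) (v + s *\<^sub>R w) - form A (T (v + s *\<^sub>R w)) (v + s *\<^sub>R w)" by simp
    moreover have "form A (v + s *\<^sub>R w) (v + s *\<^sub>R w)
        = form A v v + s * (form A v w + form A w v) + s\<^sup>2 * form A w w"
      by (simp add: form_simps algebra_simps power2_eq_square)
    moreover have "form A (T (v + s *\<^sub>R w)) (v + s *\<^sub>R w)
        = form A (T v) v + s * (form A (T v) w + form A (T w) v) + s\<^sup>2 * form A (T w) w"
      by (simp add: linear_add[OF T] linear_scale[OF T] form_simps algebra_simps power2_eq_square)
    moreover have "form A w v = form A v w" by (rule form_commute[OF A])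
    moreover have "form A (T w) v = form A (T v) w" unfolding sa[of w v] by (rule form_commute[OF A])
    moreover have "form A (\<mu> *\<^sub>R v - T v) w = \<mu> * form A v w - form A (T v) w" by (simp add: form_simps)
    then have "form A (T v) w = \<mu> * form A v w - form A w w" unfolding w_def[symmetric] by simp
    moreover have "\<lbrakk>0 \<le> \<mu> * p - q; p = a + s * (b + b') + s\<^sup>2 * d; q = e + s * (f + f') + s\<^sup>2 * h;
        b' = b; f' = f; f = \<mu> * b - d; e = \<mu> * a\<rbrakk> \<Longrightarrow> 0 \<le> 2 * s * d + s\<^sup>2 * (\<mu> * d - h)"
      for p q a b b' d e f f' h by (simp add: algebra_simps)
    ultimately show ?thesis using Tv by blast
  qed
  have "form A w w = 0"
  proof (rule ccontr)
    assume "form A w w \<noteq> 0"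
    then have ww: "0 < form A w w" using form_nonneg[OF A, of w] by simp
    define c where "c = \<mu> * form A w w - form A (T w) w"
    have c: "0 \<le> c" unfolding c_def using B[OF wS] by simp
    \<comment> \<open>For a small negative \<open>s\<close> the linear term wins over the quadratic
      one. The summand 1 in the denominator covers \<open>c = 0\<close>.\<close>
    define s where "s = - form A w w / (c + 1)"
    have "2 * s * form A w w + s\<^sup>2 * c = - ((form A w w)\<^sup>2 * (c + 2) / (c + 1)\<^sup>2)"
      unfolding s_def using c by (simp add: divide_simps power2_eq_square) (simp add: algebra_simps)
    also have "\<dots> < 0" using ww c by simp
    finally show False using q[of s] unfolding c_def by simp
  qed
  then have "w = 0" using form_pos[OF A, of w] by auto
  then have "T v = \<mu> *\<^sub>R v" unfolding w_def by simp
  then show ?thesis using that vS K0[OF v(1)] by blast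
qed

lemma form_orthogonal_exists:
  fixes A :: "real^3^3"
  obtains w where "w \<noteq> 0" "form A w u = 0" "form A w v = 0"
proof -
  have "card {A *v u, A *v v} \<le> 2" by (simp add: card_insert_if)
  then have "dim {A *v u, A *v v} < DIM(real^3)"
    using dim_le_card'[of "{A *v u, A *v v}"] by simp
  then obtain w where "w \<noteq> 0" "\<And>y. y \<in> span {A *v u, A *v v} \<Longrightarrow> orthogonal w y"
    using orthogonal_to_subspace_exists by blast
  then show ?thesis using that[of w] unfolding orthogonal_def by (simp add: span_base)
qed

lemma self_adjoint_eigenbasis:
  fixes A :: "real^3^3" and T :: "real^3 \<Rightarrow> real^3"
  assumes A: "sym_pos_def A" and T: "linear T" and sa: "\<And>x y. form A (T x) y = form A x (T y)"
  obtains v1 v2 v3 \<mu>1 \<mu>2 \<mu>3 where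
    "form A v1 v1 = 1" "form A v2 v2 = 1" "form A v3 v3 = 1"
    "form A v1 v2 = 0" "form A v1 v3 = 0" "form A v2 v3 = 0"
    "T v1 = \<mu>1 *\<^sub>R v1" "T v2 = \<mu>2 *\<^sub>R v2" "T v3 = \<mu>3 *\<^sub>R v3"
proof -
  note comm = form_commute[OF A]
  define nrm where "nrm v = (1 / sqrt (form A v v)) *\<^sub>R v" for v
  have nrm: "form A (nrm v) (nrm v) = 1" if "v \<noteq> 0" for v
    using form_pos[OF A that] unfolding nrm_def by (simp add: form_simps)
  have nrmT: "T (nrm v) = \<mu> *\<^sub>R nrm v" if "T v = \<mu> *\<^sub>R v" for v \<mu>
    using that unfolding nrm_def by (simp add: linear_scale[OF T])
  have nrm0: "form A (nrm v) w = 0" "form A w (nrm v) = 0" if "form A v w = 0" for v w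
    using that comm[of v w] unfolding nrm_def by (auto simp: form_simps)
  obtain u1 \<mu>1 where u1: "u1 \<noteq> 0" "T u1 = \<mu>1 *\<^sub>R u1"
    using self_adjoint_eigenvector[OF A T sa subspace_UNIV _ _ , of "axis 1 1"] by auto
  define S2 where "S2 = {v. form A v u1 = 0}"
  have S2: "subspace S2" unfolding S2_def subspace_def by (auto simp: form_simps)
  obtain w where w: "w \<noteq> 0" "form A w u1 = 0" using form_orthogonal_exists by blast
  obtain u2 \<mu>2 where u2: "u2 \<in> S2" "u2 \<noteq> 0" "T u2 = \<mu>2 *\<^sub>R u2"
    using self_adjoint_eigenvector[OF A T sa S2, of w] w u1(2) unfolding S2_def by (auto simp: sa form_simps)
  define S3 where "S3 = {v. form A v u1 = 0 \<and> form A v u2 = 0}"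
  have S3: "subspace S3" unfolding S3_def subspace_def by (auto simp: form_simps)
  obtain w' where w': "w' \<noteq> 0" "form A w' u1 = 0" "form A w' u2 = 0" using form_orthogonal_exists by blast
  obtain u3 \<mu>3 where u3: "u3 \<in> S3" "u3 \<noteq> 0" "T u3 = \<mu>3 *\<^sub>R u3"
    using self_adjoint_eigenvector[OF A T sa S3, of w'] w' u1(2) u2(3) unfolding S3_def by (auto simp: sa form_simps)
  have o: "form A u1 u2 = 0" "form A u1 u3 = 0" "form A u2 u3 = 0"
    using u2(1) u3(1) comm unfolding S2_def S3_def by auto
  show ?thesis
    by (rule that[of "nrm u1" "nrm u2" "nrm u3" \<mu>1 \<mu>2 \<mu>3])
      (use u1 u2 u3 o nrm0(1)[OF nrm0(2)] in \<open>auto simp: nrm nrmT intro: nrm0\<close>)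
qed

lemma form_orthonormal_expansion:
  fixes A :: "real^3^3"
  assumes A: "sym_pos_def A"
    and n: "form A v1 v1 = 1" "form A v2 v2 = 1" "form A v3 v3 = 1"
    and o: "form A v1 v2 = 0" "form A v1 v3 = 0" "form A v2 v3 = 0"
  shows "x = form A v1 x *\<^sub>R v1 + form A v2 x *\<^sub>R v2 + form A v3 x *\<^sub>R v3"
    and "independent {v1, v2, v3}" and "distinct [v1, v2, v3]" and "span {v1, v2, v3} = UNIV"
proof -
  note o' = o o[unfolded form_commute[OF A, of v1] form_commute[OF A, of v2 v3]]
  have d: "distinct [v1, v2, v3]" using n o by auto
  have comb: "a = 0 \<and> b = 0 \<and> c = 0" if z: "a *\<^sub>R v1 + b *\<^sub>R v2 + c *\<^sub>R v3 = 0" for a b c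
    using arg_cong[OF z, of "form A v1"] arg_cong[OF z, of "form A v2"] arg_cong[OF z, of "form A v3"] n o'
    by (simp add: form_simps)
  have ind: "independent {v1, v2, v3}"
  proof (rule independent_if_scalars_zero)
    fix f x assume f: "(\<Sum>x\<in>{v1, v2, v3}. f x *\<^sub>R x) = 0" and x: "x \<in> {v1, v2, v3}"
    have "f v1 *\<^sub>R v1 + f v2 *\<^sub>R v2 + f v3 *\<^sub>R v3 = 0" using f d by (simp add: add.assoc)
    from comb[OF this] show "f x = 0" using x by auto
  qed simp
  have "dim {v1, v2, v3} = 3" using dim_eq_card_independent[OF ind] d by simp
  then have sp: "span {v1, v2, v3} = UNIV" using dim_eq_full[of "{v1, v2, v3}"] by simp
  show "independent {v1, v2, v3}" "distinct [v1, v2, v3]" "span {v1, v2, v3} = UNIV" by fact+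
  have "x \<in> span {v1, v2, v3}" using sp by simp
  then obtain a b c where x: "x = a *\<^sub>R v1 + b *\<^sub>R v2 + c *\<^sub>R v3"
    by (auto simp: span_insert span_empty algebra_simps)
  show "x = form A v1 x *\<^sub>R v1 + form A v2 x *\<^sub>R v2 + form A v3 x *\<^sub>R v3"
    unfolding x using n o' by (simp add: form_simps)
qed

text \<open>In an orthonormal eigenbasis the eigenspace of \<open>x\<close> is spanned by the basis
  vectors with eigenvalue \<open>x\<close>, so its dimension counts occurrences in the list; a
  sorted list is determined by these counts.\<close>

lemma relative_eigenvalues_eq:
  fixes g k :: "real^3^3"
  assumes A: "sym_pos_def g"
    and n: "form g v1 v1 = 1" "form g v2 v2 = 1" "form g v3 v3 = 1"
    and o: "form g v1 v2 = 0" "form g v1 v3 = 0" "form g v2 v3 = 0"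
    and k: "k *v v1 = l1 *\<^sub>R (g *v v1)" "k *v v2 = l2 *\<^sub>R (g *v v2)" "k *v v3 = l3 *\<^sub>R (g *v v3)"
  shows "relative_eigenvalues g k = sort [l1, l2, l3]"
proof -
  note ex = form_orthonormal_expansion[OF A n o]
  note o' = o o[unfolded form_commute[OF A, of v1] form_commute[OF A, of v2 v3]]
  have eig: "k *v v = x *\<^sub>R (g *v v) \<longleftrightarrow>
    (form g v1 v = 0 \<or> l1 = x) \<and> (form g v2 v = 0 \<or> l2 = x) \<and> (form g v3 v = 0 \<or> l3 = x)" for v x
  proof -
    define a b c where "a = form g v1 v" and "b = form g v2 v" and "c = form g v3 v"
    have v: "v = a *\<^sub>R v1 + b *\<^sub>R v2 + c *\<^sub>R v3" unfolding a_def b_def c_def by (rule ex(1))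
    define w where "w = (a * (l1 - x)) *\<^sub>R v1 + (b * (l2 - x)) *\<^sub>R v2 + (c * (l3 - x)) *\<^sub>R v3"
    have 1: "k *v v - x *\<^sub>R (g *v v) = g *v w"
      unfolding v w_def by (simp add: matrix_vector_right_distrib matrix_vector_mult_scaleR k algebra_simps)
    have 2: "g *v w = 0 \<longleftrightarrow> w = 0" using form_pos[OF A, of w] by force
    have 3: "w = 0 \<longleftrightarrow> a * (l1 - x) = 0 \<and> b * (l2 - x) = 0 \<and> c * (l3 - x) = 0"
    proof
      assume "w = 0"
      then have "form g v1 w = 0" "form g v2 w = 0" "form g v3 w = 0" by simp_all
      then show "a * (l1 - x) = 0 \<and> b * (l2 - x) = 0 \<and> c * (l3 - x) = 0"
        unfolding w_def using n o' by (simp add: form_simps)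
    qed (auto simp: w_def)
    have "k *v v = x *\<^sub>R (g *v v) \<longleftrightarrow> g *v w = 0" unfolding 1[symmetric] by simp
    then show ?thesis unfolding 2 3 a_def b_def c_def mult_eq_0_iff right_minus_eq .
  qed
  have dim: "dim {v. k *v v = x *\<^sub>R (g *v v)} = count_list [l1, l2, l3] x" for x
  proof -
    define B where "B = (if l1 = x then {v1} else {}) \<union> (if l2 = x then {v2} else {}) \<union> (if l3 = x then {v3} else {})"
    have "{v. k *v v = x *\<^sub>R (g *v v)} = span B"
    proof
      show "{v. k *v v = x *\<^sub>R (g *v v)} \<subseteq> span B"
      proof
        fix v assume "v \<in> {v. k *v v = x *\<^sub>R (g *v v)}"
        then have e: "(form g v1 v = 0 \<or> l1 = x) \<and> (form g v2 v = 0 \<or> l2 = x) \<and> (form g v3 v = 0 \<or> l3 = x)"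
          using eig by simp
        have sc: "p *\<^sub>R u \<in> span B" if "p = 0 \<or> u \<in> B" for p u
          using that by (auto intro: span_scale span_base span_zero)
        have "form g v1 v *\<^sub>R v1 + form g v2 v *\<^sub>R v2 + form g v3 v *\<^sub>R v3 \<in> span B"
          by (intro span_add sc) (use e in \<open>auto simp: B_def\<close>)
        then show "v \<in> span B" using ex(1)[of v] by simp
      qed
      have "subspace {v. k *v v = x *\<^sub>R (g *v v)}"
        unfolding subspace_def by (auto simp: matrix_vector_right_distrib matrix_vector_mult_scaleR algebra_simps)
      then show "span B \<subseteq> {v. k *v v = x *\<^sub>R (g *v v)}"
        by (rule span_minimal[rotated]) (auto simp: B_def k split: if_splits)
    qed
    moreover have "independent B" by (rule independent_mono[OF ex(2)]) (auto simp: B_def)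
    moreover have "card B = count_list [l1, l2, l3] x" unfolding B_def using ex(3) by (auto simp: card_insert_if)
    ultimately show ?thesis by (simp add: dim_eq_card_independent)
  qed
  show ?thesis
    unfolding relative_eigenvalues_def dim
  proof (rule the_equality)
    show "sorted (sort [l1, l2, l3]) \<and> (\<forall>x. count_list (sort [l1, l2, l3]) x = count_list [l1, l2, l3] x)"
      by (simp only: count_mset[symmetric] mset_sort sorted_sort) simp
    fix xs assume xs: "sorted xs \<and> (\<forall>x. count_list xs x = count_list [l1, l2, l3] x)"
    then have "mset xs = mset [l1, l2, l3]" by (intro multiset_eqI) (simp only: count_mset)
    then show "xs = sort [l1, l2, l3]" using xs by (metis properties_for_sort)
  qed
qed

text \<open>Written with \<open>min\<close>, \<open>max\<close> and the sum, the order statistics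
  are visibly continuous, also where eigenvalues cross.\<close>

lemma sort3_nth:
  fixes a b c :: real
  shows "sort [a, b, c] ! 0 = min a (min b c)"
    and "sort [a, b, c] ! 1 = a + b + c - min a (min b c) - max a (max b c)"
    and "sort [a, b, c] ! 2 = max a (max b c)"
  by (auto simp: min_def max_def)

lemma tendsto_sort3:
  fixes a b c d :: "real \<Rightarrow> real"
  assumes "((\<lambda>t. a t / d t) \<longlongrightarrow> la) F" "((\<lambda>t. b t / d t) \<longlongrightarrow> lb) F" "((\<lambda>t. c t / d t) \<longlongrightarrow> lc) F"
    and d: "\<forall>\<^sub>F t in F. d t > 0" and i: "i < 3"
  shows "\<exists>l. ((\<lambda>t. sort [a t, b t, c t] ! i / d t) \<longlongrightarrow> l) F"
proof -
  let ?s = "\<lambda>t. sort [a t / d t, b t / d t, c t / d t]"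
  have "\<exists>l. ((\<lambda>t. ?s t ! j) \<longlongrightarrow> l) F" if "j \<in> {0, 1, 2}" for j
  proof -
    have "((\<lambda>t. ?s t ! 0) \<longlongrightarrow> min la (min lb lc)) F"
      unfolding sort3_nth by (intro tendsto_intros assms)
    moreover have "((\<lambda>t. ?s t ! 2) \<longlongrightarrow> max la (max lb lc)) F"
      unfolding sort3_nth by (intro tendsto_intros assms)
    moreover have "((\<lambda>t. ?s t ! 1) \<longlongrightarrow> la + lb + lc - min la (min lb lc) - max la (max lb lc)) F"
      unfolding sort3_nth by (intro tendsto_intros assms)
    ultimately show ?thesis using that by auto
  qed
  moreover have "i \<in> {0, 1, 2}" using i by auto
  ultimately obtain l where l: "((\<lambda>t. ?s t ! i) \<longlongrightarrow> l) F" by blast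
  have "\<forall>\<^sub>F t in F. ?s t ! i = sort [a t, b t, c t] ! i / d t"
    using d
  proof eventually_elim
    case (elim t)
    have min: "min (p / d t) (q / d t) = min p q / d t" and max: "max (p / d t) (q / d t) = max p q / d t" for p q
      using elim by (auto simp: min_def max_def divide_le_cancel)
    show ?case using \<open>i \<in> {0, 1, 2}\<close>
      unfolding insert_iff empty_iff
      by (elim disjE) (simp_all only: sort3_nth min max, simp_all add: add_divide_distrib diff_divide_distrib)
  qed
  from Lim_transform_eventually[OF l this] show ?thesis by blast
qed

section \<open>The field equations in terms of left-invariant fields\<close>

lemma sum_UNIV_option: "(\<Sum>\<mu>\<in>(UNIV :: 'a::finite option set). f \<mu>) = f None + (\<Sum>a\<in>UNIV. f (Some a))"
  unfolding UNIV_option_conv by (subst sum.insert) (auto simp: sum.reindex)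

lemma matrix_inv_eqI:
  fixes A B :: "'a::semiring_1^'n^'n"
  assumes "A ** B = mat 1" "B ** A = mat 1"
  shows "matrix_inv A = B"
proof -
  have "A ** matrix_inv A = mat 1 \<and> matrix_inv A ** A = mat 1"
    unfolding matrix_inv_def by (rule someI_ex) (use assms in blast)
  then have "matrix_inv A = (matrix_inv A ** A) ** B"
    unfolding matrix_mul_assoc[symmetric] using assms by simp
  then show ?thesis using \<open>A ** matrix_inv A = mat 1 \<and> matrix_inv A ** A = mat 1\<close> by simp
qed

lemma sym_pos_def_inverse:
  fixes A :: "real^'n^'n"
  assumes "sym_pos_def A"
  shows "A ** matrix_inv A = mat 1" "matrix_inv A ** A = mat 1"
proof -
  have "x = 0" if "A *v x = 0" for x
    using form_pos[OF assms, of x] that by force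
  then obtain B where "B ** A = mat 1" using matrix_left_invertible_ker[of A] by blast
  then have "A ** B = mat 1 \<and> B ** A = mat 1" using matrix_left_right_inverse by blast
  then have "A ** matrix_inv A = mat 1 \<and> matrix_inv A ** A = mat 1"
    unfolding matrix_inv_def by (rule someI)
  then show "A ** matrix_inv A = mat 1" "matrix_inv A ** A = mat 1" by blast+
qed

lemma sym_pos_def_det: "sym_pos_def A \<Longrightarrow> det A \<noteq> 0"
  using sym_pos_def_inverse[of A] by (metis det_I det_mul mult_zero_left zero_neq_one)

text \<open>This exhibits the entries of the inverse as quotients of polynomials in the entries of
  the metric; differentiability and analyticity of all curvature expressions rest on it.\<close>

lemma matrix_inv_cramer:
  fixes A :: "real^'n^'n"
  assumes "sym_pos_def A"
  shows "matrix_inv A $ i $ j = det (\<chi> p q. if q = i then axis j 1 $ p else A $ p $ q) / det A"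
proof -
  have "A *v (matrix_inv A *v axis j 1) = axis j 1"
    unfolding matrix_vector_mul_assoc sym_pos_def_inverse[OF assms] by simp
  then have "matrix_inv A *v axis j 1 = (\<chi> k. det (\<chi> p q. if q = k then axis j 1 $ p else A $ p $ q) / det A)"
    using cramer[OF sym_pos_def_det[OF assms]] by blast
  moreover have "matrix_inv A $ i $ j = (matrix_inv A *v axis j 1) $ i"
    by (simp add: matrix_vector_mult_basis column_def)
  ultimately show ?thesis by simp
qed

lemma matrix_mult_scaleR: "A ** (c *\<^sub>R B) = c *\<^sub>R (A ** B)" for A B :: "real^'n^'n"
  by (simp add: vec_eq_iff matrix_matrix_mult_def sum_distrib_left mult_ac)

lemma spacetime_metric_simps [simp]:
  "spacetime_metric g t $ None $ None = -1" "spacetime_metric g t $ None $ Some b = 0"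
  "spacetime_metric g t $ Some b $ None = 0" "spacetime_metric g t $ Some a $ Some b = g t $ a $ b"
  unfolding spacetime_metric_def by simp_all

lemma inverse_metric_blocks:
  assumes t: "sym_pos_def (g t)"
  shows "inverse_metric g t $ None $ None = -1" "inverse_metric g t $ None $ Some b = 0"
    "inverse_metric g t $ Some b $ None = 0" "inverse_metric g t $ Some a $ Some b = matrix_inv (g t) $ a $ b"
proof -
  define B :: "real^(3 option)^(3 option)" where "B = (\<chi> \<mu> \<nu>. case (\<mu>, \<nu>) of
    (None, None) \<Rightarrow> -1 | (Some a, Some b) \<Rightarrow> matrix_inv (g t) $ a $ b | _ \<Rightarrow> 0)"
  have [simp]: "B $ None $ None = -1" "B $ None $ Some b = 0" "B $ Some b $ None = 0"
    "B $ Some a $ Some b = matrix_inv (g t) $ a $ b" for a b unfolding B_def by simp_all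
  have "(\<Sum>c\<in>UNIV. g t $ a $ c * matrix_inv (g t) $ c $ b) = (if a = b then 1 else 0)"
    "(\<Sum>c\<in>UNIV. matrix_inv (g t) $ a $ c * g t $ c $ b) = (if a = b then 1 else 0)" for a b
    using sym_pos_def_inverse[OF t] unfolding matrix_matrix_mult_def mat_def vec_eq_iff by simp_all
  then have "spacetime_metric g t ** B = mat 1" "B ** spacetime_metric g t = mat 1"
    unfolding matrix_matrix_mult_def mat_def vec_eq_iff
    by (simp_all add: sum_UNIV_option split_option_all)
  then have "inverse_metric g t = B" unfolding inverse_metric_def by (rule matrix_inv_eqI)
  then show "inverse_metric g t $ None $ None = -1" "inverse_metric g t $ None $ Some b = 0"
    "inverse_metric g t $ Some b $ None = 0" "inverse_metric g t $ Some a $ Some b = matrix_inv (g t) $ a $ b"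
    by simp_all
qed

lemma frame_deriv_simps [simp]: "frame_deriv None f t = deriv f t" "frame_deriv (Some a) f t = 0"
  unfolding frame_deriv_def by simp_all

locale solution =
  fixes br :: "real^3 \<Rightarrow> real^3 \<Rightarrow> real^3" and I :: "real set" and g :: "real \<Rightarrow> real^3^3" and \<phi> :: "real \<Rightarrow> real"
  assumes lie: "lie_bracket br" and hom: "homogeneous_solution br I g \<phi>"
begin

lemma bil: "bilinear br" and br_self: "br x x = 0"
  and jacobi: "br x (br y z) + br y (br z x) + br z (br x y) = 0"
  using lie unfolding lie_bracket_def by blast+

lemma br_anti: "br y x = - br x y"
proof -
  have "br x y + br y x = br (x + y) (x + y)"
    unfolding bilinear_ladd[OF bil] unfolding bilinear_radd[OF bil] by (simp add: br_self)
  then have "br x y + br y x = 0" unfolding br_self .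
  then show ?thesis by (simp add: eq_neg_iff_add_eq_0 add.commute)
qed

lemma openI: "open I" and ivl: "is_interval I" and I_ne: "I \<noteq> {}"
  using hom unfolding homogeneous_solution_def by blast+

lemma spd: "t \<in> I \<Longrightarrow> sym_pos_def (g t)"
  using hom unfolding homogeneous_solution_def by blast

definition dg :: "real \<Rightarrow> real^3^3" where "dg t = (\<chi> a b. deriv (\<lambda>s. g s $ a $ b) t)"
definition \<kappa> :: "real \<Rightarrow> real^3^3" where "\<kappa> t = (1/2) *\<^sub>R (matrix_inv (g t) ** dg t)"
definition \<theta> :: "real \<Rightarrow> real" where "\<theta> t = (\<Sum>a\<in>UNIV. \<kappa> t $ a $ a)"
definition \<psi> :: "real \<Rightarrow> real" where "\<psi> = deriv \<phi>"

text \<open>The Levi-Civita connection of the spatial metric on left-invariant fields.\<close>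

definition \<Gamma> :: "real \<Rightarrow> real^3 \<Rightarrow> real^3 \<Rightarrow> real^3" where
  "\<Gamma> t X Y = (1/2) *\<^sub>R (matrix_inv (g t) *v
     (\<chi> c. form (g t) (br X Y) (axis c 1) - form (g t) (br X (axis c 1)) Y - form (g t) (br Y (axis c 1)) X))"

text \<open>The Ricci tensor of a slice. Components of left-invariant fields are constant in space,
  so the curvature is purely algebraic in \<open>\<Gamma>\<close> and \<open>br\<close>.\<close>

definition ric :: "real \<Rightarrow> real^3 \<Rightarrow> real^3 \<Rightarrow> real" where
  "ric t Y Z = (\<Sum>a\<in>UNIV. (\<Gamma> t (axis a 1) (\<Gamma> t Y Z) - \<Gamma> t Y (\<Gamma> t (axis a 1) Z) - \<Gamma> t (br (axis a 1) Y) Z) $ a)"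

lemma g_diff: "t \<in> I \<Longrightarrow> (\<lambda>s. g s $ a $ b) differentiable (at t)"
  and dg_diff: "t \<in> I \<Longrightarrow> (\<lambda>s. dg s $ a $ b) differentiable (at t)"
proof -
  assume t: "t \<in> I"
  have sm: "((deriv ^^ n) (\<lambda>s. g s $ a $ b)) differentiable (at t)" for n
    using hom t unfolding homogeneous_solution_def smooth_on_def by blast
  show "(\<lambda>s. g s $ a $ b) differentiable (at t)" using sm[of 0] by simp
  show "(\<lambda>s. dg s $ a $ b) differentiable (at t)" using sm[of 1] by (simp add: dg_def)
qed

lemma \<phi>_diff: "t \<in> I \<Longrightarrow> \<phi> differentiable (at t)" and \<psi>_diff: "t \<in> I \<Longrightarrow> \<psi> differentiable (at t)"
proof -
  assume t: "t \<in> I"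
  have sm: "((deriv ^^ n) \<phi>) differentiable (at t)" for n
    using hom t unfolding homogeneous_solution_def smooth_on_def by blast
  show "\<phi> differentiable (at t)" "\<psi> differentiable (at t)"
    using sm[of 0] sm[of 1] by (simp_all add: \<psi>_def)
qed

lemma g_deriv: "t \<in> I \<Longrightarrow> ((\<lambda>s. g s $ a $ b) has_real_derivative dg t $ a $ b) (at t)"
  using g_diff unfolding dg_def by (simp add: DERIV_deriv_iff_real_differentiable)

lemma \<phi>_deriv: "t \<in> I \<Longrightarrow> (\<phi> has_real_derivative \<psi> t) (at t)"
  using \<phi>_diff unfolding \<psi>_def by (simp add: DERIV_deriv_iff_real_differentiable)

lemma g_sym: "t \<in> I \<Longrightarrow> g t $ a $ b = g t $ b $ a"
  using spd[of t] unfolding sym_pos_def_def transpose_def by (metis (no_types, lifting) vec_lambda_beta)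

lemma ev_I: "t \<in> I \<Longrightarrow> (\<And>s. s \<in> I \<Longrightarrow> P s) \<Longrightarrow> \<forall>\<^sub>F s in nhds t. P s"
  using eventually_mono[OF eventually_nhds_in_open[OF openI]] by blast

lemma dg_sym: "t \<in> I \<Longrightarrow> dg t $ a $ b = dg t $ b $ a"
  unfolding dg_def by (simp, rule deriv_cong_ev) (auto intro: ev_I g_sym)

lemma g\<kappa>: "t \<in> I \<Longrightarrow> g t ** \<kappa> t = (1/2) *\<^sub>R dg t"
proof -
  assume t: "t \<in> I"
  have "g t ** \<kappa> t = (1/2) *\<^sub>R (g t ** (matrix_inv (g t) ** dg t))"
    unfolding \<kappa>_def by (rule matrix_mult_scaleR)
  then show ?thesis by (simp add: matrix_mul_assoc sym_pos_def_inverse[OF spd[OF t]])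
qed

lemma form_\<kappa>: "t \<in> I \<Longrightarrow> form (g t) X (\<kappa> t *v Y) = form ((1/2) *\<^sub>R dg t) X Y"
  by (simp add: matrix_vector_mul_assoc g\<kappa>)

lemma \<kappa>_self_adjoint: "t \<in> I \<Longrightarrow> form (g t) (\<kappa> t *v X) Y = form (g t) X (\<kappa> t *v Y)"
proof -
  assume t: "t \<in> I"
  have "transpose (dg t) = dg t" unfolding transpose_def using dg_sym[OF t] by (simp add: vec_eq_iff)
  then have "form (dg t) X Y = form (dg t) Y X"
    by (metis dot_lmul_matrix inner_commute transpose_matrix_vector)
  then show ?thesis
    unfolding form_commute[OF spd[OF t], of "\<kappa> t *v X"] form_\<kappa>[OF t] by (simp add: scaleR_matrix_vector_assoc[symmetric])
qed

lemma koszul_\<Gamma>: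
  assumes t: "t \<in> I"
  shows "2 * form (g t) (\<Gamma> t X Y) Z
    = form (g t) (br X Y) Z - form (g t) (br X Z) Y - form (g t) (br Y Z) X"
proof -
  let ?f = "\<lambda>Z. form (g t) (br X Y) Z - form (g t) (br X Z) Y - form (g t) (br Y Z) X"
  have lin: "linear ?f"
    by (rule linearI) (simp_all add: form_simps bilinear_radd[OF bil] bilinear_rmul[OF bil] algebra_simps)
  have "2 * form (g t) (\<Gamma> t X Y) Z = 2 * form (g t) Z (\<Gamma> t X Y)" by (simp add: form_commute[OF spd[OF t]])
  also have "\<dots> = Z \<bullet> (\<chi> c. ?f (axis c 1))"
    unfolding \<Gamma>_def by (simp add: matrix_vector_mult_scaleR matrix_vector_mul_assoc sym_pos_def_inverse[OF spd[OF t]])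
  also have "\<dots> = (\<Sum>c\<in>UNIV. Z $ c * ?f (axis c 1))" by (simp add: inner_vec_def)
  also have "\<dots> = (\<Sum>c\<in>UNIV. ?f (Z $ c *\<^sub>R axis c 1))" by (simp add: linear_scale[OF lin])
  also have "\<dots> = ?f (\<Sum>c\<in>UNIV. Z $ c *\<^sub>R axis c 1)" by (rule linear_sum[OF lin, symmetric])
  also have "(\<Sum>c\<in>UNIV. Z $ c *\<^sub>R axis c 1) = Z" using basis_expansion[of Z] by (simp add: scalar_mult_eq_scaleR)
  finally show ?thesis .
qed

lemma form_ext:
  assumes t: "t \<in> I" and eq: "\<And>Z. form (g t) x Z = form (g t) y Z"
  shows "x = y"
proof (rule ccontr)
  assume "x \<noteq> y"
  then have "0 < form (g t) (x - y) (x - y)" using form_pos[OF spd[OF t]] by simp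
  then show False using eq[of "x - y"] by (simp add: form_simps(7))
qed

lemma bilinear_\<Gamma>: assumes t: "t \<in> I" shows "bilinear (\<Gamma> t)"
proof -
  have half: "form (g t) (\<Gamma> t X Y) Z
      = (form (g t) (br X Y) Z - form (g t) (br X Z) Y - form (g t) (br Y Z) X) / 2" for X Y Z
    using koszul_\<Gamma>[OF t, of X Y Z] by simp
  show ?thesis
    unfolding bilinear_def
    by (intro conjI allI linearI; rule form_ext[OF t])
      (simp_all add: form_simps half bilinear_ladd[OF bil] bilinear_radd[OF bil] bilinear_lmul[OF bil]
        bilinear_rmul[OF bil] field_simps)
qed

lemma torsion_free: "t \<in> I \<Longrightarrow> \<Gamma> t X Y - \<Gamma> t Y X = br X Y"
proof -
  assume t: "t \<in> I"
  have "2 * form (g t) (\<Gamma> t X Y - \<Gamma> t Y X) Z = 2 * form (g t) (br X Y) Z" for Z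
    by (simp only: form_simps right_diff_distrib koszul_\<Gamma>[OF t] br_anti[of Y X])
  then show ?thesis by (intro form_ext[OF t]) simp
qed

lemma metric_compatible: "t \<in> I \<Longrightarrow> form (g t) (\<Gamma> t X Y) Z = - form (g t) (\<Gamma> t X Z) Y"
proof -
  assume t: "t \<in> I"
  have "2 * form (g t) (\<Gamma> t X Y) Z = - (2 * form (g t) (\<Gamma> t X Z) Y)"
    by (simp only: koszul_\<Gamma>[OF t] br_anti[of Y Z]) (simp add: form_simps)
  then show ?thesis by simp
qed

lemma structure_coeff_simps [simp]:
  "structure_coeff br (Some a) (Some b) (Some c) = br (axis a 1) (axis b 1) $ c"
  "structure_coeff br None \<nu> \<xi> = 0" "structure_coeff br \<mu> None \<xi> = 0" "structure_coeff br \<mu> \<nu> None = 0"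
  unfolding structure_coeff_def by (auto split: option.splits)

lemmas inverse_metric_simps = inverse_metric_blocks[where g=g and t=t for t, OF spd]

lemma koszul_simps:
  assumes t: "t \<in> I"
  shows "koszul br g None None \<xi> t = 0" "koszul br g None \<nu> None t = 0" "koszul br g \<mu> None None t = 0"
    "koszul br g None (Some b) (Some c) t = dg t $ b $ c" "koszul br g (Some b) None (Some c) t = dg t $ b $ c"
    "koszul br g (Some a) (Some b) None t = - dg t $ a $ b"
    "koszul br g (Some a) (Some b) (Some c) t = form (g t) (br (axis a 1) (axis b 1)) (axis c 1)
      - form (g t) (br (axis a 1) (axis c 1)) (axis b 1) - form (g t) (br (axis b 1) (axis c 1)) (axis a 1)"
proof -
  show "koszul br g None None \<xi> t = 0" by (cases \<xi>) (simp_all add: koszul_def Let_def)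
  show "koszul br g None \<nu> None t = 0" by (cases \<nu>) (simp_all add: koszul_def Let_def)
  show "koszul br g \<mu> None None t = 0" by (cases \<mu>) (simp_all add: koszul_def Let_def)
  show "koszul br g None (Some b) (Some c) t = dg t $ b $ c" "koszul br g (Some b) None (Some c) t = dg t $ b $ c"
    "koszul br g (Some a) (Some b) None t = - dg t $ a $ b"
    by (simp_all add: koszul_def Let_def sum_UNIV_option dg_def)
  have "form (g t) x (axis c 1) = (\<Sum>\<sigma>\<in>UNIV. x $ \<sigma> * g t $ \<sigma> $ c)" for x c
    by (simp add: inner_vec_def matrix_vector_mult_basis column_def)
  then show "koszul br g (Some a) (Some b) (Some c) t = form (g t) (br (axis a 1) (axis b 1)) (axis c 1)
      - form (g t) (br (axis a 1) (axis c 1)) (axis b 1) - form (g t) (br (axis b 1) (axis c 1)) (axis a 1)"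
    by (simp add: koszul_def Let_def sum_UNIV_option)
qed

lemma connection_simps:
  assumes t: "t \<in> I"
  shows "connection br g None None \<kappa>' t = 0" "connection br g None \<nu> None t = 0" "connection br g \<mu> None None t = 0"
    "connection br g (Some a) (Some b) None t = dg t $ a $ b / 2"
    "connection br g None (Some b) (Some c) t = \<kappa> t $ c $ b"
    "connection br g (Some b) None (Some c) t = \<kappa> t $ c $ b"
    "connection br g (Some a) (Some b) (Some c) t = \<Gamma> t (axis a 1) (axis b 1) $ c"
proof -
  note simps = connection_def koszul_simps[OF t] inverse_metric_simps[OF t] sum_UNIV_option
  show "connection br g None None \<kappa>' t = 0" by (simp add: simps)
  show "connection br g None \<nu> None t = 0" by (cases \<nu>) (simp_all add: simps)
  show "connection br g \<mu> None None t = 0" by (cases \<mu>) (simp_all add: simps)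
  show "connection br g (Some a) (Some b) None t = dg t $ a $ b / 2" by (simp add: simps)
  show "connection br g None (Some b) (Some c) t = \<kappa> t $ c $ b" "connection br g (Some b) None (Some c) t = \<kappa> t $ c $ b"
    using dg_sym[OF t, of b] by (simp_all add: simps \<kappa>_def matrix_matrix_mult_def sum_divide_distrib)
  show "connection br g (Some a) (Some b) (Some c) t = \<Gamma> t (axis a 1) (axis b 1) $ c"
    by (simp add: simps \<Gamma>_def matrix_vector_mult_def sum_divide_distrib)
qed

end

definition trace_map :: "(real^3 \<Rightarrow> real^3) \<Rightarrow> real" where
  "trace_map T = (\<Sum>a\<in>UNIV. T (axis a 1) $ a)"

lemma trace_map_orthonormal:
  assumes A: "sym_pos_def A" and T: "linear T"
    and n: "form A v1 v1 = 1" "form A v2 v2 = 1" "form A v3 v3 = 1"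
    and o: "form A v1 v2 = 0" "form A v1 v3 = 0" "form A v2 v3 = 0"
  shows "trace_map T = form A v1 (T v1) + form A v2 (T v2) + form A v3 (T v3)"
proof -
  have ex: "x = form A v1 x *\<^sub>R v1 + form A v2 x *\<^sub>R v2 + form A v3 x *\<^sub>R v3" for x
    by (rule form_orthonormal_expansion(1)[OF A n o])
  have lin: "form A u (T v) = (\<Sum>a\<in>UNIV. v $ a * form A u (T (axis a 1)))" for u v
  proof -
    have lu: "linear (form A u)" using bilinear_form unfolding bilinear_def by blast
    have "T v = T (\<Sum>a\<in>UNIV. v $ a *\<^sub>R axis a 1)" using basis_expansion[of v] by (simp add: scalar_mult_eq_scaleR)
    also have "\<dots> = (\<Sum>a\<in>UNIV. v $ a *\<^sub>R T (axis a 1))" by (simp add: linear_sum[OF T] linear_scale[OF T])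
    finally have "form A u (T v) = form A u (\<Sum>a\<in>UNIV. v $ a *\<^sub>R T (axis a 1))" by simp
    also have "\<dots> = (\<Sum>a\<in>UNIV. v $ a * form A u (T (axis a 1)))"
      unfolding linear_sum[OF lu] linear_scale[OF lu] by simp
    finally show ?thesis .
  qed
  have "T (axis a 1) $ a = v1 $ a * form A v1 (T (axis a 1)) + v2 $ a * form A v2 (T (axis a 1))
      + v3 $ a * form A v3 (T (axis a 1))" for a
    by (subst ex[of "T (axis a 1)"]) (simp add: mult.commute)
  then show ?thesis unfolding trace_map_def lin[of v1 v1] lin[of v2 v2] lin[of v3 v3] by (simp add: sum.distrib)
qed

lemma differentiable_cong_ev:
  fixes f g :: "real \<Rightarrow> real"
  assumes "g differentiable (at t)" "\<forall>\<^sub>F s in nhds t. f s = g s"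
  shows "f differentiable (at t)"
  using assms DERIV_cong_ev[OF refl assms(2) refl] unfolding real_differentiable_def by blast

lemma det3_differentiable:
  fixes A :: "real \<Rightarrow> real^3^3"
  assumes "\<And>p q. (\<lambda>s. A s $ p $ q) differentiable (at t)"
  shows "(\<lambda>s. det (A s)) differentiable (at t)"
  unfolding det_3 by (intro differentiable_add differentiable_diff differentiable_mult assms)

section \<open>Splitting of the spacetime Ricci tensor into slice and normal parts\<close>

context solution begin

lemma ric_eq_trace: "ric t Y Z = trace_map (\<lambda>X. \<Gamma> t X (\<Gamma> t Y Z) - \<Gamma> t Y (\<Gamma> t X Z) - \<Gamma> t (br X Y) Z)"
  unfolding ric_def trace_map_def ..

lemma \<theta>_eq_trace: "\<theta> t = trace_map ((*v) (\<kappa> t))"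
  unfolding \<theta>_def trace_map_def by (simp add: matrix_vector_mult_basis column_def)

lemma \<Gamma>_expand: "t \<in> I \<Longrightarrow> \<Gamma> t X Y = (\<Sum>b\<in>UNIV. Y $ b *\<^sub>R \<Gamma> t X (axis b 1))"
  and \<Gamma>_expand_left: "t \<in> I \<Longrightarrow> \<Gamma> t Y X = (\<Sum>b\<in>UNIV. Y $ b *\<^sub>R \<Gamma> t (axis b 1) X)"
proof -
  assume t: "t \<in> I"
  have Y: "Y = (\<Sum>b\<in>UNIV. Y $ b *\<^sub>R axis b 1)" using basis_expansion[of Y] by (simp add: scalar_mult_eq_scaleR)
  have l: "linear (\<Gamma> t X)" "linear (\<lambda>Y. \<Gamma> t Y X)" using bilinear_\<Gamma>[OF t] unfolding bilinear_def by auto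
  show "\<Gamma> t X Y = (\<Sum>b\<in>UNIV. Y $ b *\<^sub>R \<Gamma> t X (axis b 1))"
    by (subst Y) (simp add: linear_sum[OF l(1)] linear_scale[OF l(1)])
  show "\<Gamma> t Y X = (\<Sum>b\<in>UNIV. Y $ b *\<^sub>R \<Gamma> t (axis b 1) X)"
    by (subst Y) (simp add: linear_sum[OF l(2)] linear_scale[OF l(2)])
qed

lemma connection_deriv:
  assumes t: "t \<in> I"
  shows "deriv (connection br g (Some a) None (Some a')) t = deriv (\<lambda>s. \<kappa> s $ a' $ a) t"
    and "deriv (connection br g (Some a) (Some b) None) t = deriv (\<lambda>s. dg s $ a $ b / 2) t"
    and "deriv (connection br g None None \<nu>) t = 0"
    and "deriv (connection br g None \<nu> None) t = 0"
    and "deriv (connection br g \<nu> None None) t = 0"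
proof -
  show "deriv (connection br g (Some a) None (Some a')) t = deriv (\<lambda>s. \<kappa> s $ a' $ a) t"
    "deriv (connection br g (Some a) (Some b) None) t = deriv (\<lambda>s. dg s $ a $ b / 2) t"
    by (auto intro!: deriv_cong_ev ev_I[OF t] simp: connection_simps)
  have "deriv (connection br g None None \<nu>) t = deriv (\<lambda>_. 0) t"
    by (rule deriv_cong_ev, rule ev_I[OF t], simp_all add: connection_simps)
  moreover have "deriv (connection br g None \<nu> None) t = deriv (\<lambda>_. 0) t"
    by (rule deriv_cong_ev, rule ev_I[OF t], simp_all add: connection_simps)
  moreover have "deriv (connection br g \<nu> None None) t = deriv (\<lambda>_. 0) t"
    by (rule deriv_cong_ev, rule ev_I[OF t], simp_all add: connection_simps)
  ultimately show "deriv (connection br g None None \<nu>) t = 0" "deriv (connection br g None \<nu> None) t = 0"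
    "deriv (connection br g \<nu> None None) t = 0" by simp_all
qed

lemma \<kappa>_diff: assumes t: "t \<in> I" shows "(\<lambda>s. \<kappa> s $ a $ b) differentiable (at t)"
proof (rule differentiable_cong_ev)
  let ?A = "\<lambda>c s. \<chi> p q. if q = a then axis c 1 $ p else g s $ p $ q"
  let ?f = "\<lambda>s. (1/2) * (\<Sum>c\<in>UNIV. det (?A c s) / det (g s) * dg s $ c $ b)"
  show "\<forall>\<^sub>F s in nhds t. \<kappa> s $ a $ b = ?f s"
    by (rule ev_I[OF t]) (simp add: \<kappa>_def matrix_matrix_mult_def matrix_inv_cramer[OF spd])
  have "(\<lambda>s. ?A c s $ p $ q) differentiable (at t)" for c p q
    by (cases "q = a") (auto intro: g_diff[OF t])
  then have A: "(\<lambda>s. det (?A c s)) differentiable (at t)" for c by (rule det3_differentiable)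
  show "?f differentiable (at t)"
    unfolding sum_3
    by (intro differentiable_mult differentiable_add differentiable_divide differentiable_const A
        det3_differentiable g_diff[OF t] dg_diff[OF t] sym_pos_def_det[OF spd[OF t]])
qed

lemma ricci_00: assumes t: "t \<in> I"
  shows "ricci br g None None t = - (\<Sum>a\<in>UNIV. deriv (\<lambda>s. \<kappa> s $ a $ a) t) - trace_map (\<lambda>X. \<kappa> t *v (\<kappa> t *v X))"
proof -
  have "trace_map (\<lambda>X. \<kappa> t *v (\<kappa> t *v X)) = (\<Sum>a\<in>UNIV. \<Sum>c\<in>UNIV. \<kappa> t $ a $ c * \<kappa> t $ c $ a)"
    unfolding trace_map_def by (simp add: matrix_vector_mult_basis column_def) (simp add: matrix_vector_mult_def)
  then show ?thesis
    by (simp add: ricci_def sum_UNIV_option riemann_def Let_def connection_simps[OF t] connection_deriv[OF t]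
        sum_negf sum_subtractf mult.commute)
qed

lemma ricci_0b: assumes t: "t \<in> I"
  shows "ricci br g (Some b) None t = trace_map (\<lambda>X. \<Gamma> t X (\<kappa> t *v axis b 1))
    - trace_map (\<lambda>X. \<Gamma> t (axis b 1) (\<kappa> t *v X)) - trace_map (\<lambda>X. \<kappa> t *v br X (axis b 1))"
proof -
  have 1: "\<Gamma> t X (\<kappa> t *v axis b 1) $ a = (\<Sum>d\<in>UNIV. \<kappa> t $ d $ b * \<Gamma> t X (axis d 1) $ a)" for X b a
    by (subst \<Gamma>_expand[OF t]) (simp add: matrix_vector_mult_basis column_def)
  have 2: "(\<kappa> t *v X) $ a = (\<Sum>d\<in>UNIV. \<kappa> t $ a $ d * X $ d)" for X a
    by (simp add: matrix_vector_mult_def)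
  show ?thesis
    unfolding trace_map_def 1 2
    by (simp add: ricci_def sum_UNIV_option riemann_def Let_def connection_simps[OF t] connection_deriv[OF t]
        sum_negf sum_subtractf sum.distrib mult.commute)
qed

lemma ricci_bc: assumes t: "t \<in> I"
  shows "ricci br g (Some b) (Some c) t = ric t (axis b 1) (axis c 1)
    + deriv (\<lambda>s. dg s $ b $ c / 2) t - (\<Sum>d\<in>UNIV. \<kappa> t $ d $ c * dg t $ b $ d / 2)
    + \<theta> t * dg t $ b $ c / 2 - (\<Sum>a\<in>UNIV. dg t $ a $ c / 2 * \<kappa> t $ a $ b)"
proof -
  have 1: "\<Gamma> t X Y $ a = (\<Sum>d\<in>UNIV. Y $ d * \<Gamma> t X (axis d 1) $ a)" for X Y a
    by (subst \<Gamma>_expand[OF t]) simp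
  have 2: "\<Gamma> t Y X $ a = (\<Sum>d\<in>UNIV. Y $ d * \<Gamma> t (axis d 1) X $ a)" for X Y a
    by (subst \<Gamma>_expand_left[OF t]) simp
  have "ric t (axis b 1) (axis c 1) = (\<Sum>a\<in>UNIV.
      (\<Sum>d\<in>UNIV. \<Gamma> t (axis b 1) (axis c 1) $ d * \<Gamma> t (axis a 1) (axis d 1) $ a)
      - (\<Sum>d\<in>UNIV. \<Gamma> t (axis a 1) (axis c 1) $ d * \<Gamma> t (axis b 1) (axis d 1) $ a)
      - (\<Sum>d\<in>UNIV. br (axis a 1) (axis b 1) $ d * \<Gamma> t (axis d 1) (axis c 1) $ a))"
    unfolding ric_def vector_minus_component by (intro sum.cong refl arg_cong2[where f="(-)"] 1 2)
  moreover have "riemann br g None (Some b) (Some c) None t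
      = deriv (\<lambda>s. dg s $ b $ c / 2) t - (\<Sum>d\<in>UNIV. \<kappa> t $ d $ c * (dg t $ b $ d / 2))"
    by (simp add: sum_UNIV_option riemann_def Let_def connection_simps[OF t] connection_deriv[OF t] sum_negf)
  moreover have "riemann br g (Some a) (Some b) (Some c) (Some a) t
      = (dg t $ b $ c / 2 * \<kappa> t $ a $ a - dg t $ a $ c / 2 * \<kappa> t $ a $ b)
      + ((\<Sum>d\<in>UNIV. \<Gamma> t (axis b 1) (axis c 1) $ d * \<Gamma> t (axis a 1) (axis d 1) $ a)
      - (\<Sum>d\<in>UNIV. \<Gamma> t (axis a 1) (axis c 1) $ d * \<Gamma> t (axis b 1) (axis d 1) $ a)
      - (\<Sum>d\<in>UNIV. br (axis a 1) (axis b 1) $ d * \<Gamma> t (axis d 1) (axis c 1) $ a))" for a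
    by (simp add: sum_UNIV_option riemann_def Let_def connection_simps[OF t] sum_subtractf)
  moreover have "(\<Sum>a\<in>UNIV. dg t $ b $ c / 2 * \<kappa> t $ a $ a) = \<theta> t * dg t $ b $ c / 2"
    unfolding \<theta>_def by (simp add: sum_distrib_left sum_distrib_right sum_divide_distrib mult_ac)
  ultimately show ?thesis
    unfolding ricci_def sum_UNIV_option by (simp only: sum.distrib sum_subtractf) simp
qed

text \<open>Taking the trace of the Einstein equations identifies the scalar curvature; what remains
  is \<open>Ric = d\<phi> \<otimes> d\<phi>\<close>, which has only a time-time component because
  \<open>\<phi>\<close> depends on time alone.\<close>

lemma ricci_flat_up_to_scalar:
  assumes t: "t \<in> I"
  shows "ricci br g None None t = (\<psi> t)\<^sup>2" "ricci br g (Some b) None t = 0" "ricci br g (Some b) (Some c) t = 0"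
proof -
  have E: "ricci br g \<mu> \<nu> t - 1/2 * scalar_curvature br g t * spacetime_metric g t $ \<mu> $ \<nu> = stress_energy g \<phi> \<mu> \<nu> t" for \<mu> \<nu>
    using hom t unfolding homogeneous_solution_def einstein_equations_def by blast
  have S: "stress_energy g \<phi> None None t = (\<psi> t)\<^sup>2 / 2" "stress_energy g \<phi> (Some b) None t = 0"
    "stress_energy g \<phi> (Some b) (Some c) t = (\<psi> t)\<^sup>2 / 2 * g t $ b $ c" for b c
    by (simp_all add: stress_energy_def sum_UNIV_option inverse_metric_simps[OF t] \<psi>_def power2_eq_square)
  let ?R = "scalar_curvature br g t"
  have N: "ricci br g None None t = (\<psi> t)\<^sup>2 / 2 - ?R / 2" using E[of None None] S by simp
  have B: "ricci br g (Some b) (Some c) t = ((\<psi> t)\<^sup>2 / 2 + ?R / 2) * g t $ b $ c" for b c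
    using E[of "Some b" "Some c"] S by (simp add: algebra_simps)
  have "?R = - ricci br g None None t
      + (\<Sum>a\<in>UNIV. \<Sum>b\<in>UNIV. matrix_inv (g t) $ a $ b * ricci br g (Some a) (Some b) t)"
    by (simp add: scalar_curvature_def sum_UNIV_option inverse_metric_simps[OF t])
  also have "(\<Sum>a\<in>UNIV. \<Sum>b\<in>UNIV. matrix_inv (g t) $ a $ b * ricci br g (Some a) (Some b) t)
      = ((\<psi> t)\<^sup>2 / 2 + ?R / 2) * (\<Sum>a\<in>UNIV. \<Sum>b\<in>UNIV. matrix_inv (g t) $ a $ b * g t $ b $ a)"
    unfolding sum_distrib_left by (intro sum.cong refl) (metis B g_sym[OF t] mult.left_commute)
  also have "(\<Sum>a\<in>UNIV. \<Sum>b\<in>UNIV. matrix_inv (g t) $ a $ b * g t $ b $ a) = (\<Sum>a\<in>(UNIV::3 set). (mat 1 :: real^3^3) $ a $ a)"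
    unfolding sym_pos_def_inverse(2)[OF spd[OF t], symmetric] matrix_matrix_mult_def by simp
  also have "\<dots> = 3" by (simp add: mat_def)
  finally have "?R = - (\<psi> t)\<^sup>2" unfolding N by simp
  then show "ricci br g None None t = (\<psi> t)\<^sup>2" "ricci br g (Some b) None t = 0" "ricci br g (Some b) (Some c) t = 0"
    using N B E[of "Some b" None] S(2) by auto
qed

end

lemma bilinear_eq_axis:
  fixes f h :: "real^3 \<Rightarrow> real^3 \<Rightarrow> real"
  assumes "bilinear f" "bilinear h" "\<And>a b. f (axis a 1) (axis b 1) = h (axis a 1) (axis b 1)"
  shows "f x y = h x y"
  using bilinear_eq_stdbasis[OF assms(1,2)] assms(3) by (auto simp: Basis_vec_def)

lemma linear_eq_0_axis:
  fixes f :: "real^3 \<Rightarrow> real"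
  assumes "linear f" "\<And>a. f (axis a 1) = 0"
  shows "f x = 0"
  using linear_eq_stdbasis[OF assms(1), of "\<lambda>_. 0"] assms(2) by (auto simp: Basis_vec_def linear_zero)

lemma trace_map_linear_simps:
  "trace_map (\<lambda>x. S x + T x) = trace_map S + trace_map T"
  "trace_map (\<lambda>x. S x - T x) = trace_map S - trace_map T"
  "trace_map (\<lambda>x. c *\<^sub>R T x) = c * trace_map T"
  "trace_map (\<lambda>x. - T x) = - trace_map T"
  unfolding trace_map_def by (simp_all add: sum.distrib sum_subtractf sum_distrib_left sum_negf)

section \<open>Evolution equation, constraints and wave equation\<close>

context solution begin

lemmas br_simps = bilinear_ladd[OF bil] bilinear_radd[OF bil] bilinear_lmul[OF bil] bilinear_rmul[OF bil]
  bilinear_lneg[OF bil] bilinear_rneg[OF bil] bilinear_lsub[OF bil] bilinear_rsub[OF bil]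
  bilinear_lzero[OF bil] bilinear_rzero[OF bil]

lemma \<Gamma>_simps:
  assumes "t \<in> I"
  shows "\<Gamma> t (X + Y) Z = \<Gamma> t X Z + \<Gamma> t Y Z" "\<Gamma> t X (Y + Z) = \<Gamma> t X Y + \<Gamma> t X Z"
    "\<Gamma> t (c *\<^sub>R X) Z = c *\<^sub>R \<Gamma> t X Z" "\<Gamma> t X (c *\<^sub>R Z) = c *\<^sub>R \<Gamma> t X Z"
    "\<Gamma> t (X - Y) Z = \<Gamma> t X Z - \<Gamma> t Y Z" "\<Gamma> t X (Y - Z) = \<Gamma> t X Y - \<Gamma> t X Z"
    "\<Gamma> t (- X) Z = - \<Gamma> t X Z" "\<Gamma> t X (- Z) = - \<Gamma> t X Z" "\<Gamma> t 0 Z = 0" "\<Gamma> t X 0 = 0"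
  using bilinear_\<Gamma>[OF assms]
  by (simp_all add: bilinear_ladd bilinear_radd bilinear_lmul bilinear_rmul bilinear_lsub bilinear_rsub
      bilinear_lneg bilinear_rneg bilinear_lzero bilinear_rzero)

lemma bilinear_ric: assumes t: "t \<in> I" shows "bilinear (ric t)"
  unfolding bilinear_def
  by (intro conjI allI linearI)
    (simp_all add: ric_def \<Gamma>_simps[OF t] br_simps sum.distrib sum_subtractf sum_distrib_left algebra_simps)

definition d\<kappa> :: "real \<Rightarrow> real^3^3" where "d\<kappa> t = (\<chi> a b. deriv (\<lambda>s. \<kappa> s $ a $ b) t)"

lemma \<kappa>_deriv: "t \<in> I \<Longrightarrow> ((\<lambda>s. \<kappa> s $ a $ b) has_real_derivative d\<kappa> t $ a $ b) (at t)"
  using \<kappa>_diff unfolding d\<kappa>_def by (simp add: DERIV_deriv_iff_real_differentiable)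

text \<open>Differentiating \<open>g ** \<kappa> = dg / 2\<close> produces two products of
  \<open>dg / 2\<close> with \<open>\<kappa>\<close>; they cancel the quadratic terms of the Ricci
  tensor. Raising one index is what makes the equation this simple.\<close>

lemma evolution:
  assumes t: "t \<in> I"
  shows "form (g t) Y (d\<kappa> t *v Z) = - ric t Y Z - \<theta> t * form (g t) Y (\<kappa> t *v Z)"
proof (rule bilinear_eq_axis[where f="\<lambda>Y Z. form (g t) Y (d\<kappa> t *v Z)"
      and h="\<lambda>Y Z. - ric t Y Z - \<theta> t * form (g t) Y (\<kappa> t *v Z)"])
  show "bilinear (\<lambda>Y Z. form (g t) Y (d\<kappa> t *v Z))" "bilinear (\<lambda>Y Z. - ric t Y Z - \<theta> t * form (g t) Y (\<kappa> t *v Z))"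
    unfolding bilinear_def
    by (auto intro!: linearI simp: form_simps matrix_vector_right_distrib matrix_vector_mult_scaleR
        bilinear_ladd[OF bilinear_ric[OF t]] bilinear_radd[OF bilinear_ric[OF t]]
        bilinear_lmul[OF bilinear_ric[OF t]] bilinear_rmul[OF bilinear_ric[OF t]] algebra_simps)
  fix b c
  have comp: "(\<Sum>d\<in>UNIV. g s $ b $ d * \<kappa> s $ d $ c) = dg s $ b $ c / 2" if "s \<in> I" for s b c
    using g\<kappa>[OF that] unfolding matrix_matrix_mult_def vec_eq_iff by simp
  have form_axis: "form (g t) (axis b 1) (A *v axis c 1) = (\<Sum>d\<in>UNIV. g t $ b $ d * A $ d $ c)" for A :: "real^3^3"
    by (simp add: matrix_vector_mult_basis column_def inner_axis') (simp add: matrix_vector_mult_def)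
  have "((\<lambda>s. \<Sum>d\<in>UNIV. g s $ b $ d * \<kappa> s $ d $ c) has_real_derivative
      (\<Sum>d\<in>UNIV. dg t $ b $ d * \<kappa> t $ d $ c + g t $ b $ d * d\<kappa> t $ d $ c)) (at t)"
    by (auto intro!: derivative_eq_intros g_deriv[OF t] \<kappa>_deriv[OF t] simp: ac_simps)
  then have "((\<lambda>s. dg s $ b $ c / 2) has_real_derivative
      (\<Sum>d\<in>UNIV. dg t $ b $ d * \<kappa> t $ d $ c + g t $ b $ d * d\<kappa> t $ d $ c)) (at t)"
    by (rule DERIV_cong_ev[THEN iffD1, OF refl _ refl, rotated]) (rule ev_I[OF t comp])
  then have 1: "deriv (\<lambda>s. dg s $ b $ c / 2) t
      = (\<Sum>d\<in>UNIV. dg t $ b $ d * \<kappa> t $ d $ c) + (\<Sum>d\<in>UNIV. g t $ b $ d * d\<kappa> t $ d $ c)"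
    by (simp add: DERIV_imp_deriv sum.distrib)
  have "(\<Sum>d\<in>UNIV. dg t $ b $ d / 2 * \<kappa> t $ d $ c) = form ((1/2) *\<^sub>R dg t) (axis b 1) (\<kappa> t *v axis c 1)"
    by (simp add: matrix_vector_mult_basis column_def inner_axis') (simp add: matrix_vector_mult_def)
  also have "\<dots> = form (g t) (axis b 1) (\<kappa> t *v (\<kappa> t *v axis c 1))" unfolding form_\<kappa>[OF t] ..
  also have "\<dots> = form (g t) (\<kappa> t *v axis b 1) (\<kappa> t *v axis c 1)" by (simp add: \<kappa>_self_adjoint[OF t])
  also have "\<dots> = form ((1/2) *\<^sub>R dg t) (\<kappa> t *v axis b 1) (axis c 1)" unfolding form_\<kappa>[OF t] ..
  also have "\<dots> = (\<Sum>a\<in>UNIV. \<kappa> t $ a $ b * (dg t $ a $ c / 2))"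
    by (simp add: matrix_vector_mult_basis column_def inner_vec_def)
  finally have 2: "(\<Sum>a\<in>UNIV. dg t $ a $ c / 2 * \<kappa> t $ a $ b) = (\<Sum>d\<in>UNIV. dg t $ b $ d / 2 * \<kappa> t $ d $ c)"
    by (simp add: mult.commute)
  have 3: "(\<Sum>d\<in>UNIV. dg t $ b $ d * \<kappa> t $ d $ c) = 2 * (\<Sum>d\<in>UNIV. dg t $ b $ d / 2 * \<kappa> t $ d $ c)"
    by (simp add: sum_distrib_left)
  have 4: "(\<Sum>d\<in>UNIV. \<kappa> t $ d $ c * dg t $ b $ d / 2) = (\<Sum>d\<in>UNIV. dg t $ b $ d / 2 * \<kappa> t $ d $ c)"
    by (simp add: mult.commute)
  show "form (g t) (axis b 1) (d\<kappa> t *v axis c 1)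
      = - ric t (axis b 1) (axis c 1) - \<theta> t * form (g t) (axis b 1) (\<kappa> t *v axis c 1)"
    using ricci_bc[OF t, of b c] ricci_flat_up_to_scalar(3)[OF t, of b c]
    unfolding form_axis comp[OF t] 1 2 3 4 by simp
qed

text \<open>Metric compatibility makes \<open>\<Gamma> t X\<close> skew for the metric. Its diagonal
  vanishes in every orthonormal basis, in particular in one that diagonalizes
  \<open>\<kappa>\<close>.\<close>

lemma trace_\<Gamma>: assumes t: "t \<in> I" shows "trace_map (\<Gamma> t X) = 0" "trace_map (\<lambda>Y. \<Gamma> t X (\<kappa> t *v Y)) = 0"
proof -
  have lin: "linear ((*v) (\<kappa> t))" "linear (\<Gamma> t X)"
    using bilinear_\<Gamma>[OF t] unfolding bilinear_def by (auto simp: matrix_vector_mul_linear)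
  obtain v1 v2 v3 \<mu>1 \<mu>2 \<mu>3 where v:
    "form (g t) v1 v1 = 1" "form (g t) v2 v2 = 1" "form (g t) v3 v3 = 1"
    "form (g t) v1 v2 = 0" "form (g t) v1 v3 = 0" "form (g t) v2 v3 = 0"
    "\<kappa> t *v v1 = \<mu>1 *\<^sub>R v1" "\<kappa> t *v v2 = \<mu>2 *\<^sub>R v2" "\<kappa> t *v v3 = \<mu>3 *\<^sub>R v3"
    by (rule self_adjoint_eigenbasis[OF spd[OF t] lin(1) \<kappa>_self_adjoint[OF t]])
  have z: "form (g t) u (\<Gamma> t X u) = 0" for u
    using metric_compatible[OF t, of X u u] form_commute[OF spd[OF t], of u "\<Gamma> t X u"] by simp
  show "trace_map (\<Gamma> t X) = 0"
    by (simp add: trace_map_orthonormal[OF spd[OF t] lin(2) v(1-6)] z)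
  have "linear (\<lambda>Y. \<Gamma> t X (\<kappa> t *v Y))" using linear_compose[OF lin] by (simp add: o_def)
  from trace_map_orthonormal[OF spd[OF t] this v(1-6)]
  show "trace_map (\<lambda>Y. \<Gamma> t X (\<kappa> t *v Y)) = 0" by (simp add: v(7-9) \<Gamma>_simps[OF t] form_simps z)
qed

lemma trace_\<Gamma>_left: assumes t: "t \<in> I" shows "trace_map (\<lambda>Y. \<Gamma> t Y v) = - trace_map (br v)"
proof -
  have "\<Gamma> t Y v = \<Gamma> t v Y - br v Y" for Y
    using torsion_free[OF t, of v Y] by (simp add: algebra_simps)
  then show ?thesis by (simp add: trace_map_linear_simps trace_\<Gamma>[OF t])
qed

text \<open>Once the traces of \<open>\<Gamma>\<close> are evaluated, the mixed equations mention
  only \<open>\<kappa>\<close> and the bracket. In this invariant form they can be exploited in any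
  basis.\<close>

lemma momentum_constraint:
  assumes t: "t \<in> I"
  shows "trace_map (\<lambda>Y. \<kappa> t *v br X Y) = trace_map (br (\<kappa> t *v X))"
proof -
  have "trace_map (\<lambda>Y. \<kappa> t *v br X Y) - trace_map (br (\<kappa> t *v X)) = 0"
  proof (rule linear_eq_0_axis[where f="\<lambda>X. trace_map (\<lambda>Y. \<kappa> t *v br X Y) - trace_map (br (\<kappa> t *v X))"])
    show "linear (\<lambda>X. trace_map (\<lambda>Y. \<kappa> t *v br X Y) - trace_map (br (\<kappa> t *v X)))"
      by (rule linearI) (simp_all add: br_simps matrix_vector_right_distrib matrix_vector_mult_scaleR
          trace_map_linear_simps trace_map_linear_simps(1)[of "br _" "br _", simplified] trace_map_def
          sum.distrib sum_distrib_left algebra_simps)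
    fix b :: 3
    have "trace_map (\<lambda>Y. \<kappa> t *v br Y (axis b 1)) = - trace_map (\<lambda>Y. \<kappa> t *v br (axis b 1) Y)"
    proof -
      have "\<kappa> t *v br Y (axis b 1) = - (\<kappa> t *v br (axis b 1) Y)" for Y
        by (subst br_anti) (rule linear_neg[OF matrix_vector_mul_linear])
      then show ?thesis by (simp add: trace_map_linear_simps)
    qed
    then show "trace_map (\<lambda>Y. \<kappa> t *v br (axis b 1) Y) - trace_map (br (\<kappa> t *v axis b 1)) = 0"
      using ricci_0b[OF t, of b] ricci_flat_up_to_scalar(2)[OF t, of b]
      unfolding trace_\<Gamma>[OF t] trace_\<Gamma>_left[OF t] by simp
  qed
  then show ?thesis by simp
qed

lemma \<theta>_deriv_aux: assumes t: "t \<in> I"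
  shows "(\<Sum>a\<in>UNIV. deriv (\<lambda>s. \<kappa> s $ a $ a) t) = trace_map ((*v) (d\<kappa> t))"
  unfolding trace_map_def d\<kappa>_def by (simp add: matrix_vector_mult_basis column_def)

lemma \<theta>_deriv: assumes t: "t \<in> I"
  shows "(\<theta> has_real_derivative trace_map ((*v) (d\<kappa> t))) (at t)"
proof -
  have "(\<theta> has_real_derivative (\<Sum>a\<in>UNIV. d\<kappa> t $ a $ a)) (at t)"
    unfolding \<theta>_def by (auto intro!: derivative_eq_intros \<kappa>_deriv[OF t])
  then show ?thesis unfolding trace_map_def by (simp add: matrix_vector_mult_basis column_def)
qed

text \<open>The trace of \<open>evolution\<close> and the time-time equation both contain the
  derivative of \<open>\<theta>\<close>; eliminating it leaves a constraint.\<close>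

lemma hamiltonian_constraint:
  assumes t: "t \<in> I"
    and v: "form (g t) v1 v1 = 1" "form (g t) v2 v2 = 1" "form (g t) v3 v3 = 1"
    "form (g t) v1 v2 = 0" "form (g t) v1 v3 = 0" "form (g t) v2 v3 = 0"
  shows "ric t v1 v1 + ric t v2 v2 + ric t v3 v3 + (\<theta> t)\<^sup>2
    - trace_map (\<lambda>X. \<kappa> t *v (\<kappa> t *v X)) = (\<psi> t)\<^sup>2"
proof -
  have tr: "trace_map ((*v) A) = form (g t) v1 (A *v v1) + form (g t) v2 (A *v v2) + form (g t) v3 (A *v v3)" for A
    by (rule trace_map_orthonormal[OF spd[OF t] matrix_vector_mul_linear v])
  have "trace_map ((*v) (d\<kappa> t)) = - (ric t v1 v1 + ric t v2 v2 + ric t v3 v3) - \<theta> t * \<theta> t"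
    unfolding tr[of "d\<kappa> t"] evolution[OF t] by (subst (4) \<theta>_eq_trace) (simp add: tr algebra_simps)
  then show ?thesis
    using ricci_00[OF t] ricci_flat_up_to_scalar(1)[OF t] unfolding \<theta>_deriv_aux[OF t] by (simp add: power2_eq_square)
qed

lemma trace_hinv: "t \<in> I \<Longrightarrow> (\<Sum>a\<in>UNIV. \<Sum>b\<in>UNIV. matrix_inv (g t) $ a $ b * dg t $ a $ b) = 2 * \<theta> t"
  unfolding \<theta>_def \<kappa>_def by (simp add: matrix_matrix_mult_def sum_distrib_left dg_sym)

lemma wave: assumes t: "t \<in> I" shows "(\<psi> has_real_derivative - \<theta> t * \<psi> t) (at t)"
proof -
  have "hessian br g \<phi> None None t = deriv \<psi> t"
    by (simp add: hessian_def sum_UNIV_option connection_simps[OF t] \<psi>_def frame_deriv_def[abs_def])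
  moreover have "hessian br g \<phi> (Some a) (Some b) t = - (dg t $ a $ b / 2 * \<psi> t)" for a b
    by (simp add: hessian_def sum_UNIV_option connection_simps[OF t] \<psi>_def)
  moreover have "(\<Sum>\<mu>\<in>UNIV. \<Sum>\<nu>\<in>UNIV. inverse_metric g t $ \<mu> $ \<nu> * hessian br g \<phi> \<mu> \<nu> t) = 0"
    using hom t unfolding homogeneous_solution_def wave_equation_def by blast
  ultimately have "deriv \<psi> t + (\<Sum>a\<in>UNIV. \<Sum>b\<in>UNIV. matrix_inv (g t) $ a $ b * dg t $ a $ b) * (\<psi> t / 2) = 0"
    by (simp add: sum_UNIV_option inverse_metric_simps[OF t] sum_distrib_left sum_divide_distrib sum_negf mult_ac)
  then have "deriv \<psi> t = - \<theta> t * \<psi> t" unfolding trace_hinv[OF t] by simp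
  then show ?thesis using \<psi>_diff[OF t] by (metis DERIV_deriv_iff_real_differentiable)
qed

lemma mean_curvature_eq: "t \<in> I \<Longrightarrow> mean_curvature g t = - \<theta> t"
proof -
  assume t: "t \<in> I"
  have "mean_curvature g t = - (\<Sum>a\<in>UNIV. \<Sum>b\<in>UNIV. matrix_inv (g t) $ a $ b * dg t $ a $ b) / 2"
    unfolding mean_curvature_def second_fundamental_form_def dg_def
    by (simp add: sum_negf sum_divide_distrib)
  then show ?thesis unfolding trace_hinv[OF t] by simp
qed

lemma second_fundamental_form_eq: "t \<in> I \<Longrightarrow> second_fundamental_form g t *v X = - (g t *v (\<kappa> t *v X))"
proof -
  assume t: "t \<in> I"
  have "second_fundamental_form g t = (- 1 / 2) *\<^sub>R dg t"
    unfolding second_fundamental_form_def dg_def by (simp add: vec_eq_iff)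
  then show ?thesis
    unfolding matrix_vector_mul_assoc g\<kappa>[OF t] by (simp only: scaleR_matrix_vector_assoc[symmetric]) simp
qed

lemma form_deriv:
  assumes t: "t \<in> I"
  shows "((\<lambda>s. form (g s) X Y) has_real_derivative 2 * form (g t) X (\<kappa> t *v Y)) (at t)"
proof -
  have "((\<lambda>s. form (g s) X Y) has_real_derivative form (dg t) X Y) (at t)"
    unfolding inner_vec_def matrix_vector_mult_def
    by (auto intro!: derivative_eq_intros g_deriv[OF t] simp: mult.commute)
  then show ?thesis unfolding form_\<kappa>[OF t] by (simp add: scaleR_matrix_vector_assoc[symmetric])
qed

end

section \<open>Adapted bases\<close>

text \<open>Uniqueness for a homogeneous linear system. It is used to show that mixed components
  which vanish at one time vanish at all times.\<close>

lemma linear_system_zero: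
  fixes f h :: "real \<Rightarrow> real"
  assumes f: "\<And>s. s \<in> closed_segment t0 t \<Longrightarrow> (f has_real_derivative a s * f s + b s * h s) (at s)"
    and h: "\<And>s. s \<in> closed_segment t0 t \<Longrightarrow> (h has_real_derivative c s * f s + d s * h s) (at s)"
    and cont: "continuous_on (closed_segment t0 t) a" "continuous_on (closed_segment t0 t) b"
      "continuous_on (closed_segment t0 t) c" "continuous_on (closed_segment t0 t) d"
    and z: "f t0 = 0" "h t0 = 0"
  shows "f t = 0 \<and> h t = 0"
proof -
  have "\<exists>B. \<forall>s\<in>closed_segment t0 t. \<bar>k s\<bar> \<le> B" if "continuous_on (closed_segment t0 t) k" for k :: "real \<Rightarrow> real"
    using compact_imp_bounded[OF compact_continuous_image[OF that compact_segment]] unfolding bounded_iff by auto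
  then obtain A B C D where bd: "\<And>s. s \<in> closed_segment t0 t \<Longrightarrow> \<bar>a s\<bar> \<le> A \<and> \<bar>b s\<bar> \<le> B \<and> \<bar>c s\<bar> \<le> C \<and> \<bar>d s\<bar> \<le> D"
    using cont by metis
  have "(f t, h t) = 0"
  proof (rule gronwall_zero_vector[where u="\<lambda>s. (f s, h s)" and C="A + B + C + D"
        and u'="\<lambda>s. (a s * f s + b s * h s, c s * f s + d s * h s)"])
    fix s assume s: "s \<in> closed_segment t0 t"
    show "((\<lambda>s. (f s, h s)) has_vector_derivative (a s * f s + b s * h s, c s * f s + d s * h s)) (at s)"
      using f[OF s] h[OF s] by (intro has_vector_derivative_Pair) (simp_all add: has_real_derivative_iff_has_vector_derivative)
    let ?n = "norm (f s, h s)"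
    have n: "\<bar>f s\<bar> \<le> ?n" "\<bar>h s\<bar> \<le> ?n" using norm_fst_le[of "f s" "h s"] norm_snd_le[of "h s" "f s"] by auto
    have "norm (a s * f s + b s * h s, c s * f s + d s * h s) \<le> \<bar>a s * f s + b s * h s\<bar> + \<bar>c s * f s + d s * h s\<bar>"
      using norm_Pair_le[of "a s * f s + b s * h s" "c s * f s + d s * h s"] by simp
    also have "\<dots> \<le> (\<bar>a s\<bar> * \<bar>f s\<bar> + \<bar>b s\<bar> * \<bar>h s\<bar>) + (\<bar>c s\<bar> * \<bar>f s\<bar> + \<bar>d s\<bar> * \<bar>h s\<bar>)"
      unfolding abs_mult[symmetric] by (intro add_mono abs_triangle_ineq)
    also have "\<dots> \<le> (A * ?n + B * ?n) + (C * ?n + D * ?n)"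
      using bd[OF s] n by (intro add_mono mult_mono) auto
    finally show "norm (a s * f s + b s * h s, c s * f s + d s * h s) \<le> (A + B + C + D) * ?n"
      by (simp add: algebra_simps)
  qed (use z in \<open>simp add: zero_prod_def\<close>)
  then show ?thesis by (simp add: zero_prod_def)
qed

lemma trace_map_commute:
  assumes "linear S" "linear T"
  shows "trace_map (\<lambda>x. S (T x)) = trace_map (\<lambda>x. T (S x))"
proof -
  have ex: "L x $ a = (\<Sum>b\<in>UNIV. x $ b * L (axis b 1) $ a)" if "linear L" for L :: "real^3 \<Rightarrow> real^3" and x a
  proof -
    have "L x = L (\<Sum>b\<in>UNIV. x $ b *\<^sub>R axis b 1)" using basis_expansion[of x] by (simp add: scalar_mult_eq_scaleR)
    also have "\<dots> = (\<Sum>b\<in>UNIV. x $ b *\<^sub>R L (axis b 1))" by (simp add: linear_sum[OF that] linear_scale[OF that])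
    finally show ?thesis by simp
  qed
  have "trace_map (\<lambda>x. S (T x)) = (\<Sum>a\<in>UNIV. \<Sum>b\<in>UNIV. T (axis a 1) $ b * S (axis b 1) $ a)"
    unfolding trace_map_def by (intro sum.cong refl ex[OF assms(1)])
  also have "\<dots> = (\<Sum>b\<in>UNIV. \<Sum>a\<in>UNIV. S (axis b 1) $ a * T (axis a 1) $ b)"
    by (subst sum.swap) (simp add: mult.commute)
  also have "\<dots> = trace_map (\<lambda>x. T (S x))"
    unfolding trace_map_def by (intro sum.cong refl ex[OF assms(2), symmetric])
  finally show ?thesis .
qed

context solution begin

lemma linear_br: "linear (br x)" using bil unfolding bilinear_def by blast

text \<open>By the Jacobi identity \<open>ad\<close> turns brackets into commutators, and
  commutators have trace zero.\<close>

lemma trace_ad_commutator: "trace_map (br (br x y)) = 0"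
proof -
  have "br (br x y) z = br x (br y z) - br y (br x z)" for z
    using jacobi[of x y z] br_anti[of z "br x y"] br_anti[of z x] by (simp add: br_simps algebra_simps)
  then have "br (br x y) = (\<lambda>z. br x (br y z) - br y (br x z))" by (rule ext)
  then have "trace_map (br (br x y)) = trace_map (\<lambda>z. br x (br y z)) - trace_map (\<lambda>z. br y (br x z))"
    by (simp add: trace_map_linear_simps)
  then show ?thesis using trace_map_commute[OF linear_br linear_br, of x y] by simp
qed

lemma linear_trace_ad: "linear (\<lambda>x. trace_map (br x))"
  by (rule linearI) (simp_all add: br_simps trace_map_def sum.distrib sum_distrib_left)

lemma \<kappa>_form_deriv:
  assumes t: "t \<in> I"
  shows "((\<lambda>s. form A x (\<kappa> s *v y)) has_real_derivative form A x (d\<kappa> t *v y)) (at t)"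
  unfolding inner_vec_def matrix_vector_mult_def
  by (auto intro!: derivative_eq_intros \<kappa>_deriv[OF t] simp: mult.commute)

end

text \<open>The basis is orthonormal at the one time \<open>t0\<close> and then kept fixed in the
  Lie algebra. Accordingly \<open>co\<close> gives coordinates in this fixed basis, not inner
  products at later times.\<close>

locale orthonormal_at = solution +
  fixes t0 and b1 b2 b3 :: "real^3"
  assumes t0: "t0 \<in> I"
    and nrm: "form (g t0) b1 b1 = 1" "form (g t0) b2 b2 = 1" "form (g t0) b3 b3 = 1"
    and orth: "form (g t0) b1 b2 = 0" "form (g t0) b1 b3 = 0" "form (g t0) b2 b3 = 0"
begin

abbreviation co :: "real^3 \<Rightarrow> real^3 \<Rightarrow> real" where "co b x \<equiv> form (g t0) b x"

lemma expand: "x = co b1 x *\<^sub>R b1 + co b2 x *\<^sub>R b2 + co b3 x *\<^sub>R b3"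
  by (rule form_orthonormal_expansion(1)[OF spd[OF t0] nrm orth])

lemma co_simps:
  "co b1 b1 = 1" "co b2 b2 = 1" "co b3 b3 = 1" "co b1 b2 = 0" "co b1 b3 = 0" "co b2 b3 = 0"
  "co b2 b1 = 0" "co b3 b1 = 0" "co b3 b2 = 0"
  by (fact nrm orth | subst form_commute[OF spd[OF t0]], fact orth)+

lemma trace_expand: "linear T \<Longrightarrow> trace_map T = co b1 (T b1) + co b2 (T b2) + co b3 (T b3)"
  by (rule trace_map_orthonormal[OF spd[OF t0] _ nrm orth])

lemma k_cont: "t \<in> I \<Longrightarrow> continuous_on (closed_segment t0 t) (\<lambda>s. co x (\<kappa> s *v y))"
  and g_cont: "t \<in> I \<Longrightarrow> continuous_on (closed_segment t0 t) (\<lambda>s. form (g s) x y)"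
proof -
  assume t: "t \<in> I"
  have sub: "closed_segment t0 t \<subseteq> I" by (rule closed_segment_subset[OF t0 t is_interval_convex[OF ivl]])
  show "continuous_on (closed_segment t0 t) (\<lambda>s. co x (\<kappa> s *v y))"
    by (intro continuous_at_imp_continuous_on ballI DERIV_isCont[OF \<kappa>_form_deriv]) (use sub in blast)
  show "continuous_on (closed_segment t0 t) (\<lambda>s. form (g s) x y)"
    by (intro continuous_at_imp_continuous_on ballI DERIV_isCont[OF form_deriv]) (use sub in blast)
qed

lemma segment_sub: "t \<in> I \<Longrightarrow> closed_segment t0 t \<subseteq> I"
  by (rule closed_segment_subset[OF t0 _ is_interval_convex[OF ivl]])

text \<open>The derivative of \<open>form (g s) b1 b\<close> is
  \<open>2 * form (g s) b1 (\<kappa> s *v b)\<close>. If \<open>\<kappa>\<close> preserves the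
  plane, the right-hand side is again a combination of the two mixed components.\<close>

lemma block_if_plane_invariant:
  assumes k: "\<And>t. t \<in> I \<Longrightarrow> co b1 (\<kappa> t *v b2) = 0 \<and> co b1 (\<kappa> t *v b3) = 0" and t: "t \<in> I"
  shows "form (g t) b1 b2 = 0 \<and> form (g t) b1 b3 = 0"
proof (rule linear_system_zero[where f="\<lambda>s. form (g s) b1 b2" and h="\<lambda>s. form (g s) b1 b3"])
  fix s assume "s \<in> closed_segment t0 t"
  then have s: "s \<in> I" using segment_sub[OF t] by blast
  have e: "\<kappa> s *v b2 = co b2 (\<kappa> s *v b2) *\<^sub>R b2 + co b3 (\<kappa> s *v b2) *\<^sub>R b3"
    "\<kappa> s *v b3 = co b2 (\<kappa> s *v b3) *\<^sub>R b2 + co b3 (\<kappa> s *v b3) *\<^sub>R b3"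
    by (rule trans[OF expand], simp add: k[OF s])+
  have e2: "form (g s) b1 (\<kappa> s *v b2) = co b2 (\<kappa> s *v b2) * form (g s) b1 b2 + co b3 (\<kappa> s *v b2) * form (g s) b1 b3"
    by (subst e(1)) (simp only: form_simps real_scaleR_def)
  have e3: "form (g s) b1 (\<kappa> s *v b3) = co b2 (\<kappa> s *v b3) * form (g s) b1 b2 + co b3 (\<kappa> s *v b3) * form (g s) b1 b3"
    by (subst e(2)) (simp only: form_simps real_scaleR_def)
  show "((\<lambda>s. form (g s) b1 b2) has_real_derivative
      (2 * co b2 (\<kappa> s *v b2)) * form (g s) b1 b2 + (2 * co b3 (\<kappa> s *v b2)) * form (g s) b1 b3) (at s)"
    using form_deriv[OF s, of b1 b2] unfolding e2 by (simp add: algebra_simps)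
  show "((\<lambda>s. form (g s) b1 b3) has_real_derivative
      (2 * co b2 (\<kappa> s *v b3)) * form (g s) b1 b2 + (2 * co b3 (\<kappa> s *v b3)) * form (g s) b1 b3) (at s)"
    using form_deriv[OF s, of b1 b3] unfolding e3 by (simp add: algebra_simps)
qed (use t orth in \<open>auto intro!: continuous_intros k_cont\<close>)

text \<open>Dual to the preceding lemma: self-adjointness moves \<open>\<kappa>\<close> onto
  \<open>b1\<close>, which is then an eigenvector at all times.\<close>

lemma block_if_line_invariant:
  assumes k: "\<And>t. t \<in> I \<Longrightarrow> co b2 (\<kappa> t *v b1) = 0 \<and> co b3 (\<kappa> t *v b1) = 0" and t: "t \<in> I"
  shows "form (g t) b1 b2 = 0 \<and> form (g t) b1 b3 = 0"
proof (rule linear_system_zero[where f="\<lambda>s. form (g s) b1 b2" and h="\<lambda>s. form (g s) b1 b3"])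
  fix s assume "s \<in> closed_segment t0 t"
  then have s: "s \<in> I" using segment_sub[OF t] by blast
  have e: "\<kappa> s *v b1 = co b1 (\<kappa> s *v b1) *\<^sub>R b1"
    by (rule trans[OF expand]) (simp add: k[OF s])
  have e2: "form (g s) b1 (\<kappa> s *v b) = co b1 (\<kappa> s *v b1) * form (g s) b1 b" for b
    unfolding \<kappa>_self_adjoint[OF s, symmetric] by (subst e) (simp only: form_simps real_scaleR_def)
  show "((\<lambda>s. form (g s) b1 b2) has_real_derivative
      (2 * co b1 (\<kappa> s *v b1)) * form (g s) b1 b2 + 0 * form (g s) b1 b3) (at s)"
    using form_deriv[OF s, of b1 b2] unfolding e2 by (simp add: algebra_simps)
  show "((\<lambda>s. form (g s) b1 b3) has_real_derivative
      0 * form (g s) b1 b2 + (2 * co b1 (\<kappa> s *v b1)) * form (g s) b1 b3) (at s)"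
    using form_deriv[OF s, of b1 b3] unfolding e2 by (simp add: algebra_simps)
qed (use t orth in \<open>auto intro!: continuous_intros k_cont\<close>)

text \<open>In a basis diagonalizing the bracket the momentum constraint says that \<open>\<kappa>\<close> commutes with it.\<close>

lemma momentum_diagonal:
  assumes n: "br b2 b3 = n1 *\<^sub>R b1" "br b3 b1 = n2 *\<^sub>R b2" "br b1 b2 = n3 *\<^sub>R b3" and t: "t \<in> I"
  shows "n3 * co b2 (\<kappa> t *v b3) = n2 * co b3 (\<kappa> t *v b2)"
    and "n1 * co b3 (\<kappa> t *v b1) = n3 * co b1 (\<kappa> t *v b3)"
    and "n2 * co b1 (\<kappa> t *v b2) = n1 * co b2 (\<kappa> t *v b1)"
proof -
  have n': "br b3 b2 = - n1 *\<^sub>R b1" "br b1 b3 = - n2 *\<^sub>R b2" "br b2 b1 = - n3 *\<^sub>R b3"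
    by (rule trans[OF br_anti], simp add: n)+
  have H: "trace_map (br x) = 0" for x
  proof -
    have "trace_map (br b1) = 0" "trace_map (br b2) = 0" "trace_map (br b3) = 0"
      unfolding trace_expand[OF linear_br] by (simp_all add: n n' br_self form_simps co_simps)
    then show ?thesis
      by (subst expand[of x]) (simp add: linear_add[OF linear_trace_ad] linear_scale[OF linear_trace_ad])
  qed
  have lin: "linear (\<lambda>Y. \<kappa> t *v br X Y)" for X
    using linear_compose[OF linear_br matrix_vector_mul_linear] by (simp add: o_def)
  have "co b1 (\<kappa> t *v br X b1) + co b2 (\<kappa> t *v br X b2) + co b3 (\<kappa> t *v br X b3) = 0" for X
    using momentum_constraint[OF t, of X] unfolding H trace_expand[OF lin] .
  from this[of b1] this[of b2] this[of b3]
  show "n3 * co b2 (\<kappa> t *v b3) = n2 * co b3 (\<kappa> t *v b2)"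
    "n1 * co b3 (\<kappa> t *v b1) = n3 * co b1 (\<kappa> t *v b3)" "n2 * co b1 (\<kappa> t *v b2) = n1 * co b2 (\<kappa> t *v b1)"
    by (simp_all add: n n' br_self matrix_vector_mult_scaleR form_simps linear_neg[OF matrix_vector_mul_linear])
qed

text \<open>Neither line nor plane is known to be invariant here. Self-adjointness of
  \<open>\<kappa>\<close>, tested on \<open>b1\<close> with \<open>b2\<close> and with
  \<open>b3\<close>, together with the momentum constraint gives two linear equations for
  \<open>k b2 b1\<close> and \<open>k b3 b1\<close>. Their determinant is \<open>\<Delta>\<close>,
  and their right-hand sides are linear in the mixed metric components. Solving by Cramer's rule
  closes the linear system for the latter.\<close>

lemma block_type_VIII:
  assumes n: "br b2 b3 = n1 *\<^sub>R b1" "br b3 b1 = n2 *\<^sub>R b2" "br b1 b2 = n3 *\<^sub>R b3"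
    and sgn: "n1 * n2 < 0" "n1 * n3 < 0" and t: "t \<in> I"
  shows "form (g t) b1 b2 = 0 \<and> form (g t) b1 b3 = 0"
proof -
  define k where "k x y s = co x (\<kappa> s *v y)" for x y s
  define G where "G x y s = form (g s) x y" for x y s
  \<comment> \<open>Eliminating \<open>k b1 b2\<close> and \<open>k b1 b3\<close> adds these shifts
    to the diagonal of the plane metric. The signs of type VIII make them positive, so the shifted
    matrix remains positive definite and \<open>\<Delta>\<close> cannot vanish.\<close>
  define c2 c3 where "c2 s = - n1 / n2 * G b1 b1 s" and "c3 s = - n1 / n3 * G b1 b1 s" for s
  define \<Delta> where "\<Delta> s = (G b2 b2 s + c2 s) * (G b3 b3 s + c3 s) - (G b2 b3 s)\<^sup>2" for s
  have b0: "b1 \<noteq> 0" "b2 \<noteq> 0" "b3 \<noteq> 0" using nrm by auto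
  have Gc: "G y x s = G x y s" if "s \<in> I" for x y s unfolding G_def by (rule form_commute[OF spd[OF that]])
  have \<Delta>: "0 < \<Delta> s" if s: "s \<in> I" for s
  proof -
    have q: "0 < - n1 / n2" "0 < - n1 / n3"
      using sgn by (auto simp: mult_less_0_iff divide_less_0_iff)
    have pos: "0 < G b1 b1 s" "0 < G b2 b2 s" "0 < G b3 b3 s" unfolding G_def using form_pos[OF spd[OF s]] b0 by auto
    have "c2 s > 0" "c3 s > 0" unfolding c2_def c3_def by (intro mult_pos_pos q pos(1))+
    have "(G b2 b3 s)\<^sup>2 \<le> G b2 b2 s * G b3 b3 s"
    proof -
      define v where "v = G b3 b3 s *\<^sub>R b2 - G b2 b3 s *\<^sub>R b3"
      have "0 \<le> form (g s) v v" by (rule form_nonneg[OF spd[OF s]])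
      also have "form (g s) v v = G b3 b3 s * (G b2 b2 s * G b3 b3 s - (G b2 b3 s)\<^sup>2)"
        unfolding v_def using Gc[OF s, of b2 b3] by (simp add: form_simps G_def algebra_simps power2_eq_square)
      finally show ?thesis using pos by (simp add: zero_le_mult_iff)
    qed
    moreover have "0 < c2 s * G b3 b3 s" "0 < c3 s * G b2 b2 s" "0 < c2 s * c3 s"
      using \<open>c2 s > 0\<close> \<open>c3 s > 0\<close> pos by simp_all
    moreover have "\<Delta> s = (G b2 b2 s * G b3 b3 s - (G b2 b3 s)\<^sup>2) + c2 s * G b3 b3 s + c3 s * G b2 b2 s + c2 s * c3 s"
      unfolding \<Delta>_def by (simp add: algebra_simps)
    ultimately show ?thesis by linarith
  qed
  define p2 where "p2 s = ((k b2 b2 s - k b1 b1 s) * (G b3 b3 s + c3 s) - k b2 b3 s * G b2 b3 s) / \<Delta> s" for s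
  define p3 where "p3 s = (k b3 b2 s * (G b3 b3 s + c3 s) - (k b3 b3 s - k b1 b1 s) * G b2 b3 s) / \<Delta> s" for s
  define q2 where "q2 s = (k b2 b3 s * (G b2 b2 s + c2 s) - (k b2 b2 s - k b1 b1 s) * G b2 b3 s) / \<Delta> s" for s
  define q3 where "q3 s = ((k b3 b3 s - k b1 b1 s) * (G b2 b2 s + c2 s) - k b3 b2 s * G b2 b3 s) / \<Delta> s" for s
  have kc: "continuous_on (closed_segment t0 t) (k x y)" "continuous_on (closed_segment t0 t) (G x y)" for x y
    unfolding k_def G_def by (rule k_cont[OF t], rule g_cont[OF t])
  have \<Delta>nz: "\<forall>s\<in>closed_segment t0 t. \<Delta> s \<noteq> 0" using \<Delta> segment_sub[OF t] by fastforce
  have cc: "continuous_on (closed_segment t0 t) c2" "continuous_on (closed_segment t0 t) c3"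
    "continuous_on (closed_segment t0 t) \<Delta>"
    unfolding c2_def c3_def \<Delta>_def by (intro continuous_intros kc)+
  have pc: "continuous_on (closed_segment t0 t) p2" "continuous_on (closed_segment t0 t) p3"
    "continuous_on (closed_segment t0 t) q2" "continuous_on (closed_segment t0 t) q3"
    unfolding p2_def p3_def q2_def q3_def by (intro continuous_intros kc cc \<Delta>nz)+
  show ?thesis
  proof (rule linear_system_zero[where f="\<lambda>s. form (g s) b1 b2" and h="\<lambda>s. form (g s) b1 b3"])
    fix s assume "s \<in> closed_segment t0 t"
    then have s: "s \<in> I" using segment_sub[OF t] by blast
    have n0: "n1 \<noteq> 0" "n2 \<noteq> 0" "n3 \<noteq> 0" using sgn by auto
    have k12: "k b1 b2 s = n1 / n2 * k b2 b1 s" and k13: "k b1 b3 s = n1 / n3 * k b3 b1 s"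
      using momentum_diagonal(2,3)[OF n s] n0 unfolding k_def by (simp_all add: field_simps)
    have \<kappa>1: "form (g s) (\<kappa> s *v b1) b = k b1 b1 s * G b1 b s + k b2 b1 s * G b2 b s + k b3 b1 s * G b3 b s" for b
      by (subst expand[of "\<kappa> s *v b1"]) (simp only: form_simps k_def G_def real_scaleR_def)
    have \<kappa>b: "form (g s) b1 (\<kappa> s *v b) = k b1 b s * G b1 b1 s + k b2 b s * G b1 b2 s + k b3 b s * G b1 b3 s" for b
      by (subst expand[of "\<kappa> s *v b"]) (simp only: form_simps k_def G_def real_scaleR_def)
    have eq: "k b1 b1 s * G b1 b s + k b2 b1 s * G b2 b s + k b3 b1 s * G b3 b s
        = k b1 b s * G b1 b1 s + k b2 b s * G b1 b2 s + k b3 b s * G b1 b3 s" for b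
      unfolding \<kappa>1[symmetric] \<kappa>b[symmetric] by (rule \<kappa>_self_adjoint[OF s])
    define r2 r3 where "r2 = (k b2 b2 s - k b1 b1 s) * G b1 b2 s + k b3 b2 s * G b1 b3 s"
      and "r3 = k b2 b3 s * G b1 b2 s + (k b3 b3 s - k b1 b1 s) * G b1 b3 s"
    have m2: "k b2 b1 s * (G b2 b2 s + c2 s) + k b3 b1 s * G b2 b3 s = r2"
      using eq[of b2] Gc[OF s, of b3 b2] unfolding k12 r2_def c2_def by (simp add: algebra_simps)
    have m3: "k b2 b1 s * G b2 b3 s + k b3 b1 s * (G b3 b3 s + c3 s) = r3"
      using eq[of b3] unfolding k13 r3_def c3_def by (simp add: algebra_simps)
    have "k b2 b1 s * \<Delta> s = r2 * (G b3 b3 s + c3 s) - r3 * G b2 b3 s"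
      unfolding m2[symmetric] m3[symmetric] \<Delta>_def by (simp add: algebra_simps power2_eq_square)
    then have "k b2 b1 s = (r2 * (G b3 b3 s + c3 s) - r3 * G b2 b3 s) / \<Delta> s" using \<Delta>[OF s] by (simp add: field_simps)
    then have k21: "k b2 b1 s = p2 s * G b1 b2 s + p3 s * G b1 b3 s"
      unfolding p2_def p3_def r2_def r3_def by (simp add: add_divide_distrib diff_divide_distrib algebra_simps)
    have "k b3 b1 s * \<Delta> s = r3 * (G b2 b2 s + c2 s) - r2 * G b2 b3 s"
      unfolding m2[symmetric] m3[symmetric] \<Delta>_def by (simp add: algebra_simps power2_eq_square)
    then have "k b3 b1 s = (r3 * (G b2 b2 s + c2 s) - r2 * G b2 b3 s) / \<Delta> s" using \<Delta>[OF s] by (simp add: field_simps)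
    then have k31: "k b3 b1 s = q2 s * G b1 b2 s + q3 s * G b1 b3 s"
      unfolding q2_def q3_def r2_def r3_def by (simp add: add_divide_distrib diff_divide_distrib algebra_simps)
    have d: "((\<lambda>s. form (g s) b1 b) has_real_derivative
        2 * (k b1 b1 s * G b1 b s + k b2 b1 s * G b2 b s + k b3 b1 s * G b3 b s)) (at s)" for b
      using form_deriv[OF s, of b1 b] unfolding \<kappa>1[symmetric] \<kappa>_self_adjoint[OF s] .
    show "((\<lambda>s. form (g s) b1 b2) has_real_derivative
        (2 * (k b1 b1 s + p2 s * G b2 b2 s + q2 s * G b2 b3 s)) * form (g s) b1 b2
        + (2 * (p3 s * G b2 b2 s + q3 s * G b2 b3 s)) * form (g s) b1 b3) (at s)"
      by (rule DERIV_cong[OF d[of b2]]) (use Gc[OF s, of b3 b2] in \<open>simp add: k21 k31 G_def[symmetric] algebra_simps\<close>)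
    show "((\<lambda>s. form (g s) b1 b3) has_real_derivative
        (2 * (p2 s * G b2 b3 s + q2 s * G b3 b3 s)) * form (g s) b1 b2
        + (2 * (k b1 b1 s + p3 s * G b2 b3 s + q3 s * G b3 b3 s)) * form (g s) b1 b3) (at s)"
      by (rule DERIV_cong[OF d[of b3]]) (simp add: k21 k31 G_def[symmetric] algebra_simps)
  qed (use orth in \<open>auto intro!: continuous_intros kc pc\<close>)
qed

end

section \<open>Recognizing the excluded Bianchi types\<close>

lemma basis3:
  fixes x y z :: "real^3"
  assumes c: "\<And>a b c. a *\<^sub>R x + b *\<^sub>R y + c *\<^sub>R z = 0 \<Longrightarrow> a = 0 \<and> b = 0 \<and> c = 0"
  shows "distinct [x, y, z]" "independent {x, y, z}" "span {x, y, z} = UNIV"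
proof -
  show d: "distinct [x, y, z]" using c[of 1 "-1" 0] c[of 1 0 "-1"] c[of 0 1 "-1"] by auto
  show ind: "independent {x, y, z}"
  proof (rule independent_if_scalars_zero)
    fix f u assume f: "(\<Sum>u\<in>{x, y, z}. f u *\<^sub>R u) = 0" and u: "u \<in> {x, y, z}"
    have "f x *\<^sub>R x + f y *\<^sub>R y + f z *\<^sub>R z = 0" using f d by (simp add: add.assoc)
    from c[OF this] show "f u = 0" using u by auto
  qed simp
  have "dim {x, y, z} = 3" using dim_eq_card_independent[OF ind] d by simp
  then show "span {x, y, z} = UNIV" using dim_eq_full[of "{x, y, z}"] by simp
qed

lemma singular_kernel2:
  fixes p q r s :: real
  assumes "p * s = q * r"
  obtains x y where "p * x + q * y = 0" "r * x + s * y = 0" "x \<noteq> 0 \<or> y \<noteq> 0"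
proof -
  consider "p \<noteq> 0 \<or> q \<noteq> 0" | "r \<noteq> 0 \<or> s \<noteq> 0" | "p = 0" "q = 0" "r = 0" "s = 0" by blast
  then show ?thesis
  proof cases
    case 1 show ?thesis by (rule that[of q "-p"]) (use 1 assms in \<open>auto simp: algebra_simps\<close>)
  next
    case 2 show ?thesis by (rule that[of s "-r"]) (use 2 assms in \<open>auto simp: algebra_simps\<close>)
  next
    case 3 show ?thesis by (rule that[of 1 0]) (use 3 in auto)
  qed
qed

text \<open>The combination of the three Pauli matrices with coefficients \<open>p\<close>,
  \<open>q\<close>, \<open>r\<close>, times \<open>i / 2\<close>. With this normalization the
  commutator is minus the cross product.\<close>

definition su2_matrix :: "real \<Rightarrow> real \<Rightarrow> real \<Rightarrow> complex^2^2" where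
  "su2_matrix p q r = (\<chi> i j. if i = 1 then (if j = 1 then Complex 0 (r/2) else Complex (q/2) (p/2))
     else (if j = 1 then Complex (-q/2) (p/2) else Complex 0 (-r/2)))"

lemma su2_matrix_nth [simp]:
  "su2_matrix p q r $ 1 $ 1 = Complex 0 (r/2)" "su2_matrix p q r $ 1 $ 2 = Complex (q/2) (p/2)"
  "su2_matrix p q r $ 2 $ 1 = Complex (-q/2) (p/2)" "su2_matrix p q r $ 2 $ 2 = Complex 0 (-r/2)"
  unfolding su2_matrix_def by simp_all

lemma su2_matrix_commutator:
  "su2_matrix p q r ** su2_matrix p' q' r' - su2_matrix p' q' r' ** su2_matrix p q r
    = su2_matrix (r * q' - q * r') (p * r' - r * p') (q * p' - p * q')"
  by (simp add: vec_eq_iff forall_2 matrix_matrix_mult_def sum_2 complex_eq_iff field_simps)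

lemma su2_eq_range: "su2 = {su2_matrix p q r | p q r. True}"
proof (intro set_eqI iffI)
  fix A assume "A \<in> su2"
  then have "\<And>i j. cnj (A $ j $ i) = - A $ i $ j" and tr: "A $ 1 $ 1 + A $ 2 $ 2 = 0"
    unfolding su2_def vec_eq_iff trace_def by (auto simp: sum_2)
  from this(1)[of 1 1] this(1)[of 2 1] this(1)[of 2 2] tr
  have "A = su2_matrix (2 * Im (A $ 1 $ 2)) (2 * Re (A $ 1 $ 2)) (2 * Im (A $ 1 $ 1))"
    by (simp add: vec_eq_iff forall_2 complex_eq_iff)
  then show "A \<in> {su2_matrix p q r | p q r. True}" by blast
next
  fix A assume "A \<in> {su2_matrix p q r | p q r. True}"
  then show "A \<in> su2" unfolding su2_def
    by (auto simp: vec_eq_iff forall_2 trace_def sum_2 complex_eq_iff)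
qed

context orthonormal_at begin

text \<open>Coordinates are rescaled by \<open>m1\<close>, \<open>m2\<close>, \<open>m3\<close>. The
  map respects brackets if \<open>n1 * m1 = - (m2 * m3)\<close> and cyclically; square roots of
  products of two of the \<open>n\<close> solve this up to a common sign, and the minus sign of the
  commutator fixes it as \<open>\<sigma> = - sgn n1\<close>.\<close>

lemma bianchi_IX_if_definite:
  assumes n: "br b2 b3 = n1 *\<^sub>R b1" "br b3 b1 = n2 *\<^sub>R b2" "br b1 b2 = n3 *\<^sub>R b3"
    and sgn: "n1 * n2 > 0" "n1 * n3 > 0"
  shows "bianchi_IX br"
proof -
  define \<sigma> where "\<sigma> = - sgn n1"
  define m1 m2 m3 where "m1 = \<sigma> * sqrt (n2 * n3)" and "m2 = \<sigma> * sqrt (n3 * n1)" and "m3 = \<sigma> * sqrt (n1 * n2)"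
  have n23: "n2 * n3 > 0" using sgn by (auto simp: zero_less_mult_iff)
  have nz: "m1 \<noteq> 0" "m2 \<noteq> 0" "m3 \<noteq> 0" unfolding m1_def m2_def m3_def \<sigma>_def using sgn n23 by (auto simp: sgn_if)
  have prod: "sqrt (x * y) * sqrt (y * z) = \<bar>y\<bar> * sqrt (z * x)" for x y z :: real
  proof -
    have "(x * y) * (y * z) = y\<^sup>2 * (z * x)" by (simp add: power2_eq_square mult_ac)
    then show ?thesis by (metis real_sqrt_abs real_sqrt_mult)
  qed
  have ss: "\<sigma> * \<sigma> * \<bar>n1\<bar> = - \<sigma> * n1" "\<sigma> * \<sigma> * \<bar>n2\<bar> = - \<sigma> * n2" "\<sigma> * \<sigma> * \<bar>n3\<bar> = - \<sigma> * n3"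
    unfolding \<sigma>_def using sgn by (auto simp: sgn_if zero_less_mult_iff)
  have m: "- (m2 * m3) = n1 * m1" "- (m3 * m1) = n2 * m2" "- (m1 * m2) = n3 * m3"
  proof -
    have 1: "m2 * m3 = (\<sigma> * \<sigma>) * (sqrt (n3 * n1) * sqrt (n1 * n2))"
      and 2: "m3 * m1 = (\<sigma> * \<sigma>) * (sqrt (n1 * n2) * sqrt (n2 * n3))"
      and 3: "m1 * m2 = (\<sigma> * \<sigma>) * (sqrt (n2 * n3) * sqrt (n3 * n1))"
      unfolding m1_def m2_def m3_def by (simp_all only: mult_ac)
    show "- (m2 * m3) = n1 * m1" "- (m3 * m1) = n2 * m2" "- (m1 * m2) = n3 * m3"
      unfolding 1 2 3 prod mult.assoc[symmetric] ss unfolding m1_def m2_def m3_def by simp_all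
  qed
  define F where "F x = su2_matrix (m1 * co b1 x) (m2 * co b2 x) (m3 * co b3 x)" for x
  have lin: "linear F"
    by (rule linearI) (simp_all add: F_def vec_eq_iff forall_2 complex_eq_iff form_simps field_simps)
  have "bij_betw F UNIV su2"
    unfolding bij_betw_def
  proof
    show "inj F"
    proof (rule injI)
      fix x y assume eq: "F x = F y"
      have "co b1 x = co b1 y \<and> co b2 x = co b2 y \<and> co b3 x = co b3 y"
        using arg_cong[OF eq, of "\<lambda>A. A $ 1 $ 1"] arg_cong[OF eq, of "\<lambda>A. A $ 1 $ 2"] nz by (simp add: F_def)
      then show "x = y" using expand[of x] expand[of y] by simp
    qed
    have "su2_matrix p q r \<in> range F" for p q r
    proof -
      define x where "x = (p / m1) *\<^sub>R b1 + (q / m2) *\<^sub>R b2 + (r / m3) *\<^sub>R b3"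
      have "F x = su2_matrix p q r" unfolding F_def x_def using nz by (simp add: form_simps co_simps)
      then show ?thesis by (metis rangeI)
    qed
    then show "range F = su2" unfolding su2_eq_range F_def by auto
  qed
  moreover have "F (br x y) = F x ** F y - F y ** F x" for x y
  proof -
    have n': "br b3 b2 = - n1 *\<^sub>R b1" "br b1 b3 = - n2 *\<^sub>R b2" "br b2 b1 = - n3 *\<^sub>R b3"
      by (rule trans[OF br_anti], simp add: n)+
    have "br x y = br (co b1 x *\<^sub>R b1 + co b2 x *\<^sub>R b2 + co b3 x *\<^sub>R b3) (co b1 y *\<^sub>R b1 + co b2 y *\<^sub>R b2 + co b3 y *\<^sub>R b3)"
      using expand[of x] expand[of y] by simp
    also have "\<dots> = ((co b2 x * co b3 y - co b3 x * co b2 y) * n1) *\<^sub>R b1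
        + ((co b3 x * co b1 y - co b1 x * co b3 y) * n2) *\<^sub>R b2 + ((co b1 x * co b2 y - co b2 x * co b1 y) * n3) *\<^sub>R b3"
      by (simp add: br_simps br_self n n' algebra_simps)
    finally have b: "br x y = \<dots>" .
    have "F (br x y) = su2_matrix ((co b2 x * co b3 y - co b3 x * co b2 y) * (n1 * m1))
       ((co b3 x * co b1 y - co b1 x * co b3 y) * (n2 * m2)) ((co b1 x * co b2 y - co b2 x * co b1 y) * (n3 * m3))"
      unfolding F_def b by (simp add: form_simps co_simps mult_ac)
    then show ?thesis unfolding F_def su2_matrix_commutator m[symmetric] by (simp add: algebra_simps)
  qed
  ultimately show ?thesis unfolding bianchi_IX_def using lin by blast
qed

text \<open>The momentum constraint makes \<open>(u2, u3)\<close> a left eigenvector of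
  \<open>ad b1\<close> on the plane with eigenvalue \<open>- a\<close>, where \<open>a\<close> is
  the trace. The other eigenvalue is therefore \<open>2 * a\<close>, and this ratio of eigenvalues
  means \<open>h = -1/9\<close>.\<close>

lemma bianchi_VI_if_momentum:
  assumes l: "br b1 b2 = l22 *\<^sub>R b2 + l32 *\<^sub>R b3" "br b1 b3 = l23 *\<^sub>R b2 + l33 *\<^sub>R b3" "br b2 b3 = 0"
    and a: "l22 + l33 \<noteq> 0" and t: "t \<in> I"
    and u: "co b1 (\<kappa> t *v b2) \<noteq> 0 \<or> co b1 (\<kappa> t *v b3) \<noteq> 0"
  shows "bianchi_VI (-1/9) br"
proof -
  define a where "a = l22 + l33"
  define u2 u3 where "u2 = co b1 (\<kappa> t *v b2)" and "u3 = co b1 (\<kappa> t *v b3)"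
  have l': "br b2 b1 = - (l22 *\<^sub>R b2 + l32 *\<^sub>R b3)" "br b3 b1 = - (l23 *\<^sub>R b2 + l33 *\<^sub>R b3)" "br b3 b2 = 0"
    by (rule trans[OF br_anti], simp add: l)+
  have H: "trace_map (br b1) = a" "trace_map (br b2) = 0" "trace_map (br b3) = 0"
    unfolding trace_expand[OF linear_br] a_def by (simp_all add: l l' br_self form_simps co_simps)
  have Hx: "trace_map (br x) = a * co b1 x" for x
  proof -
    have "trace_map (br x) = trace_map (br (co b1 x *\<^sub>R b1 + co b2 x *\<^sub>R b2 + co b3 x *\<^sub>R b3))" using expand[of x] by simp
    then show ?thesis by (simp add: linear_add[OF linear_trace_ad] linear_scale[OF linear_trace_ad] H)
  qed
  have lin: "linear (\<lambda>Y. \<kappa> t *v br X Y)" for X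
    using linear_compose[OF linear_br matrix_vector_mul_linear] by (simp add: o_def)
  have mom: "co b1 (\<kappa> t *v br X b1) + co b2 (\<kappa> t *v br X b2) + co b3 (\<kappa> t *v br X b3) = a * co b1 (\<kappa> t *v X)" for X
    using momentum_constraint[OF t, of X] unfolding Hx trace_expand[OF lin] .
  have m2: "- (l22 * u2 + l32 * u3) = a * u2" and m3: "- (l23 * u2 + l33 * u3) = a * u3"
    using mom[of b2] mom[of b3] unfolding u2_def u3_def
    by (simp_all add: l l' br_self matrix_vector_mult_scaleR form_simps linear_neg[OF matrix_vector_mul_linear]
        matrix_vector_right_distrib matrix_vector_mult_diff_distrib inner_diff_right)
  have det: "(l22 + a) * (l33 + a) = l32 * l23"
  proof -
    have e: "(l22 + a) * u2 = - l32 * u3" "(l33 + a) * u3 = - l23 * u2" using m2 m3 by (simp_all add: algebra_simps)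
    have "((l22 + a) * (l33 + a) - l32 * l23) * u2 = 0" "((l22 + a) * (l33 + a) - l32 * l23) * u3 = 0"
    proof -
      have "(l22 + a) * (l33 + a) * u2 = (l33 + a) * (- l32 * u3)" unfolding e(1)[symmetric] by simp
      also have "\<dots> = - l32 * ((l33 + a) * u3)" by simp
      finally show "((l22 + a) * (l33 + a) - l32 * l23) * u2 = 0" unfolding e(2) by (simp add: algebra_simps)
      have "(l22 + a) * (l33 + a) * u3 = (l22 + a) * (- l23 * u2)" unfolding e(2)[symmetric] by simp
      also have "\<dots> = - l23 * ((l22 + a) * u2)" by simp
      finally show "((l22 + a) * (l33 + a) - l32 * l23) * u3 = 0" unfolding e(1) by (simp add: algebra_simps)
    qed
    then show ?thesis using u unfolding u2_def[symmetric] u3_def[symmetric] by auto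
  qed
  have eig: "\<exists>e. e \<noteq> 0 \<and> co b1 e = 0 \<and> br b1 e = \<mu> *\<^sub>R e" if s: "(l22 - \<mu>) * (l33 - \<mu>) = l23 * l32" for \<mu>
  proof -
    obtain x y where xy: "(l22 - \<mu>) * x + l23 * y = 0" "l32 * x + (l33 - \<mu>) * y = 0" "x \<noteq> 0 \<or> y \<noteq> 0"
      using singular_kernel2[OF s] by blast
    define e where "e = x *\<^sub>R b2 + y *\<^sub>R b3"
    have 1: "br b1 e = (l22 * x + l23 * y) *\<^sub>R b2 + (l32 * x + l33 * y) *\<^sub>R b3"
      unfolding e_def by (simp add: br_simps l algebra_simps)
    have 2: "l22 * x + l23 * y = \<mu> * x" "l32 * x + l33 * y = \<mu> * y" using xy by (simp_all add: algebra_simps)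
    have "br b1 e = \<mu> *\<^sub>R e" unfolding 1 2 unfolding e_def by (simp add: algebra_simps)
    moreover have "co b2 e = x" "co b3 e = y" "co b1 e = 0" unfolding e_def by (simp_all add: form_simps co_simps)
    then have "e \<noteq> 0" "co b1 e = 0" using xy(3) by auto
    ultimately show ?thesis by blast
  qed
  obtain e2 where e2: "e2 \<noteq> 0" "co b1 e2 = 0" "br b1 e2 = (- a) *\<^sub>R e2"
    using eig[of "- a"] det by (auto simp: mult.commute)
  have "(l22 - 2 * a) * (l33 - 2 * a) = l23 * l32" using det unfolding a_def by (simp add: algebra_simps)
  then obtain e3 where e3: "e3 \<noteq> 0" "co b1 e3 = 0" "br b1 e3 = (2 * a) *\<^sub>R e3" using eig by blast
  have a0: "a \<noteq> 0" using a unfolding a_def .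
  have comb: "p = 0 \<and> q = 0 \<and> r = 0" if z: "p *\<^sub>R b1 + q *\<^sub>R e2 + r *\<^sub>R e3 = 0" for p q r
  proof -
    have p: "p = 0" using arg_cong[OF z, of "co b1"] e2 e3 by (simp add: form_simps co_simps)
    have s: "q *\<^sub>R e2 + r *\<^sub>R e3 = 0" using z p by simp
    have "br b1 (q *\<^sub>R e2 + r *\<^sub>R e3) + a *\<^sub>R (q *\<^sub>R e2 + r *\<^sub>R e3) = (3 * a * r) *\<^sub>R e3"
      by (simp add: br_simps e2 e3 algebra_simps) (simp flip: scaleR_left_distrib)?
    then have "(3 * a * r) *\<^sub>R e3 = 0" unfolding s by (simp add: br_simps)
    then have "r = 0" using a0 e3 by simp
    then show ?thesis using p s e2 by simp
  qed
  have "br e2 e3 = 0"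
  proof -
    have ex: "e2 = co b2 e2 *\<^sub>R b2 + co b3 e2 *\<^sub>R b3" "e3 = co b2 e3 *\<^sub>R b2 + co b3 e3 *\<^sub>R b3"
      by (rule trans[OF expand], simp add: e2 e3)+
    have "br e2 e3 = br (co b2 e2 *\<^sub>R b2 + co b3 e2 *\<^sub>R b3) (co b2 e3 *\<^sub>R b2 + co b3 e3 *\<^sub>R b3)"
      by (rule arg_cong2[where f=br, OF ex])
    then show ?thesis by (simp add: br_simps br_self l l')
  qed
  note z = this and bs = basis3[OF comb]
  have h: "-1/9 = - ((- a + 2 * a) / (- a - 2 * a))\<^sup>2" using a0 by (simp add: power2_eq_square field_simps)
  have "- a \<noteq> 2 * a" "- a \<noteq> 0" "2 * a \<noteq> 0" using a0 by simp_all
  then show ?thesis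
    unfolding bianchi_VI_def using bs z e2(3) e3(3) h by blast
qed

end

section \<open>Existence of an adapted basis for each remaining type\<close>

lemma orthonormal_completion:
  fixes A :: "real^3^3"
  assumes A: "sym_pos_def A" and v1: "form A v1 v1 = 1"
  obtains v2 v3 where "form A v2 v2 = 1" "form A v3 v3 = 1" "form A v1 v2 = 0" "form A v1 v3 = 0" "form A v2 v3 = 0"
proof -
  define nrm where "nrm v = (1 / sqrt (form A v v)) *\<^sub>R v" for v
  have nrm: "form A (nrm v) (nrm v) = 1" if "v \<noteq> 0" for v
    using form_pos[OF A that] unfolding nrm_def by (simp add: form_simps)
  have nrm0: "form A w (nrm v) = 0" if "form A v w = 0" for v w
    using that form_commute[OF A, of w v] unfolding nrm_def by (simp add: form_simps)
  obtain w where w: "w \<noteq> 0" "form A w v1 = 0" using form_orthogonal_exists by blast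
  obtain w' where w': "w' \<noteq> 0" "form A w' v1 = 0" "form A w' (nrm w) = 0" using form_orthogonal_exists by blast
  show ?thesis by (rule that[of "nrm w" "nrm w'"]) (intro nrm w w' nrm0)+
qed

text \<open>The alternatives in \<open>types\<close>: \<open>ad b1\<close> vanishes on the plane
  (types I and II); abelian plane and positive trace (the nonunimodular types); abelian plane and
  trace zero (VI and VII with \<open>h = 0\<close>, the flow also allowing degenerate matrices); and
  type VIII, where \<open>b1\<close> carries the structure constant of the odd sign.\<close>

locale adapted = orthonormal_at +
  fixes l22 l32 l23 l33 c :: real
  assumes brackets: "br b1 b2 = l22 *\<^sub>R b2 + l32 *\<^sub>R b3" "br b1 b3 = l23 *\<^sub>R b2 + l33 *\<^sub>R b3" "br b2 b3 = c *\<^sub>R b1"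
    and block: "t \<in> I \<Longrightarrow> form (g t) b1 b2 = 0" "t \<in> I \<Longrightarrow> form (g t) b1 b3 = 0"
    and types: "(l22 = 0 \<and> l32 = 0 \<and> l23 = 0 \<and> l33 = 0) \<or> (c = 0 \<and> l22 + l33 > 0) \<or> (c = 0 \<and> l22 + l33 = 0)
      \<or> (l22 = 0 \<and> l33 = 0 \<and> c * l32 < 0 \<and> c * l23 > 0)"

context orthonormal_at begin

text \<open>The trace form of \<open>ad\<close> kills all brackets, and its kernel is the plane of
  \<open>b2\<close> and \<open>b3\<close>; so brackets lie in the plane, and vanishing traces of
  \<open>ad b2\<close> and \<open>ad b3\<close> force \<open>[b2, b3] = 0\<close>. The momentum
  constraint then makes the plane invariant under \<open>\<kappa>\<close>, unless the type is the
  exceptional one.\<close>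

lemma adapted_nonunimodular:
  assumes H: "trace_map (br b1) > 0" "trace_map (br b2) = 0" "trace_map (br b3) = 0"
    and VI: "\<not> bianchi_VI (-1/9) br"
  shows "\<exists>l22 l32 l23 l33 c. adapted br I g \<phi> t0 b1 b2 b3 l22 l32 l23 l33 c"
proof -
  have Hx: "trace_map (br x) = trace_map (br b1) * co b1 x" for x
  proof -
    have "trace_map (br x) = trace_map (br (co b1 x *\<^sub>R b1 + co b2 x *\<^sub>R b2 + co b3 x *\<^sub>R b3))"
      by (rule arg_cong[where f="\<lambda>x. trace_map (br x)", OF expand])
    then show ?thesis by (simp add: linear_add[OF linear_trace_ad] linear_scale[OF linear_trace_ad] H)
  qed
  have no1: "co b1 (br x y) = 0" for x y
    using trace_ad_commutator[of x y] H(1) unfolding Hx[of "br x y"] by simp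
  have e: "br x y = co b2 (br x y) *\<^sub>R b2 + co b3 (br x y) *\<^sub>R b3" for x y
    by (rule trans[OF expand]) (simp add: no1)
  have "co b3 (br b2 b3) = 0" "co b2 (br b3 b2) = 0"
    using H(2,3) unfolding trace_expand[OF linear_br] by (simp_all add: no1 br_self form_simps)
  then have "co b3 (br b2 b3) = 0" "co b2 (br b2 b3) = 0"
    using br_anti[of b2 b3] by (simp_all add: form_simps)
  then have b23: "br b2 b3 = 0" using e[of b2 b3] by (metis add.right_neutral scaleR_zero_left)
  let ?l22 = "co b2 (br b1 b2)" and ?l32 = "co b3 (br b1 b2)" and ?l23 = "co b2 (br b1 b3)" and ?l33 = "co b3 (br b1 b3)"
  have tr: "?l22 + ?l33 > 0" using H(1) unfolding trace_expand[OF linear_br] by (simp add: br_self form_simps)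
  have "co b1 (\<kappa> t *v b2) = 0 \<and> co b1 (\<kappa> t *v b3) = 0" if "t \<in> I" for t
    using bianchi_VI_if_momentum[OF e e b23 _ that] tr VI by force
  from block_if_plane_invariant[OF this]
  have "adapted br I g \<phi> t0 b1 b2 b3 ?l22 ?l32 ?l23 ?l33 0"
    using e[of b1 b2] e[of b1 b3] b23 tr by unfold_locales auto
  then show ?thesis by blast
qed

text \<open>Milnor's description of unimodular algebras: the bracket is \<open>N\<close> applied to
  the cross product \<open>cr\<close>, and vanishing of all traces of \<open>ad\<close> says that
  \<open>N\<close> is self-adjoint. An orthonormal eigenbasis of \<open>N\<close> diagonalizes the
  bracket.\<close>

lemma diagonal_basis_exists:
  assumes H: "\<And>x. trace_map (br x) = 0"
  shows "\<exists>v1 v2 v3 n1 n2 n3. orthonormal_at br I g \<phi> t0 v1 v2 v3 \<and>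
    br v2 v3 = n1 *\<^sub>R v1 \<and> br v3 v1 = n2 *\<^sub>R v2 \<and> br v1 v2 = n3 *\<^sub>R v3"
proof -
  define N where "N x = co b1 x *\<^sub>R br b2 b3 + co b2 x *\<^sub>R br b3 b1 + co b3 x *\<^sub>R br b1 b2" for x
  define cr where "cr x y = (co b2 x * co b3 y - co b3 x * co b2 y) *\<^sub>R b1
    + (co b3 x * co b1 y - co b1 x * co b3 y) *\<^sub>R b2 + (co b1 x * co b2 y - co b2 x * co b1 y) *\<^sub>R b3" for x y
  have linN: "linear N" unfolding N_def by (rule linearI) (simp_all add: form_simps algebra_simps)
  have b': "br b3 b2 = - br b2 b3" "br b1 b3 = - br b3 b1" "br b2 b1 = - br b1 b2" by (rule br_anti)+
  have brN: "br x y = N (cr x y)" for x y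
  proof -
    have "br x y = br (co b1 x *\<^sub>R b1 + co b2 x *\<^sub>R b2 + co b3 x *\<^sub>R b3) (co b1 y *\<^sub>R b1 + co b2 y *\<^sub>R b2 + co b3 y *\<^sub>R b3)"
      by (rule arg_cong2[where f=br, OF expand expand])
    also have "\<dots> = N (cr x y)"
      unfolding N_def cr_def by (simp add: br_simps br_self b' form_simps co_simps algebra_simps)
    finally show ?thesis .
  qed
  have form_co: "form (g t0) x y = co b1 x * co b1 y + co b2 x * co b2 y + co b3 x * co b3 y" for x y
  proof -
    have "form (g t0) x y = form (g t0) (co b1 x *\<^sub>R b1 + co b2 x *\<^sub>R b2 + co b3 x *\<^sub>R b3) y"
      by (rule arg_cong[where f="\<lambda>x. form (g t0) x y", OF expand])
    then show ?thesis by (simp add: form_simps)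
  qed
  have sym: "co b2 (br b2 b3) = co b1 (br b3 b1)" "co b3 (br b2 b3) = co b1 (br b1 b2)" "co b3 (br b3 b1) = co b2 (br b1 b2)"
    using H[of b1] H[of b2] H[of b3] unfolding trace_expand[OF linear_br]
    by (simp_all add: br_self b' form_simps)
  have sa: "form (g t0) (N x) y = form (g t0) x (N y)" for x y
    unfolding form_co[of "N x" y] form_co[of x "N y"] unfolding N_def by (simp add: form_simps sym algebra_simps)
  obtain v1 v2 v3 \<mu>1 \<mu>2 \<mu>3 where v:
    "form (g t0) v1 v1 = 1" "form (g t0) v2 v2 = 1" "form (g t0) v3 v3 = 1"
    "form (g t0) v1 v2 = 0" "form (g t0) v1 v3 = 0" "form (g t0) v2 v3 = 0"
    "N v1 = \<mu>1 *\<^sub>R v1" "N v2 = \<mu>2 *\<^sub>R v2" "N v3 = \<mu>3 *\<^sub>R v3"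
    by (rule self_adjoint_eigenbasis[OF spd[OF t0] linN sa])
  have ex: "x = form (g t0) v1 x *\<^sub>R v1 + form (g t0) v2 x *\<^sub>R v2 + form (g t0) v3 x *\<^sub>R v3" for x
    by (rule form_orthonormal_expansion(1)[OF spd[OF t0] v(1-6)])
  have z: "form (g t0) x (cr x y) = 0" "form (g t0) y (cr x y) = 0" for x y
    unfolding form_co[of x "cr x y"] form_co[of y "cr x y"] unfolding cr_def by (simp_all add: form_simps co_simps algebra_simps)
  have "cr v2 v3 = form (g t0) v1 (cr v2 v3) *\<^sub>R v1" "cr v3 v1 = form (g t0) v2 (cr v3 v1) *\<^sub>R v2"
    "cr v1 v2 = form (g t0) v3 (cr v1 v2) *\<^sub>R v3"
    by (rule trans[OF ex], simp add: z)+
  then obtain d1 d2 d3 where d: "cr v2 v3 = d1 *\<^sub>R v1" "cr v3 v1 = d2 *\<^sub>R v2" "cr v1 v2 = d3 *\<^sub>R v3" by blast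
  have "br v2 v3 = (d1 * \<mu>1) *\<^sub>R v1" "br v3 v1 = (d2 * \<mu>2) *\<^sub>R v2" "br v1 v2 = (d3 * \<mu>3) *\<^sub>R v3"
    unfolding brN d linear_scale[OF linN] v(7-9) by simp_all
  moreover have "orthonormal_at br I g \<phi> t0 v1 v2 v3"
    by unfold_locales (use t0 v in auto)
  ultimately show ?thesis by blast
qed

text \<open>The index 1 is the distinguished one. If only \<open>n1\<close> vanishes, the momentum
  constraint makes the plane invariant under \<open>\<kappa>\<close>; if only \<open>n1\<close> is
  nonzero, it makes the line invariant; otherwise the signs are those of type VIII.\<close>

lemma adapted_diagonal:
  assumes n: "br b2 b3 = n1 *\<^sub>R b1" "br b3 b1 = n2 *\<^sub>R b2" "br b1 b2 = n3 *\<^sub>R b3"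
    and cases: "(n1 = 0 \<and> n2 \<noteq> 0 \<and> n3 \<noteq> 0) \<or> (n1 \<noteq> 0 \<and> n2 = 0 \<and> n3 = 0) \<or> (n1 * n2 < 0 \<and> n1 * n3 < 0)"
  shows "\<exists>l22 l32 l23 l33 c. adapted br I g \<phi> t0 b1 b2 b3 l22 l32 l23 l33 c"
proof -
  have bl: "form (g t) b1 b2 = 0 \<and> form (g t) b1 b3 = 0" if t: "t \<in> I" for t
    using cases
  proof (elim disjE conjE)
    assume z: "n1 = 0" "n2 \<noteq> 0" "n3 \<noteq> 0"
    show ?thesis by (rule block_if_plane_invariant[OF _ t]) (use momentum_diagonal(2,3)[OF n] z in simp)
  next
    assume z: "n1 \<noteq> 0" "n2 = 0" "n3 = 0"
    show ?thesis by (rule block_if_line_invariant[OF _ t]) (use momentum_diagonal(2,3)[OF n] z in simp)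
  next
    assume "n1 * n2 < 0" "n1 * n3 < 0"
    from block_type_VIII[OF n this t] show ?thesis .
  qed
  have "br b1 b3 = - n2 *\<^sub>R b2" by (rule trans[OF br_anti]) (simp add: n)
  then have "adapted br I g \<phi> t0 b1 b2 b3 0 n3 (- n2) 0 n1"
    using bl n cases by unfold_locales auto
  then show ?thesis by blast
qed

end

context solution begin

text \<open>For type I the momentum constraint is void. Instead the basis diagonalizes
  \<open>\<kappa>\<close> at \<open>t0\<close>, and the evolution equation without curvature merely
  rescales \<open>\<kappa>\<close>.\<close>

lemma adapted_abelian:
  assumes t0: "t0 \<in> I" and ab: "\<And>x y. br x y = 0"
  shows "\<exists>b1 b2 b3 l22 l32 l23 l33 c. adapted br I g \<phi> t0 b1 b2 b3 l22 l32 l23 l33 c"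
proof -
  obtain v1 v2 v3 \<mu>1 \<mu>2 \<mu>3 where v:
    "form (g t0) v1 v1 = 1" "form (g t0) v2 v2 = 1" "form (g t0) v3 v3 = 1"
    "form (g t0) v1 v2 = 0" "form (g t0) v1 v3 = 0" "form (g t0) v2 v3 = 0"
    "\<kappa> t0 *v v1 = \<mu>1 *\<^sub>R v1" "\<kappa> t0 *v v2 = \<mu>2 *\<^sub>R v2" "\<kappa> t0 *v v3 = \<mu>3 *\<^sub>R v3"
    by (rule self_adjoint_eigenbasis[OF spd[OF t0] matrix_vector_mul_linear \<kappa>_self_adjoint[OF t0]])
  interpret o: orthonormal_at br I g \<phi> t0 v1 v2 v3 by unfold_locales (use t0 v in auto)
  have \<Gamma>0: "\<Gamma> t x y = 0" if t: "t \<in> I" for t x y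
    by (rule form_ext[OF t]) (use koszul_\<Gamma>[OF t, of x y] in \<open>simp add: ab\<close>)
  have "ric t x y = 0" if t: "t \<in> I" for t x y unfolding ric_def \<Gamma>0[OF t] by simp
  then have dk: "d\<kappa> t *v x = - \<theta> t *\<^sub>R (\<kappa> t *v x)" if t: "t \<in> I" for t x
    by (intro form_ext[OF t])
      (use evolution[OF t, of _ x] that in \<open>simp add: form_commute[OF spd[OF t], of "_ *v _"] form_simps\<close>)
  have line: "o.co v2 (\<kappa> t *v v1) = 0 \<and> o.co v3 (\<kappa> t *v v1) = 0" if t: "t \<in> I" for t
  proof (rule linear_system_zero[where f="\<lambda>s. o.co v2 (\<kappa> s *v v1)" and h="\<lambda>s. o.co v3 (\<kappa> s *v v1)"])
    fix s assume "s \<in> closed_segment t0 t"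
    then have s: "s \<in> I" using o.segment_sub[OF t] by blast
    show "((\<lambda>s. o.co v2 (\<kappa> s *v v1)) has_real_derivative
        (- \<theta> s) * o.co v2 (\<kappa> s *v v1) + 0 * o.co v3 (\<kappa> s *v v1)) (at s)"
      using \<kappa>_form_deriv[OF s, where A="g t0" and x=v2 and y=v1] unfolding dk[OF s] by (simp add: form_simps)
    show "((\<lambda>s. o.co v3 (\<kappa> s *v v1)) has_real_derivative
        0 * o.co v2 (\<kappa> s *v v1) + (- \<theta> s) * o.co v3 (\<kappa> s *v v1)) (at s)"
      using \<kappa>_form_deriv[OF s, where A="g t0" and x=v3 and y=v1] unfolding dk[OF s] by (simp add: form_simps)
  next
    have "continuous_on (closed_segment t0 t) \<theta>"
      by (intro continuous_at_imp_continuous_on ballI DERIV_isCont[OF \<theta>_deriv]) (use o.segment_sub[OF t] in blast)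
    then show "continuous_on (closed_segment t0 t) (\<lambda>s. - \<theta> s)" "continuous_on (closed_segment t0 t) (\<lambda>s. - \<theta> s)"
      by (auto intro: continuous_intros)
  qed (auto simp: v(7) form_simps o.co_simps)
  have "adapted br I g \<phi> t0 v1 v2 v3 0 0 0 0 0"
    using o.block_if_line_invariant[OF line] by unfold_locales (auto simp: ab)
  then show ?thesis by blast
qed

lemma adapted_exists:
  assumes t0: "t0 \<in> I" and IX: "\<not> bianchi_IX br" and VI: "\<not> bianchi_VI (-1/9) br"
  shows "\<exists>b1 b2 b3 l22 l32 l23 l33 c. adapted br I g \<phi> t0 b1 b2 b3 l22 l32 l23 l33 c"
proof (cases "\<forall>x. trace_map (br x) = 0")
  case False
  then obtain x0 where x0: "trace_map (br x0) \<noteq> 0" by blast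
  \<comment> \<open>The vector dual to the trace form with respect to the metric at
    \<open>t0\<close>; its normalization serves as \<open>b1\<close>.\<close>
  define n where "n = matrix_inv (g t0) *v (\<chi> c. trace_map (br (axis c 1)))"
  have n: "form (g t0) n x = trace_map (br x)" for x
  proof -
    have "form (g t0) n x = form (g t0) x n" by (rule form_commute[OF spd[OF t0]])
    also have "\<dots> = x \<bullet> (\<chi> c. trace_map (br (axis c 1)))"
      unfolding n_def by (simp add: matrix_vector_mul_assoc sym_pos_def_inverse[OF spd[OF t0]])
    also have "\<dots> = (\<Sum>c\<in>UNIV. trace_map (br (x $ c *\<^sub>R axis c 1)))"
      by (simp add: inner_vec_def linear_scale[OF linear_trace_ad])
    also have "\<dots> = trace_map (br (\<Sum>c\<in>UNIV. x $ c *\<^sub>R axis c 1))"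
      using linear_sum[OF linear_trace_ad] by metis
    also have "(\<Sum>c\<in>UNIV. x $ c *\<^sub>R axis c 1) = x" using basis_expansion[of x] by (simp add: scalar_mult_eq_scaleR)
    finally show ?thesis .
  qed
  have "n \<noteq> 0" using n[of x0] x0 by (auto simp: form_simps)
  then have nn: "0 < form (g t0) n n" by (rule form_pos[OF spd[OF t0]])
  define b1 where "b1 = (1 / sqrt (form (g t0) n n)) *\<^sub>R n"
  have b1: "form (g t0) b1 b1 = 1" unfolding b1_def using nn by (simp add: form_simps)
  obtain b2 b3 where b: "form (g t0) b2 b2 = 1" "form (g t0) b3 b3 = 1" "form (g t0) b1 b2 = 0" "form (g t0) b1 b3 = 0" "form (g t0) b2 b3 = 0"
    using orthonormal_completion[OF spd[OF t0] b1] by blast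
  interpret o: orthonormal_at br I g \<phi> t0 b1 b2 b3 by unfold_locales (use t0 b1 b in auto)
  have tr: "trace_map (br x) = sqrt (form (g t0) n n) * form (g t0) b1 x" for x
    unfolding n[symmetric] b1_def using nn by (simp add: form_simps)
  show ?thesis
    using o.adapted_nonunimodular[OF _ _ _ VI] nn b1 b unfolding tr by (metis mult.right_neutral mult_zero_right real_sqrt_gt_zero)
next
  case True
  then have H: "trace_map (br x) = 0" for x by blast
  show ?thesis
  proof (cases "\<forall>x y. br x y = 0")
    case True
    then show ?thesis using adapted_abelian[OF t0] by blast
  next
    case False
    have "\<exists>v1. form (g t0) v1 v1 = 1"
    proof -
      define a where "a = form (g t0) (axis 1 1) (axis 1 1)"
      have "0 < a" unfolding a_def by (rule form_pos[OF spd[OF t0]]) (simp add: axis_eq_0_iff)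
      then have "form (g t0) ((1 / sqrt a) *\<^sub>R axis 1 1) ((1 / sqrt a) *\<^sub>R axis 1 1) = 1"
        by (simp add: form_simps a_def[symmetric])
      then show ?thesis by blast
    qed
    then obtain u1 where u1: "form (g t0) u1 u1 = 1" by blast
    obtain u2 u3 where u: "form (g t0) u2 u2 = 1" "form (g t0) u3 u3 = 1" "form (g t0) u1 u2 = 0" "form (g t0) u1 u3 = 0" "form (g t0) u2 u3 = 0"
      using orthonormal_completion[OF spd[OF t0] u1] by blast
    interpret u: orthonormal_at br I g \<phi> t0 u1 u2 u3 by unfold_locales (use t0 u1 u in auto)
    obtain v1 v2 v3 n1 n2 n3 where o: "orthonormal_at br I g \<phi> t0 v1 v2 v3"
      and n: "br v2 v3 = n1 *\<^sub>R v1" "br v3 v1 = n2 *\<^sub>R v2" "br v1 v2 = n3 *\<^sub>R v3"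
      using u.diagonal_basis_exists[OF H] by blast
    interpret v: orthonormal_at br I g \<phi> t0 v1 v2 v3 by (rule o)
    have o2: "orthonormal_at br I g \<phi> t0 v2 v3 v1" and o3: "orthonormal_at br I g \<phi> t0 v3 v1 v2"
      by (unfold_locales; use t0 v.co_simps in simp)+
    have "\<not> (n1 * n2 > 0 \<and> n1 * n3 > 0)" using v.bianchi_IX_if_definite[OF n] IX by blast
    moreover have "\<not> (n1 = 0 \<and> n2 = 0 \<and> n3 = 0)"
    proof
      assume z: "n1 = 0 \<and> n2 = 0 \<and> n3 = 0"
      have "br x y = 0" for x y
      proof -
        have n': "br v3 v2 = 0" "br v1 v3 = 0" "br v2 v1 = 0" by (rule trans[OF br_anti], simp add: n z)+
        have "br x y = br (v.co v1 x *\<^sub>R v1 + v.co v2 x *\<^sub>R v2 + v.co v3 x *\<^sub>R v3) (v.co v1 y *\<^sub>R v1 + v.co v2 y *\<^sub>R v2 + v.co v3 y *\<^sub>R v3)"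
          by (rule arg_cong2[where f=br, OF v.expand v.expand])
        then show ?thesis by (simp add: br_simps br_self n n' z)
      qed
      then show False using \<open>\<not> (\<forall>x y. br x y = 0)\<close> by blast
    qed
    \<comment> \<open>Neither all zero nor all of one strict sign: some index is then the only zero,
      the only nonzero, or the only one of its sign. Cyclic relabelling, which preserves the form of
      the brackets, makes it the first.\<close>
    ultimately consider
        "(n1 = 0 \<and> n2 \<noteq> 0 \<and> n3 \<noteq> 0) \<or> (n1 \<noteq> 0 \<and> n2 = 0 \<and> n3 = 0) \<or> (n1 * n2 < 0 \<and> n1 * n3 < 0)"
      | "(n2 = 0 \<and> n3 \<noteq> 0 \<and> n1 \<noteq> 0) \<or> (n2 \<noteq> 0 \<and> n3 = 0 \<and> n1 = 0) \<or> (n2 * n3 < 0 \<and> n2 * n1 < 0)"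
      | "(n3 = 0 \<and> n1 \<noteq> 0 \<and> n2 \<noteq> 0) \<or> (n3 \<noteq> 0 \<and> n1 = 0 \<and> n2 = 0) \<or> (n3 * n1 < 0 \<and> n3 * n2 < 0)"
      by (cases n1 "0::real" rule: linorder_cases; cases n2 "0::real" rule: linorder_cases; cases n3 "0::real" rule: linorder_cases)
        (auto simp: mult_less_0_iff zero_less_mult_iff)
    then show ?thesis
    proof cases
      case 1 then show ?thesis using v.adapted_diagonal[OF n] by blast
    next
      case 2
      interpret w: orthonormal_at br I g \<phi> t0 v2 v3 v1 by (rule o2)
      show ?thesis using w.adapted_diagonal[OF n(2,3,1) 2] by blast
    next
      case 3
      interpret w: orthonormal_at br I g \<phi> t0 v3 v1 v2 by (rule o3)
      show ?thesis using w.adapted_diagonal[OF n(3,1,2) 3] by blast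
    qed
  qed
qed

section \<open>The frame equations\<close>

text \<open>One computation serves all types. The hypothesis \<open>Na\<close> is the Jacobi
  identity for these brackets.\<close>

lemma ric_frame:
  assumes t: "t \<in> I"
    and n: "form (g t) E1 E1 = 1" "form (g t) E2 E2 = 1" "form (g t) E3 E3 = 1"
    and o: "form (g t) E1 E2 = 0" "form (g t) E1 E3 = 0" "form (g t) E2 E3 = 0"
    and br: "br E1 E2 = m22 *\<^sub>R E2 + m32 *\<^sub>R E3" "br E1 E3 = m23 *\<^sub>R E2 + m33 *\<^sub>R E3" "br E2 E3 = N *\<^sub>R E1"
    and Na: "N * (m22 + m33) = 0"
  shows "ric t E1 E1 = - (m22\<^sup>2 + m33\<^sup>2 + (m23 + m32)\<^sup>2 / 2) + N\<^sup>2 / 2"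
    and "ric t E2 E2 = - ((m32 - m23 - N) * (m23 + m32) / 2) - (m22 + m33) * m22 + (m32 - m23) / 2 * N - N\<^sup>2 / 2"
    and "ric t E3 E3 = (m32 - m23 - N) * (m23 + m32) / 2 - (m22 + m33) * m33 + (m32 - m23) / 2 * N - N\<^sup>2 / 2"
    and "ric t E2 E3 = (m32 - m23 - N) / 2 * (m22 - m33) - (m22 + m33) * (m23 + m32) / 2"
proof -
  have o': "form (g t) E2 E1 = 0" "form (g t) E3 E1 = 0" "form (g t) E3 E2 = 0"
    by (subst form_commute[OF spd[OF t]], fact o)+
  have br': "br E2 E1 = - (m22 *\<^sub>R E2 + m32 *\<^sub>R E3)" "br E3 E1 = - (m23 *\<^sub>R E2 + m33 *\<^sub>R E3)" "br E3 E2 = - (N *\<^sub>R E1)"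
    by (rule trans[OF br_anti], simp add: br)+
  have half: "form (g t) Z (\<Gamma> t X Y) = (form (g t) (br X Y) Z - form (g t) (br X Z) Y - form (g t) (br Y Z) X) / 2" for X Y Z
    using koszul_\<Gamma>[OF t, of X Y Z] form_commute[OF spd[OF t], of Z "\<Gamma> t X Y"] by simp
  have ex: "x = form (g t) E1 x *\<^sub>R E1 + form (g t) E2 x *\<^sub>R E2 + form (g t) E3 x *\<^sub>R E3" for x
    by (rule form_orthonormal_expansion(1)[OF spd[OF t] n o])
  note simps = half br br' br_self form_simps n o o'
  have G: "\<Gamma> t E1 E1 = 0" "\<Gamma> t E1 E2 = ((m32 - m23 - N) / 2) *\<^sub>R E3" "\<Gamma> t E1 E3 = - ((m32 - m23 - N) / 2) *\<^sub>R E2"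
    "\<Gamma> t E2 E1 = - m22 *\<^sub>R E2 - ((m23 + m32 + N) / 2) *\<^sub>R E3" "\<Gamma> t E3 E1 = - ((m23 + m32 - N) / 2) *\<^sub>R E2 - m33 *\<^sub>R E3"
    "\<Gamma> t E2 E2 = m22 *\<^sub>R E1" "\<Gamma> t E2 E3 = ((m23 + m32 + N) / 2) *\<^sub>R E1"
    "\<Gamma> t E3 E2 = ((m23 + m32 - N) / 2) *\<^sub>R E1" "\<Gamma> t E3 E3 = m33 *\<^sub>R E1"
    by (rule trans[OF ex], simp add: simps, (simp add: algebra_simps add_divide_distrib diff_divide_distrib)?)+
  have lin: "linear (\<lambda>X. \<Gamma> t X (\<Gamma> t Y Z) - \<Gamma> t Y (\<Gamma> t X Z) - \<Gamma> t (br X Y) Z)" for Y Z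
    by (rule linearI) (simp_all add: \<Gamma>_simps[OF t] br_simps algebra_simps)
  note ricE = ric_eq_trace trace_map_orthonormal[OF spd[OF t] lin n o]
  have NN: "N * m33 = - (N * m22)" using Na by (simp add: algebra_simps)
  show "ric t E1 E1 = - (m22\<^sup>2 + m33\<^sup>2 + (m23 + m32)\<^sup>2 / 2) + N\<^sup>2 / 2"
    unfolding ricE by (simp add: G br br' br_self \<Gamma>_simps[OF t] form_simps n o o') (simp add: field_simps power2_eq_square)
  show "ric t E2 E2 = - ((m32 - m23 - N) * (m23 + m32) / 2) - (m22 + m33) * m22 + (m32 - m23) / 2 * N - N\<^sup>2 / 2"
    unfolding ricE by (simp add: G br br' br_self \<Gamma>_simps[OF t] form_simps n o o') (simp add: field_simps power2_eq_square)
  show "ric t E3 E3 = (m32 - m23 - N) * (m23 + m32) / 2 - (m22 + m33) * m33 + (m32 - m23) / 2 * N - N\<^sup>2 / 2"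
    unfolding ricE by (simp add: G br br' br_self \<Gamma>_simps[OF t] form_simps n o o') (simp add: field_simps power2_eq_square)
  show "ric t E2 E3 = (m32 - m23 - N) / 2 * (m22 - m33) - (m22 + m33) * (m23 + m32) / 2"
    unfolding ricE using NN by (simp add: G br br' br_self \<Gamma>_simps[OF t] form_simps n o o') (simp add: field_simps power2_eq_square)
qed

lemma form_\<kappa>_deriv:
  assumes t: "t \<in> I"
  shows "((\<lambda>s. form (g s) X (\<kappa> s *v Y)) has_real_derivative
    2 * form (g t) (\<kappa> t *v X) (\<kappa> t *v Y) - ric t X Y - \<theta> t * form (g t) X (\<kappa> t *v Y)) (at t)"
proof -
  have 1: "((\<lambda>s. form (g s) X (\<kappa> s *v Y)) has_real_derivative
      form (dg t) X (\<kappa> t *v Y) + form (g t) X (d\<kappa> t *v Y)) (at t)"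
    unfolding inner_vec_def matrix_vector_mult_def
    by (auto intro!: derivative_eq_intros g_deriv[OF t] \<kappa>_deriv[OF t]
        simp: sum.distrib sum_distrib_left algebra_simps)
  have "form (g t) (\<kappa> t *v X) (\<kappa> t *v Y) = form ((1/2) *\<^sub>R dg t) X (\<kappa> t *v Y)"
    unfolding \<kappa>_self_adjoint[OF t] by (rule form_\<kappa>[OF t])
  then have "form (dg t) X (\<kappa> t *v Y) = 2 * form (g t) (\<kappa> t *v X) (\<kappa> t *v Y)"
    by (simp add: scaleR_matrix_vector_assoc[symmetric])
  then show ?thesis by (intro DERIV_cong[OF 1]) (simp add: evolution[OF t])
qed

lemma moving_form_\<kappa>_deriv:
  assumes t: "t \<in> I" and X: "(X has_vector_derivative X') (at t)" and Y: "(Y has_vector_derivative Y') (at t)"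
  shows "((\<lambda>s. form (g s) (X s) (\<kappa> s *v Y s)) has_real_derivative
    2 * form (g t) (\<kappa> t *v X t) (\<kappa> t *v Y t) - ric t (X t) (Y t) - \<theta> t * form (g t) (X t) (\<kappa> t *v Y t)
    + form (g t) X' (\<kappa> t *v Y t) + form (g t) (X t) (\<kappa> t *v Y')) (at t)"
proof -
  have c: "((\<lambda>s. X s $ i) has_real_derivative X' $ i) (at t)" "((\<lambda>s. Y s $ i) has_real_derivative Y' $ i) (at t)" for i
    using bounded_linear.has_vector_derivative[OF bounded_linear_vec_nth[of i] X]
      bounded_linear.has_vector_derivative[OF bounded_linear_vec_nth[of i] Y]
    unfolding has_real_derivative_iff_has_vector_derivative by simp_all
  have 1: "((\<lambda>s. form (g s) (X s) (\<kappa> s *v Y s)) has_real_derivative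
      form (dg t) (X t) (\<kappa> t *v Y t) + form (g t) (X t) (d\<kappa> t *v Y t)
      + form (g t) X' (\<kappa> t *v Y t) + form (g t) (X t) (\<kappa> t *v Y')) (at t)"
    unfolding inner_vec_def matrix_vector_mult_def
    by (auto intro!: derivative_eq_intros g_deriv[OF t] \<kappa>_deriv[OF t] c
        simp: sum.distrib sum_distrib_left algebra_simps)
  have 2: "((\<lambda>s. form (g s) (X t) (\<kappa> s *v Y t)) has_real_derivative
      form (dg t) (X t) (\<kappa> t *v Y t) + form (g t) (X t) (d\<kappa> t *v Y t)) (at t)"
    unfolding inner_vec_def matrix_vector_mult_def
    by (auto intro!: derivative_eq_intros g_deriv[OF t] \<kappa>_deriv[OF t]
        simp: sum.distrib sum_distrib_left algebra_simps)
  show ?thesis by (rule DERIV_cong[OF 1]) (use DERIV_unique[OF 2 form_\<kappa>_deriv[OF t, of "X t" "Y t"]] in simp)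
qed

end

section \<open>The triangular orthonormal frame and its equations\<close>

context adapted begin

text \<open>The square root for \<open>b1\<close> and the Cholesky factors \<open>f1\<close>,
  \<open>f2\<close>, \<open>f3\<close> of the plane metric. \<open>E1\<close>, \<open>E2\<close>,
  \<open>E3\<close> is the Gram-Schmidt frame in which \<open>b2 = f1 E2\<close> and
  \<open>b3 = f2 E2 + f3 E3\<close>.\<close>

definition fe where "fe t = sqrt (form (g t) b1 b1)"
definition f1 where "f1 t = sqrt (form (g t) b2 b2)"
definition f2 where "f2 t = form (g t) b2 b3 / f1 t"
definition f3 where "f3 t = sqrt (form (g t) b3 b3 - (f2 t)\<^sup>2)"
definition E1 where "E1 t = (1 / fe t) *\<^sub>R b1"
definition E2 where "E2 t = (1 / f1 t) *\<^sub>R b2"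
definition E3 where "E3 t = (1 / f3 t) *\<^sub>R (b3 - (f2 t / f1 t) *\<^sub>R b2)"

lemma b_nz: "b1 \<noteq> 0" "b2 \<noteq> 0" "b3 - r *\<^sub>R b2 \<noteq> 0"
proof -
  show "b1 \<noteq> 0" "b2 \<noteq> 0" using nrm by auto
  show "b3 - r *\<^sub>R b2 \<noteq> 0"
  proof
    assume "b3 - r *\<^sub>R b2 = 0"
    from arg_cong[OF this, of "co b3"] show False by (simp add: form_simps co_simps)
  qed
qed

lemma frame_pos:
  assumes t: "t \<in> I"
  shows "0 < fe t" "0 < f1 t" "0 < f3 t"
    and "form (g t) b1 b1 = (fe t)\<^sup>2" "form (g t) b2 b2 = (f1 t)\<^sup>2" "form (g t) b2 b3 = f1 t * f2 t"
    and "form (g t) b3 b3 = (f2 t)\<^sup>2 + (f3 t)\<^sup>2"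
proof -
  have p: "0 < form (g t) b1 b1" "0 < form (g t) b2 b2" using form_pos[OF spd[OF t]] b_nz by auto
  then show e: "0 < fe t" "0 < f1 t" "form (g t) b1 b1 = (fe t)\<^sup>2" "form (g t) b2 b2 = (f1 t)\<^sup>2"
    unfolding fe_def f1_def by simp_all
  then show e23: "form (g t) b2 b3 = f1 t * f2 t" unfolding f2_def by simp
  have "0 < form (g t) (b3 - (f2 t / f1 t) *\<^sub>R b2) (b3 - (f2 t / f1 t) *\<^sub>R b2)"
    by (rule form_pos[OF spd[OF t] b_nz(3)])
  also have "\<dots> = form (g t) b3 b3 - (f2 t)\<^sup>2"
    using e(2) e23 e(4) form_commute[OF spd[OF t], of b3 b2]
    by (simp add: form_simps power2_eq_square field_simps)
  finally have "0 < form (g t) b3 b3 - (f2 t)\<^sup>2" .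
  then show "0 < f3 t" "form (g t) b3 b3 = (f2 t)\<^sup>2 + (f3 t)\<^sup>2" unfolding f3_def by simp_all
qed

lemma b_frame: "t \<in> I \<Longrightarrow> b1 = fe t *\<^sub>R E1 t" "t \<in> I \<Longrightarrow> b2 = f1 t *\<^sub>R E2 t"
  "t \<in> I \<Longrightarrow> b3 = f2 t *\<^sub>R E2 t + f3 t *\<^sub>R E3 t"
  using frame_pos(1-3)[of t] unfolding E1_def E2_def E3_def by (simp_all add: algebra_simps)

lemma E_orthonormal:
  assumes t: "t \<in> I"
  shows "form (g t) (E1 t) (E1 t) = 1" "form (g t) (E2 t) (E2 t) = 1" "form (g t) (E3 t) (E3 t) = 1"
    "form (g t) (E1 t) (E2 t) = 0" "form (g t) (E1 t) (E3 t) = 0" "form (g t) (E2 t) (E3 t) = 0"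
    "form (g t) (E2 t) (E1 t) = 0" "form (g t) (E3 t) (E1 t) = 0" "form (g t) (E3 t) (E2 t) = 0"
proof -
  have c: "form (g t) b3 b2 = f1 t * f2 t" using form_commute[OF spd[OF t], of b3 b2] frame_pos(6)[OF t] by simp
  note simps = E1_def E2_def E3_def form_simps frame_pos(4-7)[OF t] block[OF t] c
  show o: "form (g t) (E1 t) (E2 t) = 0" "form (g t) (E1 t) (E3 t) = 0" "form (g t) (E2 t) (E3 t) = 0"
    and "form (g t) (E1 t) (E1 t) = 1" "form (g t) (E2 t) (E2 t) = 1" "form (g t) (E3 t) (E3 t) = 1"
    using frame_pos(1-3)[OF t] by (simp_all add: simps field_simps power2_eq_square)
  show "form (g t) (E2 t) (E1 t) = 0" "form (g t) (E3 t) (E1 t) = 0" "form (g t) (E3 t) (E2 t) = 0"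
    by (subst form_commute[OF spd[OF t]], fact o)+
qed

definition s1 where "s1 t = form (g t) (E1 t) (\<kappa> t *v E1 t)"
definition s22 where "s22 t = form (g t) (E2 t) (\<kappa> t *v E2 t)"
definition s23 where "s23 t = form (g t) (E2 t) (\<kappa> t *v E3 t)"
definition s33 where "s33 t = form (g t) (E3 t) (\<kappa> t *v E3 t)"

text \<open>The mixed components vanish identically in time, so their derivatives, which are twice
  these expressions, vanish as well.\<close>

lemma \<kappa>_block: assumes t: "t \<in> I"
  shows "form (g t) b1 (\<kappa> t *v b2) = 0" "form (g t) b1 (\<kappa> t *v b3) = 0"
proof -
  have z: "2 * form (g t) b1 (\<kappa> t *v b) = 0" if "\<And>s. s \<in> I \<Longrightarrow> form (g s) b1 b = 0" for b
  proof -
    have "((\<lambda>s. 0 :: real) has_real_derivative 2 * form (g t) b1 (\<kappa> t *v b)) (at t)"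
      by (rule DERIV_cong_ev[THEN iffD1, OF refl _ refl form_deriv[OF t, of b1 b]]) (rule ev_I[OF t that])
    from DERIV_unique[OF this DERIV_const] show ?thesis .
  qed
  show "form (g t) b1 (\<kappa> t *v b2) = 0" "form (g t) b1 (\<kappa> t *v b3) = 0"
    using z[of b2] z[of b3] block by simp_all
qed

lemma \<kappa>_frame:
  assumes t: "t \<in> I"
  shows "\<kappa> t *v E1 t = s1 t *\<^sub>R E1 t"
    "\<kappa> t *v E2 t = s22 t *\<^sub>R E2 t + s23 t *\<^sub>R E3 t"
    "\<kappa> t *v E3 t = s23 t *\<^sub>R E2 t + s33 t *\<^sub>R E3 t"
proof -
  have sw: "form (g t) X (\<kappa> t *v Y) = form (g t) Y (\<kappa> t *v X)" for X Y
    using \<kappa>_self_adjoint[OF t, of X Y] form_commute[OF spd[OF t], of "\<kappa> t *v X" Y] by simp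
  have z: "form (g t) (E1 t) (\<kappa> t *v E2 t) = 0" "form (g t) (E1 t) (\<kappa> t *v E3 t) = 0"
    unfolding E1_def E2_def E3_def
    by (simp_all add: matrix_vector_mult_scaleR matrix_vector_mult_diff_distrib inner_diff_right form_simps \<kappa>_block[OF t])
  have ex: "x = form (g t) (E1 t) x *\<^sub>R E1 t + form (g t) (E2 t) x *\<^sub>R E2 t + form (g t) (E3 t) x *\<^sub>R E3 t" for x
    by (rule form_orthonormal_expansion(1)[OF spd[OF t] E_orthonormal(1-6)[OF t]])
  show "\<kappa> t *v E1 t = s1 t *\<^sub>R E1 t"
    by (rule trans[OF ex]) (simp add: sw[of "E2 t" "E1 t"] sw[of "E3 t" "E1 t"] z s1_def)
  show "\<kappa> t *v E2 t = s22 t *\<^sub>R E2 t + s23 t *\<^sub>R E3 t"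
    by (rule trans[OF ex]) (simp add: sw[of "E3 t" "E2 t"] z s22_def s23_def)
  show "\<kappa> t *v E3 t = s23 t *\<^sub>R E2 t + s33 t *\<^sub>R E3 t"
    by (rule trans[OF ex]) (simp add: z s23_def s33_def)
qed

lemma \<kappa>_b:
  assumes t: "t \<in> I"
  shows "\<kappa> t *v b1 = (fe t * s1 t) *\<^sub>R E1 t"
    "\<kappa> t *v b2 = (f1 t * s22 t) *\<^sub>R E2 t + (f1 t * s23 t) *\<^sub>R E3 t"
    "\<kappa> t *v b3 = (f2 t * s22 t + f3 t * s23 t) *\<^sub>R E2 t + (f2 t * s23 t + f3 t * s33 t) *\<^sub>R E3 t"
proof -
  show "\<kappa> t *v b1 = (fe t * s1 t) *\<^sub>R E1 t"
    by (subst b_frame(1)[OF t]) (simp add: matrix_vector_mult_scaleR \<kappa>_frame[OF t])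
  show "\<kappa> t *v b2 = (f1 t * s22 t) *\<^sub>R E2 t + (f1 t * s23 t) *\<^sub>R E3 t"
    by (subst b_frame(2)[OF t]) (simp add: matrix_vector_mult_scaleR \<kappa>_frame[OF t] algebra_simps)
  show "\<kappa> t *v b3 = (f2 t * s22 t + f3 t * s23 t) *\<^sub>R E2 t + (f2 t * s23 t + f3 t * s33 t) *\<^sub>R E3 t"
    by (subst b_frame(3)[OF t]) (simp add: matrix_vector_mult_scaleR matrix_vector_right_distrib \<kappa>_frame[OF t] algebra_simps)
qed

lemma form_E_b:
  assumes t: "t \<in> I"
  shows "form (g t) b1 (E1 t) = fe t" "form (g t) b1 (E2 t) = 0" "form (g t) b1 (E3 t) = 0"
    "form (g t) b2 (E2 t) = f1 t" "form (g t) b2 (E3 t) = 0"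
    "form (g t) b3 (E2 t) = f2 t" "form (g t) b3 (E3 t) = f3 t"
  by (subst b_frame[OF t], simp add: form_simps E_orthonormal[OF t])+

lemma K_b:
  assumes t: "t \<in> I"
  shows "form (g t) b1 (\<kappa> t *v b1) = (fe t)\<^sup>2 * s1 t" "form (g t) b2 (\<kappa> t *v b2) = (f1 t)\<^sup>2 * s22 t"
    "form (g t) b2 (\<kappa> t *v b3) = f1 t * (f2 t * s22 t + f3 t * s23 t)"
    "form (g t) b3 (\<kappa> t *v b3) = f2 t * (f2 t * s22 t + f3 t * s23 t) + f3 t * (f2 t * s23 t + f3 t * s33 t)"
  by (simp_all add: \<kappa>_b[OF t] inner_add_right matrix_vector_right_distrib form_simps form_E_b[OF t] matrix_vector_mult_scaleR power2_eq_square)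

lemma \<theta>_frame: "t \<in> I \<Longrightarrow> \<theta> t = s1 t + s22 t + s33 t"
  unfolding \<theta>_eq_trace trace_map_orthonormal[OF spd matrix_vector_mul_linear E_orthonormal(1-6)]
  by (simp add: s1_def s22_def s33_def)

lemma fe_deriv: assumes t: "t \<in> I" shows "(fe has_real_derivative s1 t * fe t) (at t)"
  unfolding fe_def[abs_def]
  by (rule DERIV_cong[OF DERIV_chain2[OF DERIV_real_sqrt form_deriv[OF t, of b1 b1]]])
    (use frame_pos[OF t] in \<open>simp_all add: K_b[OF t] field_simps power2_eq_square\<close>)

lemma f1_deriv: assumes t: "t \<in> I" shows "(f1 has_real_derivative s22 t * f1 t) (at t)"
  unfolding f1_def[abs_def]
  by (rule DERIV_cong[OF DERIV_chain2[OF DERIV_real_sqrt form_deriv[OF t, of b2 b2]]])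
    (use frame_pos[OF t] in \<open>simp_all add: K_b[OF t] field_simps power2_eq_square\<close>)

lemma f2_deriv: assumes t: "t \<in> I" shows "(f2 has_real_derivative s22 t * f2 t + 2 * s23 t * f3 t) (at t)"
  unfolding f2_def[abs_def]
  by (rule DERIV_cong[OF DERIV_divide[OF form_deriv[OF t, of b2 b3] f1_deriv[OF t]]])
    (use frame_pos[OF t] in \<open>simp_all add: K_b[OF t] field_simps power2_eq_square\<close>)

lemma f3_deriv: assumes t: "t \<in> I" shows "(f3 has_real_derivative s33 t * f3 t) (at t)"
  unfolding f3_def[abs_def]
  by (rule DERIV_cong[OF DERIV_chain2[OF DERIV_real_sqrt DERIV_diff[OF form_deriv[OF t, of b3 b3] DERIV_power[OF f2_deriv[OF t], of 2]]]])
    (use frame_pos[OF t] in \<open>simp_all add: K_b[OF t] field_simps power2_eq_square\<close>)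

definition m22 where "m22 t = (l22 + l32 * (f2 t / f1 t)) / fe t"
definition m32 where "m32 t = l32 * f3 t / (fe t * f1 t)"
definition m23 where "m23 t = ((l23 - f2 t / f1 t * l22) * f1 t + (l33 - f2 t / f1 t * l32) * f2 t) / (fe t * f3 t)"
definition m33 where "m33 t = (l33 - f2 t / f1 t * l32) / fe t"
definition N where "N t = c * fe t / (f1 t * f3 t)"

lemma frame_brackets:
  assumes t: "t \<in> I"
  shows "br (E1 t) (E2 t) = m22 t *\<^sub>R E2 t + m32 t *\<^sub>R E3 t"
    "br (E1 t) (E3 t) = m23 t *\<^sub>R E2 t + m33 t *\<^sub>R E3 t"
    "br (E2 t) (E3 t) = N t *\<^sub>R E1 t"
proof -
  have a: "(1 / (e * d)) *\<^sub>R (p *\<^sub>R x2 + q *\<^sub>R x3) = ((p * d1 + q * d2) / (e * d)) *\<^sub>R e2 + (q * d3 / (e * d)) *\<^sub>R e3"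
    if "x2 = d1 *\<^sub>R e2" "x3 = d2 *\<^sub>R e2 + d3 *\<^sub>R e3" "e \<noteq> 0" "d \<noteq> 0" for e d p q d1 d2 d3 :: real and x2 x3 e2 e3 :: "real^3"
    unfolding that(1,2) using that(3,4) by (simp add: vec_eq_iff field_simps)
  have nz: "fe t \<noteq> 0" "f1 t \<noteq> 0" "f3 t \<noteq> 0" using frame_pos(1-3)[OF t] by auto
  have m: "(l22 * f1 t + l32 * f2 t) / (fe t * f1 t) = m22 t" "l32 * f3 t / (fe t * f1 t) = m32 t"
    "((l23 - f2 t / f1 t * l22) * f1 t + (l33 - f2 t / f1 t * l32) * f2 t) / (fe t * f3 t) = m23 t"
    "(l33 - f2 t / f1 t * l32) * f3 t / (fe t * f3 t) = m33 t"
    using nz by (simp_all add: m22_def m32_def m23_def m33_def add_divide_distrib)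
  have "br (E1 t) (E2 t) = (1 / (fe t * f1 t)) *\<^sub>R (l22 *\<^sub>R b2 + l32 *\<^sub>R b3)"
    unfolding E1_def E2_def by (simp add: br_simps brackets)
  then show "br (E1 t) (E2 t) = m22 t *\<^sub>R E2 t + m32 t *\<^sub>R E3 t"
    unfolding a[OF b_frame(2,3)[OF t] nz(1,2)] m .
  have "br (E1 t) (E3 t) = (1 / (fe t * f3 t)) *\<^sub>R ((l23 - f2 t / f1 t * l22) *\<^sub>R b2 + (l33 - f2 t / f1 t * l32) *\<^sub>R b3)"
    unfolding E1_def E3_def by (simp add: br_simps brackets algebra_simps)
  then show "br (E1 t) (E3 t) = m23 t *\<^sub>R E2 t + m33 t *\<^sub>R E3 t"
    unfolding a[OF b_frame(2,3)[OF t] nz(1,3)] m .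
  have "br (E2 t) (E3 t) = (1 / (f1 t * f3 t)) *\<^sub>R (c *\<^sub>R b1)"
    unfolding E2_def E3_def by (simp add: br_simps brackets br_self)
  then show "br (E2 t) (E3 t) = N t *\<^sub>R E1 t"
    using nz(1) by (simp add: N_def E1_def)
qed

lemma N_trace: "N t * (m22 t + m33 t) = 0"
proof -
  have "m22 t + m33 t = (l22 + l33) / fe t" unfolding m22_def m33_def by (simp add: add_divide_distrib[symmetric])
  moreover have "c * (l22 + l33) = 0" using types by auto
  ultimately show ?thesis by (simp add: N_def)
qed

lemma bracket_derivs:
  assumes t: "t \<in> I"
  shows "(m22 has_real_derivative 2 * s23 t * m32 t - s1 t * m22 t) (at t)"
    "(m32 has_real_derivative (s33 t - s22 t) * m32 t - s1 t * m32 t) (at t)"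
    "(m23 has_real_derivative (s22 t - s33 t) * m23 t + 2 * s23 t * (m33 t - m22 t) - s1 t * m23 t) (at t)"
    "(m33 has_real_derivative - 2 * s23 t * m32 t - s1 t * m33 t) (at t)"
    "(N has_real_derivative N t * (s1 t - s22 t - s33 t)) (at t)"
  unfolding m22_def[abs_def] m32_def[abs_def] m23_def[abs_def] m33_def[abs_def] N_def[abs_def]
  using frame_pos(1-3)[OF t]
  by (auto intro!: derivative_eq_intros fe_deriv[OF t] f1_deriv[OF t] f2_deriv[OF t] f3_deriv[OF t])
    (simp_all add: field_simps)

text \<open>The term \<open>2 * s23\<close> is the price of the triangular gauge: \<open>E2\<close>
  has to stay parallel to the fixed vector \<open>b2\<close>, so all of the rotation falls on
  \<open>E3\<close>.\<close>

lemma E_derivs: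
  assumes t: "t \<in> I"
  shows "(E1 has_vector_derivative - s1 t *\<^sub>R E1 t) (at t)"
    "(E2 has_vector_derivative - s22 t *\<^sub>R E2 t) (at t)"
    "(E3 has_vector_derivative - s33 t *\<^sub>R E3 t - (2 * s23 t) *\<^sub>R E2 t) (at t)"
proof -
  note p = frame_pos(1-3)[OF t]
  have sc: "((\<lambda>s. f s *\<^sub>R v) has_vector_derivative d *\<^sub>R v) (at t)" if "(f has_real_derivative d) (at t)" for f d and v :: "real^3"
    using has_vector_derivative_scaleR[OF that has_vector_derivative_const[of v]] by simp
  have "((\<lambda>s. 1 / fe s) has_real_derivative - s1 t / fe t) (at t)"
    using p by (auto intro!: derivative_eq_intros fe_deriv[OF t] simp: power2_eq_square field_simps)
  from sc[OF this, of b1] show "(E1 has_vector_derivative - s1 t *\<^sub>R E1 t) (at t)"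
    unfolding E1_def[abs_def] by simp
  have "((\<lambda>s. 1 / f1 s) has_real_derivative - s22 t / f1 t) (at t)"
    using p by (auto intro!: derivative_eq_intros f1_deriv[OF t] simp: power2_eq_square field_simps)
  from sc[OF this, of b2] show "(E2 has_vector_derivative - s22 t *\<^sub>R E2 t) (at t)"
    unfolding E2_def[abs_def] by simp
  have 1: "((\<lambda>s. 1 / f3 s) has_real_derivative - s33 t / f3 t) (at t)"
    using p by (auto intro!: derivative_eq_intros f3_deriv[OF t] simp: power2_eq_square field_simps)
  have 2: "((\<lambda>s. f2 s / f1 s) has_real_derivative 2 * s23 t * f3 t / f1 t) (at t)"
    using p by (auto intro!: derivative_eq_intros f1_deriv[OF t] f2_deriv[OF t]) (simp add: field_simps)
  have "((\<lambda>s. b3 - (f2 s / f1 s) *\<^sub>R b2) has_vector_derivative 0 - (2 * s23 t * f3 t / f1 t) *\<^sub>R b2) (at t)"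
    by (intro has_vector_derivative_diff has_vector_derivative_const sc 2)
  from has_vector_derivative_scaleR[OF 1 this]
  show "(E3 has_vector_derivative - s33 t *\<^sub>R E3 t - (2 * s23 t) *\<^sub>R E2 t) (at t)"
    unfolding E3_def[abs_def] using p by (simp add: E2_def E3_def algebra_simps)
qed

lemma ric_E:
  assumes t: "t \<in> I"
  shows "ric t (E1 t) (E1 t) = - ((m22 t)\<^sup>2 + (m33 t)\<^sup>2 + (m23 t + m32 t)\<^sup>2 / 2) + (N t)\<^sup>2 / 2"
    and "ric t (E2 t) (E2 t) = - ((m32 t - m23 t - N t) * (m23 t + m32 t) / 2) - (m22 t + m33 t) * m22 t + (m32 t - m23 t) / 2 * N t - (N t)\<^sup>2 / 2"
    and "ric t (E3 t) (E3 t) = (m32 t - m23 t - N t) * (m23 t + m32 t) / 2 - (m22 t + m33 t) * m33 t + (m32 t - m23 t) / 2 * N t - (N t)\<^sup>2 / 2"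
    and "ric t (E2 t) (E3 t) = (m32 t - m23 t - N t) / 2 * (m22 t - m33 t) - (m22 t + m33 t) * (m23 t + m32 t) / 2"
  by (fact ric_frame[OF t E_orthonormal(1-6)[OF t] frame_brackets[OF t] N_trace])+

lemma \<kappa>_derivs:
  assumes t: "t \<in> I"
  shows "(s1 has_real_derivative - ric t (E1 t) (E1 t) - \<theta> t * s1 t) (at t)"
    "(s22 has_real_derivative 2 * (s23 t)\<^sup>2 - ric t (E2 t) (E2 t) - \<theta> t * s22 t) (at t)"
    "(s23 has_real_derivative (s33 t - s22 t) * s23 t - ric t (E2 t) (E3 t) - \<theta> t * s23 t) (at t)"
    "(s33 has_real_derivative - 2 * (s23 t)\<^sup>2 - ric t (E3 t) (E3 t) - \<theta> t * s33 t) (at t)"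
proof -
  note D = moving_form_\<kappa>_deriv[OF t]
  note simps = \<kappa>_frame[OF t] E_orthonormal[OF t] form_simps inner_add_right inner_diff_right matrix_vector_right_distrib
    matrix_vector_mult_diff_distrib matrix_vector_mult_scaleR linear_neg[OF matrix_vector_mul_linear] s1_def[symmetric] s22_def[symmetric] s23_def[symmetric] s33_def[symmetric]
  show "(s1 has_real_derivative - ric t (E1 t) (E1 t) - \<theta> t * s1 t) (at t)"
    unfolding s1_def[abs_def] by (rule DERIV_cong[OF D[OF E_derivs(1)[OF t] E_derivs(1)[OF t]]]) (simp add: simps algebra_simps)
  show "(s22 has_real_derivative 2 * (s23 t)\<^sup>2 - ric t (E2 t) (E2 t) - \<theta> t * s22 t) (at t)"
    unfolding s22_def[abs_def] by (rule DERIV_cong[OF D[OF E_derivs(2)[OF t] E_derivs(2)[OF t]]]) (simp add: simps algebra_simps power2_eq_square)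
  show "(s23 has_real_derivative (s33 t - s22 t) * s23 t - ric t (E2 t) (E3 t) - \<theta> t * s23 t) (at t)"
    unfolding s23_def[abs_def] by (rule DERIV_cong[OF D[OF E_derivs(2)[OF t] E_derivs(3)[OF t]]]) (simp add: simps algebra_simps)
  show "(s33 has_real_derivative - 2 * (s23 t)\<^sup>2 - ric t (E3 t) (E3 t) - \<theta> t * s33 t) (at t)"
    unfolding s33_def[abs_def] by (rule DERIV_cong[OF D[OF E_derivs(3)[OF t] E_derivs(3)[OF t]]]) (simp add: simps algebra_simps power2_eq_square)
qed

text \<open>Minus the scalar curvature of the slice. Every term is a square except the last, whose
  sign depends on the Bianchi type.\<close>

definition \<rho> where
  "\<rho> t = (m22 t - m33 t)\<^sup>2 / 2 + (m23 t + m32 t)\<^sup>2 / 2 + 3/2 * (m22 t + m33 t)\<^sup>2 + (N t)\<^sup>2 / 2 - (m32 t - m23 t) * N t"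

lemma scalar_hamiltonian:
  assumes t: "t \<in> I"
  shows "(\<theta> t)\<^sup>2 = (s1 t)\<^sup>2 + (s22 t)\<^sup>2 + (s33 t)\<^sup>2 + 2 * (s23 t)\<^sup>2 + (\<psi> t)\<^sup>2 + \<rho> t"
proof -
  have lin: "linear (\<lambda>X. \<kappa> t *v (\<kappa> t *v X))"
    by (rule linearI) (simp_all add: matrix_vector_right_distrib matrix_vector_mult_scaleR)
  have "trace_map (\<lambda>X. \<kappa> t *v (\<kappa> t *v X)) = (s1 t)\<^sup>2 + (s22 t)\<^sup>2 + (s33 t)\<^sup>2 + 2 * (s23 t)\<^sup>2"
    unfolding trace_map_orthonormal[OF spd[OF t] lin E_orthonormal(1-6)[OF t]]
    by (simp add: \<kappa>_frame[OF t] E_orthonormal[OF t] form_simps inner_add_right matrix_vector_right_distrib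
        matrix_vector_mult_scaleR power2_eq_square)
  moreover have "ric t (E1 t) (E1 t) + ric t (E2 t) (E2 t) + ric t (E3 t) (E3 t) = - \<rho> t"
    unfolding ric_E[OF t] \<rho>_def by (simp add: power2_eq_square field_simps)
  ultimately show ?thesis
    using hamiltonian_constraint[OF t E_orthonormal(1-6)[OF t]] by simp
qed

lemma scalar_momentum:
  assumes t: "t \<in> I"
  shows "s22 t * m22 t + s33 t * m33 t + s23 t * (m23 t + m32 t) = s1 t * (m22 t + m33 t)"
proof -
  have lin: "linear (br X)" "linear (\<lambda>Y. \<kappa> t *v br X Y)" for X
    by (rule linearI, simp_all add: br_simps matrix_vector_right_distrib matrix_vector_mult_scaleR)+
  show ?thesis
    using momentum_constraint[OF t, of "E1 t"]
    unfolding trace_map_orthonormal[OF spd[OF t] lin(1) E_orthonormal(1-6)[OF t]]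
      trace_map_orthonormal[OF spd[OF t] lin(2) E_orthonormal(1-6)[OF t]]
    by (simp add: \<kappa>_frame[OF t] frame_brackets[OF t] br_simps br_self E_orthonormal[OF t] form_simps
        inner_add_right matrix_vector_right_distrib matrix_vector_mult_scaleR algebra_simps)
qed

section \<open>Quantities adapted to rotations of the plane\<close>

definition sg where "sg t = s22 t + s33 t"
definition z1 where "z1 t = (s22 t - s33 t) / 2"
definition z2 where "z2 t = s23 t"
definition aa where "aa t = m22 t + m33 t"
definition w1 where "w1 t = (m22 t - m33 t) / 2"
definition w2 where "w2 t = (m23 t + m32 t) / 2"
definition bb where "bb t = (m32 t - m23 t) / 2"
text \<open>Rotating the plane frame by an angle turns \<open>(z1, z2)\<close> and
  \<open>(w1, w2)\<close> by twice that angle. Invariant are their lengths, their inner product,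
  which the momentum constraint expresses by \<open>aa\<close>, and this cross product.\<close>

definition \<zeta> where "\<zeta> t = z2 t * w1 t - z1 t * w2 t"

lemma s1_eq: "t \<in> I \<Longrightarrow> s1 t = \<theta> t - sg t"
  using \<theta>_frame by (simp add: sg_def)

lemma \<rho>_eq: "\<rho> t = 2 * ((w1 t)\<^sup>2 + (w2 t)\<^sup>2) + 3/2 * (aa t)\<^sup>2 + (N t)\<^sup>2 / 2 - 2 * bb t * N t"
  unfolding \<rho>_def w1_def w2_def aa_def bb_def by (simp add: power2_eq_square field_simps)

lemma \<theta>_ode: assumes t: "t \<in> I" shows "(\<theta> has_real_derivative \<rho> t - (\<theta> t)\<^sup>2) (at t)"
proof (rule DERIV_cong_ev[THEN iffD1, OF refl _ refl])
  show "\<forall>\<^sub>F s in nhds t. s1 s + s22 s + s33 s = \<theta> s" by (rule ev_I[OF t]) (simp add: \<theta>_frame)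
  have "ric t (E1 t) (E1 t) + ric t (E2 t) (E2 t) + ric t (E3 t) (E3 t) = - \<rho> t"
    unfolding ric_E[OF t] \<rho>_def by (simp add: power2_eq_square field_simps)
  then show "((\<lambda>s. s1 s + s22 s + s33 s) has_real_derivative \<rho> t - (\<theta> t)\<^sup>2) (at t)"
    by (auto intro!: derivative_eq_intros \<kappa>_derivs[OF t])
      (simp add: \<theta>_frame[OF t] power2_eq_square algebra_simps)
qed

lemma reduced_odes:
  assumes t: "t \<in> I"
  shows "(sg has_real_derivative (aa t)\<^sup>2 - 2 * bb t * N t + (N t)\<^sup>2 - \<theta> t * sg t) (at t)"
    "(z1 has_real_derivative 2 * (z2 t)\<^sup>2 + (2 * bb t - N t) * w2 t + aa t * w1 t - \<theta> t * z1 t) (at t)"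
    "(z2 has_real_derivative - 2 * z1 t * z2 t - (2 * bb t - N t) * w1 t + aa t * w2 t - \<theta> t * z2 t) (at t)"
    "(aa has_real_derivative - s1 t * aa t) (at t)"
    "(w1 has_real_derivative 2 * z2 t * (w2 t + bb t) - s1 t * w1 t) (at t)"
    "(w2 has_real_derivative - 2 * z1 t * bb t - 2 * z2 t * w1 t - s1 t * w2 t) (at t)"
    "(bb has_real_derivative 2 * \<zeta> t - s1 t * bb t) (at t)"
proof -
  note defs = sg_def z1_def z2_def aa_def w1_def w2_def bb_def \<zeta>_def
  note adefs = sg_def[abs_def] z1_def[abs_def] z2_def[abs_def] aa_def[abs_def] w1_def[abs_def] w2_def[abs_def] bb_def[abs_def]
  have N: "N t * m33 t = - (N t * m22 t)" using N_trace[of t] by (simp add: algebra_simps)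
  show "(sg has_real_derivative (aa t)\<^sup>2 - 2 * bb t * N t + (N t)\<^sup>2 - \<theta> t * sg t) (at t)"
    "(z1 has_real_derivative 2 * (z2 t)\<^sup>2 + (2 * bb t - N t) * w2 t + aa t * w1 t - \<theta> t * z1 t) (at t)"
    "(aa has_real_derivative - s1 t * aa t) (at t)"
    "(w1 has_real_derivative 2 * z2 t * (w2 t + bb t) - s1 t * w1 t) (at t)"
    "(w2 has_real_derivative - 2 * z1 t * bb t - 2 * z2 t * w1 t - s1 t * w2 t) (at t)"
    "(bb has_real_derivative 2 * \<zeta> t - s1 t * bb t) (at t)"
    unfolding adefs
    by (auto intro!: derivative_eq_intros \<kappa>_derivs[OF t] bracket_derivs[OF t])
      (simp_all add: ric_E[OF t] defs power2_eq_square field_simps N)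
  show "(z2 has_real_derivative - 2 * z1 t * z2 t - (2 * bb t - N t) * w1 t + aa t * w2 t - \<theta> t * z2 t) (at t)"
    unfolding adefs
    by (rule DERIV_cong[OF \<kappa>_derivs(3)[OF t]]) (simp add: ric_E[OF t] defs power2_eq_square field_simps N)
qed

lemma reduced_momentum:
  assumes t: "t \<in> I"
  shows "z1 t * w1 t + z2 t * w2 t = aa t * (2 * \<theta> t - 3 * sg t) / 4"
  using scalar_momentum[OF t] unfolding z1_def z2_def w1_def w2_def aa_def sg_def s1_eq[OF t]
  by (simp add: field_simps)

lemma reduced_hamiltonian:
  assumes t: "t \<in> I"
  shows "3/2 * (sg t)\<^sup>2 - 2 * \<theta> t * sg t + 2 * ((z1 t)\<^sup>2 + (z2 t)\<^sup>2) + (\<psi> t)\<^sup>2 + \<rho> t = 0"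
  using scalar_hamiltonian[OF t] unfolding s1_eq[OF t] z1_def z2_def sg_def
  by (simp add: power2_eq_square field_simps)

text \<open>The determinant of \<open>ad b1\<close> on the plane does not depend on the basis of the
  plane, and passing from \<open>b1\<close> to \<open>E1\<close> divides it by the square of
  \<open>fe\<close>. For \<open>aa = 0\<close> the sign of the left-hand side is thus fixed by the
  Lie algebra for all time.\<close>

lemma plane_determinant:
  assumes t: "t \<in> I"
  shows "(bb t)\<^sup>2 - ((w1 t)\<^sup>2 + (w2 t)\<^sup>2) = (l22 * l33 - l23 * l32) / (fe t)\<^sup>2 - (aa t)\<^sup>2 / 4"
proof -
  have "m22 t * m33 t - m23 t * m32 t = (l22 * l33 - l23 * l32) / (fe t)\<^sup>2"
    using frame_pos(1-3)[OF t] unfolding m22_def m33_def m23_def m32_def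
    by (simp add: field_simps power2_eq_square)
  moreover have "(bb t)\<^sup>2 - ((w1 t)\<^sup>2 + (w2 t)\<^sup>2) = m22 t * m33 t - m23 t * m32 t - (aa t)\<^sup>2 / 4"
    unfolding bb_def w1_def w2_def aa_def by (simp add: field_simps power2_eq_square)
  ultimately show ?thesis by simp
qed

lemma aa_eq: "aa t = (l22 + l33) / fe t"
  unfolding aa_def m22_def m33_def by (simp add: add_divide_distrib[symmetric])

text \<open>The triangular change of basis keeps the sign of \<open>l32\<close> in
  \<open>m32\<close>; in \<open>m23\<close> the contributions of \<open>l23\<close> and of
  \<open>l32\<close> have the same sign. So \<open>m32\<close> and \<open>m23\<close> never lose
  their opposite signs.\<close>

lemma c_bb:
  assumes t: "t \<in> I" and l: "l22 = 0" "l33 = 0" "c * l32 < 0" "c * l23 > 0"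
  shows "c * bb t < 0"
proof -
  note p = frame_pos(1-3)[OF t]
  have 1: "c * m32 t < 0"
    using p l(3) unfolding m32_def by (simp add: divide_neg_pos mult_neg_pos flip: mult.assoc)
  have "c * m23 t = (c * l23) * (f1 t / (fe t * f3 t)) - (c * l32) * ((f2 t)\<^sup>2 / (f1 t * fe t * f3 t))"
    using p unfolding m23_def unfolding l(1,2) by (simp add: field_simps power2_eq_square)
  moreover have "(c * l23) * (f1 t / (fe t * f3 t)) > 0" using p l(4) by simp
  moreover have "(c * l32) * ((f2 t)\<^sup>2 / (f1 t * fe t * f3 t)) \<le> 0" using p l(3) by (intro mult_nonpos_nonneg[OF less_imp_le]) auto
  ultimately have "c * m23 t > 0" by linarith
  then show ?thesis using 1 unfolding bb_def by (simp add: algebra_simps)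
qed

text \<open>This is where the exclusion of type IX enters the estimates: the signs of
  \<open>c\<close>, \<open>l32\<close> and \<open>l23\<close> of that type would reverse the
  inequality, and \<open>\<rho>\<close> could become negative.\<close>

lemma bN_nonpos: assumes t: "t \<in> I" shows "bb t * N t \<le> 0"
proof (cases "c = 0 \<or> (l22 = 0 \<and> l32 = 0 \<and> l23 = 0 \<and> l33 = 0)")
  case True
  then show ?thesis by (auto simp: N_def bb_def m32_def m23_def)
next
  case False
  then have "c * bb t < 0" using types by (intro c_bb[OF t]) auto
  then have "(c * bb t) * (fe t / (f1 t * f3 t)) \<le> 0" using frame_pos(1-3)[OF t] by (intro mult_nonpos_nonneg[OF less_imp_le]) auto
  then show ?thesis unfolding N_def by (simp add: mult_ac)
qed

lemma \<rho>_nonneg: "t \<in> I \<Longrightarrow> 0 \<le> \<rho> t"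
  using bN_nonpos[of t] zero_le_power2[of "w1 t"] zero_le_power2[of "w2 t"] zero_le_power2[of "aa t"] zero_le_power2[of "N t"]
  unfolding \<rho>_eq by argo

lemma squares_le:
  assumes t: "t \<in> I"
  shows "\<rho> t \<le> (\<theta> t)\<^sup>2" "(s1 t)\<^sup>2 \<le> (\<theta> t)\<^sup>2" "(s22 t)\<^sup>2 \<le> (\<theta> t)\<^sup>2" "(s23 t)\<^sup>2 \<le> (\<theta> t)\<^sup>2" "(s33 t)\<^sup>2 \<le> (\<theta> t)\<^sup>2" "(\<psi> t)\<^sup>2 \<le> (\<theta> t)\<^sup>2"
proof -
  note n = zero_le_power2[of "s1 t"] zero_le_power2[of "s22 t"] zero_le_power2[of "s33 t"]
    zero_le_power2[of "s23 t"] zero_le_power2[of "\<psi> t"] scalar_hamiltonian[OF t] \<rho>_nonneg[OF t]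
  show "\<rho> t \<le> (\<theta> t)\<^sup>2" "(s1 t)\<^sup>2 \<le> (\<theta> t)\<^sup>2" "(s22 t)\<^sup>2 \<le> (\<theta> t)\<^sup>2" "(s23 t)\<^sup>2 \<le> (\<theta> t)\<^sup>2" "(s33 t)\<^sup>2 \<le> (\<theta> t)\<^sup>2" "(\<psi> t)\<^sup>2 \<le> (\<theta> t)\<^sup>2"
    using n by linarith+
qed

section \<open>Monotonicity of the expansion and growth of the volume\<close>

definition vol where "vol t = fe t * f1 t * f3 t"

lemma vol_pos: "t \<in> I \<Longrightarrow> 0 < vol t"
  unfolding vol_def using frame_pos(1-3) by simp

lemma vol_deriv: "t \<in> I \<Longrightarrow> (vol has_real_derivative \<theta> t * vol t) (at t)"
  unfolding vol_def[abs_def]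
  by (auto intro!: derivative_eq_intros fe_deriv f1_deriv f3_deriv) (simp add: \<theta>_frame algebra_simps)

lemma Icc_subset: "s \<in> I \<Longrightarrow> t \<in> I \<Longrightarrow> s \<le> u \<Longrightarrow> u \<le> t \<Longrightarrow> u \<in> I"
  using ivl unfolding is_interval_1 by blast

lemma \<theta>_antimono:
  assumes "s \<in> I" "t \<in> I" "s \<le> t" shows "\<theta> t \<le> \<theta> s"
proof (rule DERIV_nonpos_imp_nonincreasing[OF assms(3)])
  fix u assume "s \<le> u" "u \<le> t"
  then have u: "u \<in> I" by (rule Icc_subset[OF assms(1,2)])
  show "\<exists>y. DERIV \<theta> u :> y \<and> y \<le> 0" using \<theta>_ode[OF u] squares_le(1)[OF u] by (intro exI conjI) auto
qed

text \<open>The product \<open>\<theta> * vol\<close> has derivative \<open>\<rho> * vol\<close>,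
  which is nonnegative.\<close>

lemma \<theta>_stays_pos:
  assumes "s \<in> I" "t \<in> I" "s \<le> t" "0 < \<theta> s" shows "0 < \<theta> t"
proof -
  have "\<theta> s * vol s \<le> \<theta> t * vol t"
  proof (rule DERIV_nonneg_imp_nondecreasing[OF assms(3)])
    fix u assume "s \<le> u" "u \<le> t"
    then have u: "u \<in> I" by (rule Icc_subset[OF assms(1,2)])
    have "((\<lambda>t. \<theta> t * vol t) has_real_derivative \<rho> u * vol u) (at u)"
      by (rule DERIV_cong[OF DERIV_mult[OF \<theta>_ode[OF u] vol_deriv[OF u]]]) (simp add: algebra_simps power2_eq_square)
    then show "\<exists>y. DERIV (\<lambda>t. \<theta> t * vol t) u :> y \<and> 0 \<le> y"
      using \<rho>_nonneg[OF u] vol_pos[OF u] by (intro exI[of _ "\<rho> u * vol u"] conjI) auto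
  qed
  moreover have "0 < \<theta> s * vol s" using assms(4) vol_pos[OF assms(1)] by simp
  ultimately have "0 < \<theta> t * vol t" by linarith
  then show ?thesis using vol_pos[OF assms(2)] by (simp add: zero_less_mult_iff)
qed

text \<open>Since \<open>\<rho> \<ge> 0\<close>, the derivative of \<open>1 / \<theta>\<close> is at
  most 1. So \<open>\<theta>\<close> is at least \<open>1 / (t + C)\<close>, and its integral
  diverges logarithmically.\<close>

lemma log_volume_limit:
  assumes I: "{t1..} \<subseteq> I" and \<theta>: "0 < \<theta> t1"
  shows "filterlim (\<lambda>t. ln (vol t)) at_top at_top"
proof -
  have tI: "t \<in> I" if "t1 \<le> t" for t using I that by auto
  have pos: "0 < \<theta> t" if "t1 \<le> t" for t using \<theta>_stays_pos[OF tI tI that \<theta>] that by auto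
  have inv: "1 / \<theta> t \<le> t - t1 + 1 / \<theta> t1" if t: "t1 \<le> t" for t
  proof -
    define h where "h t = t - 1 / \<theta> t" for t
    have "h t1 \<le> h t"
    proof (rule nondecreasing_from_deriv[where ?t0.0=t1 and f=h and f'="\<lambda>t. \<rho> t / (\<theta> t)\<^sup>2"])
      fix u assume u: "t1 \<le> u"
      show "(h has_real_derivative \<rho> u / (\<theta> u)\<^sup>2) (at u)"
        unfolding h_def[abs_def]
        by (rule DERIV_cong[OF DERIV_diff[OF DERIV_ident DERIV_divide[OF DERIV_const \<theta>_ode[OF tI[OF u]]]]])
          (use pos[OF u] in \<open>simp_all add: field_simps power2_eq_square\<close>)
      show "0 \<le> \<rho> u / (\<theta> u)\<^sup>2" using \<rho>_nonneg[OF tI[OF u]] by simp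
    qed (use t in auto)
    then show ?thesis unfolding h_def by simp
  qed
  define C where "C = 1 / \<theta> t1 - t1"
  have C: "0 < t + C" if "t1 \<le> t" for t using divide_pos_pos[OF zero_less_one \<theta>] that unfolding C_def by linarith
  have low: "ln (vol t1) - ln (t1 + C) + ln (t + C) \<le> ln (vol t)" if t: "t1 \<le> t" for t
  proof -
    define h where "h t = ln (vol t) - ln (t + C)" for t
    have "h t1 \<le> h t"
    proof (rule nondecreasing_from_deriv[where ?t0.0=t1 and f=h and f'="\<lambda>t. \<theta> t - 1 / (t + C)"])
      fix u assume u: "t1 \<le> u"
      show "(h has_real_derivative \<theta> u - 1 / (u + C)) (at u)"
        unfolding h_def[abs_def]
        by (rule DERIV_cong[OF DERIV_diff[OF DERIV_chain2[OF DERIV_ln_divide vol_deriv[OF tI[OF u]]]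
                DERIV_chain2[OF DERIV_ln_divide DERIV_add[OF DERIV_ident DERIV_const]]]])
          (use vol_pos[OF tI[OF u]] C[OF u] in simp_all)
      show "0 \<le> \<theta> u - 1 / (u + C)"
        using inv[OF u] pos[OF u] C[OF u] unfolding C_def by (simp add: field_simps)
    qed (use t in auto)
    then show ?thesis unfolding h_def by simp
  qed
  have "filterlim (\<lambda>t. t + C) at_top at_top"
    by (subst add.commute) (rule filterlim_tendsto_add_at_top[OF tendsto_const filterlim_ident])
  then have "filterlim (\<lambda>t. ln (vol t1) - ln (t1 + C) + ln (t + C)) at_top at_top"
    by (intro filterlim_tendsto_add_at_top[OF tendsto_const] filterlim_compose[OF ln_at_top])
  then show ?thesis
    by (rule filterlim_at_top_mono) (rule eventually_mono[OF eventually_ge_at_top[of t1] low])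
qed

text \<open>The sign \<open>\<sigma>\<close> accounts for reversing the orientation of the plane,
  which flips \<open>N\<close>, \<open>bb\<close> and \<open>\<zeta>\<close> together and leaves the
  other functions unchanged.\<close>

lemma normalized_flow_instance:
  assumes I: "{t1..} \<subseteq> I" and \<theta>: "0 < \<theta> t1" and \<sigma>: "\<sigma> * \<sigma> = 1"
  shows "normalized_flow t1 \<theta> (\<lambda>t. ln (vol t)) (\<lambda>t. sg t / \<theta> t) (\<lambda>t. aa t / \<theta> t)
    (\<lambda>t. ((w1 t)\<^sup>2 + (w2 t)\<^sup>2) / (\<theta> t)\<^sup>2) (\<lambda>t. ((z1 t)\<^sup>2 + (z2 t)\<^sup>2) / (\<theta> t)\<^sup>2) (\<lambda>t. \<psi> t / \<theta> t)
    (\<lambda>t. \<sigma> * bb t / \<theta> t) (\<lambda>t. \<sigma> * N t / \<theta> t) (\<lambda>t. \<sigma> * \<zeta> t / (\<theta> t)\<^sup>2) (\<lambda>t. \<rho> t / (\<theta> t)\<^sup>2)"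
proof
  fix t assume "t1 \<le> t"
  then have t: "t \<in> I" and t1: "t1 \<in> I" using I by auto
  show pos: "0 < \<theta> t" by (rule \<theta>_stays_pos[OF t1 t \<open>t1 \<le> t\<close> \<theta>])
  define r where "r = \<rho> t / (\<theta> t)\<^sup>2"
  have \<rho>r: "\<rho> t = r * (\<theta> t)\<^sup>2" unfolding r_def using pos by simp
  \<comment> \<open>Quotient rule with the derivative \<open>(r - 1) * \<theta>^2\<close> of
    \<open>\<theta>\<close>, set up so that each normalized equation becomes one algebraic identity;
    \<open>q2\<close> is the version for the square of \<open>\<theta>\<close>.\<close>
  have q1: "((\<lambda>s. f s / \<theta> s) has_real_derivative \<theta> t * d) (at t)"
    if "(f has_real_derivative f') (at t)" "f' = d * (\<theta> t)\<^sup>2 + (r - 1) * \<theta> t * f t" for f f' d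
    by (rule DERIV_cong[OF DERIV_divide[OF that(1) \<theta>_ode[OF t]]])
      (use pos in \<open>auto simp: \<rho>r that(2) field_simps power2_eq_square\<close>)
  have q2: "((\<lambda>s. f s / (\<theta> s)\<^sup>2) has_real_derivative \<theta> t * d) (at t)"
    if "(f has_real_derivative f') (at t)" "f' = d * (\<theta> t) ^ 3 + 2 * (r - 1) * \<theta> t * f t" for f f' d
    by (rule DERIV_cong[OF DERIV_divide[OF that(1) DERIV_power[OF \<theta>_ode[OF t], of 2]]])
      (use pos in \<open>auto simp: \<rho>r that(2) field_simps power2_eq_square power3_eq_cube\<close>)
  note R = r_def[symmetric]
  note o = reduced_odes[OF t]
  have \<sigma>2: "\<sigma> * (\<sigma> * v) = v" for v using \<sigma> by (metis mult.assoc mult_1)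
  show "((\<lambda>t. ln (vol t)) has_real_derivative \<theta> t) (at t)"
    using vol_pos[OF t] by (auto intro!: derivative_eq_intros vol_deriv[OF t])
  show "\<rho> t / (\<theta> t)\<^sup>2 = 2 * (((w1 t)\<^sup>2 + (w2 t)\<^sup>2) / (\<theta> t)\<^sup>2) + 3 / 2 * (aa t / \<theta> t)\<^sup>2 + (\<sigma> * N t / \<theta> t)\<^sup>2 / 2 - 2 * (\<sigma> * bb t / \<theta> t) * (\<sigma> * N t / \<theta> t)"
    unfolding \<rho>_eq using pos by (simp add: field_simps power2_eq_square \<sigma>2)
  show "((\<lambda>t. sg t / \<theta> t) has_real_derivative \<theta> t * ((aa t / \<theta> t)\<^sup>2 + (\<sigma> * N t / \<theta> t)\<^sup>2 - 2 * (\<sigma> * bb t / \<theta> t) * (\<sigma> * N t / \<theta> t) - \<rho> t / (\<theta> t)\<^sup>2 * (sg t / \<theta> t))) (at t)"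
    unfolding R by (rule q1[OF o(1)]) (use pos in \<open>simp add: field_simps power2_eq_square \<sigma>2\<close>)
  show "((\<lambda>t. aa t / \<theta> t) has_real_derivative \<theta> t * (aa t / \<theta> t * (sg t / \<theta> t - \<rho> t / (\<theta> t)\<^sup>2))) (at t)"
    unfolding R by (rule q1[OF o(4)]) (use pos in \<open>simp add: s1_eq[OF t] field_simps power2_eq_square\<close>)
  have "((\<lambda>t. \<psi> t / \<theta> t) has_real_derivative \<theta> t * - (\<rho> t / (\<theta> t)\<^sup>2 * (\<psi> t / \<theta> t))) (at t)"
    unfolding R by (rule q1[OF wave[OF t]]) (use pos in \<open>simp add: field_simps power2_eq_square\<close>)
  then show "((\<lambda>t. \<psi> t / \<theta> t) has_real_derivative - (\<theta> t * (\<rho> t / (\<theta> t)\<^sup>2 * (\<psi> t / \<theta> t)))) (at t)" by simp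
  have Nd: "(N has_real_derivative N t * (\<theta> t - 2 * sg t)) (at t)"
    by (rule DERIV_cong[OF bracket_derivs(5)[OF t]]) (simp add: s1_eq[OF t], simp add: sg_def)
  show "((\<lambda>t. \<sigma> * N t / \<theta> t) has_real_derivative \<theta> t * (\<sigma> * N t / \<theta> t * (2 - 2 * (sg t / \<theta> t) - \<rho> t / (\<theta> t)\<^sup>2))) (at t)"
    unfolding R by (rule q1[OF DERIV_cmult[OF Nd]])
      (use pos in \<open>simp add: field_simps power2_eq_square\<close>)
  show "((\<lambda>t. \<sigma> * bb t / \<theta> t) has_real_derivative \<theta> t * ((sg t / \<theta> t - \<rho> t / (\<theta> t)\<^sup>2) * (\<sigma> * bb t / \<theta> t) + 2 * (\<sigma> * \<zeta> t / (\<theta> t)\<^sup>2))) (at t)"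
    unfolding R by (rule q1[OF DERIV_cmult[OF o(7)]]) (use pos in \<open>simp add: s1_eq[OF t] field_simps power2_eq_square\<close>)
  have W': "((\<lambda>t. (w1 t)\<^sup>2 + (w2 t)\<^sup>2) has_real_derivative 4 * bb t * \<zeta> t - 2 * s1 t * ((w1 t)\<^sup>2 + (w2 t)\<^sup>2)) (at t)"
    by (auto intro!: derivative_eq_intros o) (simp add: \<zeta>_def power2_eq_square algebra_simps)
  show "((\<lambda>t. ((w1 t)\<^sup>2 + (w2 t)\<^sup>2) / (\<theta> t)\<^sup>2) has_real_derivative
      \<theta> t * (2 * (sg t / \<theta> t - \<rho> t / (\<theta> t)\<^sup>2) * (((w1 t)\<^sup>2 + (w2 t)\<^sup>2) / (\<theta> t)\<^sup>2) + 4 * (\<sigma> * bb t / \<theta> t) * (\<sigma> * \<zeta> t / (\<theta> t)\<^sup>2))) (at t)"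
    unfolding R by (rule q2[OF W'])
      (use pos in \<open>simp add: s1_eq[OF t] field_simps power2_eq_square power3_eq_cube \<sigma>2\<close>)
  have Z': "((\<lambda>t. (z1 t)\<^sup>2 + (z2 t)\<^sup>2) has_real_derivative
      - 2 * (2 * bb t - N t) * \<zeta> t + 2 * aa t * (z1 t * w1 t + z2 t * w2 t) - 2 * \<theta> t * ((z1 t)\<^sup>2 + (z2 t)\<^sup>2)) (at t)"
    by (auto intro!: derivative_eq_intros o) (simp add: \<zeta>_def power2_eq_square algebra_simps)
  show "((\<lambda>t. ((z1 t)\<^sup>2 + (z2 t)\<^sup>2) / (\<theta> t)\<^sup>2) has_real_derivative
      \<theta> t * (- 2 * (\<rho> t / (\<theta> t)\<^sup>2) * (((z1 t)\<^sup>2 + (z2 t)\<^sup>2) / (\<theta> t)\<^sup>2) - 2 * (2 * (\<sigma> * bb t / \<theta> t) - \<sigma> * N t / \<theta> t) * (\<sigma> * \<zeta> t / (\<theta> t)\<^sup>2)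
        + (aa t / \<theta> t)\<^sup>2 * (2 - 3 * (sg t / \<theta> t)) / 2)) (at t)"
    unfolding R by (rule q2[OF Z'])
      (use pos in \<open>simp add: reduced_momentum[OF t] field_simps power2_eq_square power3_eq_cube \<sigma>2\<close>)
  have \<zeta>': "(\<zeta> has_real_derivative
      - (2 * bb t - N t) * ((w1 t)\<^sup>2 + (w2 t)\<^sup>2) + 2 * bb t * ((z1 t)\<^sup>2 + (z2 t)\<^sup>2) - (\<theta> t + s1 t) * \<zeta> t) (at t)"
    unfolding \<zeta>_def[abs_def]
    by (auto intro!: derivative_eq_intros o) (simp add: \<zeta>_def power2_eq_square algebra_simps)
  show "((\<lambda>t. \<sigma> * \<zeta> t / (\<theta> t)\<^sup>2) has_real_derivative
      \<theta> t * ((sg t / \<theta> t - 2 * (\<rho> t / (\<theta> t)\<^sup>2)) * (\<sigma> * \<zeta> t / (\<theta> t)\<^sup>2) - (2 * (\<sigma> * bb t / \<theta> t) - \<sigma> * N t / \<theta> t) * (((w1 t)\<^sup>2 + (w2 t)\<^sup>2) / (\<theta> t)\<^sup>2)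
        + 2 * (\<sigma> * bb t / \<theta> t) * (((z1 t)\<^sup>2 + (z2 t)\<^sup>2) / (\<theta> t)\<^sup>2))) (at t)"
    unfolding R by (rule q2[OF DERIV_cmult[OF \<zeta>']])
      (use pos in \<open>simp add: s1_eq[OF t] field_simps power2_eq_square power3_eq_cube\<close>)
  show "3 / 2 * (sg t / \<theta> t)\<^sup>2 - 2 * (sg t / \<theta> t) + 2 * (((z1 t)\<^sup>2 + (z2 t)\<^sup>2) / (\<theta> t)\<^sup>2) + (\<psi> t / \<theta> t)\<^sup>2 + \<rho> t / (\<theta> t)\<^sup>2 = 0"
  proof -
    have "(3/2 * (sg t)\<^sup>2 - 2 * \<theta> t * sg t + 2 * ((z1 t)\<^sup>2 + (z2 t)\<^sup>2) + (\<psi> t)\<^sup>2 + \<rho> t) / (\<theta> t)\<^sup>2 = 0"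
      unfolding reduced_hamiltonian[OF t] by simp
    then show ?thesis using pos by (simp add: add_divide_distrib diff_divide_distrib power2_eq_square)
  qed
  have cs: "(z1 t * w1 t + z2 t * w2 t)\<^sup>2 \<le> ((z1 t)\<^sup>2 + (z2 t)\<^sup>2) * ((w1 t)\<^sup>2 + (w2 t)\<^sup>2)"
    "(\<zeta> t)\<^sup>2 \<le> ((z1 t)\<^sup>2 + (z2 t)\<^sup>2) * ((w1 t)\<^sup>2 + (w2 t)\<^sup>2)"
    using zero_le_power2[of "\<zeta> t"] zero_le_power2[of "z1 t * w1 t + z2 t * w2 t"]
    by (simp_all add: \<zeta>_def power2_eq_square algebra_simps)
  have sc: "(v / (\<theta> t)\<^sup>2)\<^sup>2 \<le> p / (\<theta> t)\<^sup>2 * (q / (\<theta> t)\<^sup>2)" if "v\<^sup>2 \<le> p * q" for v p q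
    using divide_right_mono[OF that, of "((\<theta> t)\<^sup>2)\<^sup>2"] by (simp add: power_divide power2_eq_square[of "(\<theta> t)\<^sup>2"])
  have "aa t / \<theta> t * (2 - 3 * (sg t / \<theta> t)) / 4 = (z1 t * w1 t + z2 t * w2 t) / (\<theta> t)\<^sup>2"
    unfolding reduced_momentum[OF t] using pos by (simp add: field_simps power2_eq_square)
  then show "(aa t / \<theta> t * (2 - 3 * (sg t / \<theta> t)) / 4)\<^sup>2 \<le> ((z1 t)\<^sup>2 + (z2 t)\<^sup>2) / (\<theta> t)\<^sup>2 * (((w1 t)\<^sup>2 + (w2 t)\<^sup>2) / (\<theta> t)\<^sup>2)"
    using sc[OF cs(1)] by simp
  show "(\<sigma> * \<zeta> t / (\<theta> t)\<^sup>2)\<^sup>2 \<le> ((z1 t)\<^sup>2 + (z2 t)\<^sup>2) / (\<theta> t)\<^sup>2 * (((w1 t)\<^sup>2 + (w2 t)\<^sup>2) / (\<theta> t)\<^sup>2)"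
    using \<sigma> by (intro sc) (use cs(2) in \<open>simp add: power2_eq_square \<sigma>2 mult_ac\<close>)
  show "0 \<le> ((w1 t)\<^sup>2 + (w2 t)\<^sup>2) / (\<theta> t)\<^sup>2" "0 \<le> ((z1 t)\<^sup>2 + (z2 t)\<^sup>2) / (\<theta> t)\<^sup>2" by simp_all
  have "\<sigma> * bb t / \<theta> t * (\<sigma> * N t / \<theta> t) = bb t * N t / (\<theta> t)\<^sup>2"
    using pos \<sigma>2[of "bb t * N t"] by (simp add: field_simps power2_eq_square)
  then show "\<sigma> * bb t / \<theta> t * (\<sigma> * N t / \<theta> t) \<le> 0"
    using bN_nonpos[OF t] by (simp add: divide_nonpos_nonneg)
qed (rule log_volume_limit[OF I \<theta>])

theorem normalized_shear_converges:
  assumes I: "{t1..} \<subseteq> I" and \<theta>: "0 < \<theta> t1"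
  shows "\<exists>l. ((\<lambda>t. sg t / \<theta> t) \<longlongrightarrow> l) at_top"
    and "\<exists>l. ((\<lambda>t. ((z1 t)\<^sup>2 + (z2 t)\<^sup>2) / (\<theta> t)\<^sup>2) \<longlongrightarrow> l) at_top"
    and "\<exists>l. ((\<lambda>t. (\<psi> t / \<theta> t)\<^sup>2) \<longlongrightarrow> l) at_top"
proof -
  \<comment> \<open>The orientation is chosen so that \<open>\<sigma> * c < 0\<close> when
    \<open>c\<close> is nonzero. For type VIII this makes the normalized \<open>N\<close> negative
    and \<open>bb\<close> positive.\<close>
  define \<sigma> :: real where "\<sigma> = (if c > 0 then - 1 else 1)"
  have \<sigma>: "\<sigma> * \<sigma> = 1" unfolding \<sigma>_def by simp
  interpret normalized_flow t1 \<theta> "\<lambda>t. ln (vol t)" "\<lambda>t. sg t / \<theta> t" "\<lambda>t. aa t / \<theta> t"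
    "\<lambda>t. ((w1 t)\<^sup>2 + (w2 t)\<^sup>2) / (\<theta> t)\<^sup>2" "\<lambda>t. ((z1 t)\<^sup>2 + (z2 t)\<^sup>2) / (\<theta> t)\<^sup>2" "\<lambda>t. \<psi> t / \<theta> t"
    "\<lambda>t. \<sigma> * bb t / \<theta> t" "\<lambda>t. \<sigma> * N t / \<theta> t" "\<lambda>t. \<sigma> * \<zeta> t / (\<theta> t)\<^sup>2" "\<lambda>t. \<rho> t / (\<theta> t)\<^sup>2"
    by (rule normalized_flow_instance[OF I \<theta> \<sigma>])
  have tI: "t \<in> I" if "t1 \<le> t" for t using I that by auto
  show "\<exists>l. ((\<lambda>t. (\<psi> t / \<theta> t)\<^sup>2) \<longlongrightarrow> l) at_top" by (rule x_converges)
  have det: "((w1 t)\<^sup>2 + (w2 t)\<^sup>2) / (\<theta> t)\<^sup>2 < (\<sigma> * bb t / \<theta> t)\<^sup>2 \<longleftrightarrow> 0 < l22 * l33 - l23 * l32"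
    if t: "t1 \<le> t" and l: "l22 + l33 = 0" for t
  proof -
    have "((w1 t)\<^sup>2 + (w2 t)\<^sup>2) / (\<theta> t)\<^sup>2 < (\<sigma> * bb t / \<theta> t)\<^sup>2 \<longleftrightarrow> (w1 t)\<^sup>2 + (w2 t)\<^sup>2 < (bb t)\<^sup>2"
      using \<sigma> \<theta>_pos[OF t] by (simp add: power_divide power_mult_distrib power2_eq_square[of \<sigma>] divide_less_cancel)
    also have "\<dots> \<longleftrightarrow> 0 < (l22 * l33 - l23 * l32) / (fe t)\<^sup>2"
      using plane_determinant[OF tI[OF t]] aa_eq[of t] l by auto
    finally show ?thesis using frame_pos(1)[OF tI[OF t]] by (simp add: zero_less_divide_iff)
  qed
  have "(\<exists>l. ((\<lambda>t. sg t / \<theta> t) \<longlongrightarrow> l) at_top) \<and> (\<exists>l. ((\<lambda>t. ((z1 t)\<^sup>2 + (z2 t)\<^sup>2) / (\<theta> t)\<^sup>2) \<longlongrightarrow> l) at_top)"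
    using types
  proof (elim disjE conjE)
    assume l: "l22 = 0" "l32 = 0" "l23 = 0" "l33 = 0"
    have "m22 t = 0" "m23 t = 0" "m32 t = 0" "m33 t = 0" for t
      unfolding m22_def m23_def m32_def m33_def unfolding l by simp_all
    then show ?thesis
      by (intro converges_without_brackets) (simp_all add: aa_def bb_def w1_def w2_def)
  next
    assume c: "c = 0" and l: "l22 + l33 > 0"
    have "N t = 0" for t unfolding N_def unfolding c by simp
    then show ?thesis
      using l frame_pos(1)[OF tI] \<theta>_pos by (intro converges_nonunimodular) (simp_all add: aa_eq)
  next
    assume c: "c = 0" and l: "l22 + l33 = 0"
    have "N t = 0" for t unfolding N_def unfolding c by simp
    then show ?thesis
    proof (intro converges_unimodular_plane)
      show "(\<forall>t\<ge>t1. (\<sigma> * bb t / \<theta> t)\<^sup>2 \<le> ((w1 t)\<^sup>2 + (w2 t)\<^sup>2) / (\<theta> t)\<^sup>2) \<or> (\<forall>t\<ge>t1. ((w1 t)\<^sup>2 + (w2 t)\<^sup>2) / (\<theta> t)\<^sup>2 < (\<sigma> * bb t / \<theta> t)\<^sup>2)"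
        using det[OF _ l] by (meson not_less)
    qed (simp_all add: aa_eq l)
  next
    assume l: "l22 = 0" "l33 = 0" "c * l32 < 0" "c * l23 > 0"
    then have cn: "c \<noteq> 0" by auto
    show ?thesis
    proof (rule converges_type_VIII)
      fix t assume t: "t1 \<le> t"
      note p = frame_pos(1-3)[OF tI[OF t]]
      show "aa t / \<theta> t = 0" unfolding aa_eq using l(1,2) by simp
      have "\<sigma> * c < 0" using cn unfolding \<sigma>_def by simp
      then have "(\<sigma> * c) * (fe t / (f1 t * f3 t)) < 0" using p by (intro mult_neg_pos[OF \<open>\<sigma> * c < 0\<close>]) simp_all
      then show "\<sigma> * N t / \<theta> t < 0" unfolding N_def using \<theta>_pos[OF t] by (intro divide_neg_pos) (simp_all add: mult.assoc)
      have "0 < \<sigma> * bb t"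
        using c_bb[OF tI[OF t] l] cn unfolding \<sigma>_def by (auto simp: mult_less_0_iff)
      then show "0 < \<sigma> * bb t / \<theta> t" using \<theta>_pos[OF t] by simp
      have "(c * l23) * (c * l32) < 0" by (rule mult_pos_neg[OF l(4,3)])
      then have "(c * c) * (l23 * l32) < 0" by (simp add: mult_ac)
      then have "l23 * l32 < 0" using cn by (simp add: mult_less_0_iff not_square_less_zero)
      then show "((w1 t)\<^sup>2 + (w2 t)\<^sup>2) / (\<theta> t)\<^sup>2 < (\<sigma> * bb t / \<theta> t)\<^sup>2"
        using det[OF t] l by simp
    qed
  qed
  then show "\<exists>l. ((\<lambda>t. sg t / \<theta> t) \<longlongrightarrow> l) at_top" "\<exists>l. ((\<lambda>t. ((z1 t)\<^sup>2 + (z2 t)\<^sup>2) / (\<theta> t)\<^sup>2) \<longlongrightarrow> l) at_top"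
    by blast+
qed

text \<open>With \<open>(z1, z2) = d * (cos p, sin p)\<close>, the trace-free part of
  \<open>\<kappa>\<close> on the plane is \<open>d\<close> times a reflection whose axis makes the
  angle \<open>p / 2\<close> with \<open>E2\<close>. Half-angle formulas give the eigenvectors
  \<open>u\<close> and \<open>v\<close>.\<close>

lemma relative_eigenvalues_frame:
  assumes t: "t \<in> I"
  defines "d \<equiv> sqrt ((z1 t)\<^sup>2 + (z2 t)\<^sup>2)"
  shows "relative_eigenvalues (g t) (second_fundamental_form g t) = sort [sg t - \<theta> t, - (sg t / 2 + d), - (sg t / 2 - d)]"
proof -
  have "\<exists>p. z1 t = d * cos p \<and> z2 t = d * sin p"
  proof (cases "d = 0")
    case True
    then have "z1 t = 0 \<and> z2 t = 0" unfolding d_def by (simp add: add_nonneg_eq_0_iff)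
    then show ?thesis using True by simp
  next
    case False
    then have "0 < (z1 t)\<^sup>2 + (z2 t)\<^sup>2" unfolding d_def by (smt (verit) real_sqrt_eq_zero_cancel_iff sum_power2_ge_zero)
    moreover have "d\<^sup>2 = (z1 t)\<^sup>2 + (z2 t)\<^sup>2" unfolding d_def by simp
    ultimately have "(z1 t / d)\<^sup>2 + (z2 t / d)\<^sup>2 = 1"
      unfolding power_divide add_divide_distrib[symmetric] by (metis divide_self_if less_irrefl)
    then obtain p where "z1 t / d = cos p" "z2 t / d = sin p" by (rule sincos_total_2pi)
    then show ?thesis using False by (metis nonzero_mult_div_cancel_left times_divide_eq_right)
  qed
  then obtain p where p: "z1 t = d * cos p" "z2 t = d * sin p" by blast
  define x y where "x = cos (p/2)" and "y = sin (p/2)"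
  have xy: "x * x + y * y = 1" using sin_cos_squared_add3[of "p/2"] unfolding x_def y_def by simp
  have cs: "cos p = x * x - y * y" "sin p = 2 * y * x"
    using cos_double[of "p/2"] sin_double[of "p/2"] unfolding x_def y_def by (simp_all add: power2_eq_square)
  have s: "s22 t = sg t / 2 + d * (x * x - y * y)" "s33 t = sg t / 2 - d * (x * x - y * y)" "s23 t = d * (2 * x * y)"
    using p unfolding z1_def z2_def sg_def cs by argo+
  define u v where "u = x *\<^sub>R E2 t + y *\<^sub>R E3 t" and "v = y *\<^sub>R E2 t - x *\<^sub>R E3 t"
  have e: "x * s22 t + y * s23 t = (sg t / 2 + d) * x" "x * s23 t + y * s33 t = (sg t / 2 + d) * y"
    "y * s22 t - x * s23 t = (sg t / 2 - d) * y" "y * s23 t - x * s33 t = - ((sg t / 2 - d) * x)"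
    unfolding s using xy by algebra+
  have "\<kappa> t *v u = (x * s22 t + y * s23 t) *\<^sub>R E2 t + (x * s23 t + y * s33 t) *\<^sub>R E3 t"
    "\<kappa> t *v v = (y * s22 t - x * s23 t) *\<^sub>R E2 t + (y * s23 t - x * s33 t) *\<^sub>R E3 t"
    unfolding u_def v_def
    by (simp_all add: matrix_vector_right_distrib matrix_vector_mult_diff_distrib matrix_vector_mult_scaleR \<kappa>_frame[OF t] algebra_simps)
  then have \<kappa>e: "\<kappa> t *v u = (sg t / 2 + d) *\<^sub>R u" "\<kappa> t *v v = (sg t / 2 - d) *\<^sub>R v"
    unfolding e u_def v_def by (simp_all add: scaleR_add_right scaleR_diff_right)
  show ?thesis
  proof (rule relative_eigenvalues_eq[OF spd[OF t], of "E1 t" u v])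
    show "form (g t) u u = 1" "form (g t) v v = 1" "form (g t) u v = 0"
      using xy by (simp_all add: u_def v_def form_simps E_orthonormal[OF t] algebra_simps)
    show "form (g t) (E1 t) (E1 t) = 1" "form (g t) (E1 t) u = 0" "form (g t) (E1 t) v = 0"
      by (simp_all add: u_def v_def form_simps E_orthonormal[OF t])
    have neg: "- (r *\<^sub>R a) = (- r) *\<^sub>R a" for r and a :: "real^3" by simp
    show "second_fundamental_form g t *v E1 t = (sg t - \<theta> t) *\<^sub>R (g t *v E1 t)"
      "second_fundamental_form g t *v u = (- (sg t / 2 + d)) *\<^sub>R (g t *v u)"
      "second_fundamental_form g t *v v = (- (sg t / 2 - d)) *\<^sub>R (g t *v v)"
      unfolding second_fundamental_form_eq[OF t] \<kappa>_frame(1)[OF t] \<kappa>e matrix_vector_mult_scaleR neg s1_eq[OF t] by simp_all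
  qed
qed

theorem kasner_exponents_converge:
  assumes I: "{t1..} \<subseteq> I" and \<theta>: "0 < \<theta> t1"
  shows "\<forall>\<^sub>F t in at_top. mean_curvature g t \<noteq> 0"
    and "i < 3 \<Longrightarrow> \<exists>p. (kasner_exponent g i \<longlongrightarrow> p) at_top"
    and "\<exists>\<Omega>. (density_parameter g \<phi> \<longlongrightarrow> \<Omega>) at_top"
proof -
  have tI: "t \<in> I" if "t1 \<le> t" for t using I that by auto
  have pos: "0 < \<theta> t" if "t1 \<le> t" for t using \<theta>_stays_pos[OF tI tI that \<theta>] that by auto
  note ev = eventually_mono[OF eventually_ge_at_top[of t1]]
  show "\<forall>\<^sub>F t in at_top. mean_curvature g t \<noteq> 0"
    by (rule ev) (use mean_curvature_eq[OF tI] pos in \<open>fastforce\<close>)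
  obtain y Z x where lim: "((\<lambda>t. sg t / \<theta> t) \<longlongrightarrow> y) at_top"
    "((\<lambda>t. ((z1 t)\<^sup>2 + (z2 t)\<^sup>2) / (\<theta> t)\<^sup>2) \<longlongrightarrow> Z) at_top" "((\<lambda>t. (\<psi> t / \<theta> t)\<^sup>2) \<longlongrightarrow> x) at_top"
    using normalized_shear_converges[OF I \<theta>] by blast
  have "((\<lambda>t. 3 / 2 * (\<psi> t / \<theta> t)\<^sup>2) \<longlongrightarrow> 3 / 2 * x) at_top" by (intro tendsto_intros lim)
  then have "(density_parameter g \<phi> \<longlongrightarrow> 3 / 2 * x) at_top"
  proof (rule Lim_transform_eventually)
    show "\<forall>\<^sub>F t in at_top. 3 / 2 * (\<psi> t / \<theta> t)\<^sup>2 = density_parameter g \<phi> t"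
      by (rule ev) (simp add: density_parameter_def energy_density_def mean_curvature_eq[OF tI] \<psi>_def power_divide)
  qed
  then show "\<exists>\<Omega>. (density_parameter g \<phi> \<longlongrightarrow> \<Omega>) at_top" ..
  define d where "d t = sqrt ((z1 t)\<^sup>2 + (z2 t)\<^sup>2)" for t
  have d: "((\<lambda>t. d t / \<theta> t) \<longlongrightarrow> sqrt Z) at_top"
  proof (rule Lim_transform_eventually[OF tendsto_real_sqrt[OF lim(2)]])
    show "\<forall>\<^sub>F t in at_top. sqrt (((z1 t)\<^sup>2 + (z2 t)\<^sup>2) / (\<theta> t)\<^sup>2) = d t / \<theta> t"
      by (rule ev) (use pos in \<open>simp add: d_def real_sqrt_divide less_imp_le\<close>)
  qed
  assume i: "i < 3"
  have 1: "((\<lambda>t. (sg t - \<theta> t) / \<theta> t) \<longlongrightarrow> y - 1) at_top"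
    by (rule Lim_transform_eventually[OF tendsto_diff[OF lim(1) tendsto_const[of 1]]])
      (rule ev, use pos in \<open>force simp: diff_divide_distrib\<close>)
  have 2: "((\<lambda>t. - (sg t / 2 + d t) / \<theta> t) \<longlongrightarrow> - (y / 2 + sqrt Z)) at_top"
    by (rule Lim_transform_eventually[OF tendsto_minus[OF tendsto_add[OF tendsto_divide[OF lim(1) tendsto_const[of 2]] d]]])
      (simp, rule ev, simp add: add_divide_distrib diff_divide_distrib)
  have 3: "((\<lambda>t. - (sg t / 2 - d t) / \<theta> t) \<longlongrightarrow> - (y / 2 - sqrt Z)) at_top"
    by (rule Lim_transform_eventually[OF tendsto_minus[OF tendsto_diff[OF tendsto_divide[OF lim(1) tendsto_const[of 2]] d]]])
      (simp, rule ev, simp add: add_divide_distrib diff_divide_distrib)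
  have "\<forall>\<^sub>F t in at_top. 0 < \<theta> t" by (rule ev) (rule pos)
  from tendsto_sort3[OF 1 2 3 this i] obtain l where
    "((\<lambda>t. sort [sg t - \<theta> t, - (sg t / 2 + d t), - (sg t / 2 - d t)] ! i / \<theta> t) \<longlongrightarrow> l) at_top" ..
  \<comment> \<open>The minus sign enters because \<open>mean_curvature\<close> equals
    \<open>- \<theta>\<close>.\<close>
  from tendsto_minus[OF this] have "(kasner_exponent g i \<longlongrightarrow> - l) at_top"
  proof (rule Lim_transform_eventually)
    show "\<forall>\<^sub>F t in at_top. - (sort [sg t - \<theta> t, - (sg t / 2 + d t), - (sg t / 2 - d t)] ! i / \<theta> t) = kasner_exponent g i t"
      by (rule ev) (simp add: kasner_exponent_def relative_eigenvalues_frame[OF tI] mean_curvature_eq[OF tI] d_def)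
  qed
  then show "\<exists>p. (kasner_exponent g i \<longlongrightarrow> p) at_top" ..
qed

end

section \<open>Extension of solutions\<close>

text \<open>The equations at \<open>t\<close> involve derivatives, so agreement at \<open>t\<close>
  alone would not do; openness of \<open>U\<close> passes agreement on to each derivative.\<close>

lemma field_equations_local:
  assumes U: "open U" and g: "\<And>s. s \<in> U \<Longrightarrow> g' s = g s" and \<phi>: "\<And>s. s \<in> U \<Longrightarrow> \<phi>' s = \<phi> s" and t: "t \<in> U"
  shows "einstein_equations br g' \<phi>' t = einstein_equations br g \<phi> t" (is ?E)
    and "wave_equation br g' \<phi>' t = wave_equation br g \<phi> t" (is ?W)
proof -
  have fd: "frame_deriv \<mu> f s = frame_deriv \<mu> h s" if "\<And>s. s \<in> U \<Longrightarrow> f s = h s" "s \<in> U" for \<mu> f h s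
  proof (cases \<mu>)
    case None
    have "\<forall>\<^sub>F u in nhds s. f u = h u" using eventually_nhds_in_open[OF U that(2)] that(1) by (rule eventually_mono)
    then show ?thesis using None by (simp add: deriv_cong_ev)
  qed simp
  have sm: "spacetime_metric g' s = spacetime_metric g s" and inv: "inverse_metric g' s = inverse_metric g s" if "s \<in> U" for s
    unfolding inverse_metric_def spacetime_metric_def g[OF that] by simp_all
  have "koszul br g' \<mu> \<nu> \<xi> s = koszul br g \<mu> \<nu> \<xi> s" if s: "s \<in> U" for \<mu> \<nu> \<xi> s
    using fd[of "\<lambda>s. spacetime_metric g' s $ _ $ _" "\<lambda>s. spacetime_metric g s $ _ $ _", OF _ s] sm
    unfolding koszul_def Let_def by (simp add: s)
  then have con: "connection br g' \<mu> \<nu> \<xi> s = connection br g \<mu> \<nu> \<xi> s" if "s \<in> U" for \<mu> \<nu> \<xi> s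
    unfolding connection_def using inv that by simp
  have "riemann br g' \<mu> \<nu> \<xi> \<kappa> s = riemann br g \<mu> \<nu> \<xi> \<kappa> s" if s: "s \<in> U" for \<mu> \<nu> \<xi> \<kappa> s
    unfolding riemann_def Let_def using con s
    by (simp add: fd[of "connection br g' _ _ _" "connection br g _ _ _", OF con s])
  then have ric: "ricci br g' \<mu> \<nu> s = ricci br g \<mu> \<nu> s" if "s \<in> U" for \<mu> \<nu> s
    unfolding ricci_def using that by simp
  then have sc: "scalar_curvature br g' t = scalar_curvature br g t"
    unfolding scalar_curvature_def using inv[OF t] t by simp
  have fp: "frame_deriv \<mu> \<phi>' s = frame_deriv \<mu> \<phi> s" if "s \<in> U" for \<mu> s by (rule fd[OF \<phi> that])
  then have fp2: "frame_deriv \<mu> (frame_deriv \<nu> \<phi>') t = frame_deriv \<mu> (frame_deriv \<nu> \<phi>) t" for \<mu> \<nu>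
    by (rule fd[OF _ t])
  show ?E unfolding einstein_equations_def stress_energy_def ric[OF t] sc sm[OF t] inv[OF t] fp[OF t] ..
  show ?W unfolding wave_equation_def hessian_def con[OF t] inv[OF t] fp[OF t] fp2 ..
qed

lemma smooth_on_local:
  assumes U: "open U" and f: "\<And>s. s \<in> U \<Longrightarrow> f s = h s" and sm: "smooth_on S h" and t: "t \<in> U" "t \<in> S"
  shows "(deriv ^^ n) f differentiable (at t)"
proof -
  have "(deriv ^^ n) f s = (deriv ^^ n) h s" if "s \<in> U" for s
    by (rule higher_deriv_cong_ev) (use eventually_mono[OF eventually_nhds_in_open[OF U that] f] in auto)
  then have "\<forall>\<^sub>F s in nhds t. (deriv ^^ n) f s = (deriv ^^ n) h s"
    by (intro eventually_mono[OF eventually_nhds_in_open[OF U t(1)]])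
  then show ?thesis by (rule differentiable_cong_ev[rotated]) (use sm t in \<open>auto simp: smooth_on_def\<close>)
qed

lemma homogeneous_solution_union:
  assumes A: "homogeneous_solution br I g \<phi>" and B: "homogeneous_solution br J g' \<phi>'"
    and ne: "I \<inter> J \<noteq> {}" and eq: "\<And>t. t \<in> I \<inter> J \<Longrightarrow> g t = g' t \<and> \<phi> t = \<phi>' t"
  shows "homogeneous_solution br (I \<union> J) (\<lambda>t. if t \<in> I then g t else g' t) (\<lambda>t. if t \<in> I then \<phi> t else \<phi>' t)"
    (is "homogeneous_solution br _ ?g ?\<phi>")
proof -
  have o: "open I" "open J" "is_interval I" "is_interval J" using A B unfolding homogeneous_solution_def by auto
  have gI: "?g s = g s" "?\<phi> s = \<phi> s" if "s \<in> I" for s using that by auto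
  have gJ: "?g s = g' s" "?\<phi> s = \<phi>' s" if "s \<in> J" for s using that eq by auto
  have "is_interval (I \<union> J)"
    using o ne unfolding is_interval_connected_1 by (intro connected_Un)
  moreover have "smooth_on (I \<union> J) (\<lambda>t. ?g t $ a $ b)" for a b
    unfolding smooth_on_def[of "I \<union> J"]
  proof (intro allI ballI)
    fix n t assume "t \<in> I \<union> J"
    then show "(deriv ^^ n) (\<lambda>t. ?g t $ a $ b) differentiable (at t)"
    proof
      assume "t \<in> I"
      then show ?thesis using A by (intro smooth_on_local[OF o(1), of _ "\<lambda>t. g t $ a $ b" I]) (auto simp: homogeneous_solution_def)
    next
      assume "t \<in> J"
      then show ?thesis using B gJ by (intro smooth_on_local[OF o(2), of _ "\<lambda>t. g' t $ a $ b" J]) (auto simp: homogeneous_solution_def)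
    qed
  qed
  moreover have "smooth_on (I \<union> J) ?\<phi>"
    unfolding smooth_on_def[of "I \<union> J"]
  proof (intro allI ballI)
    fix n t assume "t \<in> I \<union> J"
    then show "(deriv ^^ n) ?\<phi> differentiable (at t)"
    proof
      assume "t \<in> I"
      then show ?thesis using A by (intro smooth_on_local[OF o(1), of _ \<phi> I]) (auto simp: homogeneous_solution_def)
    next
      assume "t \<in> J"
      then show ?thesis using B gJ by (intro smooth_on_local[OF o(2), of _ \<phi>' J]) (auto simp: homogeneous_solution_def)
    qed
  qed
  moreover have "sym_pos_def (?g t) \<and> einstein_equations br ?g ?\<phi> t \<and> wave_equation br ?g ?\<phi> t" if "t \<in> I \<union> J" for t
  proof (cases "t \<in> I")
    case True
    have "einstein_equations br ?g ?\<phi> t = einstein_equations br g \<phi> t" "wave_equation br ?g ?\<phi> t = wave_equation br g \<phi> t"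
      by (rule field_equations_local[OF o(1) gI True], assumption+)+
    then show ?thesis using A True gI(1)[OF True] unfolding homogeneous_solution_def by simp
  next
    case False
    then have t: "t \<in> J" using that by auto
    have "einstein_equations br ?g ?\<phi> t = einstein_equations br g' \<phi>' t" "wave_equation br ?g ?\<phi> t = wave_equation br g' \<phi>' t"
      by (rule field_equations_local[OF o(2) gJ t], assumption+)+
    then show ?thesis using B t gJ(1)[OF t] False unfolding homogeneous_solution_def by simp
  qed
  ultimately show ?thesis using o ne unfolding homogeneous_solution_def by auto
qed

lemmas real_analytic_intros = real_analytic_at_const real_analytic_at_add real_analytic_at_mult real_analytic_at_minus
  real_analytic_at_diff real_analytic_at_sum real_analytic_at_prod

text \<open>Both sides of the field equations are real-analytic functions of \<open>t\<close>, so it suffices that they agree on \<open>U\<close>.\<close>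

lemma analytic_solution:
  assumes J: "open J" "connected J"
    and g: "\<And>t a b. t \<in> J \<Longrightarrow> real_analytic_at (\<lambda>s. g s $ a $ b) t" and \<phi>: "\<And>t. t \<in> J \<Longrightarrow> real_analytic_at \<phi> t"
    and spd: "\<And>t. t \<in> J \<Longrightarrow> sym_pos_def (g t)"
    and U: "open U" "U \<subseteq> J" "U \<noteq> {}"
    and eq: "\<And>t. t \<in> U \<Longrightarrow> einstein_equations br g \<phi> t \<and> wave_equation br g \<phi> t"
  shows "homogeneous_solution br J g \<phi>"
proof -
  note i = real_analytic_intros
  have G: "real_analytic_at (\<lambda>s. spacetime_metric g s $ \<mu> $ \<nu>) t" if "t \<in> J" for \<mu> \<nu> t
    by (cases \<mu>; cases \<nu>) (auto intro: real_analytic_at_const g that)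
  have det: "real_analytic_at (\<lambda>s. det (A s)) t" if "\<And>p q. real_analytic_at (\<lambda>s. A s $ p $ q) t" for A :: "real \<Rightarrow> real^3^3" and t
    unfolding det_def by (intro i that)
  have H: "real_analytic_at (\<lambda>s. matrix_inv (g s) $ a $ b) t" if t: "t \<in> J" for a b t
  proof (rule real_analytic_at_cong)
    have entries: "real_analytic_at (\<lambda>s. if q = a then axis b 1 $ p else g s $ p $ q) t" for p q
      by (cases "q = a") (simp_all add: real_analytic_at_const g t)
    show "real_analytic_at (\<lambda>s. det (\<chi> p q. if q = a then axis b 1 $ p else g s $ p $ q) / det (g s)) t"
      by (rule real_analytic_at_divide) (auto intro!: det sym_pos_def_det[OF spd[OF t]] g t entries)
    show "\<forall>\<^sub>F s in nhds t. det (\<chi> p q. if q = a then axis b 1 $ p else g s $ p $ q) / det (g s) = matrix_inv (g s) $ a $ b"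
      by (rule eventually_mono[OF eventually_nhds_in_open[OF J(1) t]]) (simp add: matrix_inv_cramer[OF spd])
  qed
  have inv: "real_analytic_at (\<lambda>s. inverse_metric g s $ \<mu> $ \<nu>) t" if t: "t \<in> J" for \<mu> \<nu> t
  proof (rule real_analytic_at_cong)
    let ?h = "\<lambda>s. case (\<mu>, \<nu>) of (None, None) \<Rightarrow> - 1 | (Some a, Some b) \<Rightarrow> matrix_inv (g s) $ a $ b | _ \<Rightarrow> 0"
    show "real_analytic_at ?h t" by (cases \<mu>; cases \<nu>) (auto intro: real_analytic_at_const H t)
    show "\<forall>\<^sub>F s in nhds t. ?h s = inverse_metric g s $ \<mu> $ \<nu>"
      by (rule eventually_mono[OF eventually_nhds_in_open[OF J(1) t]])
        (cases \<mu>; cases \<nu>; simp add: inverse_metric_blocks[where g=g, OF spd])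
  qed
  have fd: "real_analytic_at (frame_deriv \<mu> f) t" if "real_analytic_at f t" for \<mu> f t
    by (cases \<mu>) (auto simp: frame_deriv_def[abs_def] intro: real_analytic_at_const real_analytic_at_deriv that)
  have kos: "real_analytic_at (koszul br g \<mu> \<nu> \<xi>) t" if t: "t \<in> J" for \<mu> \<nu> \<xi> t
    unfolding koszul_def[abs_def] Let_def by (intro i fd G t)
  have con: "real_analytic_at (connection br g \<mu> \<nu> \<xi>) t" if t: "t \<in> J" for \<mu> \<nu> \<xi> t
    unfolding connection_def[abs_def] divide_inverse by (intro i inv kos t)
  have rie: "real_analytic_at (riemann br g \<mu> \<nu> \<xi> \<kappa>) t" if t: "t \<in> J" for \<mu> \<nu> \<xi> \<kappa> t
    unfolding riemann_def[abs_def] Let_def by (intro i fd con t)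
  have ric: "real_analytic_at (ricci br g \<mu> \<nu>) t" if t: "t \<in> J" for \<mu> \<nu> t
    unfolding ricci_def[abs_def] by (intro i rie t)
  have sc: "real_analytic_at (scalar_curvature br g) t" if t: "t \<in> J" for t
    unfolding scalar_curvature_def[abs_def] by (intro i inv ric t)
  have se: "real_analytic_at (stress_energy g \<phi> \<mu> \<nu>) t" if t: "t \<in> J" for \<mu> \<nu> t
    unfolding stress_energy_def[abs_def] by (intro i fd \<phi> inv G t)
  have he: "real_analytic_at (hessian br g \<phi> \<mu> \<nu>) t" if t: "t \<in> J" for \<mu> \<nu> t
    unfolding hessian_def[abs_def] by (intro i fd \<phi> con t)
  obtain t0 where t0: "t0 \<in> U" using U(3) by blast
  have ev: "\<forall>\<^sub>F s in nhds t0. f s = 0" if "\<And>s. s \<in> U \<Longrightarrow> f s = 0" for f :: "real \<Rightarrow> real"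
    using eventually_nhds_in_open[OF U(1) t0] that by (rule eventually_mono)
  have t0J: "t0 \<in> J" using t0 U(2) by blast
  have "ricci br g \<mu> \<nu> t - 1/2 * scalar_curvature br g t * spacetime_metric g t $ \<mu> $ \<nu> - stress_energy g \<phi> \<mu> \<nu> t = 0"
    if t: "t \<in> J" for t \<mu> \<nu>
  proof (rule real_analytic_identity[OF _ J t0J ev t])
    show "real_analytic_at (\<lambda>t. ricci br g \<mu> \<nu> t - 1/2 * scalar_curvature br g t * spacetime_metric g t $ \<mu> $ \<nu> - stress_energy g \<phi> \<mu> \<nu> t) t"
      if "t \<in> J" for t by (intro i ric sc G se that)
  qed (use eq in \<open>simp add: einstein_equations_def\<close>)
  moreover have "(\<Sum>\<mu>\<in>UNIV. \<Sum>\<nu>\<in>UNIV. inverse_metric g t $ \<mu> $ \<nu> * hessian br g \<phi> \<mu> \<nu> t) = 0" if t: "t \<in> J" for t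
  proof (rule real_analytic_identity[OF _ J t0J ev t])
    show "real_analytic_at (\<lambda>t. \<Sum>\<mu>\<in>UNIV. \<Sum>\<nu>\<in>UNIV. inverse_metric g t $ \<mu> $ \<nu> * hessian br g \<phi> \<mu> \<nu> t) t"
      if "t \<in> J" for t by (intro i inv he that)
  qed (use eq in \<open>simp add: wave_equation_def\<close>)
  ultimately show ?thesis
    unfolding homogeneous_solution_def einstein_equations_def wave_equation_def
    using J t0J spd by (auto simp: is_interval_connected_1 intro!: real_analytic_imp_smooth_on g \<phi>)
qed

section \<open>The frame equations as a homogeneous quadratic flow\<close>

type_synonym frame_state = "real \<times> real \<times> real \<times> real \<times> real \<times> real \<times> real \<times> real \<times>
  real \<times> real \<times> real \<times> real \<times> real \<times> real \<times> real \<times> real"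

text \<open>The bilinear map whose diagonal is the frame flow, made homogeneous by a last component that is constantly \<open>1\<close>.\<close>

definition frame_flow :: "frame_state \<Rightarrow> frame_state \<Rightarrow> frame_state" where
  "frame_flow x y = (case x of (e, f1, f2, f3, \<phi>, \<psi>, m22, m32, m23, m33, N, s1, s22, s23, s33, u) \<Rightarrow>
     case y of (e', f1', f2', f3', \<phi>', \<psi>', m22', m32', m23', m33', N', s1', s22', s23', s33', u') \<Rightarrow>
     (s1 * e', s22 * f1', s22 * f2' + 2 * (s23 * f3'), s33 * f3', \<psi> * u', - ((s1 + s22 + s33) * \<psi>'),
      2 * (s23 * m32') - s1 * m22', (s33 - s22) * m32' - s1 * m32',
      (s22 - s33) * m23' + 2 * (s23 * (m33' - m22')) - s1 * m23', - (2 * (s23 * m32')) - s1 * m33',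
      N * (s1' - s22' - s33'),
      m22 * m22' + m33 * m33' + (m23 + m32) * (m23' + m32') / 2 - N * N' / 2 - (s1 + s22 + s33) * s1',
      2 * (s23 * s23') + (m32 - m23 - N) * (m23' + m32') / 2 + (m22 + m33) * m22' - (m32 - m23) * N' / 2 + N * N' / 2 - (s1 + s22 + s33) * s22',
      (s33 - s22) * s23' - (m32 - m23 - N) * (m22' - m33') / 2 + (m22 + m33) * (m23' + m32') / 2 - (s1 + s22 + s33) * s23',
      - (2 * (s23 * s23')) - (m32 - m23 - N) * (m23' + m32') / 2 + (m22 + m33) * m33' - (m32 - m23) * N' / 2 + N * N' / 2 - (s1 + s22 + s33) * s33',
      0))"

lemma bilinear_frame_flow: "bilinear frame_flow"
  unfolding bilinear_def linear_iff
  by (simp add: frame_flow_def split_paired_all algebra_simps add_divide_distrib diff_divide_distrib)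

lemma norm_frame_state:
  "(norm ((e, f1, f2, f3, p, q, m22, m32, m23, m33, N, s1, s22, s23, s33, u) :: frame_state))\<^sup>2 =
   e\<^sup>2 + f1\<^sup>2 + f2\<^sup>2 + f3\<^sup>2 + p\<^sup>2 + q\<^sup>2 + m22\<^sup>2 + m32\<^sup>2 + m23\<^sup>2 + m33\<^sup>2 + N\<^sup>2 + s1\<^sup>2 + s22\<^sup>2 + s23\<^sup>2 + s33\<^sup>2 + u\<^sup>2"
  unfolding power2_norm_eq_inner by (simp add: power2_eq_square)

lemma matrix_entry_form: "(A :: real^3^3) $ i $ j = form A (axis i 1) (axis j 1)"
  by (simp add: inner_axis' matrix_vector_mult_basis column_def)

lemma linear_ode_zero:
  fixes f a :: "real \<Rightarrow> real"
  assumes "\<And>s. s \<in> closed_segment u t \<Longrightarrow> (f has_real_derivative a s * f s) (at s)"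
    and "continuous_on (closed_segment u t) a" "f u = 0"
  shows "f t = 0"
  using linear_system_zero[where h="\<lambda>_. 0" and b="\<lambda>_. 0" and c="\<lambda>_. 0" and d="\<lambda>_. 0" and f=f and a=a and ?t0.0=u and t=t] assms by simp

section \<open>Continuation beyond a finite endpoint\<close>

context adapted begin

definition state :: "real \<Rightarrow> frame_state" where
  "state t = (fe t, f1 t, f2 t, f3 t, \<phi> t, \<psi> t, m22 t, m32 t, m23 t, m33 t, N t, s1 t, s22 t, s23 t, s33 t, 1)"

lemma state_deriv:
  assumes t: "t \<in> I"
  shows "(state has_vector_derivative frame_flow (state t) (state t)) (at t)"
proof -
  note K = \<kappa>_derivs[OF t]
  have k: "(s1 has_real_derivative m22 t * m22 t + m33 t * m33 t + (m23 t + m32 t) * (m23 t + m32 t) / 2 - N t * N t / 2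
        - (s1 t + s22 t + s33 t) * s1 t) (at t)"
    "(s22 has_real_derivative 2 * (s23 t * s23 t) + (m32 t - m23 t - N t) * (m23 t + m32 t) / 2 + (m22 t + m33 t) * m22 t
        - (m32 t - m23 t) * N t / 2 + N t * N t / 2 - (s1 t + s22 t + s33 t) * s22 t) (at t)"
    "(s23 has_real_derivative (s33 t - s22 t) * s23 t - (m32 t - m23 t - N t) * (m22 t - m33 t) / 2
        + (m22 t + m33 t) * (m23 t + m32 t) / 2 - (s1 t + s22 t + s33 t) * s23 t) (at t)"
    "(s33 has_real_derivative - (2 * (s23 t * s23 t)) - (m32 t - m23 t - N t) * (m23 t + m32 t) / 2 + (m22 t + m33 t) * m33 t
        - (m32 t - m23 t) * N t / 2 + N t * N t / 2 - (s1 t + s22 t + s33 t) * s33 t) (at t)"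
    by (rule DERIV_cong[OF K(1)] DERIV_cong[OF K(2)] DERIV_cong[OF K(3)] DERIV_cong[OF K(4)],
        simp add: ric_E[OF t] \<theta>_frame[OF t] power2_eq_square)+
  have b: "(f2 has_real_derivative s22 t * f2 t + 2 * (s23 t * f3 t)) (at t)"
    "(\<psi> has_real_derivative - ((s1 t + s22 t + s33 t) * \<psi> t)) (at t)" "(\<phi> has_real_derivative \<psi> t * 1) (at t)"
    "(m22 has_real_derivative 2 * (s23 t * m32 t) - s1 t * m22 t) (at t)"
    "(m23 has_real_derivative (s22 t - s33 t) * m23 t + 2 * (s23 t * (m33 t - m22 t)) - s1 t * m23 t) (at t)"
    "(m33 has_real_derivative - (2 * (s23 t * m32 t)) - s1 t * m33 t) (at t)"
    "((\<lambda>s. 1) has_real_derivative 0) (at t)"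
    by (rule DERIV_cong[OF f2_deriv[OF t]] DERIV_cong[OF wave[OF t]] DERIV_cong[OF \<phi>_deriv[OF t]] DERIV_cong[OF bracket_derivs(1)[OF t]]
        DERIV_cong[OF bracket_derivs(3)[OF t]] DERIV_cong[OF bracket_derivs(4)[OF t]] DERIV_const, (simp add: \<theta>_frame[OF t] algebra_simps; fail)?)+
  show ?thesis
    unfolding state_def[abs_def] frame_flow_def prod.case
    by (intro has_vector_derivative_Pair k[unfolded has_real_derivative_iff_has_vector_derivative]
        b[unfolded has_real_derivative_iff_has_vector_derivative]
        fe_deriv[OF t, unfolded has_real_derivative_iff_has_vector_derivative] f1_deriv[OF t, unfolded has_real_derivative_iff_has_vector_derivative]
        f3_deriv[OF t, unfolded has_real_derivative_iff_has_vector_derivative]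
        bracket_derivs(2,5)[OF t, unfolded has_real_derivative_iff_has_vector_derivative])
qed

text \<open>The Hamiltonian constraint bounds \<open>\<psi>\<close>, \<open>N\<close>, the
  components of \<open>\<kappa>\<close> and all bracket components except \<open>bb\<close> by
  \<open>\<theta>\<close>, hence by its initial value. The metric factors, \<open>\<phi>\<close> and
  \<open>bb\<close> obey equations with bounded coefficients, so they grow at most
  exponentially.\<close>

lemma state_bounded:
  assumes t1: "t1 \<in> I" and \<theta>: "0 < \<theta> t1" and sub: "{t1..<T} \<subseteq> I"
  obtains M where "0 < M" "\<And>t. t1 \<le> t \<Longrightarrow> t < T \<Longrightarrow> norm (state t) \<le> M"
proof -
  define K where "K = \<theta> t1"
  have K: "0 < K" using \<theta> unfolding K_def .
  have tI: "t \<in> I" if "t1 \<le> t" "t < T" for t using sub that by auto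
  have \<theta>2: "(\<theta> t)\<^sup>2 \<le> K\<^sup>2" if "t1 \<le> t" "t < T" for t
    using \<theta>_antimono[OF t1 tI[OF that] that(1)] \<theta>_stays_pos[OF t1 tI[OF that] that(1) \<theta>] unfolding K_def
    by (intro power_mono) auto
  have sq: "\<bar>v\<bar> \<le> K" if "v\<^sup>2 \<le> (\<theta> t)\<^sup>2" "t1 \<le> t" "t < T" for v t
  proof -
    have "v\<^sup>2 \<le> K\<^sup>2" using that(1) \<theta>2[OF that(2,3)] by linarith
    then show ?thesis using K by (metis abs_le_square_iff abs_of_pos)
  qed
  \<comment> \<open>The summand 1 absorbs the source terms \<open>\<psi> * \<phi>\<close> and
    \<open>\<zeta> * bb\<close>, which are linear in the quantities to be bounded;
    \<open>\<zeta>\<close> contributes the part with \<open>K^2\<close> in \<open>C\<close>.\<close>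
  define V where "V t = (fe t)\<^sup>2 + (f1 t)\<^sup>2 + (f2 t)\<^sup>2 + (f3 t)\<^sup>2 + (\<phi> t)\<^sup>2 + (bb t)\<^sup>2 + 1" for t
  define C where "C = 4 * K + 2 * K\<^sup>2"
  have V_le: "V t \<le> V t1 * exp (C * (t - t1))" if t: "t1 \<le> t" "t < T" for t
  proof (rule gronwall_bound[OF _ _ t])
    fix s assume s: "t1 \<le> s" "s < T"
    note sI = tI[OF s]
    let ?V' = "2 * (s1 s * (fe s * fe s)) + 2 * (s22 s * (f1 s * f1 s)) + 2 * (s22 s * (f2 s * f2 s)) + 4 * (s23 s * (f2 s * f3 s))
      + 2 * (s33 s * (f3 s * f3 s)) + 2 * (\<psi> s * (\<phi> s * 1)) + 4 * (\<zeta> s * (bb s * 1)) + 2 * ((- s1 s) * (bb s * bb s))"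
    show "(V has_real_derivative ?V') (at s)"
      unfolding V_def[abs_def]
      by (auto intro!: derivative_eq_intros fe_deriv[OF sI] f1_deriv[OF sI] f2_deriv[OF sI] f3_deriv[OF sI] \<phi>_deriv[OF sI]
          reduced_odes(7)[OF sI]) (simp add: algebra_simps)
    have L: "u * (x * y) \<le> L * ((x\<^sup>2 + y\<^sup>2) / 2)" if "\<bar>u\<bar> \<le> L" for u x y L :: real
    proof -
      have "u * (x * y) \<le> \<bar>u\<bar> * \<bar>x * y\<bar>" by (simp flip: abs_mult)
      also have "\<bar>x * y\<bar> \<le> (x\<^sup>2 + y\<^sup>2) / 2"
        using zero_le_power2[of "x - y"] zero_le_power2[of "x + y"] by (simp add: abs_le_iff power2_eq_square algebra_simps)
      then have "\<bar>u\<bar> * \<bar>x * y\<bar> \<le> L * ((x\<^sup>2 + y\<^sup>2) / 2)" using that by (intro mult_mono) auto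
      finally show ?thesis .
    qed
    note b = squares_le(2-)[OF sI, THEN sq[OF _ s]]
    have "\<bar>\<zeta> s\<bar> \<le> K\<^sup>2"
    proof -
      have "2 * \<bar>\<zeta> s\<bar> \<le> (z1 s)\<^sup>2 + (z2 s)\<^sup>2 + ((w1 s)\<^sup>2 + (w2 s)\<^sup>2)"
        using zero_le_power2[of "z2 s - w1 s"] zero_le_power2[of "z2 s + w1 s"] zero_le_power2[of "z1 s - w2 s"] zero_le_power2[of "z1 s + w2 s"]
        unfolding \<zeta>_def by (simp add: abs_le_iff abs_real_def power2_eq_square algebra_simps)
      moreover have "(z1 s)\<^sup>2 + (z2 s)\<^sup>2 \<le> (s22 s)\<^sup>2 + (s33 s)\<^sup>2 + (s23 s)\<^sup>2"
      proof -
        have "((s22 s - s33 s) / 2)\<^sup>2 = ((s22 s)\<^sup>2 + (s33 s)\<^sup>2) / 2 - ((s22 s + s33 s) / 2)\<^sup>2"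
          by (simp add: power2_eq_square field_simps)
        then show ?thesis
          using zero_le_power2[of "(s22 s + s33 s) / 2"] zero_le_power2[of "s22 s"] zero_le_power2[of "s33 s"]
          unfolding z1_def z2_def by argo
      qed
      moreover have "2 * ((w1 s)\<^sup>2 + (w2 s)\<^sup>2) \<le> \<rho> s"
        using bN_nonpos[OF sI] zero_le_power2[of "aa s"] zero_le_power2[of "N s"] unfolding \<rho>_eq by argo
      moreover have "(s22 s)\<^sup>2 + (s33 s)\<^sup>2 + (s23 s)\<^sup>2 + \<rho> s \<le> (\<theta> s)\<^sup>2"
        using scalar_hamiltonian[OF sI] zero_le_power2[of "s1 s"] zero_le_power2[of "s23 s"] zero_le_power2[of "\<psi> s"] by linarith
      ultimately have "2 * \<bar>\<zeta> s\<bar> \<le> 2 * (\<theta> s)\<^sup>2"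
        using zero_le_power2[of "w1 s"] zero_le_power2[of "w2 s"] zero_le_power2[of "\<theta> s"] by argo
      then show ?thesis using \<theta>2[OF s] by linarith
    qed
    then have \<zeta>: "\<zeta> s * (bb s * 1) \<le> K\<^sup>2 * (bb s)\<^sup>2 / 2 + K\<^sup>2 / 2"
      using L[of "\<zeta> s" "K\<^sup>2" "bb s" 1] by (simp add: distrib_left add_divide_distrib)
    have L1: "u * (x * x) \<le> K * x\<^sup>2" if "\<bar>u\<bar> \<le> K" for u x :: real using L[OF that, of x x] by simp
    have L2: "s23 s * (f2 s * f3 s) \<le> K * (f2 s)\<^sup>2 / 2 + K * (f3 s)\<^sup>2 / 2" "\<psi> s * (\<phi> s * 1) \<le> K * (\<phi> s)\<^sup>2 / 2 + K / 2"
      using L[OF b(3), of "f2 s" "f3 s"] L[OF b(5), of "\<phi> s" 1] by (simp_all add: distrib_left add_divide_distrib)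
    have "- s1 s * (bb s * bb s) \<le> K * (bb s)\<^sup>2" by (rule L1) (use b(1) in simp)
    note b = \<zeta> L1[OF b(1), of "fe s"] L1[OF b(2), of "f1 s"] L1[OF b(2), of "f2 s"] L2 L1[OF b(4), of "f3 s"] this
    have n: "0 \<le> K * (fe s)\<^sup>2" "0 \<le> K * (f1 s)\<^sup>2" "0 \<le> K * (f2 s)\<^sup>2" "0 \<le> K * (f3 s)\<^sup>2" "0 \<le> K * (\<phi> s)\<^sup>2" "0 \<le> K * (bb s)\<^sup>2"
      "0 \<le> K\<^sup>2 * (fe s)\<^sup>2" "0 \<le> K\<^sup>2 * (f1 s)\<^sup>2" "0 \<le> K\<^sup>2 * (f2 s)\<^sup>2" "0 \<le> K\<^sup>2 * (f3 s)\<^sup>2" "0 \<le> K\<^sup>2 * (\<phi> s)\<^sup>2" "0 \<le> K\<^sup>2 * (bb s)\<^sup>2"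
      using K by simp_all
    have "C * V s = 4 * (K * (fe s)\<^sup>2) + 4 * (K * (f1 s)\<^sup>2) + 4 * (K * (f2 s)\<^sup>2) + 4 * (K * (f3 s)\<^sup>2) + 4 * (K * (\<phi> s)\<^sup>2) + 4 * (K * (bb s)\<^sup>2) + 4 * K
      + 2 * (K\<^sup>2 * (fe s)\<^sup>2) + 2 * (K\<^sup>2 * (f1 s)\<^sup>2) + 2 * (K\<^sup>2 * (f2 s)\<^sup>2) + 2 * (K\<^sup>2 * (f3 s)\<^sup>2) + 2 * (K\<^sup>2 * (\<phi> s)\<^sup>2) + 2 * (K\<^sup>2 * (bb s)\<^sup>2) + 2 * K\<^sup>2"
      unfolding C_def V_def by (simp add: algebra_simps)
    then show "?V' \<le> C * V s"
      using b n K zero_le_power2[of K] by linarith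
  qed
  define B where "B = V t1 * exp (C * (T - t1))"
  have C0: "0 \<le> C" using K unfolding C_def by simp
  have V0: "0 < V t" for t unfolding V_def by (simp add: add_nonneg_pos)
  have VB: "V t \<le> B" if t: "t1 \<le> t" "t < T" for t
  proof -
    have "V t1 * exp (C * (t - t1)) \<le> B" unfolding B_def
      using t C0 V0[of t1] by (intro mult_left_mono) (auto intro: mult_left_mono)
    then show ?thesis using V_le[OF t] by linarith
  qed
  show thesis
  proof
    show "0 < 2 * \<bar>B\<bar> + 2 * K\<^sup>2 + 1" using zero_le_power2[of K] by linarith
    fix t assume t: "t1 \<le> t" "t < T"
    note I = tI[OF t]
    have m: "(m22 t)\<^sup>2 + (m33 t)\<^sup>2 = (aa t)\<^sup>2 / 2 + 2 * (w1 t)\<^sup>2" "(m23 t)\<^sup>2 + (m32 t)\<^sup>2 = 2 * (w2 t)\<^sup>2 + 2 * (bb t)\<^sup>2"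
      unfolding aa_def w1_def w2_def bb_def by (simp_all add: power2_eq_square field_simps)
    have r: "2 * ((w1 t)\<^sup>2 + (w2 t)\<^sup>2) + 3/2 * (aa t)\<^sup>2 + (N t)\<^sup>2 / 2 \<le> \<rho> t"
      using bN_nonpos[OF I] unfolding \<rho>_eq by argo
    have "(norm (state t))\<^sup>2 = (V t - (bb t)\<^sup>2) + (\<psi> t)\<^sup>2 + ((m22 t)\<^sup>2 + (m33 t)\<^sup>2) + ((m23 t)\<^sup>2 + (m32 t)\<^sup>2) + (N t)\<^sup>2
        + (s1 t)\<^sup>2 + (s22 t)\<^sup>2 + (s23 t)\<^sup>2 + (s33 t)\<^sup>2"
      unfolding state_def norm_frame_state V_def by simp
    also have "\<dots> \<le> 2 * V t + 2 * (\<theta> t)\<^sup>2"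
    proof -
      have bV: "(bb t)\<^sup>2 \<le> V t" unfolding V_def by (simp add: add_nonneg_nonneg)
      show ?thesis
        unfolding m using scalar_hamiltonian[OF I] r bV zero_le_power2[of "s1 t"] zero_le_power2[of "s22 t"] zero_le_power2[of "s23 t"]
          zero_le_power2[of "s33 t"] zero_le_power2[of "\<psi> t"] zero_le_power2[of "aa t"] zero_le_power2[of "w1 t"] zero_le_power2[of "w2 t"]
        by argo
    qed
    finally have "(norm (state t))\<^sup>2 \<le> 2 * \<bar>B\<bar> + 2 * K\<^sup>2" using VB[OF t] \<theta>2[OF t] by linarith
    moreover have "norm (state t) \<le> (norm (state t))\<^sup>2 + 1"
      using zero_le_power2[of "norm (state t) - 1/2"] by (simp add: power2_eq_square algebra_simps)
    ultimately show "norm (state t) \<le> 2 * \<bar>B\<bar> + 2 * K\<^sup>2 + 1" by linarith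
  qed
qed

text \<open>The metric whose triangular factors in the fixed basis \<open>b1\<close>,
  \<open>b2\<close>, \<open>b3\<close> are \<open>e\<close>, \<open>p\<close>, \<open>q\<close>,
  \<open>r\<close>. It rebuilds a metric from the flow beyond the original interval.\<close>

definition frame_metric :: "real \<Rightarrow> real \<Rightarrow> real \<Rightarrow> real \<Rightarrow> real^3^3" where
  "frame_metric e p q r = (\<chi> i j. (e * co b1 (axis i 1)) * (e * co b1 (axis j 1))
     + (p * co b2 (axis i 1) + q * co b3 (axis i 1)) * (p * co b2 (axis j 1) + q * co b3 (axis j 1))
     + (r * co b3 (axis i 1)) * (r * co b3 (axis j 1)))"

lemma form_frame_metric:
  "form (frame_metric e p q r) x y = (e * co b1 x) * (e * co b1 y)
     + (p * co b2 x + q * co b3 x) * (p * co b2 y + q * co b3 y) + (r * co b3 x) * (r * co b3 y)"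
proof -
  have c: "co b z = z $ 1 * co b (axis 1 1) + z $ 2 * co b (axis 2 1) + z $ 3 * co b (axis 3 1)" for b z
  proof -
    have "z = z $ 1 *\<^sub>R axis 1 1 + z $ 2 *\<^sub>R axis 2 1 + z $ 3 *\<^sub>R axis 3 1"
      by (simp add: vec_eq_iff forall_3 axis_def)
    from arg_cong[OF this, of "co b"] show ?thesis by (simp add: form_simps)
  qed
  define c1 c2 c3 where "c1 i = co b1 (axis i 1)" and "c2 i = co b2 (axis i 1)" and "c3 i = co b3 (axis i 1)" for i
  show ?thesis
    unfolding c[of _ x] c[of _ y] frame_metric_def c1_def[symmetric] c2_def[symmetric] c3_def[symmetric]
    by (simp add: inner_vec_def matrix_vector_mult_def sum_3 algebra_simps)
qed

lemma frame_metric_spd: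
  assumes "e \<noteq> 0" "p \<noteq> 0" "r \<noteq> 0" shows "sym_pos_def (frame_metric e p q r)"
  unfolding sym_pos_def_def
proof (intro conjI allI impI)
  show "transpose (frame_metric e p q r) = frame_metric e p q r"
    unfolding transpose_def frame_metric_def by (simp add: vec_eq_iff mult_ac)
  fix v :: "real^3" assume v: "v \<noteq> 0"
  have "co b1 v \<noteq> 0 \<or> co b2 v \<noteq> 0 \<or> co b3 v \<noteq> 0"
  proof (rule ccontr)
    assume "\<not> ?thesis"
    then show False using expand[of v] v by simp
  qed
  then have "e * co b1 v \<noteq> 0 \<or> p * co b2 v + q * co b3 v \<noteq> 0 \<or> r * co b3 v \<noteq> 0" using assms by auto
  then show "0 < form (frame_metric e p q r) v v"
    unfolding form_frame_metric
    by (metis add_nonneg_pos add_pos_nonneg add_nonneg_nonneg not_real_square_gt_zero zero_le_square)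
qed

lemma g_frame_metric:
  assumes t: "t \<in> I" shows "g t = frame_metric (fe t) (f1 t) (f2 t) (f3 t)"
proof -
  have c: "form (g t) b3 b2 = f1 t * f2 t" using form_commute[OF spd[OF t], of b3 b2] frame_pos(6)[OF t] by simp
  have d: "form (g t) b2 b1 = 0" "form (g t) b3 b1 = 0" using block[OF t] form_commute[OF spd[OF t]] by metis+
  have "form (g t) x y = form (frame_metric (fe t) (f1 t) (f2 t) (f3 t)) x y" for x y
    unfolding form_frame_metric
    by (rule trans[OF arg_cong2[OF expand expand, of "form (g t)" x y]])
      (simp add: form_simps frame_pos(4-7)[OF t] block[OF t] c d algebra_simps power2_eq_square)
  then show ?thesis unfolding vec_eq_iff matrix_entry_form[of "g t"] matrix_entry_form[of "frame_metric _ _ _ _"] by blast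
qed

text \<open>The state stays bounded up to \<open>T\<close>, so the flow restarted close enough to
  \<open>T\<close> lives past \<open>T\<close>. It agrees with the old solution before
  \<open>T\<close> by uniqueness, and its analyticity carries the field equations across.\<close>

theorem extendible:
  assumes t1: "t1 \<in> I" and \<theta>: "0 < \<theta> t1" and sub: "{t1..<T} \<subseteq> I" and T: "t1 < T" "T \<notin> I"
  shows "\<exists>J g' \<phi>'. I \<subset> J \<and> homogeneous_solution br J g' \<phi>' \<and> (\<forall>t\<in>I. g' t = g t \<and> \<phi>' t = \<phi> t)"
proof -
  have below: "t < T" if "t \<in> I" for t
    using Icc_subset[OF t1 that, of T] T by (cases "t < T") auto
  obtain M where M: "0 < M" "\<And>t. t1 \<le> t \<Longrightarrow> t < T \<Longrightarrow> norm (state t) \<le> M"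
    using state_bounded[OF t1 \<theta> sub] by blast
  obtain q where q: "0 < q" "\<And>x y. norm (frame_flow x y) \<le> q * norm x * norm y"
    using bilinear_bound_pos[OF bilinear_frame_flow] by blast
  define \<delta> where "\<delta> = 1 / (q * M)"
  have \<delta>: "0 < \<delta>" using q(1) M(1) unfolding \<delta>_def by simp
  \<comment> \<open>From \<open>u\<close> at most \<open>\<delta> / 2\<close> remains to
    \<open>T\<close>, while the flow lives at least for the time \<open>\<delta>\<close>.\<close>
  define u where "u = max t1 (T - \<delta> / 2)"
  have u: "t1 \<le> u" "u < T" "T < u + \<delta>" using T(1) \<delta> unfolding u_def by auto
  obtain Y where Yu: "Y u = state u"
    and Y: "\<And>t. \<bar>t - u\<bar> < \<delta> \<Longrightarrow> (Y has_vector_derivative frame_flow (Y t) (Y t)) (at t)"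
    and Ya: "\<And>t v. \<bar>t - u\<bar> < \<delta> \<Longrightarrow> real_analytic_at (\<lambda>s. Y s \<bullet> v) t"
    using quadratic_flow_exists[OF bilinear_frame_flow q(2) q(1) M(1) M(2)[OF u(1,2)], of u] unfolding \<delta>_def[symmetric] by blast
  define J where "J = {u<..<u + \<delta>}"
  have inJ: "\<bar>s - u\<bar> < \<delta>" if "s \<in> closed_segment u t" "t \<in> J" for s t
    using that unfolding J_def closed_segment_eq_real_ivl by auto
  have agree: "Y t = state t" if t: "u \<le> t" "t < T" for t
  proof (rule quadratic_flow_unique[where ?t0.0=u and Q=frame_flow and x=Y and y=state, OF bilinear_frame_flow _ _ Yu])
    fix s assume "s \<in> closed_segment u t"
    then have s: "u \<le> s" "s \<le> t" using t unfolding closed_segment_eq_real_ivl by auto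
    show "(Y has_vector_derivative frame_flow (Y s) (Y s)) (at s)" by (rule Y) (use s t u in auto)
    show "(state has_vector_derivative frame_flow (state s) (state s)) (at s)"
      by (rule state_deriv) (use s t u sub in auto)
  qed
  define Fe F1 F2 F3 \<Phi> where "Fe s = fst (Y s)" and "F1 s = fst (snd (Y s))" and "F2 s = fst (snd (snd (Y s)))"
    and "F3 s = fst (snd (snd (snd (Y s))))" and "\<Phi> s = fst (snd (snd (snd (snd (Y s)))))" for s
  have an: "real_analytic_at Fe t" "real_analytic_at F1 t" "real_analytic_at F2 t" "real_analytic_at F3 t" "real_analytic_at \<Phi> t"
    if "\<bar>t - u\<bar> < \<delta>" for t
    using Ya[OF that, of "(1, 0)"] Ya[OF that, of "(0, 1, 0)"] Ya[OF that, of "(0, 0, 1, 0)"] Ya[OF that, of "(0, 0, 0, 1, 0)"]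
      Ya[OF that, of "(0, 0, 0, 0, 1, 0)"]
    unfolding Fe_def F1_def F2_def F3_def \<Phi>_def by (simp_all add: inner_prod_def)
  have cY: "continuous_on (closed_segment u t) Y" if "t \<in> J" for t
    by (intro continuous_at_imp_continuous_on ballI has_vector_derivative_continuous[OF Y] inJ[OF _ that])
  have Lin: "((\<lambda>s. L (Y s)) has_real_derivative L (frame_flow (Y t) (Y t))) (at t)" if "bounded_linear L" "\<bar>t - u\<bar> < \<delta>" for L :: "frame_state \<Rightarrow> real" and t
    using bounded_linear.has_vector_derivative[OF that(1) Y[OF that(2)]] unfolding has_real_derivative_iff_has_vector_derivative .
  have eu: "fe u \<noteq> 0" "f1 u \<noteq> 0" "f3 u \<noteq> 0" using frame_pos(1-3)[of u] u sub by auto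
  \<comment> \<open>Each of these factors solves a homogeneous linear equation. A zero at
    \<open>t\<close> would propagate back to \<open>u\<close>, where the factors are positive; so
    the rebuilt metric stays positive definite.\<close>
  have nz: "Fe t \<noteq> 0 \<and> F1 t \<noteq> 0 \<and> F3 t \<noteq> 0" if t: "t \<in> J" for t
  proof -
    have sw: "closed_segment t u = closed_segment u t" by (rule closed_segment_commute)
    have *: "f t \<noteq> 0" if "\<And>s. \<bar>s - u\<bar> < \<delta> \<Longrightarrow> (f has_real_derivative a s * f s) (at s)"
      "continuous_on (closed_segment u t) a" "f u \<noteq> 0" for f a
      using linear_ode_zero[of t u f a] that inJ[OF _ t] unfolding sw by blast
    have bl: "bounded_linear (\<lambda>y :: frame_state. fst y)" "bounded_linear (\<lambda>y :: frame_state. fst (snd y))"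
      "bounded_linear (\<lambda>y :: frame_state. fst (snd (snd (snd y))))"
      by (intro bounded_linear_fst_comp bounded_linear_snd_comp bounded_linear_ident bounded_linear_fst)+
    have "Fe t \<noteq> 0"
    proof (rule *)
      show "(Fe has_real_derivative fst (snd (snd (snd (snd (snd (snd (snd (snd (snd (snd (snd (Y s)))))))))))) * Fe s) (at s)"
        if "\<bar>s - u\<bar> < \<delta>" for s
        using Lin[OF bl(1) that] unfolding Fe_def[abs_def] frame_flow_def by (simp add: case_prod_beta)
    qed (use eu in \<open>auto intro!: continuous_intros cY t simp: Fe_def Yu state_def\<close>)
    moreover have "F1 t \<noteq> 0"
    proof (rule *)
      show "(F1 has_real_derivative fst (snd (snd (snd (snd (snd (snd (snd (snd (snd (snd (snd (snd (Y s))))))))))))) * F1 s) (at s)"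
        if "\<bar>s - u\<bar> < \<delta>" for s
        using Lin[OF bl(2) that] unfolding F1_def[abs_def] frame_flow_def by (simp add: case_prod_beta)
    qed (use eu in \<open>auto intro!: continuous_intros cY t simp: F1_def Yu state_def\<close>)
    moreover have "F3 t \<noteq> 0"
    proof (rule *)
      show "(F3 has_real_derivative fst (snd (snd (snd (snd (snd (snd (snd (snd (snd (snd (snd (snd (snd (snd (Y s))))))))))))))) * F3 s) (at s)"
        if "\<bar>s - u\<bar> < \<delta>" for s
        using Lin[OF bl(3) that] unfolding F3_def[abs_def] frame_flow_def by (simp add: case_prod_beta)
    qed (use eu in \<open>auto intro!: continuous_intros cY t simp: F3_def Yu state_def\<close>)
    ultimately show ?thesis by blast
  qed
  define h where "h t = frame_metric (Fe t) (F1 t) (F2 t) (F3 t)" for t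
  have IJ: "g t = h t \<and> \<phi> t = \<Phi> t" if "t \<in> I \<inter> J" for t
  proof -
    have "Y t = state t" using that below by (intro agree) (auto simp: J_def)
    then show ?thesis using that g_frame_metric[of t]
      unfolding h_def Fe_def F1_def F2_def F3_def \<Phi>_def by (simp add: state_def)
  qed
  have uT: "{u<..<T} \<subseteq> I \<inter> J" using u sub unfolding J_def by auto
  have "homogeneous_solution br J h \<Phi>"
  proof (rule analytic_solution[where U="{u<..<T}"])
    show "open J" "connected J" unfolding J_def by auto
    show "open {u<..<T}" "{u<..<T} \<subseteq> J" "{u<..<T} \<noteq> {}" using uT u by auto
    fix t
    {
      assume "t \<in> J"
      then have t: "\<bar>t - u\<bar> < \<delta>" unfolding J_def by auto
      show "real_analytic_at \<Phi> t" by (rule an[OF t])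
      show "real_analytic_at (\<lambda>s. h s $ a $ b) t" for a b
        unfolding h_def frame_metric_def by (simp, intro real_analytic_intros an[OF t])
      show "sym_pos_def (h t)" unfolding h_def using nz[OF \<open>t \<in> J\<close>] by (intro frame_metric_spd) auto
    }
    assume t: "t \<in> {u<..<T}"
    have e: "h s = g s" "\<Phi> s = \<phi> s" if "s \<in> {u<..<T}" for s using IJ[of s] subsetD[OF uT that] by auto
    have "einstein_equations br g \<phi> t \<and> wave_equation br g \<phi> t"
      using hom t uT unfolding homogeneous_solution_def by auto
    then show "einstein_equations br h \<Phi> t \<and> wave_equation br h \<Phi> t"
      using field_equations_local[where g=g and g'=h and \<phi>=\<phi> and \<phi>'=\<Phi>, OF open_greaterThanLessThan e t, of br] by simp
  qed
  moreover have "I \<inter> J \<noteq> {}" using uT u by (metis greaterThanLessThan_empty_iff not_le subset_empty)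
  ultimately have "homogeneous_solution br (I \<union> J) (\<lambda>t. if t \<in> I then g t else h t) (\<lambda>t. if t \<in> I then \<phi> t else \<Phi> t)"
    by (intro homogeneous_solution_union[OF hom] IJ)
  moreover have "T \<in> J" using u unfolding J_def by auto
  ultimately show ?thesis
    using T(2) by (intro exI[of _ "I \<union> J"] exI[of _ "\<lambda>t. if t \<in> I then g t else h t"] exI[of _ "\<lambda>t. if t \<in> I then \<phi> t else \<Phi> t"]) auto
qed

text \<open>Were a later time missing, \<open>I\<close> would be bounded above. Its supremum is not
  in the open set \<open>I\<close>, and \<open>extendible\<close> applied there contradicts
  maximality.\<close>

lemma complete_if_maximal:
  assumes max: "maximal_solution br I g \<phi>" and t1: "t1 \<in> I" and \<theta>: "0 < \<theta> t1"
  shows "{t1..} \<subseteq> I"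
proof (rule ccontr)
  assume "\<not> {t1..} \<subseteq> I"
  then obtain t where t: "t1 \<le> t" "t \<notin> I" by auto
  have le: "s \<le> t" if "s \<in> I" for s using Icc_subset[OF t1 that t(1)] t(2) by force
  then have bdd: "bdd_above I" by (rule bdd_aboveI)
  have "Sup I \<notin> I"
  proof
    assume "Sup I \<in> I"
    then obtain e where e: "0 < e" "ball (Sup I) e \<subseteq> I" using openI open_contains_ball by blast
    then have "Sup I + e / 2 \<in> I" by (auto simp: subset_eq dist_real_def)
    then show False using cSup_upper[OF _ bdd] e(1) by fastforce
  qed
  moreover have "t1 \<le> Sup I" by (rule cSup_upper[OF t1 bdd])
  ultimately have "t1 < Sup I" using t1 by (cases "t1 = Sup I") auto
  moreover have "{t1..<Sup I} \<subseteq> I"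
  proof
    fix s assume s: "s \<in> {t1..<Sup I}"
    then obtain v where "v \<in> I" "s < v" using less_cSup_iff[OF I_ne bdd, of s] by auto
    then show "s \<in> I" using Icc_subset[OF t1 \<open>v \<in> I\<close>, of s] s by auto
  qed
  ultimately show False using extendible[OF t1 \<theta>] \<open>Sup I \<notin> I\<close> max unfolding maximal_solution_def by blast
qed

end

theorem theorem1:
  fixes br :: "real^3 \<Rightarrow> real^3 \<Rightarrow> real^3"
    and I :: "real set"
    and g :: "real \<Rightarrow> real^3^3"
    and \<phi> :: "real \<Rightarrow> real"
  assumes "lie_bracket br"
    and "\<not> bianchi_IX br"
    and "\<not> bianchi_VI (-1/9) br"
    and "maximal_solution br I g \<phi>"
    and "\<exists>t\<in>I. mean_curvature g t < 0"
  shows "Sup (ereal ` I) = \<infinity> \<and>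
         (\<forall>\<^sub>F t in at_top. mean_curvature g t \<noteq> 0) \<and>
         (\<forall>i<3. \<exists>p. (kasner_exponent g i \<longlongrightarrow> p) at_top) \<and>
         (\<exists>\<Omega>. (density_parameter g \<phi> \<longlongrightarrow> \<Omega>) at_top)"
proof -
  interpret solution br I g \<phi>
    using assms(1,4) unfolding maximal_solution_def by unfold_locales auto
  obtain t1 where t1: "t1 \<in> I" "mean_curvature g t1 < 0" using assms(5) by blast
  then have \<theta>: "0 < \<theta> t1" using mean_curvature_eq by simp
  \<comment> \<open>The basis is adapted at an expanding time, which is also the time from which
    completeness and convergence are derived.\<close>
  obtain b1 b2 b3 l22 l32 l23 l33 c where "adapted br I g \<phi> t1 b1 b2 b3 l22 l32 l23 l33 c"
    using adapted_exists[OF t1(1) assms(2,3)] by blast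
  then interpret adapted br I g \<phi> t1 b1 b2 b3 l22 l32 l23 l33 c .
  have sub: "{t1..} \<subseteq> I" by (rule complete_if_maximal[OF assms(4) t1(1) \<theta>])
  have "Sup (ereal ` I) = \<infinity>"
  proof (rule SUP_PInfty)
    fix n :: nat
    have "max t1 (real n) \<in> I" using sub by auto
    then show "\<exists>i\<in>I. ereal (real n) \<le> ereal i" by (rule rev_bexI) simp
  qed
  then show ?thesis using kasner_exponents_converge[OF sub \<theta>] by blast
qed

end
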